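(* Let $R$ be a discrete valuation ring that is not complete, with maximal ideal $\mathfrak m=XR$ and residue field $k=R/\mathfrak m$, and let $\widehat R$ be its $\mathfrak m$-adic completion. Set $E=E_R(k)=E_{\widehat R}(k)$, and let $K=Q(R)$ and $\widetilde K=Q(\widehat R)$ be the quotient fields. If $[\widetilde K:K]=\infty$, then there are an uncountable cardinal $C$ and $\widehat R$-module isomorphisms $$\operatorname{Ext}^i_R(\widehat R,R)\cong\begin{cases}0 & \text{if } i\neq 1,\\ E\oplus \widetilde K^{(C)} & \text{if } i=1,\end{cases}$$ where $\widetilde K^{(C)}$ is the direct sum of copies of $\widetilde K$ indexed by $C$.
   Context: $E_R(k)$ denotes the injective hull of $k$ as an $R$-module; it carries a natural $\widehat R$-module structure making it the injective hull $E_{\widehat R}(k)$ of $k$ over $\widehat R$. $Q(-)$ denotes the quotient field of a domain. "Not complete" means that $R$ is not $\mathfrak m$-adically complete. $\operatorname{Ext}^i_R(\widehat R,R)$ is an $\widehat R$-module via the first argument. *)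

theory Defs
  imports "HOL-Algebra.Module" "HOL-Algebra.QuotRing" "HOL-Algebra.Ideal_Product"
    "HOL-Algebra.Ring_Divisibility" "HOL-Algebra.Embedded_Algebras" "HOL-Library.Countable_Set"
begin

section \<open>Discrete valuation rings and adic completion\<close>

definition discrete_valuation_ring :: "('a, 'b) ring_scheme \<Rightarrow> 'a set \<Rightarrow> bool" where
  "discrete_valuation_ring R m \<longleftrightarrow>
     principal_domain R \<and> m \<noteq> {\<zero>\<^bsub>R\<^esub>} \<and>
     maximalideal m R \<and> (\<forall>n. maximalideal n R \<longrightarrow> n = m)"

primrec ideal_pow :: "('a, 'b) ring_scheme \<Rightarrow> 'a set \<Rightarrow> nat \<Rightarrow> 'a set" where
  "ideal_pow R I 0 = carrier R"
| "ideal_pow R I (Suc n) = ideal_prod R (ideal_pow R I n) I"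

text \<open>The inverse limit of the rings \<open>R/I\<^sup>n\<close>. The transition map
  \<open>R/I\<^sup>n\<^sup>+\<^sup>1 \<rightarrow> R/I\<^sup>n\<close> sends a coset \<open>c\<close> to \<open>c + I\<^sup>n\<close>.\<close>

definition adic_completion :: "('a, 'b) ring_scheme \<Rightarrow> 'a set \<Rightarrow> (nat \<Rightarrow> 'a set) ring" where
  "adic_completion R I =
     \<lparr> carrier = {f. (\<forall>n. f n \<in> carrier (R Quot ideal_pow R I n)) \<and>
                     (\<forall>n. f (Suc n) <+>\<^bsub>R\<^esub> ideal_pow R I n = f n)},
       monoid.mult = (\<lambda>f g n. f n \<otimes>\<^bsub>R Quot ideal_pow R I n\<^esub> g n),
       one = (\<lambda>n. \<one>\<^bsub>R Quot ideal_pow R I n\<^esub>),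
       ring.zero = (\<lambda>n. \<zero>\<^bsub>R Quot ideal_pow R I n\<^esub>),
       add = (\<lambda>f g n. f n \<oplus>\<^bsub>R Quot ideal_pow R I n\<^esub> g n) \<rparr>"

definition completion_map :: "('a, 'b) ring_scheme \<Rightarrow> 'a set \<Rightarrow> 'a \<Rightarrow> nat \<Rightarrow> 'a set" where
  "completion_map R I r = (\<lambda>n. ideal_pow R I n +>\<^bsub>R\<^esub> r)"

definition adically_complete :: "('a, 'b) ring_scheme \<Rightarrow> 'a set \<Rightarrow> bool" where
  "adically_complete R I \<longleftrightarrow> completion_map R I \<in> ring_iso R (adic_completion R I)"


section \<open>Quotient fields\<close>

definition fraction_rel :: "('a, 'b) ring_scheme \<Rightarrow> (('a \<times> 'a) \<times> ('a \<times> 'a)) set" where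
  "fraction_rel D = {((a, b), (c, d)).
     a \<in> carrier D \<and> b \<in> carrier D - {\<zero>\<^bsub>D\<^esub>} \<and>
     c \<in> carrier D \<and> d \<in> carrier D - {\<zero>\<^bsub>D\<^esub>} \<and> a \<otimes>\<^bsub>D\<^esub> d = c \<otimes>\<^bsub>D\<^esub> b}"

definition fraction :: "('a, 'b) ring_scheme \<Rightarrow> 'a \<Rightarrow> 'a \<Rightarrow> ('a \<times> 'a) set" where
  "fraction D a b = fraction_rel D `` {(a, b)}"

definition quotient_field :: "('a, 'b) ring_scheme \<Rightarrow> ('a \<times> 'a) set ring" where
  "quotient_field D =
     \<lparr> carrier = (carrier D \<times> (carrier D - {\<zero>\<^bsub>D\<^esub>})) // fraction_rel D,
       monoid.mult = (\<lambda>P Q. \<Union>(a, b)\<in>P. \<Union>(c, d)\<in>Q. fraction D (a \<otimes>\<^bsub>D\<^esub> c) (b \<otimes>\<^bsub>D\<^esub> d)),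
       one = fraction D \<one>\<^bsub>D\<^esub> \<one>\<^bsub>D\<^esub>,
       ring.zero = fraction D \<zero>\<^bsub>D\<^esub> \<one>\<^bsub>D\<^esub>,
       add = (\<lambda>P Q. \<Union>(a, b)\<in>P. \<Union>(c, d)\<in>Q.
                fraction D (a \<otimes>\<^bsub>D\<^esub> d \<oplus>\<^bsub>D\<^esub> c \<otimes>\<^bsub>D\<^esub> b) (b \<otimes>\<^bsub>D\<^esub> d)) \<rparr>"

definition fraction_embed :: "('a, 'b) ring_scheme \<Rightarrow> 'a \<Rightarrow> ('a \<times> 'a) set" where
  "fraction_embed D a = fraction D a \<one>\<^bsub>D\<^esub>"

text \<open>The map \<open>Q(D) \<rightarrow> Q(D')\<close>, \<open>a/b \<mapsto> \<phi>(a)/\<phi>(b)\<close>, induced by an injective ring homomorphism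
  \<open>\<phi> : D \<rightarrow> D'\<close>.\<close>

definition fraction_lift :: "('b, 'd) ring_scheme \<Rightarrow> ('a \<Rightarrow> 'b) \<Rightarrow> ('a \<times> 'a) set \<Rightarrow> ('b \<times> 'b) set" where
  "fraction_lift D' \<phi> P = (\<Union>(a, b)\<in>P. fraction D' (\<phi> a) (\<phi> b))"


section \<open>Modules\<close>

text \<open>The record type of modules extends that of rings; the locale \<^locale>\<open>module\<close> says nothing about
  the fields \<^const>\<open>monoid.mult\<close> and \<^const>\<open>one\<close>, which are left undefined where there is no
  natural value.\<close>

definition ring_module :: "('a, 'b) ring_scheme \<Rightarrow> ('a, 'a) module" where
  "ring_module S =
     \<lparr> carrier = carrier S, monoid.mult = monoid.mult S, one = one S,
       ring.zero = ring.zero S, add = add S, smult = monoid.mult S \<rparr>"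

definition restrict_scalars ::
    "('r \<Rightarrow> 's) \<Rightarrow> ('s, 'm, 'b) module_scheme \<Rightarrow> ('r, 'm) module" where
  "restrict_scalars \<phi> M =
     \<lparr> carrier = carrier M, monoid.mult = monoid.mult M, one = one M,
       ring.zero = ring.zero M, add = add M,
       smult = (\<lambda>r x. \<phi> r \<odot>\<^bsub>M\<^esub> x) \<rparr>"

definition linear_maps ::
    "('r, 'b) ring_scheme \<Rightarrow> ('r, 'm, 'c) module_scheme \<Rightarrow> ('r, 'n, 'd) module_scheme
      \<Rightarrow> ('m \<Rightarrow> 'n) set" where
  "linear_maps R M N =
     {f \<in> carrier M \<rightarrow> carrier N.
        (\<forall>x\<in>carrier M. \<forall>y\<in>carrier M. f (x \<oplus>\<^bsub>M\<^esub> y) = f x \<oplus>\<^bsub>N\<^esub> f y) \<and>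
        (\<forall>r\<in>carrier R. \<forall>x\<in>carrier M. f (r \<odot>\<^bsub>M\<^esub> x) = r \<odot>\<^bsub>N\<^esub> f x)}"

definition modules_isomorphic ::
    "('r, 'b) ring_scheme \<Rightarrow> ('r, 'm, 'c) module_scheme \<Rightarrow> ('r, 'n, 'd) module_scheme \<Rightarrow> bool" where
  "modules_isomorphic R M N \<longleftrightarrow>
     (\<exists>h\<in>linear_maps R M N. bij_betw h (carrier M) (carrier N))"

definition quotient_module ::
    "('r, 'm, 'c) module_scheme \<Rightarrow> 'm set \<Rightarrow> ('r, 'm set) module" where
  "quotient_module M N =
     \<lparr> carrier = a_rcosets\<^bsub>M\<^esub> N, monoid.mult = undefined, one = undefined,
       ring.zero = N, add = set_add M,
       smult = (\<lambda>r P. \<Union>x\<in>P. N +>\<^bsub>M\<^esub> (r \<odot>\<^bsub>M\<^esub> x)) \<rparr>"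

definition module_prod ::
    "('r, 'm, 'c) module_scheme \<Rightarrow> ('r, 'n, 'd) module_scheme \<Rightarrow> ('r, 'm \<times> 'n) module" where
  "module_prod M N =
     \<lparr> carrier = carrier M \<times> carrier N, monoid.mult = undefined, one = undefined,
       ring.zero = (\<zero>\<^bsub>M\<^esub>, \<zero>\<^bsub>N\<^esub>),
       add = (\<lambda>(x, y) (x', y'). (x \<oplus>\<^bsub>M\<^esub> x', y \<oplus>\<^bsub>N\<^esub> y')),
       smult = (\<lambda>r (x, y). (r \<odot>\<^bsub>M\<^esub> x, r \<odot>\<^bsub>N\<^esub> y)) \<rparr>"

text \<open>The direct sum of copies of \<open>M\<close> indexed by \<open>C\<close>.\<close>

definition direct_power ::
    "('r, 'm, 'c) module_scheme \<Rightarrow> 'i set \<Rightarrow> ('r, 'i \<Rightarrow> 'm) module" where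
  "direct_power M C =
     \<lparr> carrier = {f \<in> C \<rightarrow>\<^sub>E carrier M. finite {c \<in> C. f c \<noteq> \<zero>\<^bsub>M\<^esub>}},
       monoid.mult = undefined, one = undefined,
       ring.zero = (\<lambda>c\<in>C. \<zero>\<^bsub>M\<^esub>),
       add = (\<lambda>f g. \<lambda>c\<in>C. f c \<oplus>\<^bsub>M\<^esub> g c),
       smult = (\<lambda>r f. \<lambda>c\<in>C. r \<odot>\<^bsub>M\<^esub> f c) \<rparr>"


section \<open>Injective modules, injective hulls, injective resolutions\<close>

text \<open>The extension property is required for all monomorphisms \<open>A \<rightarrow> B\<close> of modules whose elements
  have the same type as those of \<open>R\<close>. These include the inclusions of the ideals into \<open>R\<close>, so by
  Baer's criterion nothing is lost by the bound on the type.\<close>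

definition injective_module :: "('r, 'b) ring_scheme \<Rightarrow> ('r, 'm, 'c) module_scheme \<Rightarrow> bool" where
  "injective_module R J \<longleftrightarrow> module R J \<and>
     (\<forall>(A :: ('r, 'r) module) (B :: ('r, 'r) module) f g.
        module R A \<and> module R B \<and> f \<in> linear_maps R A B \<and> inj_on f (carrier A) \<and>
        g \<in> linear_maps R A J \<longrightarrow>
        (\<exists>h\<in>linear_maps R B J. \<forall>x\<in>carrier A. h (f x) = g x))"

definition injective_hull ::
    "('r, 'b) ring_scheme \<Rightarrow> ('r, 'm, 'c) module_scheme \<Rightarrow> ('m \<Rightarrow> 'e)
      \<Rightarrow> ('r, 'e, 'd) module_scheme \<Rightarrow> bool" where
  "injective_hull R M \<iota> E \<longleftrightarrow>
     injective_module R E \<and> \<iota> \<in> linear_maps R M E \<and> inj_on \<iota> (carrier M) \<and>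
     (\<forall>N. submodule N R E \<and> N \<noteq> {\<zero>\<^bsub>E\<^esub>} \<longrightarrow> N \<inter> \<iota> ` carrier M \<noteq> {\<zero>\<^bsub>E\<^esub>})"

text \<open>An exact sequence \<open>0 \<rightarrow> N \<rightarrow> J\<^sup>0 \<rightarrow> J\<^sup>1 \<rightarrow> \<dots>\<close> with augmentation \<open>\<epsilon>\<close>, differentials \<open>d\<close>
  and injective modules \<open>J\<^sup>n\<close>.\<close>

definition injective_resolution ::
    "('r, 'b) ring_scheme \<Rightarrow> ('r, 'm, 'c) module_scheme \<Rightarrow> ('m \<Rightarrow> 'e)
      \<Rightarrow> (nat \<Rightarrow> ('r, 'e, 'd) module_scheme) \<Rightarrow> (nat \<Rightarrow> 'e \<Rightarrow> 'e) \<Rightarrow> bool" where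
  "injective_resolution R N \<epsilon> J d \<longleftrightarrow>
     (\<forall>n. injective_module R (J n)) \<and>
     (\<forall>n. d n \<in> linear_maps R (J n) (J (Suc n))) \<and>
     \<epsilon> \<in> linear_maps R N (J 0) \<and> inj_on \<epsilon> (carrier N) \<and>
     \<epsilon> ` carrier N = {x \<in> carrier (J 0). d 0 x = \<zero>\<^bsub>J 1\<^esub>} \<and>
     (\<forall>n. d n ` carrier (J n) =
        {x \<in> carrier (J (Suc n)). d (Suc n) x = \<zero>\<^bsub>J (Suc (Suc n))\<^esub>})"


section \<open>Ext modules\<close>

text \<open>For a ring homomorphism \<open>\<phi> : R \<rightarrow> S\<close>, an \<open>S\<close>-module \<open>M\<close> and an \<open>R\<close>-module \<open>N\<close>, the \<open>S\<close>-module
  \<open>Hom\<^sub>R(M, N)\<close>, on which \<open>S\<close> acts through the first argument.\<close>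

definition hom_module ::
    "('r, 'b) ring_scheme \<Rightarrow> ('r \<Rightarrow> 's) \<Rightarrow> ('s, 'm, 'c) module_scheme
      \<Rightarrow> ('r, 'n, 'd) module_scheme \<Rightarrow> ('s, 'm \<Rightarrow> 'n) module" where
  "hom_module R \<phi> M N =
     \<lparr> carrier = linear_maps R (restrict_scalars \<phi> M) N \<inter> extensional (carrier M),
       monoid.mult = undefined, one = undefined,
       ring.zero = (\<lambda>x\<in>carrier M. \<zero>\<^bsub>N\<^esub>),
       add = (\<lambda>f g. \<lambda>x\<in>carrier M. f x \<oplus>\<^bsub>N\<^esub> g x),
       smult = (\<lambda>s f. \<lambda>x\<in>carrier M. f (s \<odot>\<^bsub>M\<^esub> x)) \<rparr>"

definition cocycles where
  "cocycles R \<phi> M J d i =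
     {f \<in> carrier (hom_module R \<phi> M (J i)). \<forall>x\<in>carrier M. d i (f x) = \<zero>\<^bsub>J (Suc i)\<^esub>}"

definition coboundaries where
  "coboundaries R \<phi> M J d i =
     (case i of
        0 \<Rightarrow> {\<zero>\<^bsub>hom_module R \<phi> M (J 0)\<^esub>}
      | Suc j \<Rightarrow> (\<lambda>g. \<lambda>x\<in>carrier M. d j (g x)) ` carrier (hom_module R \<phi> M (J j)))"

text \<open>\<open>Ext\<^sup>i\<^sub>R(M, N)\<close> as an \<open>S\<close>-module, computed from an injective resolution \<open>(J, d)\<close> of the
  \<open>R\<close>-module \<open>N\<close> as the cohomology of the complex \<open>Hom\<^sub>R(M, J)\<close> of \<open>S\<close>-modules.\<close>

definition Ext_module ::
    "('r, 'b) ring_scheme \<Rightarrow> ('r \<Rightarrow> 's) \<Rightarrow> ('s, 'm, 'c) module_scheme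
      \<Rightarrow> (nat \<Rightarrow> ('r, 'n, 'd) module_scheme) \<Rightarrow> (nat \<Rightarrow> 'n \<Rightarrow> 'n) \<Rightarrow> nat
      \<Rightarrow> ('s, ('m \<Rightarrow> 'n) set) module" where
  "Ext_module R \<phi> M J d i =
     quotient_module ((hom_module R \<phi> M (J i))\<lparr>carrier := cocycles R \<phi> M J d i\<rparr>)
       (coboundaries R \<phi> M J d i)"


section \<open>The modules over a local ring and its completion\<close>

definition residue_module :: "('a, 'b) ring_scheme \<Rightarrow> 'a set \<Rightarrow> ('a, 'a set) module" where
  "residue_module R m = restrict_scalars (\<lambda>r. m +>\<^bsub>R\<^esub> r) (ring_module (R Quot m))"

text \<open>The natural module structure over the \<open>I\<close>-adic completion on an \<open>R\<close>-module \<open>E\<close> all of whose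
  elements are annihilated by powers of \<open>I\<close>: if \<open>I\<^sup>n e = 0\<close>, then \<open>f = (f\<^sub>n)\<^sub>n\<close> acts on \<open>e\<close> as any
  representative of the coset \<open>f\<^sub>n \<in> R/I\<^sup>n\<close>.\<close>

definition completion_module ::
    "('a, 'b) ring_scheme \<Rightarrow> 'a set \<Rightarrow> ('a, 'e, 'c) module_scheme
      \<Rightarrow> (nat \<Rightarrow> 'a set, 'e) module" where
  "completion_module R I E =
     \<lparr> carrier = carrier E, monoid.mult = monoid.mult E, one = one E,
       ring.zero = ring.zero E, add = add E,
       smult = (\<lambda>f e. THE y. \<exists>n. (\<forall>a\<in>ideal_pow R I n. a \<odot>\<^bsub>E\<^esub> e = \<zero>\<^bsub>E\<^esub>) \<and>
                                  (\<exists>r\<in>f n. y = r \<odot>\<^bsub>E\<^esub> e)) \<rparr>"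

definition quotient_field_module ::
    "('a, 'b) ring_scheme \<Rightarrow> ('a, ('a \<times> 'a) set) module" where
  "quotient_field_module D = restrict_scalars (fraction_embed D) (ring_module (quotient_field D))"

text \<open>\<open>[Q(D') : Q(D)] = \<infinity>\<close>, where \<open>Q(D)\<close> is identified with its image under the map induced by
  \<open>\<phi> : D \<rightarrow> D'\<close>.\<close>

definition infinite_degree ::
    "('a, 'b) ring_scheme \<Rightarrow> ('a \<Rightarrow> 'c) \<Rightarrow> ('c, 'd) ring_scheme \<Rightarrow> bool" where
  "infinite_degree D \<phi> D' \<longleftrightarrow>
     \<not> ring.finite_dimension (quotient_field D')
         (fraction_lift D' \<phi> ` carrier (quotient_field D)) (carrier (quotient_field D'))"

end

theory Submission
  imports Defs "HOL-Algebra.Free_Abelian_Groups"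
begin

text \<open>Write \<open>S\<close> for the completion, \<open>K = Q(R)\<close> and \<open>M = Ext\<^sup>1(S, R)\<close>. Modules divisible by \<open>x\<close> are injective, so
  \<open>Ext\<^sup>i(S, R) = 0\<close> for \<open>i \<ge> 2\<close>. An \<open>R\<close>-linear map \<open>S \<rightarrow> S\<close> is determined by its value at \<open>1\<close>, because \<open>R\<close> is
  dense in \<open>S\<close>; hence \<open>Hom(S, R) = 0\<close> unless \<open>R\<close> is complete. The same arguments show that \<open>M\<close> is divisible
  and that its socle over \<open>S\<close> is one-dimensional, so \<open>M\<close> is the direct sum of \<open>E\<close> and copies of \<open>Q(S)\<close>
  indexed by a maximal independent set \<open>C\<close>.

  For the size of \<open>C\<close>, choose \<open>\<alpha>\<close> in \<open>S\<close> but not in \<open>R\<close>. The \<open>S\<close>-linear map \<open>Hom(S, K) \<rightarrow> M\<close> that sends \<open>\<lambda>\<close> to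
  the class of \<open>\<alpha>\<lambda>\<close> modulo \<open>R\<close> stays injective modulo torsion, because \<open>[Q(S) : K]\<close> is infinite. If \<open>C\<close>
  were countable, then \<open>Hom(S, K)\<close> would have countable rank over \<open>S\<close>. But if \<open>B\<close> is a (necessarily
  infinite) basis of \<open>S\<close> over \<open>R\<close> up to torsion, then countably many functionals \<open>D\<^sub>n\<close> and their
  \<open>S\<close>-multiples involve only \<open>|B|\<close> functionals \<open>y \<mapsto> D\<^sub>n(b y)\<close> over \<open>K\<close>. As \<open>B\<close> contains \<open>|B|\<close> disjoint
  infinite subsets, one for each finite set of these, diagonalisation yields a functional outside their
  span.\<close>

section \<open>Linear maps\<close>

text \<open>Multiplication by \<alpha> is what makes Hom(S, K) useful: a functional that is merely
  reduced modulo R gives the zero class, because the functional itself is a lift to K. The twist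
  makes sense because K/R is torsion, so that S acts on it; for the same reason S acts on those
  elements of an injective module that powers of x annihilate. Infinite degree enters through the
  infinite basis B. Disjoint halves of B supply independent elements in the kernel of a functional,
  which force the multiplier of an induced endomorphism of S to be zero; and all cardinals in the
  diagonalisation are compared with |B|, which absorbs products with countable sets and passage to
  finite subsets. Two constraints shape the code. Injectivity is tested only on modules over the
  element type of R, so every extension of a map is derived anew from divisibility by x. And the
  resolution is arbitrary, so K/R has to be located inside J^1, by extending \<epsilon> from R to K
  and applying the first differential.\<close>

lemma linear_mapsI:
  assumes "\<And>x. x \<in> carrier M \<Longrightarrow> f x \<in> carrier N"
    and "\<And>x y. x \<in> carrier M \<Longrightarrow> y \<in> carrier M \<Longrightarrow> f (x \<oplus>\<^bsub>M\<^esub> y) = f x \<oplus>\<^bsub>N\<^esub> f y"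
    and "\<And>r x. r \<in> carrier R \<Longrightarrow> x \<in> carrier M \<Longrightarrow> f (r \<odot>\<^bsub>M\<^esub> x) = r \<odot>\<^bsub>N\<^esub> f x"
  shows "f \<in> linear_maps R M N"
  using assms by (auto simp: linear_maps_def)

lemma linear_maps_closed: "f \<in> linear_maps R M N \<Longrightarrow> x \<in> carrier M \<Longrightarrow> f x \<in> carrier N"
  by (auto simp: linear_maps_def)

lemma linear_maps_add:
  "f \<in> linear_maps R M N \<Longrightarrow> x \<in> carrier M \<Longrightarrow> y \<in> carrier M \<Longrightarrow> f (x \<oplus>\<^bsub>M\<^esub> y) = f x \<oplus>\<^bsub>N\<^esub> f y"
  by (auto simp: linear_maps_def)

lemma linear_maps_smult:
  "f \<in> linear_maps R M N \<Longrightarrow> r \<in> carrier R \<Longrightarrow> x \<in> carrier M \<Longrightarrow> f (r \<odot>\<^bsub>M\<^esub> x) = r \<odot>\<^bsub>N\<^esub> f x"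
  by (auto simp: linear_maps_def)

lemma linear_maps_zero:
  assumes "module R M" "module R N" "f \<in> linear_maps R M N"
  shows "f \<zero>\<^bsub>M\<^esub> = \<zero>\<^bsub>N\<^esub>"
proof -
  interpret M: module R M by fact
  interpret N: module R N by fact
  have "f (\<zero>\<^bsub>R\<^esub> \<odot>\<^bsub>M\<^esub> \<zero>\<^bsub>M\<^esub>) = \<zero>\<^bsub>R\<^esub> \<odot>\<^bsub>N\<^esub> f \<zero>\<^bsub>M\<^esub>"
    by (rule linear_maps_smult[OF assms(3)]) auto
  then show ?thesis using linear_maps_closed[OF assms(3)] by simp
qed

lemma (in abelian_group) a_inv_zero [simp]: "\<ominus> \<zero> = \<zero>"
  using l_neg[of \<zero>] by simp

lemma (in module) minus_as_smult:
  "v \<in> carrier M \<Longrightarrow> \<ominus>\<^bsub>M\<^esub> v = (\<ominus> \<one>) \<odot>\<^bsub>M\<^esub> v"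
  by (simp add: smult_l_minus)

lemma linear_maps_a_inv:
  assumes "module R M" "module R N" "f \<in> linear_maps R M N" "v \<in> carrier M"
  shows "f (\<ominus>\<^bsub>M\<^esub> v) = \<ominus>\<^bsub>N\<^esub> f v"
proof -
  interpret M: module R M by fact
  interpret N: module R N by fact
  show ?thesis using linear_maps_smult[OF assms(3) _ assms(4), of "\<ominus>\<^bsub>R\<^esub> \<one>\<^bsub>R\<^esub>"]
      linear_maps_closed[OF assms(3,4)] assms(4)
    by (simp add: M.minus_as_smult N.minus_as_smult)
qed

lemma linear_maps_diff:
  assumes "module R M" "module R N" "f \<in> linear_maps R M N" "v \<in> carrier M" "w \<in> carrier M"
  shows "f (v \<ominus>\<^bsub>M\<^esub> w) = f v \<ominus>\<^bsub>N\<^esub> f w"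
proof -
  interpret M: module R M by fact
  interpret N: module R N by fact
  show ?thesis using assms
    by (simp add: a_minus_def linear_maps_add[OF assms(3)] linear_maps_a_inv[OF assms(1-3)])
qed

lemma linear_maps_compose:
  assumes "f \<in> linear_maps R M N" "g \<in> linear_maps R N P"
  shows "(\<lambda>v. g (f v)) \<in> linear_maps R M P"
  using assms by (auto simp: linear_maps_def Pi_iff)

lemma linear_maps_pointwise_add:
  assumes "module R N" "f \<in> linear_maps R M N" "g \<in> linear_maps R M N"
  shows "(\<lambda>v. f v \<oplus>\<^bsub>N\<^esub> g v) \<in> linear_maps R M N"
proof -
  interpret N: module R N by fact
  show ?thesis using assms(2,3)
    by (auto simp: linear_maps_def Pi_iff N.smult_r_distr N.M.a_ac)
qed

lemma linear_maps_pointwise_smult: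
  assumes "module R N" "f \<in> linear_maps R M N" "r \<in> carrier R"
  shows "(\<lambda>v. r \<odot>\<^bsub>N\<^esub> f v) \<in> linear_maps R M N"
proof -
  interpret N: module R N by fact
  show ?thesis using assms(2,3)
    by (auto simp: linear_maps_def Pi_iff N.smult_r_distr N.smult_assoc1[symmetric] N.R.m_comm)
qed

lemma linear_maps_pointwise_diff:
  assumes "module R N" "f \<in> linear_maps R M N" "g \<in> linear_maps R M N"
  shows "(\<lambda>v. f v \<ominus>\<^bsub>N\<^esub> g v) \<in> linear_maps R M N"
proof -
  interpret N: module R N by fact
  show ?thesis using assms(2,3)
    by (auto simp: linear_maps_def Pi_iff a_minus_def N.smult_r_distr N.smult_r_minus N.M.minus_add N.M.a_ac)
qed

lemma linear_maps_cong:
  assumes "\<And>v. v \<in> carrier M \<Longrightarrow> f v = g v" "module R M" "f \<in> linear_maps R M N"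
  shows "g \<in> linear_maps R M N"
proof -
  interpret M: module R M by fact
  show ?thesis using assms(1,3) by (auto simp: linear_maps_def Pi_iff)
qed

section \<open>Discrete valuations and divisible modules\<close>

definition divisible_by :: "('r, 'm, 'c) module_scheme \<Rightarrow> 'r \<Rightarrow> bool" where
  "divisible_by M r \<longleftrightarrow> (\<forall>v\<in>carrier M. \<exists>w\<in>carrier M. r \<odot>\<^bsub>M\<^esub> w = v)"

text \<open>The input about valuations on which the module theory below rests: every nonzero element
  is a unit times a power of \<open>x\<close>. Isolating it lets the same results serve R and its
  completion, where \<open>\<phi> x\<close> takes the place of \<open>x\<close>.\<close>

locale uniformized_domain = domain R for R (structure) +
  fixes x
  assumes x_closed [simp, intro]: "x \<in> carrier R"
    and x_nonzero: "x \<noteq> \<zero>"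
    and x_not_unit: "x \<notin> Units R"
    and unit_power_ex: "\<lbrakk>r \<in> carrier R; r \<noteq> \<zero>\<rbrakk> \<Longrightarrow> \<exists>u\<in>Units R. \<exists>n::nat. r = u \<otimes> x [^] n"
begin

lemma x_pow_nonzero: "x [^] (n::nat) \<noteq> \<zero>"
  by (induction n) (auto simp: integral_iff x_nonzero)

lemma divisible_by_power:
  assumes "module R M" "divisible_by M x" "v \<in> carrier M"
  shows "\<exists>w\<in>carrier M. x [^] (n::nat) \<odot>\<^bsub>M\<^esub> w = v"
  using assms(3)
proof (induction n arbitrary: v)
  interpret M: module R M by fact
  case 0
  then show ?case by auto
next
  interpret M: module R M by fact
  case (Suc n)
  then obtain w where w: "w \<in> carrier M" "x [^] n \<odot>\<^bsub>M\<^esub> w = v" by blast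
  then obtain w' where "w' \<in> carrier M" "x \<odot>\<^bsub>M\<^esub> w' = w" using assms(2) by (auto simp: divisible_by_def)
  then have "x [^] Suc n \<odot>\<^bsub>M\<^esub> w' = v" "w' \<in> carrier M" using w by (auto simp: M.smult_assoc1)
  then show ?case by blast
qed

lemma divisible_by_nonzero:
  assumes "module R M" "divisible_by M x" "r \<in> carrier R" "r \<noteq> \<zero>"
  shows "divisible_by M r"
  unfolding divisible_by_def
proof
  interpret M: module R M by fact
  fix v assume v: "v \<in> carrier M"
  obtain u n where u: "u \<in> Units R" "r = u \<otimes> x [^] (n::nat)" using unit_power_ex assms by blast
  obtain w where w: "w \<in> carrier M" "x [^] n \<odot>\<^bsub>M\<^esub> w = inv u \<odot>\<^bsub>M\<^esub> v"
    using divisible_by_power[OF assms(1,2)] v u by (metis M.smult_closed Units_inv_closed)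
  have "r \<odot>\<^bsub>M\<^esub> w = u \<odot>\<^bsub>M\<^esub> (inv u \<odot>\<^bsub>M\<^esub> v)" using u w by (simp add: M.smult_assoc1 Units_closed)
  also have "\<dots> = v" using u v by (simp add: M.smult_assoc1[symmetric] Units_closed)
  finally show "\<exists>w\<in>carrier M. r \<odot>\<^bsub>M\<^esub> w = v" using w by blast
qed

text \<open>A linear map on a submodule of M, encoded by its graph, so that extension is inclusion
  and a chain has its union as upper bound. The last clause makes the relation
  single-valued.\<close>

definition linear_graph ::
    "('a, 'm, 'c) module_scheme \<Rightarrow> ('a, 'n, 'd) module_scheme \<Rightarrow> ('m \<times> 'n) set \<Rightarrow> bool" where
  "linear_graph M N G \<longleftrightarrow> G \<subseteq> carrier M \<times> carrier N \<and> (\<zero>\<^bsub>M\<^esub>, \<zero>\<^bsub>N\<^esub>) \<in> G \<and>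
     (\<forall>a b a' b'. (a, b) \<in> G \<longrightarrow> (a', b') \<in> G \<longrightarrow> (a \<oplus>\<^bsub>M\<^esub> a', b \<oplus>\<^bsub>N\<^esub> b') \<in> G) \<and>
     (\<forall>r a b. r \<in> carrier R \<longrightarrow> (a, b) \<in> G \<longrightarrow> (r \<odot>\<^bsub>M\<^esub> a, r \<odot>\<^bsub>N\<^esub> b) \<in> G) \<and>
     (\<forall>b. (\<zero>\<^bsub>M\<^esub>, b) \<in> G \<longrightarrow> b = \<zero>\<^bsub>N\<^esub>)"

lemma linear_graphD:
  assumes "linear_graph M N G"
  shows "\<And>a b. (a, b) \<in> G \<Longrightarrow> a \<in> carrier M" "\<And>a b. (a, b) \<in> G \<Longrightarrow> b \<in> carrier N"
    and "(\<zero>\<^bsub>M\<^esub>, \<zero>\<^bsub>N\<^esub>) \<in> G"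
    and "\<And>a b a' b'. (a, b) \<in> G \<Longrightarrow> (a', b') \<in> G \<Longrightarrow> (a \<oplus>\<^bsub>M\<^esub> a', b \<oplus>\<^bsub>N\<^esub> b') \<in> G"
    and "\<And>r a b. r \<in> carrier R \<Longrightarrow> (a, b) \<in> G \<Longrightarrow> (r \<odot>\<^bsub>M\<^esub> a, r \<odot>\<^bsub>N\<^esub> b) \<in> G"
    and "\<And>b. (\<zero>\<^bsub>M\<^esub>, b) \<in> G \<Longrightarrow> b = \<zero>\<^bsub>N\<^esub>"
  using assms unfolding linear_graph_def by blast+

lemma linear_graph_neg:
  assumes "module R M" "module R N" "linear_graph M N G" "(a, b) \<in> G"
  shows "(\<ominus>\<^bsub>M\<^esub> a, \<ominus>\<^bsub>N\<^esub> b) \<in> G"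
proof -
  interpret M: module R M by fact
  interpret N: module R N by fact
  show ?thesis using linear_graphD[OF assms(3)] assms(4) M.minus_as_smult N.minus_as_smult
    by (metis a_inv_closed one_closed)
qed

lemma linear_graph_functional:
  assumes "module R M" "module R N" "linear_graph M N G" "(a, b) \<in> G" "(a, b') \<in> G"
  shows "b = b'"
proof -
  interpret M: module R M by fact
  interpret N: module R N by fact
  have "(a \<oplus>\<^bsub>M\<^esub> \<ominus>\<^bsub>M\<^esub> a, b \<oplus>\<^bsub>N\<^esub> \<ominus>\<^bsub>N\<^esub> b') \<in> G"
    using linear_graphD(4)[OF assms(3)] linear_graph_neg[OF assms(1-3)] assms(4,5) by blast
  moreover have "a \<oplus>\<^bsub>M\<^esub> \<ominus>\<^bsub>M\<^esub> a = \<zero>\<^bsub>M\<^esub>"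
    using linear_graphD(1)[OF assms(3,4)] by (rule M.r_neg)
  ultimately have "b \<oplus>\<^bsub>N\<^esub> \<ominus>\<^bsub>N\<^esub> b' = \<zero>\<^bsub>N\<^esub>"
    using linear_graphD(6)[OF assms(3)] by metis
  then show ?thesis using linear_graphD(2)[OF assms(3)] assms(4,5)
    by (metis N.M.minus_minus N.M.minus_equality N.M.a_inv_closed N.M.a_comm)
qed

text \<open>y is adjoined with value j. The only danger is an equation 0 = c + r y with c in the old
  domain; it puts r y there too, and \<open>compat\<close> makes the two prescribed values
  cancel.\<close>

lemma linear_graph_extend:
  assumes M: "module R M" and N: "module R N" and G: "linear_graph M N G"
    and y: "y \<in> carrier M" and j: "j \<in> carrier N"
    and compat: "\<And>r b. r \<in> carrier R \<Longrightarrow> (r \<odot>\<^bsub>M\<^esub> y, b) \<in> G \<Longrightarrow> r \<odot>\<^bsub>N\<^esub> j = b"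
  shows "linear_graph M N {(a \<oplus>\<^bsub>M\<^esub> r \<odot>\<^bsub>M\<^esub> y, b \<oplus>\<^bsub>N\<^esub> r \<odot>\<^bsub>N\<^esub> j) |a b r. (a, b) \<in> G \<and> r \<in> carrier R}"
    (is "linear_graph M N ?G'")
proof -
  interpret M: module R M by fact
  interpret N: module R N by fact
  note D = linear_graphD[OF G]
  have c1: "?G' \<subseteq> carrier M \<times> carrier N" using D(1,2) y j by auto
  have c2: "(\<zero>\<^bsub>M\<^esub>, \<zero>\<^bsub>N\<^esub>) \<in> ?G'"
    using D(3) y j by (auto intro!: exI[of _ "\<zero>\<^bsub>M\<^esub>"] exI[of _ "\<zero>\<^bsub>N\<^esub>"] exI[of _ \<zero>])
  have c3: "(a \<oplus>\<^bsub>M\<^esub> a', b \<oplus>\<^bsub>N\<^esub> b') \<in> ?G'" if ab: "(a, b) \<in> ?G'" "(a', b') \<in> ?G'" for a b a' b'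
  proof -
    obtain c e r c' e' r' where
      1: "a = c \<oplus>\<^bsub>M\<^esub> r \<odot>\<^bsub>M\<^esub> y" "b = e \<oplus>\<^bsub>N\<^esub> r \<odot>\<^bsub>N\<^esub> j" "(c, e) \<in> G" "r \<in> carrier R" and
      2: "a' = c' \<oplus>\<^bsub>M\<^esub> r' \<odot>\<^bsub>M\<^esub> y" "b' = e' \<oplus>\<^bsub>N\<^esub> r' \<odot>\<^bsub>N\<^esub> j" "(c', e') \<in> G" "r' \<in> carrier R"
      using ab by blast
    have "a \<oplus>\<^bsub>M\<^esub> a' = (c \<oplus>\<^bsub>M\<^esub> c') \<oplus>\<^bsub>M\<^esub> (r \<oplus> r') \<odot>\<^bsub>M\<^esub> y"
      using 1 2 D(1)[OF 1(3)] D(1)[OF 2(3)] y by (simp add: M.smult_l_distr M.M.a_ac)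
    moreover have "b \<oplus>\<^bsub>N\<^esub> b' = (e \<oplus>\<^bsub>N\<^esub> e') \<oplus>\<^bsub>N\<^esub> (r \<oplus> r') \<odot>\<^bsub>N\<^esub> j"
      using 1 2 D(2)[OF 1(3)] D(2)[OF 2(3)] j by (simp add: N.smult_l_distr N.M.a_ac)
    ultimately show ?thesis using D(4)[OF 1(3) 2(3)] 1(4) 2(4) by blast
  qed
  have c4: "(s \<odot>\<^bsub>M\<^esub> a, s \<odot>\<^bsub>N\<^esub> b) \<in> ?G'" if ab: "s \<in> carrier R" "(a, b) \<in> ?G'" for s a b
  proof -
    obtain c e r where
      1: "a = c \<oplus>\<^bsub>M\<^esub> r \<odot>\<^bsub>M\<^esub> y" "b = e \<oplus>\<^bsub>N\<^esub> r \<odot>\<^bsub>N\<^esub> j" "(c, e) \<in> G" "r \<in> carrier R"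
      using ab by blast
    have "s \<odot>\<^bsub>M\<^esub> a = s \<odot>\<^bsub>M\<^esub> c \<oplus>\<^bsub>M\<^esub> (s \<otimes> r) \<odot>\<^bsub>M\<^esub> y"
      using 1 D(1)[OF 1(3)] y ab by (simp add: M.smult_r_distr M.smult_assoc1)
    moreover have "s \<odot>\<^bsub>N\<^esub> b = s \<odot>\<^bsub>N\<^esub> e \<oplus>\<^bsub>N\<^esub> (s \<otimes> r) \<odot>\<^bsub>N\<^esub> j"
      using 1 D(2)[OF 1(3)] j ab by (simp add: N.smult_r_distr N.smult_assoc1)
    ultimately show ?thesis using D(5)[OF ab(1) 1(3)] 1(4) ab(1) by blast
  qed
  have c5: "b = \<zero>\<^bsub>N\<^esub>" if b: "(\<zero>\<^bsub>M\<^esub>, b) \<in> ?G'" for b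
  proof -
    obtain c e r where
      1: "\<zero>\<^bsub>M\<^esub> = c \<oplus>\<^bsub>M\<^esub> r \<odot>\<^bsub>M\<^esub> y" "b = e \<oplus>\<^bsub>N\<^esub> r \<odot>\<^bsub>N\<^esub> j" "(c, e) \<in> G" "r \<in> carrier R"
      using b by blast
    have "r \<odot>\<^bsub>M\<^esub> y = \<ominus>\<^bsub>M\<^esub> c" using 1 D(1)[OF 1(3)] y
      by (metis M.M.minus_equality M.M.a_comm M.smult_closed)
    then have "(r \<odot>\<^bsub>M\<^esub> y, \<ominus>\<^bsub>N\<^esub> e) \<in> G" using linear_graph_neg[OF M N G 1(3)] by simp
    then have "r \<odot>\<^bsub>N\<^esub> j = \<ominus>\<^bsub>N\<^esub> e" using compat 1(4) by blast
    then show ?thesis using 1(2) D(2)[OF 1(3)] by (simp add: N.M.r_neg)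
  qed
  show ?thesis unfolding linear_graph_def by (intro conjI allI impI) (fact c1 c2 | erule (1) c3 c4 | erule c5)+
qed

text \<open>The scalars r with r y in the domain of G form an ideal, which is zero or generated by a
  power of x. The value prescribed at that power times y is divided by the same power in N.\<close>

lemma linear_graph_extension_value:
  assumes M: "module R M" and N: "module R N" and div: "divisible_by N x"
    and G: "linear_graph M N G" and y: "y \<in> carrier M"
  shows "\<exists>j\<in>carrier N. \<forall>r b. r \<in> carrier R \<longrightarrow> (r \<odot>\<^bsub>M\<^esub> y, b) \<in> G \<longrightarrow> r \<odot>\<^bsub>N\<^esub> j = b"
proof -
  interpret M: module R M by fact
  interpret N: module R N by fact
  note D = linear_graphD[OF G]
  let ?D = "\<lambda>n::nat. \<exists>b. (x [^] n \<odot>\<^bsub>M\<^esub> y, b) \<in> G"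
  have reduce: "(x [^] k \<odot>\<^bsub>M\<^esub> y, inv u \<odot>\<^bsub>N\<^esub> b) \<in> G"
    if "u \<in> Units R" "((u \<otimes> x [^] (k::nat)) \<odot>\<^bsub>M\<^esub> y, b) \<in> G" for u k b
  proof -
    have "(inv u \<odot>\<^bsub>M\<^esub> ((u \<otimes> x [^] k) \<odot>\<^bsub>M\<^esub> y), inv u \<odot>\<^bsub>N\<^esub> b) \<in> G" using D(5) that by blast
    moreover have "inv u \<odot>\<^bsub>M\<^esub> ((u \<otimes> x [^] k) \<odot>\<^bsub>M\<^esub> y) = x [^] k \<odot>\<^bsub>M\<^esub> y"
      using that y by (simp add: M.smult_assoc1[symmetric] Units_closed m_assoc[symmetric])
    ultimately show ?thesis by simp
  qed
  show ?thesis
  proof (cases "\<exists>n. ?D n")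
    \<comment> \<open>If no power of x brings y into the domain, then only r = 0 does, and j = 0
      serves.\<close>
    case False
    have "r \<odot>\<^bsub>N\<^esub> \<zero>\<^bsub>N\<^esub> = b" if "r \<in> carrier R" "(r \<odot>\<^bsub>M\<^esub> y, b) \<in> G" for r b
    proof (cases "r = \<zero>")
      case True
      then show ?thesis using that(2) D(2)[OF that(2)] D(6) y by (metis M.smult_l_null N.smult_l_null)
    next
      case False
      from unit_power_ex[OF that(1) False]
      obtain u n where "u \<in> Units R" "r = u \<otimes> x [^] (n::nat)" by blast
      with that(2) have "((u \<otimes> x [^] n) \<odot>\<^bsub>M\<^esub> y, b) \<in> G" by simp
      from reduce[OF \<open>u \<in> Units R\<close> this] show ?thesis using \<open>\<nexists>n. ?D n\<close> by blast
    qed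
    then show ?thesis by blast
  next
    case True
    \<comment> \<open>x^n generates the ideal, so a compatible j has to solve x^n j = b0.\<close>
    define n where "n = (LEAST n. ?D n)"
    have n: "?D n" "\<And>k. ?D k \<Longrightarrow> n \<le> k"
      using True LeastI_ex[of ?D] Least_le[of ?D] unfolding n_def by blast+
    then obtain b0 where b0: "(x [^] n \<odot>\<^bsub>M\<^esub> y, b0) \<in> G" by blast
    obtain j where j: "j \<in> carrier N" "x [^] n \<odot>\<^bsub>N\<^esub> j = b0"
      using divisible_by_power[OF N div D(2)[OF b0]] by blast
    have "r \<odot>\<^bsub>N\<^esub> j = b" if "r \<in> carrier R" "(r \<odot>\<^bsub>M\<^esub> y, b) \<in> G" for r b
    proof (cases "r = \<zero>")
      case True
      then show ?thesis using that(2) D(6) y j by (metis M.smult_l_null N.smult_l_null)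
    next
      case False
      from unit_power_ex[OF that(1) False]
      obtain u k where u: "u \<in> Units R" "r = u \<otimes> x [^] (k::nat)" by blast
      with that(2) have "((u \<otimes> x [^] k) \<odot>\<^bsub>M\<^esub> y, b) \<in> G" by simp
      then have xk: "(x [^] k \<odot>\<^bsub>M\<^esub> y, inv u \<odot>\<^bsub>N\<^esub> b) \<in> G" by (rule reduce[OF u(1)])
      then have "n \<le> k" using n(2) by blast
      then have pow: "x [^] k = x [^] (k - n) \<otimes> x [^] n" by (simp add: nat_pow_mult)
      have "(x [^] (k - n) \<odot>\<^bsub>M\<^esub> (x [^] n \<odot>\<^bsub>M\<^esub> y), x [^] (k - n) \<odot>\<^bsub>N\<^esub> b0) \<in> G"
        using D(5) b0 by blast
      then have "(x [^] k \<odot>\<^bsub>M\<^esub> y, x [^] (k - n) \<odot>\<^bsub>N\<^esub> b0) \<in> G"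
        using y by (simp add: pow M.smult_assoc1)
      then have "inv u \<odot>\<^bsub>N\<^esub> b = x [^] (k - n) \<odot>\<^bsub>N\<^esub> b0"
        using linear_graph_functional[OF M N G xk] by blast
      also have "\<dots> = x [^] k \<odot>\<^bsub>N\<^esub> j" using j by (simp add: pow N.smult_assoc1)
      finally have eq: "u \<odot>\<^bsub>N\<^esub> (inv u \<odot>\<^bsub>N\<^esub> b) = u \<odot>\<^bsub>N\<^esub> (x [^] k \<odot>\<^bsub>N\<^esub> j)" by simp
      have "b \<in> carrier N" using D(2) that by blast
      then show ?thesis using eq u j by (simp add: N.smult_assoc1[symmetric] Units_closed)
    qed
    then show ?thesis using j by blast
  qed
qed

lemma linear_graph_chain_Union:
  assumes "C \<noteq> {}" "\<And>G. G \<in> C \<Longrightarrow> linear_graph M N G"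
    and chain: "\<And>G H. G \<in> C \<Longrightarrow> H \<in> C \<Longrightarrow> G \<subseteq> H \<or> H \<subseteq> G"
  shows "linear_graph M N (\<Union>C)"
proof -
  note D = linear_graphD[OF assms(2)]
  have "(a \<oplus>\<^bsub>M\<^esub> a', b \<oplus>\<^bsub>N\<^esub> b') \<in> \<Union>C" if ab: "(a, b) \<in> \<Union>C" "(a', b') \<in> \<Union>C" for a b a' b'
  proof -
    obtain G H where "G \<in> C" "H \<in> C" "(a, b) \<in> G" "(a', b') \<in> H" using ab by blast
    with chain[of G H] D(4) show ?thesis by blast
  qed
  moreover have "\<Union>C \<subseteq> carrier M \<times> carrier N" using D(1,2) by fast
  moreover have "(\<zero>\<^bsub>M\<^esub>, \<zero>\<^bsub>N\<^esub>) \<in> \<Union>C" using D(3) assms(1) by blast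
  moreover have "(r \<odot>\<^bsub>M\<^esub> a, r \<odot>\<^bsub>N\<^esub> b) \<in> \<Union>C" if "r \<in> carrier R" "(a, b) \<in> \<Union>C" for r a b
    using D(5) that by blast
  moreover have "b = \<zero>\<^bsub>N\<^esub>" if "(\<zero>\<^bsub>M\<^esub>, b) \<in> \<Union>C" for b using D(6) that by blast
  ultimately show ?thesis unfolding linear_graph_def by blast
qed

text \<open>Baer's criterion: divisibility by the single element x makes N injective. The modules
  may have elements of any types, whereas \<open>injective_module\<close> speaks of test modules on
  the element type of R; extensions along maps out of K or the completion have to go through this
  theorem.\<close>

theorem divisible_extension:
  assumes M: "module R M" and N: "module R N" and A: "module R A" and div: "divisible_by N x"
    and i: "i \<in> linear_maps R A M" "inj_on i (carrier A)" and f: "f \<in> linear_maps R A N"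
  shows "\<exists>g\<in>linear_maps R M N. \<forall>v\<in>carrier A. g (i v) = f v"
proof -
  interpret M: module R M by fact
  interpret N: module R N by fact
  interpret A: module R A by fact
  define G0 where "G0 = (\<lambda>v. (i v, f v)) ` carrier A"
  have "linear_graph M N G0"
    unfolding linear_graph_def
  proof (intro conjI allI impI)
    show "G0 \<subseteq> carrier M \<times> carrier N" using linear_maps_closed[OF i(1)] linear_maps_closed[OF f] by (auto simp: G0_def)
    show "(\<zero>\<^bsub>M\<^esub>, \<zero>\<^bsub>N\<^esub>) \<in> G0"
      using linear_maps_zero[OF A M i(1)] linear_maps_zero[OF A N f] by (force simp: G0_def)
    show "(a \<oplus>\<^bsub>M\<^esub> a', b \<oplus>\<^bsub>N\<^esub> b') \<in> G0" if "(a, b) \<in> G0" "(a', b') \<in> G0" for a b a' b'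
      using that linear_maps_add[OF i(1)] linear_maps_add[OF f]
      by (auto simp: G0_def) (metis (mono_tags, lifting) A.M.a_closed image_iff)
    show "(r \<odot>\<^bsub>M\<^esub> a, r \<odot>\<^bsub>N\<^esub> b) \<in> G0" if "r \<in> carrier R" "(a, b) \<in> G0" for r a b
      using that linear_maps_smult[OF i(1)] linear_maps_smult[OF f]
      by (auto simp: G0_def intro!: image_eqI[where x = "r \<odot>\<^bsub>A\<^esub> v" for v])
    \<comment> \<open>Injectivity of i makes the initial graph single-valued.\<close>
    show "b = \<zero>\<^bsub>N\<^esub>" if "(\<zero>\<^bsub>M\<^esub>, b) \<in> G0" for b
    proof -
      obtain v where v: "v \<in> carrier A" "i v = \<zero>\<^bsub>M\<^esub>" "b = f v" using \<open>(\<zero>\<^bsub>M\<^esub>, b) \<in> G0\<close> by (auto simp: G0_def)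
      then have "v = \<zero>\<^bsub>A\<^esub>" using i(2) linear_maps_zero[OF A M i(1)] by (metis A.M.zero_closed inj_onD)
      then show ?thesis using v linear_maps_zero[OF A N f] by simp
    qed
  qed
  then obtain G where G: "linear_graph M N G" "G0 \<subseteq> G"
    and max: "\<And>H. linear_graph M N H \<Longrightarrow> G \<subseteq> H \<Longrightarrow> H = G"
  proof -
    have "\<exists>G\<in>{G. linear_graph M N G \<and> G0 \<subseteq> G}. \<forall>H\<in>{G. linear_graph M N G \<and> G0 \<subseteq> G}. G \<subseteq> H \<longrightarrow> H = G"
    proof (rule subset_Zorn_nonempty)
      show "{G. linear_graph M N G \<and> G0 \<subseteq> G} \<noteq> {}" using \<open>linear_graph M N G0\<close> by blast
      show "\<Union>C \<in> {G. linear_graph M N G \<and> G0 \<subseteq> G}"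
        if "C \<noteq> {}" "subset.chain {G. linear_graph M N G \<and> G0 \<subseteq> G} C" for C
        using that linear_graph_chain_Union[OF that(1), of M N]
        by (auto simp: subset_chain_def)
    qed
    then show ?thesis using that by (metis (no_types, lifting) mem_Collect_eq order_trans)
  qed
  note D = linear_graphD[OF G(1)]
  have total: "\<exists>b. (y, b) \<in> G" if y: "y \<in> carrier M" for y
  proof -
    obtain j where j: "j \<in> carrier N" "\<And>r b. r \<in> carrier R \<Longrightarrow> (r \<odot>\<^bsub>M\<^esub> y, b) \<in> G \<Longrightarrow> r \<odot>\<^bsub>N\<^esub> j = b"
      using linear_graph_extension_value[OF M N div G(1) y] by blast
    let ?G' = "{(a \<oplus>\<^bsub>M\<^esub> r \<odot>\<^bsub>M\<^esub> y, b \<oplus>\<^bsub>N\<^esub> r \<odot>\<^bsub>N\<^esub> j) |a b r. (a, b) \<in> G \<and> r \<in> carrier R}"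
    have "linear_graph M N ?G'" using linear_graph_extend[OF M N G(1) y j] by blast
    moreover have "G \<subseteq> ?G'"
    proof (clarify)
      fix a b assume ab: "(a, b) \<in> G"
      have "a = a \<oplus>\<^bsub>M\<^esub> \<zero> \<odot>\<^bsub>M\<^esub> y" "b = b \<oplus>\<^bsub>N\<^esub> \<zero> \<odot>\<^bsub>N\<^esub> j" using D(1,2)[OF ab] y j by auto
      then show "\<exists>a' b' r. (a, b) = (a' \<oplus>\<^bsub>M\<^esub> r \<odot>\<^bsub>M\<^esub> y, b' \<oplus>\<^bsub>N\<^esub> r \<odot>\<^bsub>N\<^esub> j) \<and> (a', b') \<in> G \<and> r \<in> carrier R"
        using ab by blast
    qed
    ultimately have "?G' = G" using max by blast
    moreover have "(\<zero>\<^bsub>M\<^esub> \<oplus>\<^bsub>M\<^esub> \<one> \<odot>\<^bsub>M\<^esub> y, \<zero>\<^bsub>N\<^esub> \<oplus>\<^bsub>N\<^esub> \<one> \<odot>\<^bsub>N\<^esub> j) \<in> ?G'" using D(3) by blast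
    ultimately show ?thesis using y by auto
  qed
  define g where "g y = (THE b. (y, b) \<in> G)" for y
  have g: "g y = b" if "(y, b) \<in> G" for y b
    unfolding g_def using that linear_graph_functional[OF M N G(1)] by blast
  have gG: "(y, g y) \<in> G" if "y \<in> carrier M" for y using total[OF that] g by auto
  have "g \<in> linear_maps R M N"
    using gG D(2,4,5) by (intro linear_mapsI g) auto
  moreover have "g (i v) = f v" if "v \<in> carrier A" for v
    using G(2) that by (intro g) (auto simp: G0_def)
  ultimately show ?thesis by blast
qed

end

section \<open>Quotient fields\<close>

lemma module_ring_module: "cring S \<Longrightarrow> module S (ring_module S)"
proof -
  assume "cring S"
  then interpret cring S .
  have "abelian_group (ring_module S)"
  proof (rule abelian_groupI)
    show "\<exists>w\<in>carrier (ring_module S). w \<oplus>\<^bsub>ring_module S\<^esub> v = \<zero>\<^bsub>ring_module S\<^esub>"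
      if "v \<in> carrier (ring_module S)" for v
      using that by (intro bexI[of _ "\<ominus>\<^bsub>S\<^esub> v"]) (auto simp: ring_module_def l_neg)
  qed (auto simp: ring_module_def a_ac)
  then show ?thesis
    by (intro moduleI) (auto simp: ring_module_def l_distr r_distr m_assoc is_cring)
qed

lemma module_restrict_scalars:
  assumes "cring R" "h \<in> ring_hom R S" "module S M"
  shows "module R (restrict_scalars h M)"
proof -
  interpret M: module S M by fact
  have "abelian_group (restrict_scalars h M)"
  proof (rule abelian_groupI)
    show "\<exists>w\<in>carrier (restrict_scalars h M). w \<oplus>\<^bsub>restrict_scalars h M\<^esub> v = \<zero>\<^bsub>restrict_scalars h M\<^esub>"
      if "v \<in> carrier (restrict_scalars h M)" for v
      using that by (intro bexI[of _ "\<ominus>\<^bsub>M\<^esub> v"]) (auto simp: restrict_scalars_def M.M.l_neg)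
  qed (auto simp: restrict_scalars_def M.M.a_ac)
  then show ?thesis using assms
    by (intro moduleI)
      (auto simp: restrict_scalars_def ring_hom_closed ring_hom_add ring_hom_mult ring_hom_one
        M.smult_l_distr M.smult_r_distr M.smult_assoc1)
qed

lemma restrict_scalars_simps [simp]:
  "carrier (restrict_scalars h M) = carrier M" "ring.add (restrict_scalars h M) = ring.add M"
  "ring.zero (restrict_scalars h M) = ring.zero M" "smult (restrict_scalars h M) r v = smult M (h r) v"
  by (simp_all add: restrict_scalars_def)

lemma ring_module_simps [simp]:
  "carrier (ring_module S) = carrier S" "ring.add (ring_module S) = ring.add S"
  "ring.zero (ring_module S) = ring.zero S" "smult (ring_module S) = monoid.mult S"
  by (simp_all add: ring_module_def)

context domain
begin

abbreviation "K \<equiv> quotient_field R"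
abbreviation "quot \<equiv> fraction R"

lemma fraction_rel_equiv: "equiv (carrier R \<times> (carrier R - {\<zero>})) (fraction_rel R)"
proof (rule equivI)
  show "fraction_rel R \<subseteq> (carrier R \<times> (carrier R - {\<zero>})) \<times> (carrier R \<times> (carrier R - {\<zero>}))"
    by (auto simp: fraction_rel_def)
  show "refl_on (carrier R \<times> (carrier R - {\<zero>})) (fraction_rel R)"
    by (auto simp: fraction_rel_def refl_on_def)
  show "sym (fraction_rel R)" by (auto simp: fraction_rel_def sym_def)
  show "trans (fraction_rel R)"
  proof (rule transI, clarify)
    fix a b c d e f
    assume "((a, b), c, d) \<in> fraction_rel R" "((c, d), e, f) \<in> fraction_rel R"
    then have *: "a \<in> carrier R" "b \<in> carrier R" "c \<in> carrier R" "d \<in> carrier R" "e \<in> carrier R"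
        "f \<in> carrier R" "b \<noteq> \<zero>" "d \<noteq> \<zero>" "f \<noteq> \<zero>"
      and eq: "a \<otimes> d = c \<otimes> b" "c \<otimes> f = e \<otimes> d"
      by (auto simp: fraction_rel_def)
    \<comment> \<open>Transitivity holds after multiplication by d, which a domain allows to
      cancel.\<close>
    have "d \<otimes> (a \<otimes> f) = (a \<otimes> d) \<otimes> f" using * by (simp add: m_ac)
    also have "\<dots> = (c \<otimes> f) \<otimes> b" unfolding eq(1) using * by (simp add: m_ac)
    also have "\<dots> = d \<otimes> (e \<otimes> b)" unfolding eq(2) using * by (simp add: m_ac)
    finally have "a \<otimes> f = e \<otimes> b" using * m_lcancel by auto
    then show "((a, b), e, f) \<in> fraction_rel R" using * by (simp add: fraction_rel_def)
  qed
qed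

lemma fraction_eq_iff:
  assumes "a \<in> carrier R" "b \<in> carrier R" "b \<noteq> \<zero>" "c \<in> carrier R" "d \<in> carrier R" "d \<noteq> \<zero>"
  shows "quot a b = quot c d \<longleftrightarrow> a \<otimes> d = c \<otimes> b"
  unfolding fraction_def using eq_equiv_class_iff[OF fraction_rel_equiv, of "(a, b)" "(c, d)"] assms
  by (simp add: fraction_rel_def)

lemma fraction_closed [simp, intro]:
  "\<lbrakk>a \<in> carrier R; b \<in> carrier R; b \<noteq> \<zero>\<rbrakk> \<Longrightarrow> quot a b \<in> carrier K"
  unfolding quotient_field_def fraction_def by (auto intro: quotientI)

lemma quotient_field_cases:
  assumes "P \<in> carrier K"
  obtains a b where "a \<in> carrier R" "b \<in> carrier R" "b \<noteq> \<zero>" "P = quot a b"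
  using assms unfolding quotient_field_def fraction_def by (auto elim!: quotientE)

lemma fraction_mem_iff:
  assumes "a \<in> carrier R" "b \<in> carrier R" "b \<noteq> \<zero>"
  shows "(c, d) \<in> quot a b \<longleftrightarrow> c \<in> carrier R \<and> d \<in> carrier R \<and> d \<noteq> \<zero> \<and> a \<otimes> d = c \<otimes> b"
  using assms by (auto simp: fraction_def fraction_rel_def)

text \<open>All representatives yield the same class, so the double union in the definition of the
  product collapses.\<close>

lemma fraction_mult:
  assumes "a \<in> carrier R" "b \<in> carrier R" "b \<noteq> \<zero>" "c \<in> carrier R" "d \<in> carrier R" "d \<noteq> \<zero>"
  shows "quot a b \<otimes>\<^bsub>K\<^esub> quot c d = quot (a \<otimes> c) (b \<otimes> d)"
proof -
  have "quot (a' \<otimes> c') (b' \<otimes> d') = quot (a \<otimes> c) (b \<otimes> d)"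
    if "(a', b') \<in> quot a b" "(c', d') \<in> quot c d" for a' b' c' d'
  proof -
    from that have *: "a' \<in> carrier R" "b' \<in> carrier R" "b' \<noteq> \<zero>" "c' \<in> carrier R" "d' \<in> carrier R" "d' \<noteq> \<zero>"
      and eq: "a \<otimes> b' = a' \<otimes> b" "c \<otimes> d' = c' \<otimes> d"
      using assms by (auto simp: fraction_mem_iff)
    have "(a' \<otimes> c') \<otimes> (b \<otimes> d) = (a' \<otimes> b) \<otimes> (c' \<otimes> d)" using * assms by (simp add: m_ac)
    also have "\<dots> = (a \<otimes> b') \<otimes> (c \<otimes> d')" using eq by simp
    also have "\<dots> = (a \<otimes> c) \<otimes> (b' \<otimes> d')" using * assms by (simp add: m_ac)
    finally show ?thesis using * assms by (simp add: fraction_eq_iff integral_iff)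
  qed
  then have "(\<Union>(a', b')\<in>quot a b. \<Union>(c', d')\<in>quot c d. quot (a' \<otimes> c') (b' \<otimes> d'))
      = (\<Union>z\<in>quot a b. \<Union>w\<in>quot c d. quot (a \<otimes> c) (b \<otimes> d))"
    by (intro SUP_cong) auto
  moreover have "(a, b) \<in> quot a b" "(c, d) \<in> quot c d" using assms by (simp_all add: fraction_mem_iff)
  ultimately show ?thesis by (auto simp: quotient_field_def)
qed

lemma fraction_add:
  assumes "a \<in> carrier R" "b \<in> carrier R" "b \<noteq> \<zero>" "c \<in> carrier R" "d \<in> carrier R" "d \<noteq> \<zero>"
  shows "quot a b \<oplus>\<^bsub>K\<^esub> quot c d = quot (a \<otimes> d \<oplus> c \<otimes> b) (b \<otimes> d)"
proof -
  have "quot (a' \<otimes> d' \<oplus> c' \<otimes> b') (b' \<otimes> d') = quot (a \<otimes> d \<oplus> c \<otimes> b) (b \<otimes> d)"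
    if "(a', b') \<in> quot a b" "(c', d') \<in> quot c d" for a' b' c' d'
  proof -
    from that have *: "a' \<in> carrier R" "b' \<in> carrier R" "b' \<noteq> \<zero>" "c' \<in> carrier R" "d' \<in> carrier R" "d' \<noteq> \<zero>"
      and eq: "a \<otimes> b' = a' \<otimes> b" "c \<otimes> d' = c' \<otimes> d"
      using assms by (auto simp: fraction_mem_iff)
    have "(a' \<otimes> d' \<oplus> c' \<otimes> b') \<otimes> (b \<otimes> d) = (a' \<otimes> b) \<otimes> (d \<otimes> d') \<oplus> (c' \<otimes> d) \<otimes> (b \<otimes> b')"
      using * assms by (simp add: m_ac l_distr r_distr)
    also have "\<dots> = (a \<otimes> b') \<otimes> (d \<otimes> d') \<oplus> (c \<otimes> d') \<otimes> (b \<otimes> b')" using eq by simp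
    also have "\<dots> = (a \<otimes> d \<oplus> c \<otimes> b) \<otimes> (b' \<otimes> d')" using * assms by (simp add: m_ac l_distr r_distr)
    finally show ?thesis using * assms by (simp add: fraction_eq_iff integral_iff)
  qed
  then have "(\<Union>(a', b')\<in>quot a b. \<Union>(c', d')\<in>quot c d. quot (a' \<otimes> d' \<oplus> c' \<otimes> b') (b' \<otimes> d'))
      = (\<Union>z\<in>quot a b. \<Union>w\<in>quot c d. quot (a \<otimes> d \<oplus> c \<otimes> b) (b \<otimes> d))"
    by (intro SUP_cong) auto
  moreover have "(a, b) \<in> quot a b" "(c, d) \<in> quot c d" using assms by (simp_all add: fraction_mem_iff)
  ultimately show ?thesis by (auto simp: quotient_field_def)
qed

lemma fraction_one: "\<one>\<^bsub>K\<^esub> = quot \<one> \<one>" and fraction_zero: "\<zero>\<^bsub>K\<^esub> = quot \<zero> \<one>"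
  by (simp_all add: quotient_field_def)

lemma fraction_eq_zero_iff:
  "\<lbrakk>a \<in> carrier R; b \<in> carrier R; b \<noteq> \<zero>\<rbrakk> \<Longrightarrow> quot a b = \<zero>\<^bsub>K\<^esub> \<longleftrightarrow> a = \<zero>"
  by (simp add: fraction_zero fraction_eq_iff)

lemma quotient_field_cring: "cring K"
proof (rule cringI)
  show "abelian_group K"
  proof (rule abelian_groupI)
    show "P \<oplus>\<^bsub>K\<^esub> Q \<in> carrier K" if "P \<in> carrier K" "Q \<in> carrier K" for P Q
      using that by (auto elim!: quotient_field_cases simp: fraction_add integral_iff)
    show "\<zero>\<^bsub>K\<^esub> \<in> carrier K" by (simp add: fraction_zero)
    show "(P \<oplus>\<^bsub>K\<^esub> Q) \<oplus>\<^bsub>K\<^esub> U = P \<oplus>\<^bsub>K\<^esub> (Q \<oplus>\<^bsub>K\<^esub> U)"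
      if PQU: "P \<in> carrier K" "Q \<in> carrier K" "U \<in> carrier K" for P Q U
    proof -
      obtain a b where P: "a \<in> carrier R" "b \<in> carrier R" "b \<noteq> \<zero>" "P = quot a b"
        using PQU(1) by (rule quotient_field_cases)
      obtain c d where Q: "c \<in> carrier R" "d \<in> carrier R" "d \<noteq> \<zero>" "Q = quot c d"
        using PQU(2) by (rule quotient_field_cases)
      obtain e f where U: "e \<in> carrier R" "f \<in> carrier R" "f \<noteq> \<zero>" "U = quot e f"
        using PQU(3) by (rule quotient_field_cases)
      show ?thesis unfolding P(4) Q(4) U(4) using P(1-3) Q(1-3) U(1-3)
        by (simp add: fraction_add fraction_mult integral_iff fraction_eq_iff)
          (simp add: m_ac l_distr r_distr a_ac)
    qed
    show "P \<oplus>\<^bsub>K\<^esub> Q = Q \<oplus>\<^bsub>K\<^esub> P" if "P \<in> carrier K" "Q \<in> carrier K" for P Q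
      using that by (auto elim!: quotient_field_cases simp: fraction_add m_ac a_ac)
    show "\<zero>\<^bsub>K\<^esub> \<oplus>\<^bsub>K\<^esub> P = P" if "P \<in> carrier K" for P
      using that by (auto elim!: quotient_field_cases simp: fraction_zero fraction_add)
    show "\<exists>Q\<in>carrier K. Q \<oplus>\<^bsub>K\<^esub> P = \<zero>\<^bsub>K\<^esub>" if P: "P \<in> carrier K" for P
    proof -
      obtain a b where *: "a \<in> carrier R" "b \<in> carrier R" "b \<noteq> \<zero>" "P = quot a b"
        using P by (rule quotient_field_cases)
      then have "quot (\<ominus> a) b \<oplus>\<^bsub>K\<^esub> P = \<zero>\<^bsub>K\<^esub>"
        by (simp add: fraction_add fraction_eq_zero_iff integral_iff l_neg flip: l_distr)
      then show ?thesis using * by blast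
    qed
  qed
  show "comm_monoid K"
  proof (rule comm_monoidI)
    show "P \<otimes>\<^bsub>K\<^esub> Q \<in> carrier K" if "P \<in> carrier K" "Q \<in> carrier K" for P Q
      using that by (auto elim!: quotient_field_cases simp: fraction_mult integral_iff)
    show "\<one>\<^bsub>K\<^esub> \<in> carrier K" by (simp add: fraction_one)
    show "(P \<otimes>\<^bsub>K\<^esub> Q) \<otimes>\<^bsub>K\<^esub> U = P \<otimes>\<^bsub>K\<^esub> (Q \<otimes>\<^bsub>K\<^esub> U)"
      if "P \<in> carrier K" "Q \<in> carrier K" "U \<in> carrier K" for P Q U
      using that by (auto elim!: quotient_field_cases simp: fraction_mult integral_iff m_assoc)
    show "P \<otimes>\<^bsub>K\<^esub> Q = Q \<otimes>\<^bsub>K\<^esub> P" if "P \<in> carrier K" "Q \<in> carrier K" for P Q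
      using that by (auto elim!: quotient_field_cases simp: fraction_mult m_comm)
    show "\<one>\<^bsub>K\<^esub> \<otimes>\<^bsub>K\<^esub> P = P" if "P \<in> carrier K" for P
      using that by (auto elim!: quotient_field_cases simp: fraction_one fraction_mult)
  qed
  show "(P \<oplus>\<^bsub>K\<^esub> Q) \<otimes>\<^bsub>K\<^esub> U = P \<otimes>\<^bsub>K\<^esub> U \<oplus>\<^bsub>K\<^esub> Q \<otimes>\<^bsub>K\<^esub> U"
    if PQU: "P \<in> carrier K" "Q \<in> carrier K" "U \<in> carrier K" for P Q U
  proof -
    obtain a b where P: "a \<in> carrier R" "b \<in> carrier R" "b \<noteq> \<zero>" "P = quot a b"
      using PQU(1) by (rule quotient_field_cases)
    obtain c d where Q: "c \<in> carrier R" "d \<in> carrier R" "d \<noteq> \<zero>" "Q = quot c d"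
      using PQU(2) by (rule quotient_field_cases)
    obtain e f where U: "e \<in> carrier R" "f \<in> carrier R" "f \<noteq> \<zero>" "U = quot e f"
      using PQU(3) by (rule quotient_field_cases)
    show ?thesis unfolding P(4) Q(4) U(4) using P(1-3) Q(1-3) U(1-3)
      by (simp add: fraction_add fraction_mult integral_iff fraction_eq_iff)
        (simp add: m_ac l_distr r_distr a_ac)
  qed
qed

lemma fraction_inverse:
  assumes "a \<in> carrier R" "b \<in> carrier R" "a \<noteq> \<zero>" "b \<noteq> \<zero>"
  shows "quot a b \<otimes>\<^bsub>K\<^esub> quot b a = \<one>\<^bsub>K\<^esub>"
  using assms by (simp add: fraction_mult fraction_one fraction_eq_iff integral_iff m_comm)

lemma quotient_field_field: "field K"
proof (rule cring.cring_fieldI[OF quotient_field_cring], intro equalityI subsetI)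
  interpret K: cring K by (rule quotient_field_cring)
  have nonzero: "\<one>\<^bsub>K\<^esub> \<noteq> \<zero>\<^bsub>K\<^esub>" by (simp add: fraction_one fraction_eq_zero_iff)
  fix P
  {
    assume "P \<in> Units K"
    then show "P \<in> carrier K - {\<zero>\<^bsub>K\<^esub>}"
      using nonzero by (metis DiffI K.Units_closed K.Units_inv_closed K.Units_r_inv K.l_null singletonD)
  next
    assume "P \<in> carrier K - {\<zero>\<^bsub>K\<^esub>}"
    then have P: "P \<in> carrier K" "P \<noteq> \<zero>\<^bsub>K\<^esub>" by auto
    from P(1) obtain a b where *: "a \<in> carrier R" "b \<in> carrier R" "b \<noteq> \<zero>" "P = quot a b"
      by (rule quotient_field_cases)
    then have "a \<noteq> \<zero>" using P by (simp add: fraction_eq_zero_iff)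
    then show "P \<in> Units K" using * fraction_inverse[of a b] fraction_inverse[of b a]
      by (auto simp: Units_def)
  }
qed

lemma fraction_embed_hom: "fraction_embed R \<in> ring_hom R K"
  by (rule ring_hom_memI) (auto simp: fraction_embed_def fraction_mult fraction_add fraction_one)

lemma module_quotient_field: "module R (quotient_field_module R)"
  unfolding quotient_field_module_def
  by (rule module_restrict_scalars[OF is_cring fraction_embed_hom module_ring_module[OF quotient_field_cring]])

lemma quotient_field_module_simps [simp]:
  "carrier (quotient_field_module R) = carrier K" "ring.add (quotient_field_module R) = ring.add K"
  "ring.zero (quotient_field_module R) = ring.zero K"
  by (simp_all add: quotient_field_module_def)

lemma quotient_field_smult:
  "\<lbrakk>r \<in> carrier R; a \<in> carrier R; b \<in> carrier R; b \<noteq> \<zero>\<rbrakk> \<Longrightarrow>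
    r \<odot>\<^bsub>quotient_field_module R\<^esub> quot a b = quot (r \<otimes> a) b"
  by (simp add: quotient_field_module_def fraction_embed_def fraction_mult)

lemma quotient_field_torsion_free:
  assumes "r \<in> carrier R" "r \<noteq> \<zero>" "P \<in> carrier K" "r \<odot>\<^bsub>quotient_field_module R\<^esub> P = \<zero>\<^bsub>K\<^esub>"
  shows "P = \<zero>\<^bsub>K\<^esub>"
proof -
  obtain a b where "a \<in> carrier R" "b \<in> carrier R" "b \<noteq> \<zero>" "P = quot a b"
    using assms(3) by (rule quotient_field_cases)
  then show ?thesis using assms(1,2,4) by (simp add: quotient_field_smult fraction_eq_zero_iff integral_iff)
qed

lemma quotient_field_divisible:
  assumes "r \<in> carrier R" "r \<noteq> \<zero>"
  shows "divisible_by (quotient_field_module R) r"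
  unfolding divisible_by_def
proof
  fix P assume "P \<in> carrier (quotient_field_module R)"
  then obtain a b where *: "a \<in> carrier R" "b \<in> carrier R" "b \<noteq> \<zero>" "P = quot a b"
    by (auto elim: quotient_field_cases)
  then have "r \<odot>\<^bsub>quotient_field_module R\<^esub> quot a (r \<otimes> b) = P"
    using assms by (simp add: quotient_field_smult integral_iff fraction_eq_iff m_ac)
  then show "\<exists>w\<in>carrier (quotient_field_module R). r \<odot>\<^bsub>quotient_field_module R\<^esub> w = P"
    using * assms by (intro bexI[of _ "quot a (r \<otimes> b)"]) (auto simp: integral_iff)
qed

text \<open>K has rank one over R. This stands in for dividing P by Q in arguments whose maps into K
  are only known to be R-linear.\<close>

lemma quotient_field_common_multiple:
  assumes "P \<in> carrier K" "Q \<in> carrier K" "Q \<noteq> \<zero>\<^bsub>K\<^esub>"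
  shows "\<exists>r\<in>carrier R - {\<zero>}. \<exists>s\<in>carrier R.
    r \<odot>\<^bsub>quotient_field_module R\<^esub> P = s \<odot>\<^bsub>quotient_field_module R\<^esub> Q"
proof -
  obtain a b where P: "a \<in> carrier R" "b \<in> carrier R" "b \<noteq> \<zero>" "P = quot a b"
    using assms(1) by (rule quotient_field_cases)
  obtain c d where Q: "c \<in> carrier R" "d \<in> carrier R" "d \<noteq> \<zero>" "Q = quot c d"
    using assms(2) by (rule quotient_field_cases)
  have "c \<noteq> \<zero>" using assms Q by (simp add: fraction_eq_zero_iff)
  moreover have "(c \<otimes> b) \<odot>\<^bsub>quotient_field_module R\<^esub> P = (a \<otimes> d) \<odot>\<^bsub>quotient_field_module R\<^esub> Q"
    unfolding P(4) Q(4) using P(1-3) Q(1-3) by (simp add: quotient_field_smult fraction_eq_iff m_ac)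
  moreover have "a \<otimes> d \<in> carrier R" "c \<otimes> b \<in> carrier R" using P(1,2) Q(1,2) by auto
  ultimately show ?thesis using P(2,3) Q(1) by (metis DiffI integral singletonD)
qed

end

section \<open>Pure spans and coordinates\<close>

lemma module_module_prod:
  assumes "module R M" "module R N"
  shows "module R (module_prod M N)"
proof -
  interpret M: module R M by fact
  interpret N: module R N by fact
  have "abelian_group (module_prod M N)"
  proof (rule abelian_groupI)
    show "\<exists>y\<in>carrier (module_prod M N). y \<oplus>\<^bsub>module_prod M N\<^esub> v = \<zero>\<^bsub>module_prod M N\<^esub>"
      if "v \<in> carrier (module_prod M N)" for v
      using that by (intro bexI[of _ "(\<ominus>\<^bsub>M\<^esub> fst v, \<ominus>\<^bsub>N\<^esub> snd v)"])
        (auto simp: module_prod_def M.M.l_neg N.M.l_neg)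
  qed (auto simp: module_prod_def M.M.a_ac N.M.a_ac)
  then show ?thesis
    by (intro moduleI) (auto simp: module_prod_def M.is_cring M.smult_l_distr N.smult_l_distr
      M.smult_r_distr N.smult_r_distr M.smult_assoc1 N.smult_assoc1)
qed

text \<open>Linear algebra over Q(R) carried out inside M: for a domain R and X inside M this is the
  preimage of the Q(R)-span of X under the map from M to its tensor product with Q(R). The rule
  \<open>div\<close> makes the quotient torsion-free; in particular all torsion of M is
  included.\<close>

inductive_set pure_span :: "('r, 'b) ring_scheme \<Rightarrow> ('r, 'm, 'c) module_scheme \<Rightarrow> 'm set \<Rightarrow> 'm set"
  for R :: "('r, 'b) ring_scheme" and M :: "('r, 'm, 'c) module_scheme" and X :: "'m set" where
  base: "v \<in> X \<Longrightarrow> v \<in> pure_span R M X"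
| zero: "\<zero>\<^bsub>M\<^esub> \<in> pure_span R M X"
| add: "\<lbrakk>v \<in> pure_span R M X; w \<in> pure_span R M X\<rbrakk> \<Longrightarrow> v \<oplus>\<^bsub>M\<^esub> w \<in> pure_span R M X"
| smult: "\<lbrakk>r \<in> carrier R; v \<in> pure_span R M X\<rbrakk> \<Longrightarrow> r \<odot>\<^bsub>M\<^esub> v \<in> pure_span R M X"
| div: "\<lbrakk>r \<in> carrier R; r \<noteq> \<zero>\<^bsub>R\<^esub>; v \<in> carrier M; r \<odot>\<^bsub>M\<^esub> v \<in> pure_span R M X\<rbrakk> \<Longrightarrow> v \<in> pure_span R M X"

lemma pure_span_least:
  assumes "X \<subseteq> Y" "\<zero>\<^bsub>M\<^esub> \<in> Y" "\<And>v w. v \<in> Y \<Longrightarrow> w \<in> Y \<Longrightarrow> v \<oplus>\<^bsub>M\<^esub> w \<in> Y"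
    "\<And>r v. r \<in> carrier R \<Longrightarrow> v \<in> Y \<Longrightarrow> r \<odot>\<^bsub>M\<^esub> v \<in> Y"
    "\<And>r v. r \<in> carrier R \<Longrightarrow> r \<noteq> \<zero>\<^bsub>R\<^esub> \<Longrightarrow> v \<in> carrier M \<Longrightarrow> r \<odot>\<^bsub>M\<^esub> v \<in> Y \<Longrightarrow> v \<in> Y"
  shows "pure_span R M X \<subseteq> Y"
proof
  fix v assume "v \<in> pure_span R M X"
  then show "v \<in> Y" by induction (use assms in blast)+
qed

lemma pure_span_mono_closed: "X \<subseteq> pure_span R M Y \<Longrightarrow> pure_span R M X \<subseteq> pure_span R M Y"
  by (rule pure_span_least) (auto intro: pure_span.intros)

lemma pure_span_mono: "X \<subseteq> Y \<Longrightarrow> pure_span R M X \<subseteq> pure_span R M Y"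
  by (rule pure_span_mono_closed) (auto intro: pure_span.base)

text \<open>A derivation uses finitely many elements of X. This finiteness is behind both Zorn's
  lemma for independent sets and the finite support of coordinates.\<close>

lemma pure_span_finite: "v \<in> pure_span R M X \<Longrightarrow> \<exists>F. finite F \<and> F \<subseteq> X \<and> v \<in> pure_span R M F"
proof (induction rule: pure_span.induct)
  case (base v)
  then show ?case by (intro exI[of _ "{v}"]) (auto intro: pure_span.base)
next
  case zero
  then show ?case by (intro exI[of _ "{}"]) (auto intro: pure_span.zero)
next
  case (add v w)
  then obtain F G where *: "finite F" "F \<subseteq> X" "v \<in> pure_span R M F" "finite G" "G \<subseteq> X" "w \<in> pure_span R M G"
    by blast
  then have "v \<in> pure_span R M (F \<union> G)" "w \<in> pure_span R M (F \<union> G)"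
    using pure_span_mono[of F "F \<union> G" R M] pure_span_mono[of G "F \<union> G" R M] by blast+
  then show ?case using * by (intro exI[of _ "F \<union> G"]) (auto intro: pure_span.add)
qed (blast intro: pure_span.smult pure_span.div)+

context module
begin

lemma pure_span_subset_carrier: "X \<subseteq> carrier M \<Longrightarrow> pure_span R M X \<subseteq> carrier M"
  by (rule pure_span_least) auto

lemma pure_span_a_inv:
  "X \<subseteq> carrier M \<Longrightarrow> v \<in> pure_span R M X \<Longrightarrow> \<ominus>\<^bsub>M\<^esub> v \<in> pure_span R M X"
  using pure_span.smult[of "\<ominus> \<one>" R v M X] minus_as_smult[of v] pure_span_subset_carrier[of X] by auto

lemma pure_span_diff:
  "\<lbrakk>X \<subseteq> carrier M; v \<in> pure_span R M X; w \<in> pure_span R M X\<rbrakk> \<Longrightarrow> v \<ominus>\<^bsub>M\<^esub> w \<in> pure_span R M X"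
  by (simp add: a_minus_def pure_span.add pure_span_a_inv)

lemma pure_span_submodule: "X \<subseteq> carrier M \<Longrightarrow> submodule (pure_span R M X) R M"
  using pure_span_subset_carrier[of X]
  by (intro submoduleI) (auto intro: pure_span.intros pure_span_a_inv)

text \<open>Over Q(R) one would write y as (r/s) v plus a combination of X; s clears the denominator
  and absorbs the divisions made on the way. This is the exchange step of the linear algebra
  below.\<close>

lemma pure_span_insert:
  assumes dom: "domain R" and X: "X \<subseteq> carrier M" "v \<in> carrier M" and y: "y \<in> pure_span R M (insert v X)"
  shows "\<exists>s\<in>carrier R - {\<zero>}. \<exists>r\<in>carrier R. s \<odot>\<^bsub>M\<^esub> y \<ominus>\<^bsub>M\<^esub> r \<odot>\<^bsub>M\<^esub> v \<in> pure_span R M X"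
  using y
proof induction
  interpret R: domain R by fact
  {
    case (base y)
    show ?case
    proof (cases "y = v")
      case True
      then have "\<one> \<odot>\<^bsub>M\<^esub> y \<ominus>\<^bsub>M\<^esub> \<one> \<odot>\<^bsub>M\<^esub> v = \<zero>\<^bsub>M\<^esub>" using X by (simp add: M.r_neg a_minus_def)
      then show ?thesis using pure_span.zero by (metis DiffI R.one_closed R.one_not_zero singletonD)
    next
      case False
      then have "y \<in> X" "y \<in> carrier M" using base X by auto
      then have "\<one> \<odot>\<^bsub>M\<^esub> y \<ominus>\<^bsub>M\<^esub> \<zero> \<odot>\<^bsub>M\<^esub> v = y" using X by (simp add: a_minus_def)
      then show ?thesis using pure_span.base[OF \<open>y \<in> X\<close>] by (metis DiffI R.one_closed R.one_not_zero R.zero_closed singletonD)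
    qed
  next
    case zero
    have "\<one> \<odot>\<^bsub>M\<^esub> \<zero>\<^bsub>M\<^esub> \<ominus>\<^bsub>M\<^esub> \<zero> \<odot>\<^bsub>M\<^esub> v = \<zero>\<^bsub>M\<^esub>" using X by (simp add: a_minus_def)
    then show ?case using pure_span.zero by (metis DiffI R.one_closed R.one_not_zero R.zero_closed singletonD)
  next
    case (add y z)
    have yz: "y \<in> carrier M" "z \<in> carrier M" using add.hyps pure_span_subset_carrier[of "insert v X"] X by auto
    obtain s r where 1: "s \<in> carrier R" "s \<noteq> \<zero>" "r \<in> carrier R" "s \<odot>\<^bsub>M\<^esub> y \<ominus>\<^bsub>M\<^esub> r \<odot>\<^bsub>M\<^esub> v \<in> pure_span R M X"
      using add by auto
    obtain t q where 2: "t \<in> carrier R" "t \<noteq> \<zero>" "q \<in> carrier R" "t \<odot>\<^bsub>M\<^esub> z \<ominus>\<^bsub>M\<^esub> q \<odot>\<^bsub>M\<^esub> v \<in> pure_span R M X"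
      using add by auto
    have "t \<odot>\<^bsub>M\<^esub> (s \<odot>\<^bsub>M\<^esub> y \<ominus>\<^bsub>M\<^esub> r \<odot>\<^bsub>M\<^esub> v) \<oplus>\<^bsub>M\<^esub> s \<odot>\<^bsub>M\<^esub> (t \<odot>\<^bsub>M\<^esub> z \<ominus>\<^bsub>M\<^esub> q \<odot>\<^bsub>M\<^esub> v) \<in> pure_span R M X"
      using 1 2 by (intro pure_span.add pure_span.smult)
    also have "t \<odot>\<^bsub>M\<^esub> (s \<odot>\<^bsub>M\<^esub> y \<ominus>\<^bsub>M\<^esub> r \<odot>\<^bsub>M\<^esub> v) \<oplus>\<^bsub>M\<^esub> s \<odot>\<^bsub>M\<^esub> (t \<odot>\<^bsub>M\<^esub> z \<ominus>\<^bsub>M\<^esub> q \<odot>\<^bsub>M\<^esub> v)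
      = (s \<otimes> t) \<odot>\<^bsub>M\<^esub> (y \<oplus>\<^bsub>M\<^esub> z) \<ominus>\<^bsub>M\<^esub> (t \<otimes> r \<oplus> s \<otimes> q) \<odot>\<^bsub>M\<^esub> v"
      using 1 2 yz X
      by (simp add: a_minus_def smult_r_distr smult_l_distr smult_assoc1[symmetric] smult_r_minus
          M.minus_add M.a_ac R.m_ac)
    finally show ?case using 1 2
      by (intro bexI[of _ "s \<otimes> t"] bexI[of _ "t \<otimes> r \<oplus> s \<otimes> q"]) (auto simp: R.integral_iff)
  next
    case (smult t y)
    have y: "y \<in> carrier M" using smult.hyps pure_span_subset_carrier[of "insert v X"] X by auto
    obtain s r where 1: "s \<in> carrier R" "s \<noteq> \<zero>" "r \<in> carrier R" "s \<odot>\<^bsub>M\<^esub> y \<ominus>\<^bsub>M\<^esub> r \<odot>\<^bsub>M\<^esub> v \<in> pure_span R M X"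
      using smult by auto
    have "t \<odot>\<^bsub>M\<^esub> (s \<odot>\<^bsub>M\<^esub> y \<ominus>\<^bsub>M\<^esub> r \<odot>\<^bsub>M\<^esub> v) \<in> pure_span R M X"
      using 1 smult by (intro pure_span.smult)
    also have "t \<odot>\<^bsub>M\<^esub> (s \<odot>\<^bsub>M\<^esub> y \<ominus>\<^bsub>M\<^esub> r \<odot>\<^bsub>M\<^esub> v) = s \<odot>\<^bsub>M\<^esub> (t \<odot>\<^bsub>M\<^esub> y) \<ominus>\<^bsub>M\<^esub> (t \<otimes> r) \<odot>\<^bsub>M\<^esub> v"
      using 1 smult y X
      by (simp add: a_minus_def smult_r_distr smult_assoc1[symmetric] smult_r_minus R.m_ac)
    finally show ?case using 1 smult by (intro bexI[of _ s] bexI[of _ "t \<otimes> r"]) auto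
  next
    case (div t y)
    obtain s r where 1: "s \<in> carrier R" "s \<noteq> \<zero>" "r \<in> carrier R"
      "s \<odot>\<^bsub>M\<^esub> (t \<odot>\<^bsub>M\<^esub> y) \<ominus>\<^bsub>M\<^esub> r \<odot>\<^bsub>M\<^esub> v \<in> pure_span R M X"
      using div by auto
    then show ?case using div(1-3)
      by (intro bexI[of _ "s \<otimes> t"] bexI[of _ r]) (auto simp: smult_assoc1 R.integral_iff)
  }
qed

text \<open>The end point when generators are removed one by one: with none left, only torsion
  remains.\<close>

lemma pure_span_empty:
  assumes dom: "domain R" and "y \<in> pure_span R M {}"
  shows "\<exists>s\<in>carrier R - {\<zero>}. s \<odot>\<^bsub>M\<^esub> y = \<zero>\<^bsub>M\<^esub>"
proof -
  interpret R: domain R by fact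
  have "\<exists>s\<in>carrier R - {\<zero>}. s \<odot>\<^bsub>M\<^esub> y = \<zero>\<^bsub>M\<^esub>" using assms(2)
  proof induction
    case zero
    show ?case using R.one_not_zero by (intro bexI[of _ \<one>]) auto
  next
    case (add y z)
    have yz: "y \<in> carrier M" "z \<in> carrier M" using add.hyps pure_span_subset_carrier[of "{}"] by auto
    obtain s t where 1: "s \<in> carrier R" "s \<noteq> \<zero>" "s \<odot>\<^bsub>M\<^esub> y = \<zero>\<^bsub>M\<^esub>" "t \<in> carrier R" "t \<noteq> \<zero>" "t \<odot>\<^bsub>M\<^esub> z = \<zero>\<^bsub>M\<^esub>"
      using add by auto
    have "(s \<otimes> t) \<odot>\<^bsub>M\<^esub> (y \<oplus>\<^bsub>M\<^esub> z) = t \<odot>\<^bsub>M\<^esub> (s \<odot>\<^bsub>M\<^esub> y) \<oplus>\<^bsub>M\<^esub> s \<odot>\<^bsub>M\<^esub> (t \<odot>\<^bsub>M\<^esub> z)"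
      using 1(1,2,4,5) yz by (simp add: smult_r_distr smult_assoc1[symmetric] R.m_comm)
    then show ?case using 1 by (intro bexI[of _ "s \<otimes> t"]) (auto simp: R.integral_iff)
  next
    case (smult t y)
    have y: "y \<in> carrier M" using smult.hyps pure_span_subset_carrier[of "{}"] by auto
    obtain s where 1: "s \<in> carrier R" "s \<noteq> \<zero>" "s \<odot>\<^bsub>M\<^esub> y = \<zero>\<^bsub>M\<^esub>" using smult by auto
    have "s \<odot>\<^bsub>M\<^esub> (t \<odot>\<^bsub>M\<^esub> y) = t \<odot>\<^bsub>M\<^esub> (s \<odot>\<^bsub>M\<^esub> y)"
      using 1(1,2) smult y by (simp add: smult_assoc1[symmetric] R.m_comm)
    then show ?case using 1 smult by auto
  next
    case (div t y)
    then obtain s where 1: "s \<in> carrier R" "s \<noteq> \<zero>" "s \<odot>\<^bsub>M\<^esub> (t \<odot>\<^bsub>M\<^esub> y) = \<zero>\<^bsub>M\<^esub>" by auto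
    then show ?case using div by (intro bexI[of _ "s \<otimes> t"]) (auto simp: R.integral_iff smult_assoc1)
  qed auto
  then show ?thesis .
qed

text \<open>The kernel of a map into a torsion-free module is closed under division, hence contains
  the pure span of each of its subsets.\<close>

lemma linear_map_vanishes_on_pure_span:
  assumes "module R N" "f \<in> linear_maps R M N" "X \<subseteq> carrier M" "\<And>v. v \<in> X \<Longrightarrow> f v = \<zero>\<^bsub>N\<^esub>"
    and tf: "\<And>r w. r \<in> carrier R \<Longrightarrow> r \<noteq> \<zero> \<Longrightarrow> w \<in> carrier N \<Longrightarrow> r \<odot>\<^bsub>N\<^esub> w = \<zero>\<^bsub>N\<^esub> \<Longrightarrow> w = \<zero>\<^bsub>N\<^esub>"
    and "v \<in> pure_span R M X"
  shows "f v = \<zero>\<^bsub>N\<^esub>"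
proof -
  interpret N: module R N by fact
  have "pure_span R M X \<subseteq> {v \<in> carrier M. f v = \<zero>\<^bsub>N\<^esub>}"
  proof (rule pure_span_least)
    show "\<zero>\<^bsub>M\<^esub> \<in> {v \<in> carrier M. f v = \<zero>\<^bsub>N\<^esub>}"
      using linear_maps_zero[OF module_axioms assms(1,2)] by simp
    show "v \<in> {v \<in> carrier M. f v = \<zero>\<^bsub>N\<^esub>}"
      if *: "r \<in> carrier R" "r \<noteq> \<zero>" "v \<in> carrier M" "r \<odot>\<^bsub>M\<^esub> v \<in> {v \<in> carrier M. f v = \<zero>\<^bsub>N\<^esub>}" for r v
      using * tf[OF *(1,2)] linear_maps_smult[OF assms(2)] linear_maps_closed[OF assms(2)] by simp
  qed (use assms linear_maps_add[OF assms(2)] linear_maps_smult[OF assms(2)] in auto)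
  then show ?thesis using assms by blast
qed

end

text \<open>C is a basis of V up to torsion, and p is the dual family of coordinates. Recording the
  functionals instead of the independence of C turns arguments about linear combinations into
  evaluations. V may have torsion, as Ext^1 does.\<close>

definition coordinate_system ::
    "('r, 'b) ring_scheme \<Rightarrow> ('r, 'm, 'c) module_scheme \<Rightarrow> 'm set \<Rightarrow> ('m \<Rightarrow> 'm \<Rightarrow> ('r \<times> 'r) set) \<Rightarrow> bool" where
  "coordinate_system R V C p \<longleftrightarrow> C \<subseteq> carrier V \<and> pure_span R V C = carrier V \<and>
     (\<forall>c\<in>C. p c \<in> linear_maps R V (quotient_field_module R)) \<and>
     (\<forall>c\<in>C. \<forall>c'\<in>C. p c c' = (if c = c' then \<one>\<^bsub>quotient_field R\<^esub> else \<zero>\<^bsub>quotient_field R\<^esub>))"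

lemma coordinate_systemD:
  assumes "coordinate_system R V C p"
  shows "C \<subseteq> carrier V" "pure_span R V C = carrier V"
    "\<And>c. c \<in> C \<Longrightarrow> p c \<in> linear_maps R V (quotient_field_module R)"
    "\<And>c. c \<in> C \<Longrightarrow> p c c = \<one>\<^bsub>quotient_field R\<^esub>"
    "\<And>c c'. c \<in> C \<Longrightarrow> c' \<in> C \<Longrightarrow> c \<noteq> c' \<Longrightarrow> p c c' = \<zero>\<^bsub>quotient_field R\<^esub>"
  using assms by (auto simp: coordinate_system_def)

section \<open>Coordinates of a single vector\<close>

context domain
begin

lemma coordinate_vanishes:
  assumes V: "module R V" and C: "coordinate_system R V C p" and "c \<in> C" "X \<subseteq> C" "c \<notin> X"
    and "v \<in> pure_span R V X"
  shows "p c v = \<zero>\<^bsub>K\<^esub>"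
proof -
  interpret V: module R V by fact
  note D = coordinate_systemD[OF C]
  show ?thesis
    using V.linear_map_vanishes_on_pure_span[OF module_quotient_field D(3)[OF assms(3)], of X v]
      assms D(1) D(5)[OF assms(3)] quotient_field_torsion_free by auto
qed

lemma coordinates_finite_support:
  assumes V: "module R V" and C: "coordinate_system R V C p" and v: "v \<in> carrier V"
  shows "finite {c\<in>C. p c v \<noteq> \<zero>\<^bsub>K\<^esub>}"
proof -
  obtain F where F: "finite F" "F \<subseteq> C" "v \<in> pure_span R V F"
    using pure_span_finite v coordinate_systemD(2)[OF C] by metis
  then have "{c\<in>C. p c v \<noteq> \<zero>\<^bsub>K\<^esub>} \<subseteq> F" using coordinate_vanishes[OF V C] by blast
  then show ?thesis using F(1) finite_subset by blast
qed

text \<open>A vector in the pure span of a finite part F of C is freed from the elements of F one at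
  a time: evaluating \<open>p c\<close> on the exchange relation s v - r c shows that r = 0. What
  remains lies in the pure span of the empty set.\<close>

lemma coordinates_joint_kernel:
  assumes V: "module R V" and C: "coordinate_system R V C p"
    and v: "v \<in> carrier V" "\<And>c. c \<in> C \<Longrightarrow> p c v = \<zero>\<^bsub>K\<^esub>"
  shows "\<exists>s\<in>carrier R - {\<zero>}. s \<odot>\<^bsub>V\<^esub> v = \<zero>\<^bsub>V\<^esub>"
proof -
  interpret V: module R V by fact
  note D = coordinate_systemD[OF C]
  interpret Q: module R "quotient_field_module R" by (rule module_quotient_field)
  have *: "v \<in> pure_span R V {}" if "finite F" "F \<subseteq> C" "v \<in> pure_span R V F" for F
    using that
  proof (induction F)
    case (insert c F)
    have cF: "c \<in> C" "F \<subseteq> carrier V" "c \<in> carrier V" using insert D(1) by auto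
    obtain s r where sr: "s \<in> carrier R" "s \<noteq> \<zero>" "r \<in> carrier R"
      "s \<odot>\<^bsub>V\<^esub> v \<ominus>\<^bsub>V\<^esub> r \<odot>\<^bsub>V\<^esub> c \<in> pure_span R V F"
      using V.pure_span_insert[OF domain_axioms cF(2,3) insert(5)] by auto
    have "p c (s \<odot>\<^bsub>V\<^esub> v \<ominus>\<^bsub>V\<^esub> r \<odot>\<^bsub>V\<^esub> c) = \<zero>\<^bsub>K\<^esub>"
      using coordinate_vanishes[OF V C cF(1) _ _ sr(4)] insert by auto
    moreover have "p c (s \<odot>\<^bsub>V\<^esub> v \<ominus>\<^bsub>V\<^esub> r \<odot>\<^bsub>V\<^esub> c)
        = s \<odot>\<^bsub>quotient_field_module R\<^esub> p c v \<ominus>\<^bsub>quotient_field_module R\<^esub> r \<odot>\<^bsub>quotient_field_module R\<^esub> p c c"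
      using sr v cF linear_maps_diff[OF V module_quotient_field D(3)[OF cF(1)]]
        linear_maps_smult[OF D(3)[OF cF(1)]] by simp
    moreover have "\<dots> = quot (\<ominus> r) \<one>"
      using v(2)[OF cF(1)] D(4)[OF cF(1)] sr Q.smult_r_null[OF sr(1)]
        Q.smult_l_minus[OF sr(3), of "\<one>\<^bsub>K\<^esub>", symmetric]
      by (simp add: a_minus_def fraction_one quotient_field_smult)
         (simp add: fraction_zero fraction_add)
    ultimately have "\<ominus> r = \<zero>" using sr by (simp add: fraction_eq_zero_iff)
    then have "r = \<zero>" using sr by (metis minus_minus minus_zero)
    then have "s \<odot>\<^bsub>V\<^esub> v \<in> pure_span R V F" using sr v cF by (simp add: a_minus_def)
    then have "v \<in> pure_span R V F" using sr v pure_span.div by metis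
    then show ?case using insert by blast
  qed
  obtain F where "finite F" "F \<subseteq> C" "v \<in> pure_span R V F"
    using pure_span_finite v D(2) by metis
  then show ?thesis using V.pure_span_empty[OF domain_axioms *] by blast
qed

end

section \<open>Existence of coordinate systems\<close>

context uniformized_domain
begin

text \<open>On the sum of A, the pure span of X, and R v the functional sends a + r v to r. It
  extends to V because K is divisible.\<close>

lemma separating_functional:
  assumes V: "module R V" and X: "X \<subseteq> carrier V" and v: "v \<in> carrier V" "v \<notin> pure_span R V X"
  shows "\<exists>p\<in>linear_maps R V (quotient_field_module R).
    p v = \<one>\<^bsub>K\<^esub> \<and> (\<forall>y\<in>pure_span R V X. p y = \<zero>\<^bsub>K\<^esub>)"
proof -
  interpret V: module R V by fact
  interpret Q: module R "quotient_field_module R" by (rule module_quotient_field)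
  let ?A = "pure_span R V X"
  have AV: "?A \<subseteq> carrier V" using V.pure_span_subset_carrier[OF X] .
  interpret A: module R "V\<lparr>carrier := ?A\<rparr>"
    using submodule.submodule_is_module[OF V.pure_span_submodule[OF X] V] .
  \<comment> \<open>The submodule A + R v, presented as a product, so that the functional on it is a
    projection.\<close>
  let ?B = "module_prod (V\<lparr>carrier := ?A\<rparr>) (ring_module R)"
  have B: "module R ?B" by (intro module_module_prod A.module_axioms module_ring_module is_cring)
  let ?i = "\<lambda>(a, r). a \<oplus>\<^bsub>V\<^esub> r \<odot>\<^bsub>V\<^esub> v"
  have i: "?i \<in> linear_maps R ?B V"
    using AV v
    by (intro linear_mapsI) (auto simp: module_prod_def V.smult_l_distr V.smult_r_distr V.smult_assoc1 subset_iff V.M.a_ac)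
  have inj: "inj_on ?i (carrier ?B)"
  proof (rule inj_onI, clarify)
    fix a r a' r' assume "(a, r) \<in> carrier ?B" "(a', r') \<in> carrier ?B"
      and eq: "a \<oplus>\<^bsub>V\<^esub> r \<odot>\<^bsub>V\<^esub> v = a' \<oplus>\<^bsub>V\<^esub> r' \<odot>\<^bsub>V\<^esub> v"
    then have *: "a \<in> ?A" "a' \<in> ?A" "r \<in> carrier R" "r' \<in> carrier R" "a \<in> carrier V" "a' \<in> carrier V"
      using AV by (auto simp: module_prod_def)
    have "(r \<ominus> r') \<odot>\<^bsub>V\<^esub> v = r \<odot>\<^bsub>V\<^esub> v \<oplus>\<^bsub>V\<^esub> \<ominus>\<^bsub>V\<^esub> (r' \<odot>\<^bsub>V\<^esub> v)"
      using * v by (simp add: a_minus_def V.smult_l_distr V.smult_l_minus)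
    also have "\<dots> = (\<ominus>\<^bsub>V\<^esub> a \<oplus>\<^bsub>V\<^esub> (a \<oplus>\<^bsub>V\<^esub> r \<odot>\<^bsub>V\<^esub> v)) \<oplus>\<^bsub>V\<^esub> \<ominus>\<^bsub>V\<^esub> (r' \<odot>\<^bsub>V\<^esub> v)"
      using * v by (simp add: V.M.r_neg1)
    also have "\<dots> = a' \<ominus>\<^bsub>V\<^esub> a"
      unfolding eq using * v by (simp add: a_minus_def V.M.a_ac V.M.r_neg V.M.r_neg2)
    finally have "(r \<ominus> r') \<odot>\<^bsub>V\<^esub> v \<in> ?A" using V.pure_span_diff[OF X] * by simp
    \<comment> \<open>Purity of A enters here: a nonzero multiple of v in A would put v itself into
      A.\<close>
    then have "r \<ominus> r' = \<zero>" using pure_span.div[of "r \<ominus> r'" R v V X] v * by auto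
    then have "r = r'" using * by simp
    then show "a = a' \<and> r = r'" using eq * v by simp
  qed
  have f: "(\<lambda>(a, r). quot r \<one>) \<in> linear_maps R ?B (quotient_field_module R)"
    by (intro linear_mapsI) (auto simp: module_prod_def quotient_field_smult fraction_add)
  obtain g where g: "g \<in> linear_maps R V (quotient_field_module R)"
    "\<And>z. z \<in> carrier ?B \<Longrightarrow> g (?i z) = (\<lambda>(a, r). quot r \<one>) z"
    using divisible_extension[OF V module_quotient_field B quotient_field_divisible[OF x_closed x_nonzero] i inj f]
    by blast
  have "g v = \<one>\<^bsub>K\<^esub>"
    using g(2)[of "(\<zero>\<^bsub>V\<^esub>, \<one>)"] v by (simp add: module_prod_def pure_span.zero fraction_one)
  moreover have "g y = \<zero>\<^bsub>K\<^esub>" if "y \<in> ?A" for y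
    using g(2)[of "(y, \<zero>)"] v that AV by (auto simp add: module_prod_def fraction_zero)
  ultimately show ?thesis using g(1) by blast
qed

text \<open>A maximal independent set spans by the exchange relation, and the coordinate of c is a
  functional that separates c from the span of the other elements.\<close>

theorem coordinate_system_exists:
  assumes V: "module R V"
  shows "\<exists>C p. coordinate_system R V C p"
proof -
  interpret V: module R V by fact
  define indep where "indep X \<longleftrightarrow> X \<subseteq> carrier V \<and> (\<forall>v\<in>X. v \<notin> pure_span R V (X - {v}))" for X
  have "\<exists>C\<in>{X. indep X}. \<forall>X\<in>{X. indep X}. C \<subseteq> X \<longrightarrow> X = C"
  proof (rule subset_Zorn_nonempty)
    have "indep {}" by (simp add: indep_def)
    then show "{X. indep X} \<noteq> {}" by blast
    show "\<Union>\<C> \<in> {X. indep X}" if \<C>: "\<C> \<noteq> {}" "subset.chain {X. indep X} \<C>" for \<C>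
    proof -
      have ind: "indep X" if "X \<in> \<C>" for X using \<C>(2) that by (auto simp: subset_chain_def)
      \<comment> \<open>A dependence involves finitely many elements, and these lie in a single
        member of the chain.\<close>
      have False if v: "v \<in> \<Union>\<C>" "v \<in> pure_span R V (\<Union>\<C> - {v})" for v
      proof -
        obtain F where F: "finite F" "F \<subseteq> \<Union>\<C> - {v}" "v \<in> pure_span R V F"
          using pure_span_finite[OF v(2)] by blast
        obtain X where X: "X \<in> \<C>" "insert v F \<subseteq> X"
          using finite_subset_Union_chain[of "insert v F" \<C> "{X. indep X}"] F v \<C> by auto
        then have "v \<in> pure_span R V (X - {v})" using F pure_span_mono[of F "X - {v}" R V] by blast
        then show False using ind[OF X(1)] X(2) by (auto simp: indep_def)
      qed
      moreover have "\<Union>\<C> \<subseteq> carrier V" using ind by (auto simp: indep_def)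
      ultimately show ?thesis by (auto simp: indep_def)
    qed
  qed
  then obtain C where C: "indep C" and max: "\<And>X. indep X \<Longrightarrow> C \<subseteq> X \<Longrightarrow> X = C" by blast
  have CV: "C \<subseteq> carrier V" using C by (simp add: indep_def)
  have span: "y \<in> pure_span R V C" if y: "y \<in> carrier V" for y
  proof (rule ccontr)
    assume not: "y \<notin> pure_span R V C"
    then have yC: "y \<notin> C" using pure_span.base by metis
    have "v \<notin> pure_span R V (insert y C - {v})" if v: "v \<in> insert y C" for v
    proof (cases "v = y")
      case True
      then show ?thesis using not yC by simp
    next
      case False
      then have vC: "v \<in> C" "insert y C - {v} = insert y (C - {v})" using v by auto
      show ?thesis
      proof
        assume "v \<in> pure_span R V (insert y C - {v})"
        then obtain s r where sr: "s \<in> carrier R" "s \<noteq> \<zero>" "r \<in> carrier R"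
          "s \<odot>\<^bsub>V\<^esub> v \<ominus>\<^bsub>V\<^esub> r \<odot>\<^bsub>V\<^esub> y \<in> pure_span R V (C - {v})"
          using V.pure_span_insert[OF domain_axioms _ y, of "C - {v}" v] CV vC by auto
        have vV: "v \<in> carrier V" using vC CV by blast
        show False
        \<comment> \<open>In the exchange relation for v, r = 0 contradicts the independence of C,
          and r nonzero puts y into the span of C.\<close>
        proof (cases "r = \<zero>")
          case True
          then have "s \<odot>\<^bsub>V\<^esub> v \<in> pure_span R V (C - {v})" using sr y vV by (simp add: a_minus_def)
          then have "v \<in> pure_span R V (C - {v})" using pure_span.div[OF sr(1,2) vV] by blast
          then show False using C vC by (auto simp: indep_def)
        next
          case False
          have "s \<odot>\<^bsub>V\<^esub> v \<ominus>\<^bsub>V\<^esub> (s \<odot>\<^bsub>V\<^esub> v \<ominus>\<^bsub>V\<^esub> r \<odot>\<^bsub>V\<^esub> y) \<in> pure_span R V C"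
            using V.pure_span_diff[OF CV pure_span.smult[OF sr(1) pure_span.base[OF vC(1)]]]
              sr(4) pure_span_mono[of "C - {v}" C R V] by blast
          also have "s \<odot>\<^bsub>V\<^esub> v \<ominus>\<^bsub>V\<^esub> (s \<odot>\<^bsub>V\<^esub> v \<ominus>\<^bsub>V\<^esub> r \<odot>\<^bsub>V\<^esub> y) = r \<odot>\<^bsub>V\<^esub> y"
            using sr vV y by (simp add: a_minus_def V.M.minus_add V.M.r_neg1 V.M.r_neg2)
          finally show False using pure_span.div[OF sr(3) False y] not by blast
        qed
      qed
    qed
    then have "indep (insert y C)" using y CV by (auto simp: indep_def)
    then show False using max[of "insert y C"] yC by blast
  qed
  define p where "p c = (SOME f. f \<in> linear_maps R V (quotient_field_module R) \<and>
    f c = \<one>\<^bsub>K\<^esub> \<and> (\<forall>y\<in>pure_span R V (C - {c}). f y = \<zero>\<^bsub>K\<^esub>))" for c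
  have p: "p c \<in> linear_maps R V (quotient_field_module R) \<and>
    p c c = \<one>\<^bsub>K\<^esub> \<and> (\<forall>y\<in>pure_span R V (C - {c}). p c y = \<zero>\<^bsub>K\<^esub>)" if "c \<in> C" for c
  proof -
    have "C - {c} \<subseteq> carrier V" "c \<in> carrier V" "c \<notin> pure_span R V (C - {c})"
      using C that by (auto simp: indep_def)
    from separating_functional[OF V this] show ?thesis unfolding p_def Bex_def by (rule someI_ex)
  qed
  have "coordinate_system R V C p"
    unfolding coordinate_system_def
  proof (intro conjI ballI)
    show "pure_span R V C = carrier V" using span V.pure_span_subset_carrier[OF CV] by blast
    show "p c c' = (if c = c' then \<one>\<^bsub>K\<^esub> else \<zero>\<^bsub>K\<^esub>)" if "c \<in> C" "c' \<in> C" for c c'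
      using p[OF that(1)] pure_span.base[of c' "C - {c}" R V] that by auto
  qed (use p CV in auto)
  then show ?thesis by blast
qed

end

section \<open>The completion of a discrete valuation ring\<close>

text \<open>A nonzero nonunit is factored into irreducibles. In a principal ideal domain each of
  them generates a maximal ideal, which can only be m, so each is a unit times x.\<close>

lemma discrete_valuation_ring_uniformized:
  fixes R :: "('a, 'b) ring_scheme" (structure)
  assumes dvr: "discrete_valuation_ring R m" and x: "x \<in> carrier R" "m = cgenideal R x"
  shows "uniformized_domain R x"
proof -
  interpret principal_domain R using dvr by (simp add: discrete_valuation_ring_def)
  have max: "maximalideal m R" and uniq: "\<And>n. maximalideal n R \<Longrightarrow> n = m" and ne: "m \<noteq> {\<zero>}"
    using dvr by (auto simp: discrete_valuation_ring_def)
  show ?thesis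
  proof
    show "x \<noteq> \<zero>"
    proof
      assume "x = \<zero>"
      then have "m = {r \<otimes> \<zero> |r. r \<in> carrier R}" using x(2) by (simp add: cgenideal_def)
      also have "\<dots> = {\<zero>}" by (auto intro: exI[of _ \<zero>])
      finally have "m = {\<zero>}" .
      then show False using ne by simp
    qed
    show "x \<notin> Units R" using maximalideal.I_notcarr[OF max] ideal_eq_carrier_iff[OF x(1)] x(2) by simp
    show "x \<in> carrier R" by fact
    fix r assume r: "r \<in> carrier R" "r \<noteq> \<zero>"
    show "\<exists>u\<in>Units R. \<exists>n::nat. r = u \<otimes> x [^] n"
    proof (cases "r \<in> Units R")
      case True
      then show ?thesis using r by (intro bexI[of _ r] exI[of _ 0]) auto
    next
      case False
      then obtain fs where fs: "set fs \<subseteq> carrier (mult_of R)" "wfactors (mult_of R) fs r"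
        using factorization_property r by blast
      have prime: "\<exists>u\<in>Units R. p = u \<otimes> x" if p: "p \<in> set fs" for p
      proof -
        have pc: "p \<in> carrier R" "p \<noteq> \<zero>" using fs(1) p by auto
        have "irreducible (mult_of R) p" using fs(2) p by (auto simp: wfactors_def)
        then have "ring_irreducible p" using ring_irreducibleI' pc by blast
        then have "PIdl p = PIdl x" using irreducible_imp_maximalideal pc uniq x(2) by blast
        then show ?thesis using associated_iff_same_ideal ring_associated_iff pc(1) x(1) by blast
      qed
      have "\<exists>u\<in>Units R. \<exists>n::nat. foldr (\<otimes>) fs \<one> = u \<otimes> x [^] n"
        using prime
      proof (induction fs)
        case Nil
        then show ?case by (intro bexI[of _ \<one>] exI[of _ 0]) auto
      next
        case (Cons p fs)
        obtain u n where u: "u \<in> Units R" "foldr (\<otimes>) fs \<one> = u \<otimes> x [^] (n::nat)" using Cons by auto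
        obtain v where v: "v \<in> Units R" "p = v \<otimes> x" using Cons by auto
        have "foldr (\<otimes>) (p # fs) \<one> = (v \<otimes> u) \<otimes> x [^] Suc n"
          using u v x(1) by (simp add: Units_closed m_ac)
        then show ?case using u v by blast
      qed
      then obtain u n where u: "u \<in> Units R" "foldr (\<otimes>) fs \<one> = u \<otimes> x [^] (n::nat)" by blast
      have "foldr (\<otimes>) fs \<one> \<sim>\<^bsub>mult_of R\<^esub> r" using fs(2) by (simp add: wfactors_def)
      then have "r \<sim> u \<otimes> x [^] n"
        using u r x(1) assoc_iff_assoc_mult[of "u \<otimes> x [^] n" r] by (simp add: Units_closed associated_sym)
      then obtain v where "v \<in> Units R" "r = v \<otimes> (u \<otimes> x [^] n)"
        using ring_associated_iff[of r "u \<otimes> x [^] n"] u r x(1) Units_closed by auto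
      then have "r = (v \<otimes> u) \<otimes> x [^] n" "v \<otimes> u \<in> Units R"
        using u x(1) by (auto simp: Units_closed m_assoc)
      then show ?thesis by blast
    qed
  qed
qed

locale dvr_completion = uniformized_domain +
  fixes m
  assumes m_eq: "m = PIdl x"
begin

abbreviation "S \<equiv> adic_completion R m"
abbreviation "\<phi> \<equiv> completion_map R m"

definition I :: "nat \<Rightarrow> 'a set" where "I n = PIdl (x [^] n)"

lemma I_ideal: "ideal (I n) R" by (simp add: I_def cgenideal_ideal)

lemma I_iff: "a \<in> I n \<longleftrightarrow> (\<exists>c\<in>carrier R. a = c \<otimes> x [^] n)"
  by (auto simp: I_def cgenideal_def)

lemma I_0: "I 0 = carrier R" by (auto simp: I_iff)

lemma ideal_pow_m: "ideal_pow R m n = I n"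
proof (induction n)
  case 0
  then show ?case by (simp add: I_0)
next
  case (Suc n)
  have "ideal_prod R (I n) m = I (Suc n)"
  proof (intro equalityI subsetI)
    fix a assume "a \<in> ideal_prod R (I n) m"
    then show "a \<in> I (Suc n)"
    proof induction
      case (prod i j)
      then obtain c where "c \<in> carrier R" "i = c \<otimes> x [^] n" unfolding I_iff by blast
      moreover obtain e where "e \<in> carrier R" "j = e \<otimes> x" using prod(2) by (auto simp: m_eq cgenideal_def)
      ultimately
      have "i \<otimes> j = (c \<otimes> e) \<otimes> x [^] Suc n" "c \<otimes> e \<in> carrier R" by (auto simp: m_ac)
      then show ?case by (auto simp: I_iff)
    next
      case (sum a b)
      then show ?case using additive_subgroup.a_closed[OF ideal.axioms(1)[OF I_ideal]] by blast
    qed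
  next
    fix a assume "a \<in> I (Suc n)"
    then obtain c where c: "c \<in> carrier R" "a = c \<otimes> x [^] Suc n" by (auto simp: I_iff)
    then have "a = (c \<otimes> x [^] n) \<otimes> x" by (simp add: m_assoc)
    moreover have "c \<otimes> x [^] n \<in> I n" "x \<in> m" using c by (auto simp: I_iff m_eq cgenideal_self)
    ultimately show "a \<in> ideal_prod R (I n) m" using ideal_prod.prod by metis
  qed
  then show ?case using Suc by simp
qed

lemma I_carrier: "a \<in> I n \<Longrightarrow> a \<in> carrier R" by (auto simp: I_iff)
lemma I_subset: "I n \<subseteq> carrier R" using I_carrier by blast
lemma I_add: "a \<in> I n \<Longrightarrow> b \<in> I n \<Longrightarrow> a \<oplus> b \<in> I n"
  using additive_subgroup.a_closed[OF ideal.axioms(1)[OF I_ideal]] .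
lemma I_a_inv: "a \<in> I n \<Longrightarrow> \<ominus> a \<in> I n"
  using additive_subgroup.a_inv_closed[OF ideal.axioms(1)[OF I_ideal]] .
lemma I_mult: "a \<in> carrier R \<Longrightarrow> b \<in> I n \<Longrightarrow> a \<otimes> b \<in> I n"
  using ideal.I_l_closed[OF I_ideal] by blast
lemma I_zero: "\<zero> \<in> I n"
  using additive_subgroup.zero_closed[OF ideal.axioms(1)[OF I_ideal]] .
lemma I_antimono: "k \<le> n \<Longrightarrow> I n \<subseteq> I k"
proof
  fix a assume "k \<le> n" "a \<in> I n"
  then obtain c where "c \<in> carrier R" "a = c \<otimes> x [^] n" by (auto simp: I_iff)
  then have "a = (c \<otimes> x [^] (n - k)) \<otimes> x [^] k" using \<open>k \<le> n\<close> by (simp add: m_assoc nat_pow_mult)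
  then show "a \<in> I k" using \<open>c \<in> carrier R\<close> by (auto simp: I_iff)
qed

lemma I_trans:
  "\<lbrakk>a \<in> carrier R; b \<in> carrier R; c \<in> carrier R; a \<ominus> b \<in> I n; b \<ominus> c \<in> I n\<rbrakk> \<Longrightarrow> a \<ominus> c \<in> I n"
  using I_add[of "a \<ominus> b" n "b \<ominus> c"] by (simp add: a_minus_def a_assoc r_neg1)

lemma I_sym: "\<lbrakk>a \<in> carrier R; b \<in> carrier R; a \<ominus> b \<in> I n\<rbrakk> \<Longrightarrow> b \<ominus> a \<in> I n"
  using I_a_inv[of "a \<ominus> b" n] by (simp add: a_minus_def minus_add a_comm)

lemma x_pow_notin_I: "x [^] n \<notin> I (Suc n)"
proof
  assume "x [^] n \<in> I (Suc n)"
  then obtain c where c: "c \<in> carrier R" "x [^] n = c \<otimes> x [^] Suc n" by (auto simp: I_iff)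
  then have "x [^] n \<otimes> \<one> = x [^] n \<otimes> (c \<otimes> x)" by (simp add: m_ac)
  then have "\<one> = c \<otimes> x" using m_lcancel[of "x [^] n" \<one> "c \<otimes> x"] x_pow_nonzero[of n] c(1)
    by simp
  then have "c \<otimes> x = \<one>" "x \<otimes> c = \<one>" using c(1) m_comm[of c x] by auto
  then have "x \<in> Units R" unfolding Units_def using c(1) x_closed by blast
  then show False using x_not_unit by simp
qed

lemma I_1_unit: "a \<in> carrier R \<Longrightarrow> a \<notin> I 1 \<Longrightarrow> a \<in> Units R"
proof -
  assume a: "a \<in> carrier R" "a \<notin> I 1"
  then have "a \<noteq> \<zero>" using I_zero by auto
  then obtain u k where u: "u \<in> Units R" "a = u \<otimes> x [^] (k::nat)" using unit_power_ex a by blast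
  have "k = 0"
  proof (rule ccontr)
    assume "k \<noteq> 0"
    moreover have "a \<in> I k" unfolding I_iff using u by (blast intro: Units_closed)
    ultimately have "a \<in> I 1" using I_antimono[of 1 k] by auto
    then show False using a by simp
  qed
  then show ?thesis using u by simp
qed

lemma I_Inter: assumes "a \<in> carrier R" "\<And>n. a \<in> I n" shows "a = \<zero>"
proof (rule ccontr)
  assume "a \<noteq> \<zero>"
  then obtain u k where u: "u \<in> Units R" "a = u \<otimes> x [^] (k::nat)" using unit_power_ex assms by blast
  have "inv u \<otimes> a \<in> I (Suc k)" using assms u by (intro I_mult) auto
  then have "x [^] k \<in> I (Suc k)" using u by (simp add: m_assoc[symmetric] Units_closed)
  then show False using x_pow_notin_I by blast
qed

lemma coset_eq_iff: "a \<in> carrier R \<Longrightarrow> b \<in> carrier R \<Longrightarrow> I n +> a = I n +> b \<longleftrightarrow> a \<ominus> b \<in> I n"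
  using quotient_eq_iff_same_a_r_cos[OF I_ideal] by blast

text \<open>Elements of the completion are handled through sequences of representatives in R, on
  which the ring operations act termwise; \<open>coset_seq\<close> maps these onto the completion.
  The n-th term counts modulo x^n only, so the term at 0 carries no information.\<close>

definition coherent :: "(nat \<Rightarrow> 'a) \<Rightarrow> bool" where
  "coherent a \<longleftrightarrow> (\<forall>n. a n \<in> carrier R) \<and> (\<forall>n. a (Suc n) \<ominus> a n \<in> I n)"

definition coset_seq :: "(nat \<Rightarrow> 'a) \<Rightarrow> nat \<Rightarrow> 'a set" where
  "coset_seq a = (\<lambda>n. I n +> a n)"

lemma coherentD: "coherent a \<Longrightarrow> a n \<in> carrier R" "coherent a \<Longrightarrow> a (Suc n) \<ominus> a n \<in> I n"
  by (auto simp: coherent_def)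

lemma coherent_le: "coherent a \<Longrightarrow> n \<le> k \<Longrightarrow> a k \<ominus> a n \<in> I n"
proof (induction k)
  case 0
  then show ?case using coherentD(1)[of a] by (simp add: I_zero a_minus_def r_neg)
next
  case (Suc k)
  show ?case
  proof (cases "n = Suc k")
    case True
    then show ?thesis using Suc coherentD(1)[of a] by (simp add: I_zero a_minus_def r_neg)
  next
    case False
    then have "a k \<ominus> a n \<in> I n" "a (Suc k) \<ominus> a k \<in> I n"
      using Suc coherentD(2)[of a k] I_antimono[of n k] by auto
    then show ?thesis using I_trans coherentD(1)[OF Suc(2)] by blast
  qed
qed

lemma coset_seq_eq_iff: "coherent a \<Longrightarrow> coherent b \<Longrightarrow> coset_seq a = coset_seq b \<longleftrightarrow> (\<forall>n. a n \<ominus> b n \<in> I n)"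
  by (auto simp: coset_seq_def fun_eq_iff coset_eq_iff coherentD)

lemma coset_add: "\<lbrakk>a \<in> carrier R; b \<in> carrier R\<rbrakk> \<Longrightarrow> (I n +> a) <+>\<^bsub>R\<^esub> (I n +> b) = I n +> (a \<oplus> b)"
  by (rule ideal.a_rcos_sum[OF I_ideal])

text \<open>Since x^n divides x^(n+1), the transition map in \<open>adic_completion\<close> keeps
  the representative.\<close>

lemma coset_Suc: "a \<in> carrier R \<Longrightarrow> (I (Suc n) +> a) <+>\<^bsub>R\<^esub> I n = I n +> a"
proof (intro equalityI subsetI)
  assume a: "a \<in> carrier R"
  {
    fix z assume "z \<in> (I (Suc n) +> a) <+>\<^bsub>R\<^esub> I n"
    then obtain h k where hk: "h \<in> I (Suc n)" "k \<in> I n" "z = (h \<oplus> a) \<oplus> k"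
      by (auto simp: set_add_def' a_r_coset_def')
    then have "h \<oplus> k \<in> I n" using I_antimono[of n "Suc n"] I_add by auto
    moreover have "z = (h \<oplus> k) \<oplus> a" using hk a I_carrier[OF hk(1)] I_carrier[OF hk(2)] by (simp add: a_ac)
    ultimately show "z \<in> I n +> a" by (auto simp: a_r_coset_def')
  next
    fix z assume "z \<in> I n +> a"
    then obtain h where h: "h \<in> I n" "z = h \<oplus> a" by (auto simp: a_r_coset_def')
    then have "z = (\<zero> \<oplus> a) \<oplus> h" using a I_carrier[OF h(1)] by (simp add: a_ac)
    then show "z \<in> (I (Suc n) +> a) <+>\<^bsub>R\<^esub> I n"
      using h I_zero[of "Suc n"] unfolding set_add_def' a_r_coset_def' by blast
  }
qed

lemma coset_seq_closed: "coherent a \<Longrightarrow> coset_seq a \<in> carrier S"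
  using coherentD[of a]
  by (auto simp: adic_completion_def coset_seq_def ideal_pow_m FactRing_def coset_Suc coset_eq_iff intro!: a_rcosetsI[OF I_subset])

lemma completion_cases:
  assumes "f \<in> carrier S"
  obtains a where "coherent a" "f = coset_seq a"
proof -
  have f: "f n \<in> a_rcosets (I n)" "f (Suc n) <+>\<^bsub>R\<^esub> I n = f n" for n
    using assms by (auto simp: adic_completion_def ideal_pow_m FactRing_def)
  have "\<exists>a. a \<in> carrier R \<and> f n = I n +> a" for n using f(1)[of n] by (auto simp: A_RCOSETS_def')
  then obtain a where a: "\<And>n. a n \<in> carrier R" "\<And>n. f n = I n +> a n" by metis
  have "I n +> a (Suc n) = I n +> a n" for n using f(2)[of n] a coset_Suc by simp
  then have "coherent a" using a by (simp add: coherent_def coset_eq_iff)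
  moreover have "f = coset_seq a" using a by (simp add: coset_seq_def fun_eq_iff)
  ultimately show ?thesis using that by blast
qed

lemma coset_seq_add: "coherent a \<Longrightarrow> coherent b \<Longrightarrow> coset_seq a \<oplus>\<^bsub>S\<^esub> coset_seq b = coset_seq (\<lambda>n. a n \<oplus> b n)"
  by (simp add: adic_completion_def coset_seq_def ideal_pow_m FactRing_def coset_add coherentD)

lemma coset_seq_mult: "coherent a \<Longrightarrow> coherent b \<Longrightarrow> coset_seq a \<otimes>\<^bsub>S\<^esub> coset_seq b = coset_seq (\<lambda>n. a n \<otimes> b n)"
  by (simp add: adic_completion_def coset_seq_def ideal_pow_m FactRing_def ideal.rcoset_mult_add[OF I_ideal] coherentD)

lemma coset_seq_one: "\<one>\<^bsub>S\<^esub> = coset_seq (\<lambda>_. \<one>)"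
  by (simp add: adic_completion_def coset_seq_def ideal_pow_m FactRing_def)

lemma coset_zero: "I n +> \<zero> = I n"
  using a_coset_add_zero[of "I n"] I_carrier by (metis subsetI)

lemma coset_seq_zero: "\<zero>\<^bsub>S\<^esub> = coset_seq (\<lambda>_. \<zero>)"
  by (simp add: adic_completion_def coset_seq_def ideal_pow_m FactRing_def coset_zero)

lemma completion_map_eq: "\<phi> r = coset_seq (\<lambda>_. r)"
  by (simp add: completion_map_def coset_seq_def ideal_pow_m)

lemma coherent_const: "r \<in> carrier R \<Longrightarrow> coherent (\<lambda>_. r)"
  by (simp add: coherent_def a_minus_def r_neg I_zero)

lemma coherent_add: "coherent a \<Longrightarrow> coherent b \<Longrightarrow> coherent (\<lambda>n. a n \<oplus> b n)"
  unfolding coherent_def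
proof (intro conjI allI)
  fix n assume "(\<forall>n. a n \<in> carrier R) \<and> (\<forall>n. a (Suc n) \<ominus> a n \<in> I n)"
    "(\<forall>n. b n \<in> carrier R) \<and> (\<forall>n. b (Suc n) \<ominus> b n \<in> I n)"
  then have *: "a n \<in> carrier R" "b n \<in> carrier R" "a (Suc n) \<in> carrier R" "b (Suc n) \<in> carrier R"
    "(a (Suc n) \<ominus> a n) \<oplus> (b (Suc n) \<ominus> b n) \<in> I n" using I_add by auto
  then show "a (Suc n) \<oplus> b (Suc n) \<ominus> (a n \<oplus> b n) \<in> I n"
    by (simp add: a_minus_def minus_add a_ac)
  show "a n \<oplus> b n \<in> carrier R" using * by simp
qed

lemma coherent_mult: "coherent a \<Longrightarrow> coherent b \<Longrightarrow> coherent (\<lambda>n. a n \<otimes> b n)"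
  unfolding coherent_def
proof (intro conjI allI)
  fix n assume "(\<forall>n. a n \<in> carrier R) \<and> (\<forall>n. a (Suc n) \<ominus> a n \<in> I n)"
    "(\<forall>n. b n \<in> carrier R) \<and> (\<forall>n. b (Suc n) \<ominus> b n \<in> I n)"
  then have *: "a n \<in> carrier R" "b n \<in> carrier R" "a (Suc n) \<in> carrier R" "b (Suc n) \<in> carrier R"
    "a (Suc n) \<otimes> (b (Suc n) \<ominus> b n) \<oplus> b n \<otimes> (a (Suc n) \<ominus> a n) \<in> I n" using I_add I_mult by auto
  have "a (Suc n) \<otimes> (b (Suc n) \<ominus> b n) \<oplus> b n \<otimes> (a (Suc n) \<ominus> a n) = a (Suc n) \<otimes> b (Suc n) \<ominus> a n \<otimes> b n"
    using *(1-4) by algebra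
  then show "a (Suc n) \<otimes> b (Suc n) \<ominus> a n \<otimes> b n \<in> I n" using * by simp
  show "a n \<otimes> b n \<in> carrier R" using * by simp
qed

section \<open>Ring structure, divisibility and units of the completion\<close>

lemma completion_cring: "cring S"
proof (rule cringI)
  show "abelian_group S"
  proof (rule abelian_groupI)
    show "\<exists>g\<in>carrier S. g \<oplus>\<^bsub>S\<^esub> f = \<zero>\<^bsub>S\<^esub>" if "f \<in> carrier S" for f
    proof -
      obtain a where a: "coherent a" "f = coset_seq a" using \<open>f \<in> carrier S\<close> by (rule completion_cases)
      have "coherent (\<lambda>n. \<ominus> \<one> \<otimes> a n)" using a by (intro coherent_mult coherent_const) auto
      moreover from this have "coset_seq (\<lambda>n. \<ominus> \<one> \<otimes> a n) \<oplus>\<^bsub>S\<^esub> f = \<zero>\<^bsub>S\<^esub>"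
        using a coherentD(1)[OF a(1)] by (simp add: coset_seq_add coset_seq_zero l_minus l_neg)
      ultimately show ?thesis using coset_seq_closed by blast
    qed
  qed (auto elim!: completion_cases simp: coset_seq_add coset_seq_zero coherent_add coset_seq_closed coherent_const coherentD a_ac)
  show "comm_monoid S"
    by (rule comm_monoidI)
     (auto elim!: completion_cases simp: coset_seq_mult coset_seq_one coherent_mult coset_seq_closed coherent_const coherentD m_ac)
  show "(f \<oplus>\<^bsub>S\<^esub> g) \<otimes>\<^bsub>S\<^esub> h = f \<otimes>\<^bsub>S\<^esub> h \<oplus>\<^bsub>S\<^esub> g \<otimes>\<^bsub>S\<^esub> h"
    if "f \<in> carrier S" "g \<in> carrier S" "h \<in> carrier S" for f g h
    using that by (auto elim!: completion_cases simp: coset_seq_mult coset_seq_add coherent_mult coherent_add coherentD l_distr)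
qed

sublocale S: cring S by (rule completion_cring)

lemma completion_map_hom: "\<phi> \<in> ring_hom R S"
  by (rule ring_hom_memI)
    (auto simp: completion_map_eq coset_seq_closed coherent_const coset_seq_add coset_seq_mult coset_seq_one)

lemmas completion_map_simps =
  ring_hom_mult[OF completion_map_hom] ring_hom_add[OF completion_map_hom] ring_hom_one[OF completion_map_hom]
lemmas completion_map_closed [simp, intro] = ring_hom_closed[OF completion_map_hom]

lemma completion_map_zero: "\<phi> \<zero> = \<zero>\<^bsub>S\<^esub>" by (simp add: completion_map_eq coset_seq_zero)

lemma completion_map_pow: "r \<in> carrier R \<Longrightarrow> \<phi> (r [^] (n::nat)) = \<phi> r [^]\<^bsub>S\<^esub> n"
  by (induction n) (auto simp: completion_map_simps)

lemma coset_seq_minus: "coherent a \<Longrightarrow> coherent b \<Longrightarrow> coset_seq a \<ominus>\<^bsub>S\<^esub> coset_seq b = coset_seq (\<lambda>n. a n \<ominus> b n)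
    \<and> coherent (\<lambda>n. a n \<ominus> b n)"
proof -
  assume ab: "coherent a" "coherent b"
  have c: "coherent (\<lambda>n. \<ominus> \<one> \<otimes> b n)" using ab by (intro coherent_mult coherent_const) auto
  have eq: "(\<lambda>n. a n \<oplus> \<ominus> \<one> \<otimes> b n) = (\<lambda>n. a n \<ominus> b n)"
    using coherentD(1)[OF ab(2)] by (simp add: l_minus a_minus_def)
  have "coset_seq (\<lambda>n. \<ominus> \<one> \<otimes> b n) \<oplus>\<^bsub>S\<^esub> coset_seq b = \<zero>\<^bsub>S\<^esub>"
    using ab c coherentD(1)[OF ab(2)] by (simp add: coset_seq_add coset_seq_zero l_minus l_neg)
  then have "\<ominus>\<^bsub>S\<^esub> coset_seq b = coset_seq (\<lambda>n. \<ominus> \<one> \<otimes> b n)"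
    using S.minus_equality coset_seq_closed[OF ab(2)] coset_seq_closed[OF c] by blast
  then show ?thesis using ab c coset_seq_add[OF ab(1) c] coherent_add[OF ab(1) c] eq by (simp add: a_minus_def)
qed

text \<open>Divisibility by x^n in the completion is read off from the n-th component alone.
  Separatedness, density, the form of units and the domain property of S all reduce to this.\<close>

lemma divisible_iff:
  assumes "coherent a"
  shows "(\<exists>g\<in>carrier S. coset_seq a = \<phi> (x [^] n) \<otimes>\<^bsub>S\<^esub> g) \<longleftrightarrow> a n \<in> I n"
proof
  assume "\<exists>g\<in>carrier S. coset_seq a = \<phi> (x [^] n) \<otimes>\<^bsub>S\<^esub> g"
  then obtain b where b: "coherent b" "coset_seq a = \<phi> (x [^] n) \<otimes>\<^bsub>S\<^esub> coset_seq b" using completion_cases by metis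
  then have "a n \<ominus> x [^] n \<otimes> b n \<in> I n"
    using assms by (simp add: completion_map_eq coset_seq_mult coherent_const coset_seq_eq_iff coherent_mult)
  moreover have "x [^] n \<otimes> b n \<in> I n" using coherentD(1)[OF b(1)] by (auto simp: I_iff m_comm)
  ultimately have "(a n \<ominus> x [^] n \<otimes> b n) \<oplus> x [^] n \<otimes> b n \<in> I n" by (rule I_add)
  then show "a n \<in> I n" using coherentD(1)[OF b(1)] coherentD(1)[OF assms]
    by (simp add: a_minus_def a_assoc l_neg)
next
  assume an: "a n \<in> I n"
  have "a (n + k) \<in> I n" for k
  proof -
    have "(a (n + k) \<ominus> a n) \<oplus> a n \<in> I n" using coherent_le[OF assms, of n "n + k"] an by (intro I_add) auto
    then show ?thesis using coherentD(1)[OF assms] by (simp add: a_minus_def a_assoc l_neg)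
  qed
  then have "\<exists>c. c \<in> carrier R \<and> a (n + k) = c \<otimes> x [^] n" for k using I_iff by blast
  \<comment> \<open>Division by x^n costs n steps of precision, so the k-th term of the quotient is
    a (n + k) / x^n.\<close>
  then obtain t where t: "\<And>k. t k \<in> carrier R" "\<And>k. a (n + k) = t k \<otimes> x [^] n" by metis
  have "coherent t"
    unfolding coherent_def
  proof (intro conjI allI)
    fix k
    have "a (Suc (n + k)) \<ominus> a (n + k) \<in> I (n + k)" using coherentD(2)[OF assms] .
    then obtain c where c: "c \<in> carrier R" "t (Suc k) \<otimes> x [^] n \<ominus> t k \<otimes> x [^] n = c \<otimes> x [^] (n + k)"
      using t(2)[of "Suc k"] t(2)[of k] by (auto simp: I_iff)
    have "x [^] n \<otimes> (t (Suc k) \<ominus> t k) = t (Suc k) \<otimes> x [^] n \<ominus> t k \<otimes> x [^] n"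
      using t(1)[of k] t(1)[of "Suc k"] nat_pow_closed[OF x_closed, of n] by algebra
    also have "\<dots> = x [^] n \<otimes> (c \<otimes> x [^] k)"
      unfolding c(2) nat_pow_mult[OF x_closed, symmetric] using c(1) by (simp add: m_ac)
    finally have "t (Suc k) \<ominus> t k = c \<otimes> x [^] k"
      using m_lcancel[OF x_pow_nonzero[of n]] c(1) t(1) by simp
    then show "t (Suc k) \<ominus> t k \<in> I k" using c by (auto simp: I_iff)
  qed (use t in auto)
  moreover have "coset_seq a = \<phi> (x [^] n) \<otimes>\<^bsub>S\<^esub> coset_seq t"
  proof -
    have "a k \<ominus> x [^] n \<otimes> t k \<in> I k" for k
    proof (rule I_sym)
      have "a (n + k) = x [^] n \<otimes> t k" using t by (simp add: m_comm)
      then show "x [^] n \<otimes> t k \<ominus> a k \<in> I k" using coherent_le[OF assms, of k "n + k"] by simp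
    qed (use t coherentD(1)[OF assms] in auto)
    then show ?thesis
      using assms \<open>coherent t\<close> by (simp add: completion_map_eq coset_seq_mult coherent_const coset_seq_eq_iff coherent_mult)
  qed
  ultimately show "\<exists>g\<in>carrier S. coset_seq a = \<phi> (x [^] n) \<otimes>\<^bsub>S\<^esub> g" using coset_seq_closed by blast
qed

lemma completion_separated:
  assumes "f \<in> carrier S" "\<And>n::nat. \<exists>g\<in>carrier S. f = \<phi> (x [^] n) \<otimes>\<^bsub>S\<^esub> g"
  shows "f = \<zero>\<^bsub>S\<^esub>"
proof -
  obtain a where a: "coherent a" "f = coset_seq a" using assms(1) by (rule completion_cases)
  then have "a n \<in> I n" for n using divisible_iff[OF a(1), of n] assms(2)[of n] by simp
  then show ?thesis using a coherentD(1)[OF a(1)] by (simp add: coset_seq_zero coset_seq_eq_iff coherent_const a_minus_def)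
qed

text \<open>The n-th term of a representing sequence serves as r.\<close>

lemma completion_dense:
  assumes "f \<in> carrier S"
  shows "\<exists>r\<in>carrier R. \<exists>g\<in>carrier S. f = \<phi> r \<oplus>\<^bsub>S\<^esub> \<phi> (x [^] (n::nat)) \<otimes>\<^bsub>S\<^esub> g"
proof -
  obtain a where a: "coherent a" "f = coset_seq a" using assms by (rule completion_cases)
  note an = coherentD(1)[OF a(1), of n]
  have *: "coset_seq a \<ominus>\<^bsub>S\<^esub> \<phi> (a n) = coset_seq (\<lambda>k. a k \<ominus> a n)" "coherent (\<lambda>k. a k \<ominus> a n)"
    using coset_seq_minus[OF a(1) coherent_const[OF an]] by (auto simp: completion_map_eq)
  have "a n \<ominus> a n \<in> I n" using an by (simp add: a_minus_def r_neg I_zero)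
  then obtain g where "g \<in> carrier S" "coset_seq a \<ominus>\<^bsub>S\<^esub> \<phi> (a n) = \<phi> (x [^] n) \<otimes>\<^bsub>S\<^esub> g"
    using divisible_iff[OF *(2), of n] * by auto
  moreover have "f = \<phi> (a n) \<oplus>\<^bsub>S\<^esub> (coset_seq a \<ominus>\<^bsub>S\<^esub> \<phi> (a n))"
    using a an assms by (simp add: a_minus_def S.a_ac S.r_neg2 S.r_neg S.r_neg1)
  ultimately show ?thesis using an by auto
qed

text \<open>Used to cancel powers of x in R after a computation in S.\<close>

lemma completion_map_in_divisible: "r \<in> carrier R \<Longrightarrow> g \<in> carrier S \<Longrightarrow> \<phi> r = \<phi> (x [^] n) \<otimes>\<^bsub>S\<^esub> g \<Longrightarrow> r \<in> I n"
  using divisible_iff[OF coherent_const] completion_map_eq by metis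

lemma completion_map_inject: assumes "r \<in> carrier R" "\<phi> r = \<zero>\<^bsub>S\<^esub>" shows "r = \<zero>"
proof (rule I_Inter[OF assms(1)])
  show "r \<in> I n" for n using completion_map_in_divisible[OF assms(1), of "\<zero>\<^bsub>S\<^esub>" n] assms by simp
qed

lemma completion_map_inj: "inj_on \<phi> (carrier R)"
proof (rule inj_onI)
  fix r s assume rs: "r \<in> carrier R" "s \<in> carrier R" "\<phi> r = \<phi> s"
  have "\<phi> (r \<ominus> s) \<oplus>\<^bsub>S\<^esub> \<phi> s = \<phi> r" using rs(1,2) by (simp add: completion_map_simps[symmetric] a_minus_def a_assoc l_neg)
  then have "\<phi> (r \<ominus> s) = \<zero>\<^bsub>S\<^esub>" using rs by simp
  then show "r = s" using completion_map_inject[of "r \<ominus> s"] rs by simp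
qed

text \<open>For n \<ge> 1 the term a n agrees with a 1 modulo x, so it is a unit of R; the inverse
  is formed termwise.\<close>

lemma completion_unit:
  assumes a: "coherent a" and "a 1 \<notin> I 1"
  shows "coset_seq a \<in> Units S"
proof -
  have unit: "a (Suc n) \<in> Units R" for n
  proof (rule I_1_unit[OF coherentD(1)[OF a]])
    have "a (Suc n) \<ominus> a 1 \<in> I 1" using coherent_le[OF a, of 1 "Suc n"] by simp
    then have "a 1 \<ominus> a (Suc n) \<in> I 1" using I_sym coherentD(1)[OF a] by blast
    then have "(a 1 \<ominus> a (Suc n)) \<oplus> a (Suc n) \<in> I 1" if "a (Suc n) \<in> I 1" using I_add that by blast
    then show "a (Suc n) \<notin> I 1" using assms(2) coherentD(1)[OF a]
      by (auto simp: a_minus_def a_assoc l_neg)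
  qed
  \<comment> \<open>a 0 need not be a unit, but I 0 is all of R, so any term at 0 will do.\<close>
  define b where "b n = (if n = 0 then \<one> else inv (a n))" for n
  have ab: "b (Suc n) \<in> carrier R" "a (Suc n) \<otimes> b (Suc n) = \<one>" for n using unit[of n] by (auto simp: b_def)
  have "coherent b"
    unfolding coherent_def
  proof (intro conjI allI)
    show bc: "b n \<in> carrier R" for n using ab(1) by (cases n) (auto simp: b_def)
    show "b (Suc n) \<ominus> b n \<in> I n" for n
    proof (cases n)
      case 0
      then show ?thesis using bc I_0 by simp
    next
      case (Suc k)
      note cl = coherentD(1)[OF a, of "Suc k"] coherentD(1)[OF a, of "Suc (Suc k)"] ab(1)[of k] ab(1)[of "Suc k"]
      \<comment> \<open>With a' the successor of a, 1/a' - 1/a = (a - a')/(a a'), so consecutive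
        inverses agree modulo x^n because a and a' do.\<close>
      have "b (Suc n) \<otimes> (b n \<otimes> (a n \<ominus> a (Suc n))) \<in> I n"
        using coherentD[OF a] I_sym bc by (intro I_mult) auto
      also have "b (Suc n) \<otimes> (b n \<otimes> (a n \<ominus> a (Suc n)))
          = b (Suc n) \<otimes> (a n \<otimes> b n) \<ominus> b n \<otimes> (a (Suc n) \<otimes> b (Suc n))"
        unfolding Suc using cl by algebra
      also have "\<dots> = b (Suc n) \<ominus> b n" using ab(2)[of k] ab(2)[of "Suc k"] cl Suc by simp
      finally show ?thesis .
    qed
  qed
  moreover have "coset_seq a \<otimes>\<^bsub>S\<^esub> coset_seq b = \<one>\<^bsub>S\<^esub>"
  proof -
    have "a n \<otimes> b n \<ominus> \<one> \<in> I n" for n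
    proof (cases n)
      case 0
      then show ?thesis using coherentD(1)[OF a] coherentD(1)[OF \<open>coherent b\<close>] I_0 by simp
    next
      case (Suc k)
      then show ?thesis using ab(2)[of k] by (simp add: a_minus_def r_neg I_zero)
    qed
    then show ?thesis using a \<open>coherent b\<close> by (simp add: coset_seq_mult coset_seq_one coset_seq_eq_iff coherent_mult coherent_const)
  qed
  ultimately show ?thesis using a S.m_comm[OF coset_seq_closed coset_seq_closed, of a b] coset_seq_closed unfolding Units_def by auto
qed

lemma completion_unit_power:
  assumes f: "f \<in> carrier S" "f \<noteq> \<zero>\<^bsub>S\<^esub>"
  shows "\<exists>u\<in>Units S. \<exists>n::nat. f = u \<otimes>\<^bsub>S\<^esub> \<phi> x [^]\<^bsub>S\<^esub> n"
proof -
  obtain a where a: "coherent a" "f = coset_seq a" using f(1) by (rule completion_cases)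
  have "\<exists>n. a n \<notin> I n"
    using completion_separated[OF f(1)] f(2) divisible_iff[OF a(1)] a(2) by blast
  \<comment> \<open>The valuation of f is n - 1: component n - 1 still vanishes, component n does
    not.\<close>
  define n where "n = (LEAST n. a n \<notin> I n)"
  have n: "a n \<notin> I n" "\<And>k. k < n \<Longrightarrow> a k \<in> I k"
    using LeastI_ex[OF \<open>\<exists>n. a n \<notin> I n\<close>] not_less_Least unfolding n_def by blast+
  have "n \<noteq> 0" using n(1) coherentD(1)[OF a(1)] I_0 by metis
  then obtain k where k: "n = Suc k" by (cases n) auto
  then obtain g where g: "g \<in> carrier S" "coset_seq a = \<phi> (x [^] k) \<otimes>\<^bsub>S\<^esub> g"
    using n(2)[of k] divisible_iff[OF a(1), of k] by auto
  obtain b where b: "coherent b" "g = coset_seq b" using g(1) by (rule completion_cases)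
  have "b 1 \<notin> I 1"
  proof
    assume "b 1 \<in> I 1"
    then obtain h where h: "h \<in> carrier S" "g = \<phi> (x [^] (1::nat)) \<otimes>\<^bsub>S\<^esub> h"
      using divisible_iff[OF b(1), of 1] b by auto
    have "coset_seq a = \<phi> (x [^] Suc k) \<otimes>\<^bsub>S\<^esub> h"
      using g h by (simp add: completion_map_simps S.m_assoc)
    then show False using divisible_iff[OF a(1), of "Suc k"] h n(1) k by auto
  qed
  then have "g \<in> Units S" using completion_unit b by simp
  then show ?thesis using a g by (auto simp: completion_map_pow S.m_comm)
qed

lemma completion_x_pow_nonzero: "\<phi> x [^]\<^bsub>S\<^esub> (n::nat) \<noteq> \<zero>\<^bsub>S\<^esub>"
  using completion_map_inject[of "x [^] n"] x_pow_nonzero[of n] by (auto simp: completion_map_pow)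

text \<open>Valuations add: the product of u x^n and v x^k is a unit times x^(n+k), which is
  nonzero.\<close>

lemma completion_domain: "domain S"
proof
  show nontriv: "\<one>\<^bsub>S\<^esub> \<noteq> \<zero>\<^bsub>S\<^esub>" using completion_map_inject[of \<one>] by (auto simp: completion_map_simps)
  fix f g assume fg: "f \<otimes>\<^bsub>S\<^esub> g = \<zero>\<^bsub>S\<^esub>" "f \<in> carrier S" "g \<in> carrier S"
  show "f = \<zero>\<^bsub>S\<^esub> \<or> g = \<zero>\<^bsub>S\<^esub>"
  proof (rule ccontr)
    assume "\<not> (f = \<zero>\<^bsub>S\<^esub> \<or> g = \<zero>\<^bsub>S\<^esub>)"
    then obtain u n v k where u: "u \<in> Units S" "f = u \<otimes>\<^bsub>S\<^esub> \<phi> x [^]\<^bsub>S\<^esub> (n::nat)"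
      and v: "v \<in> Units S" "g = v \<otimes>\<^bsub>S\<^esub> \<phi> x [^]\<^bsub>S\<^esub> (k::nat)"
      using completion_unit_power fg by meson
    have "\<zero>\<^bsub>S\<^esub> = inv\<^bsub>S\<^esub> (u \<otimes>\<^bsub>S\<^esub> v) \<otimes>\<^bsub>S\<^esub> (f \<otimes>\<^bsub>S\<^esub> g)" using fg u v by (simp add: S.Units_closed)
    also have "f \<otimes>\<^bsub>S\<^esub> g = (u \<otimes>\<^bsub>S\<^esub> v) \<otimes>\<^bsub>S\<^esub> \<phi> x [^]\<^bsub>S\<^esub> (n + k)"
      using u v by (simp add: S.nat_pow_mult[symmetric] S.m_ac S.Units_closed)
    also have "inv\<^bsub>S\<^esub> (u \<otimes>\<^bsub>S\<^esub> v) \<otimes>\<^bsub>S\<^esub> \<dots> = \<phi> x [^]\<^bsub>S\<^esub> (n + k)"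
    proof -
      have w: "u \<otimes>\<^bsub>S\<^esub> v \<in> Units S" using u v by simp
      show ?thesis
        using S.Units_l_inv[OF w] S.m_assoc[OF S.Units_inv_closed[OF w] S.Units_closed[OF w], of "\<phi> x [^]\<^bsub>S\<^esub> (n + k)", symmetric]
        by simp
    qed
    finally show False using completion_x_pow_nonzero by metis
  qed
qed

lemma completion_uniformized: "uniformized_domain S (\<phi> x)"
proof -
  interpret D: domain S by (rule completion_domain)
  show ?thesis
  proof
    show "\<phi> x \<noteq> \<zero>\<^bsub>S\<^esub>" using completion_x_pow_nonzero[of 1] by simp
    show "\<phi> x \<notin> Units S"
    proof
      assume "\<phi> x \<in> Units S"
      then have "\<phi> \<one> = \<phi> (x [^] (1::nat)) \<otimes>\<^bsub>S\<^esub> inv\<^bsub>S\<^esub> \<phi> x" by (simp add: completion_map_simps)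
      then show False using completion_map_in_divisible[of \<one> "inv\<^bsub>S\<^esub> \<phi> x" 1] \<open>\<phi> x \<in> Units S\<close> x_pow_notin_I[of 0] by simp
    qed
  qed (use completion_unit_power in auto)
qed

text \<open>From here on quotient fields, pure spans and coordinates are available over the
  completion as well, under the prefix \<open>S\<close>.\<close>

sublocale S: uniformized_domain S "\<phi> x" by (rule completion_uniformized)

section \<open>R-linear maps out of the completion\<close>

abbreviation "SR \<equiv> restrict_scalars \<phi> (ring_module S)"

lemma module_SR: "module R SR"
  by (rule module_restrict_scalars[OF is_cring completion_map_hom module_ring_module[OF completion_cring]])

text \<open>With y = r + x^n g the difference of the two sides is x^n times an element of S. As n is
  arbitrary and S is separated, it vanishes.\<close>

lemma completion_endomorphism:
  assumes f: "f \<in> linear_maps R SR SR" and y: "y \<in> carrier S"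
  shows "f y = y \<otimes>\<^bsub>S\<^esub> f \<one>\<^bsub>S\<^esub>"
proof -
  have cl: "f z \<in> carrier S" if "z \<in> carrier S" for z using linear_maps_closed[OF f] that by simp
  have add: "f (z \<oplus>\<^bsub>S\<^esub> w) = f z \<oplus>\<^bsub>S\<^esub> f w" if "z \<in> carrier S" "w \<in> carrier S" for z w
    using linear_maps_add[OF f] that by simp
  have sc: "f (\<phi> r \<otimes>\<^bsub>S\<^esub> z) = \<phi> r \<otimes>\<^bsub>S\<^esub> f z" if "z \<in> carrier S" "r \<in> carrier R" for z r
    using linear_maps_smult[OF f] that by simp
  have "f y \<ominus>\<^bsub>S\<^esub> y \<otimes>\<^bsub>S\<^esub> f \<one>\<^bsub>S\<^esub> = \<zero>\<^bsub>S\<^esub>"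
  proof (rule completion_separated)
    fix n :: nat
    obtain r g where r: "r \<in> carrier R" "g \<in> carrier S" "y = \<phi> r \<oplus>\<^bsub>S\<^esub> \<phi> (x [^] n) \<otimes>\<^bsub>S\<^esub> g"
      using completion_dense[OF y] by blast
    have "f y = f (\<phi> r \<otimes>\<^bsub>S\<^esub> \<one>\<^bsub>S\<^esub>) \<oplus>\<^bsub>S\<^esub> f (\<phi> (x [^] n) \<otimes>\<^bsub>S\<^esub> g)" using r by (simp add: add)
    also have "\<dots> = \<phi> r \<otimes>\<^bsub>S\<^esub> f \<one>\<^bsub>S\<^esub> \<oplus>\<^bsub>S\<^esub> \<phi> (x [^] n) \<otimes>\<^bsub>S\<^esub> f g"
      using r by (simp only: sc S.one_closed nat_pow_closed x_closed)
    finally have fy: "f y = \<dots>" .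
    have "f y \<ominus>\<^bsub>S\<^esub> y \<otimes>\<^bsub>S\<^esub> f \<one>\<^bsub>S\<^esub> = \<phi> (x [^] n) \<otimes>\<^bsub>S\<^esub> (f g \<ominus>\<^bsub>S\<^esub> g \<otimes>\<^bsub>S\<^esub> f \<one>\<^bsub>S\<^esub>)"
      unfolding fy unfolding r(3) using r(2) cl[OF r(2)] cl[OF S.one_closed] completion_map_closed[OF r(1)]
        completion_map_closed[OF nat_pow_closed[OF x_closed, of n]] by algebra
    then show "\<exists>g\<in>carrier S. f y \<ominus>\<^bsub>S\<^esub> y \<otimes>\<^bsub>S\<^esub> f \<one>\<^bsub>S\<^esub> = \<phi> (x [^] n) \<otimes>\<^bsub>S\<^esub> g"
      using r(2) cl by (metis S.minus_closed S.m_closed S.one_closed)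
  qed (use y cl in auto)
  then show ?thesis using y cl by simp
qed

text \<open>Composed with \<phi>, f is multiplication by \<phi> (f 1). If f 1 = u x^k were nonzero,
  z u x^k would lie in R for every z in S; cancelling u x^k puts z into R, so R would be
  complete.\<close>

lemma completion_dual_zero:
  assumes nc: "\<not> adically_complete R m" and f: "f \<in> linear_maps R SR (ring_module R)" and y: "y \<in> carrier S"
  shows "f y = \<zero>"
proof -
  have cl: "f z \<in> carrier R" if "z \<in> carrier S" for z using linear_maps_closed[OF f] that by simp
  have "\<phi> \<in> linear_maps R (ring_module R) SR" by (intro linear_mapsI) (auto simp: completion_map_simps)
  note lin = linear_maps_compose[OF f this]
  have eq: "\<phi> (f z) = z \<otimes>\<^bsub>S\<^esub> \<phi> (f \<one>\<^bsub>S\<^esub>)" if "z \<in> carrier S" for z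
    by (rule completion_endomorphism[OF lin that])
  have "f \<one>\<^bsub>S\<^esub> = \<zero>"
  proof (rule ccontr)
    assume "f \<one>\<^bsub>S\<^esub> \<noteq> \<zero>"
    then obtain u k where u: "u \<in> Units R" "f \<one>\<^bsub>S\<^esub> = u \<otimes> x [^] (k::nat)"
      using unit_power_ex cl by blast
    have "z \<in> \<phi> ` carrier R" if z: "z \<in> carrier S" for z
    proof -
      have *: "\<phi> (f z) = \<phi> (x [^] k) \<otimes>\<^bsub>S\<^esub> (z \<otimes>\<^bsub>S\<^esub> \<phi> u)"
        using eq[OF z] u z by (simp add: completion_map_simps Units_closed S.m_ac)
      then have "f z \<in> I k" using completion_map_in_divisible[OF cl[OF z], of "z \<otimes>\<^bsub>S\<^esub> \<phi> u"] z u by (auto simp: Units_closed)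
      then obtain t where t: "t \<in> carrier R" "f z = t \<otimes> x [^] k" by (auto simp: I_iff)
      then have "\<phi> (x [^] k) \<otimes>\<^bsub>S\<^esub> \<phi> t = \<phi> (x [^] k) \<otimes>\<^bsub>S\<^esub> (z \<otimes>\<^bsub>S\<^esub> \<phi> u)"
        using * by (simp add: completion_map_simps S.m_comm)
      then have "\<phi> t = z \<otimes>\<^bsub>S\<^esub> \<phi> u"
        using S.m_lcancel[of "\<phi> (x [^] k)" "\<phi> t" "z \<otimes>\<^bsub>S\<^esub> \<phi> u"] completion_x_pow_nonzero[of k] t z u
        by (simp add: completion_map_pow Units_closed)
      then have "\<phi> (t \<otimes> inv u) = z \<otimes>\<^bsub>S\<^esub> \<phi> (u \<otimes> inv u)"
        using t u z by (simp add: completion_map_simps Units_closed S.m_assoc del: Units_r_inv)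
      then have "\<phi> (t \<otimes> inv u) = z" using u z by (simp add: completion_map_simps)
      then show ?thesis using t u by (metis Units_inv_closed imageI m_closed)
    qed
    moreover have "inj_on \<phi> (carrier R)" by (rule completion_map_inj)
    ultimately have "bij_betw \<phi> (carrier R) (carrier S)" by (auto simp: bij_betw_def)
    then show False using nc completion_map_hom by (simp add: adically_complete_def ring_iso_def)
  qed
  then have "\<phi> (f y) = \<zero>\<^bsub>S\<^esub>" using eq[OF y] y by (simp add: completion_map_zero)
  then show ?thesis using completion_map_inject[OF cl[OF y]] by simp
qed

end

section \<open>Quotient modules, modules of homomorphisms, and injective hulls\<close>

lemma quotient_module_simps [simp]:
  "carrier (quotient_module M N) = a_rcosets\<^bsub>M\<^esub> N" "ring.zero (quotient_module M N) = N"
  "ring.add (quotient_module M N) = set_add M"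
  by (simp_all add: quotient_module_def)

context module
begin

lemma coset_eq_iff:
  assumes N: "submodule N R M" and "v \<in> carrier M" "w \<in> carrier M"
  shows "N +>\<^bsub>M\<^esub> v = N +>\<^bsub>M\<^esub> w \<longleftrightarrow> v \<ominus>\<^bsub>M\<^esub> w \<in> N"
proof -
  interpret N: abelian_subgroup N M
    using N by (intro abelian_subgroupI3 additive_subgroup.intro M.abelian_group_axioms) (simp add: submodule_def)
  note E = submoduleE[OF N]
  show ?thesis
  proof
    assume "N +>\<^bsub>M\<^esub> v = N +>\<^bsub>M\<^esub> w"
    then have "v \<in> N +>\<^bsub>M\<^esub> w" using N.a_rcos_self assms by blast
    then obtain h where "h \<in> N" "v = h \<oplus>\<^bsub>M\<^esub> w" by (auto simp: a_r_coset_def')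
    moreover from this have "h \<in> carrier M" using E(1) by blast
    ultimately show "v \<ominus>\<^bsub>M\<^esub> w \<in> N" using assms by (simp add: a_minus_def M.a_assoc M.r_neg)
  next
    assume "v \<ominus>\<^bsub>M\<^esub> w \<in> N"
    moreover have "v = (v \<ominus>\<^bsub>M\<^esub> w) \<oplus>\<^bsub>M\<^esub> w" using assms by (simp add: a_minus_def M.a_assoc M.l_neg)
    ultimately have "v \<in> N +>\<^bsub>M\<^esub> w" unfolding a_r_coset_def' by blast
    then show "N +>\<^bsub>M\<^esub> v = N +>\<^bsub>M\<^esub> w" using N.a_repr_independence' assms by metis
  qed
qed

lemma quotient_add:
  assumes N: "submodule N R M" and "v \<in> carrier M" "w \<in> carrier M"
  shows "(N +>\<^bsub>M\<^esub> v) \<oplus>\<^bsub>quotient_module M N\<^esub> (N +>\<^bsub>M\<^esub> w) = N +>\<^bsub>M\<^esub> (v \<oplus>\<^bsub>M\<^esub> w)"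
proof -
  interpret N: abelian_subgroup N M
    using N by (intro abelian_subgroupI3 additive_subgroup.intro M.abelian_group_axioms) (simp add: submodule_def)
  show ?thesis using N.a_rcos_sum assms by simp
qed

text \<open>The scalar action on \<open>quotient_module\<close> is a union over representatives; its
  members coincide because N is a submodule.\<close>

lemma quotient_smult:
  assumes N: "submodule N R M" and "v \<in> carrier M" "r \<in> carrier R"
  shows "r \<odot>\<^bsub>quotient_module M N\<^esub> (N +>\<^bsub>M\<^esub> v) = N +>\<^bsub>M\<^esub> (r \<odot>\<^bsub>M\<^esub> v)"
proof -
  interpret N: abelian_subgroup N M
    using N by (intro abelian_subgroupI3 additive_subgroup.intro M.abelian_group_axioms) (simp add: submodule_def)
  note E = submoduleE[OF N]
  have "N +>\<^bsub>M\<^esub> (r \<odot>\<^bsub>M\<^esub> w) = N +>\<^bsub>M\<^esub> (r \<odot>\<^bsub>M\<^esub> v)" if w: "w \<in> N +>\<^bsub>M\<^esub> v" for w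
  proof -
    obtain h where h: "h \<in> N" "w = h \<oplus>\<^bsub>M\<^esub> v" using w by (auto simp: a_r_coset_def')
    then have hM: "h \<in> carrier M" using E(1) by blast
    have "r \<odot>\<^bsub>M\<^esub> w \<ominus>\<^bsub>M\<^esub> r \<odot>\<^bsub>M\<^esub> v = r \<odot>\<^bsub>M\<^esub> h"
      using h hM assms by (simp add: smult_r_distr a_minus_def M.a_assoc M.r_neg)
    then show ?thesis using coset_eq_iff[OF N] E(4) h hM assms by simp
  qed
  moreover have "v \<in> N +>\<^bsub>M\<^esub> v" using N.a_rcos_self assms by blast
  ultimately have "(\<Union>w\<in>N +>\<^bsub>M\<^esub> v. N +>\<^bsub>M\<^esub> (r \<odot>\<^bsub>M\<^esub> w)) = N +>\<^bsub>M\<^esub> (r \<odot>\<^bsub>M\<^esub> v)"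
    by (intro SUP_eq_const) blast+
  then show ?thesis by (simp add: quotient_module_def)
qed

lemma quotient_cases:
  assumes "P \<in> carrier (quotient_module M N)"
  obtains v where "v \<in> carrier M" "P = N +>\<^bsub>M\<^esub> v"
  using assms by (auto simp: A_RCOSETS_def')

lemma quotient_closed: "submodule N R M \<Longrightarrow> v \<in> carrier M \<Longrightarrow> N +>\<^bsub>M\<^esub> v \<in> carrier (quotient_module M N)"
  using M.a_rcosetsI submoduleE(1) by simp

lemma quotient_zero_iff:
  assumes N: "submodule N R M" and v: "v \<in> carrier M"
  shows "N +>\<^bsub>M\<^esub> v = N \<longleftrightarrow> v \<in> N"
proof -
  have "N +>\<^bsub>M\<^esub> \<zero>\<^bsub>M\<^esub> = N" using M.a_coset_add_zero submoduleE(1)[OF N] by simp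
  then show ?thesis using coset_eq_iff[OF N v M.zero_closed] v by (simp add: a_minus_def)
qed

lemma module_quotient_module:
  assumes N: "submodule N R M"
  shows "module R (quotient_module M N)"
proof -
  let ?Q = "quotient_module M N"
  note E = submoduleE[OF N]
  have N0: "N = N +>\<^bsub>M\<^esub> \<zero>\<^bsub>M\<^esub>" using M.a_coset_add_zero E(1) by simp
  note s = quotient_add[OF N] quotient_smult[OF N]
  have "abelian_group ?Q"
  proof (rule abelian_groupI)
    fix P assume P: "P \<in> carrier ?Q"
    then obtain v where v: "v \<in> carrier M" "P = N +>\<^bsub>M\<^esub> v" by (rule quotient_cases)
    show "\<zero>\<^bsub>?Q\<^esub> \<oplus>\<^bsub>?Q\<^esub> P = P" using v s(1)[of "\<zero>\<^bsub>M\<^esub>" v] N0 by simp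
    have "(N +>\<^bsub>M\<^esub> (\<ominus>\<^bsub>M\<^esub> v)) \<oplus>\<^bsub>?Q\<^esub> P = \<zero>\<^bsub>?Q\<^esub>"
      using v s(1)[of "\<ominus>\<^bsub>M\<^esub> v" v] N0 by (simp add: M.l_neg)
    then show "\<exists>Q\<in>carrier ?Q. Q \<oplus>\<^bsub>?Q\<^esub> P = \<zero>\<^bsub>?Q\<^esub>" using quotient_closed[OF N] v by blast
    fix Q assume Q: "Q \<in> carrier ?Q"
    then obtain w where w: "w \<in> carrier M" "Q = N +>\<^bsub>M\<^esub> w" by (rule quotient_cases)
    show "P \<oplus>\<^bsub>?Q\<^esub> Q \<in> carrier ?Q" unfolding v(2) w(2) s(1)[OF v(1) w(1)] using v w by (intro quotient_closed[OF N]) auto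
    show "P \<oplus>\<^bsub>?Q\<^esub> Q = Q \<oplus>\<^bsub>?Q\<^esub> P" unfolding v(2) w(2) s(1)[OF v(1) w(1)] s(1)[OF w(1) v(1)] using v w by (simp add: M.a_comm)
    fix U assume "U \<in> carrier ?Q"
    then obtain u where u: "u \<in> carrier M" "U = N +>\<^bsub>M\<^esub> u" by (rule quotient_cases)
    show "(P \<oplus>\<^bsub>?Q\<^esub> Q) \<oplus>\<^bsub>?Q\<^esub> U = P \<oplus>\<^bsub>?Q\<^esub> (Q \<oplus>\<^bsub>?Q\<^esub> U)"
      unfolding v(2) w(2) u(2) using u v w s(1) by (simp del: quotient_module_simps add: M.a_assoc)
  next
    show "\<zero>\<^bsub>?Q\<^esub> \<in> carrier ?Q" using quotient_closed[OF N, of "\<zero>\<^bsub>M\<^esub>"] N0 by simp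
  qed
  then show ?thesis
  proof (rule moduleI[OF is_cring])
    fix r s P assume rs: "r \<in> carrier R" "s \<in> carrier R" and P: "P \<in> carrier ?Q"
    obtain v where v: "v \<in> carrier M" "P = N +>\<^bsub>M\<^esub> v" using P by (rule quotient_cases)
    show "r \<odot>\<^bsub>?Q\<^esub> P \<in> carrier ?Q" unfolding v(2) s(2)[OF v(1) rs(1)] using v rs by (intro quotient_closed[OF N]) auto
    show "(r \<oplus> s) \<odot>\<^bsub>?Q\<^esub> P = r \<odot>\<^bsub>?Q\<^esub> P \<oplus>\<^bsub>?Q\<^esub> s \<odot>\<^bsub>?Q\<^esub> P"
      unfolding v(2) using v rs s by (simp del: quotient_module_simps add: smult_l_distr)
    show "(r \<otimes> s) \<odot>\<^bsub>?Q\<^esub> P = r \<odot>\<^bsub>?Q\<^esub> (s \<odot>\<^bsub>?Q\<^esub> P)"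
      unfolding v(2) using v rs s by (simp del: quotient_module_simps add: smult_assoc1)
  next
    fix P assume P: "P \<in> carrier ?Q"
    obtain v where v: "v \<in> carrier M" "P = N +>\<^bsub>M\<^esub> v" using P by (rule quotient_cases)
    show "\<one> \<odot>\<^bsub>?Q\<^esub> P = P" unfolding v(2) using v s by (simp del: quotient_module_simps)
  next
    fix r P Q assume rs: "r \<in> carrier R" and P: "P \<in> carrier ?Q" and Q: "Q \<in> carrier ?Q"
    obtain v where v: "v \<in> carrier M" "P = N +>\<^bsub>M\<^esub> v" using P by (rule quotient_cases)
    obtain w where w: "w \<in> carrier M" "Q = N +>\<^bsub>M\<^esub> w" using Q by (rule quotient_cases)
    show "r \<odot>\<^bsub>?Q\<^esub> (P \<oplus>\<^bsub>?Q\<^esub> Q) = r \<odot>\<^bsub>?Q\<^esub> P \<oplus>\<^bsub>?Q\<^esub> r \<odot>\<^bsub>?Q\<^esub> Q"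
      unfolding v(2) w(2) using v w rs s by (simp del: quotient_module_simps add: smult_r_distr)
  qed
qed

end

lemma hom_module_simps [simp]:
  "carrier (hom_module R \<phi> M N) = linear_maps R (restrict_scalars \<phi> M) N \<inter> extensional (carrier M)"
  "ring.zero (hom_module R \<phi> M N) = (\<lambda>v\<in>carrier M. \<zero>\<^bsub>N\<^esub>)"
  "ring.add (hom_module R \<phi> M N) = (\<lambda>f g. \<lambda>v\<in>carrier M. f v \<oplus>\<^bsub>N\<^esub> g v)"
  "smult (hom_module R \<phi> M N) = (\<lambda>s f. \<lambda>v\<in>carrier M. f (s \<odot>\<^bsub>M\<^esub> v))"
  by (simp_all add: hom_module_def)

lemma restrict_linear:
  assumes "module R M" "f \<in> linear_maps R M N"
  shows "restrict f (carrier M) \<in> linear_maps R M N"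
  by (rule linear_maps_cong[OF _ assms]) simp

lemma module_hom_module:
  assumes R: "cring R" and \<phi>: "\<phi> \<in> ring_hom R S" and M: "module S M" and N: "module R N"
  shows "module S (hom_module R \<phi> M N)"
proof -
  interpret R: cring R by fact
  interpret M: module S M by fact
  interpret N: module R N by fact
  let ?M = "restrict_scalars \<phi> M" and ?H = "hom_module R \<phi> M N"
  have RM: "module R ?M" by (rule module_restrict_scalars[OF R \<phi> M])
  note rl = restrict_linear[OF RM, simplified]
  have scale: "(\<lambda>v. f (s \<odot>\<^bsub>M\<^esub> v)) \<in> linear_maps R ?M N" if "f \<in> linear_maps R ?M N" "s \<in> carrier S" for f s
  proof (rule linear_maps_compose[OF _ that(1)])
    show "(\<odot>\<^bsub>M\<^esub>) s \<in> linear_maps R ?M ?M"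
      using that(2) ring_hom_closed[OF \<phi>]
      by (intro linear_mapsI) (auto simp: M.smult_r_distr M.smult_assoc1[symmetric] M.R.m_comm)
  qed
  have cl: "f v \<in> carrier N" if "f \<in> linear_maps R ?M N" "v \<in> carrier M" for f v
    using linear_maps_closed[OF that(1)] that(2) by simp
  have ab: "abelian_group ?H"
  proof (rule abelian_groupI)
    show "f \<oplus>\<^bsub>?H\<^esub> g \<in> carrier ?H" if "f \<in> carrier ?H" "g \<in> carrier ?H" for f g
      using that by (auto intro!: rl linear_maps_pointwise_add[OF N])
    show "\<zero>\<^bsub>?H\<^esub> \<in> carrier ?H"
      by (auto intro!: rl linear_mapsI)
    show "\<exists>g\<in>carrier ?H. g \<oplus>\<^bsub>?H\<^esub> f = \<zero>\<^bsub>?H\<^esub>" if f: "f \<in> carrier ?H" for f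
    proof (intro bexI)
      show "(\<lambda>v\<in>carrier M. (\<ominus>\<^bsub>R\<^esub> \<one>\<^bsub>R\<^esub>) \<odot>\<^bsub>N\<^esub> f v) \<in> carrier ?H"
        using f by (auto intro!: rl linear_maps_pointwise_smult[OF N])
      show "(\<lambda>v\<in>carrier M. (\<ominus>\<^bsub>R\<^esub> \<one>\<^bsub>R\<^esub>) \<odot>\<^bsub>N\<^esub> f v) \<oplus>\<^bsub>?H\<^esub> f = \<zero>\<^bsub>?H\<^esub>"
        using f cl[of f] by (auto simp: restrict_def fun_eq_iff N.smult_l_minus N.M.l_neg)
    qed
  qed (auto simp: restrict_def fun_eq_iff cl N.M.a_ac extensional_def)
  show ?thesis
  proof (rule moduleI[OF M.is_cring ab])
    show "s \<odot>\<^bsub>?H\<^esub> f \<in> carrier ?H" if "s \<in> carrier S" "f \<in> carrier ?H" for s f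
      using that by (auto intro!: rl scale)
    show "(r \<oplus>\<^bsub>S\<^esub> s) \<odot>\<^bsub>?H\<^esub> f = r \<odot>\<^bsub>?H\<^esub> f \<oplus>\<^bsub>?H\<^esub> s \<odot>\<^bsub>?H\<^esub> f"
      if "r \<in> carrier S" "s \<in> carrier S" "f \<in> carrier ?H" for r s f
      using that linear_maps_add[of f R ?M N] by (auto simp: restrict_def fun_eq_iff M.smult_l_distr)
    show "(r \<otimes>\<^bsub>S\<^esub> s) \<odot>\<^bsub>?H\<^esub> f = r \<odot>\<^bsub>?H\<^esub> (s \<odot>\<^bsub>?H\<^esub> f)"
      if "r \<in> carrier S" "s \<in> carrier S" "f \<in> carrier ?H" for r s f
      using that by (auto simp: restrict_def fun_eq_iff M.smult_assoc1[symmetric] M.R.m_comm)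
  qed (auto simp: restrict_def fun_eq_iff extensional_def)
qed

text \<open>Injectivity is tested on multiplication by x on R itself, a monomorphism because R is a
  domain: the map r to r z is extended along it and evaluated at 1.\<close>

lemma (in uniformized_domain) injective_module_divisible:
  fixes J :: "('a, 'n, 'c) module_scheme"
  assumes "injective_module R J"
  shows "divisible_by J x"
  unfolding divisible_by_def
proof
  interpret J: module R J using assms by (simp add: injective_module_def)
  fix z assume z: "z \<in> carrier J"
  let ?R = "ring_module R"
  have R: "module R ?R" by (rule module_ring_module[OF is_cring])
  have f: "(\<lambda>r. x \<otimes> r) \<in> linear_maps R ?R ?R"
    by (intro linear_mapsI) (auto simp: r_distr m_ac)
  have inj: "inj_on (\<lambda>r. x \<otimes> r) (carrier ?R)"
    by (rule inj_onI) (simp add: m_lcancel[OF x_nonzero])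
  have g: "(\<lambda>r. r \<odot>\<^bsub>J\<^esub> z) \<in> linear_maps R ?R J"
    using z by (intro linear_mapsI) (auto simp: J.smult_l_distr J.smult_assoc1)
  obtain h where h: "h \<in> linear_maps R ?R J" "\<And>r. r \<in> carrier R \<Longrightarrow> h (x \<otimes> r) = r \<odot>\<^bsub>J\<^esub> z"
  proof -
    have "\<exists>h\<in>linear_maps R ?R J. \<forall>r\<in>carrier ?R. h (x \<otimes> r) = r \<odot>\<^bsub>J\<^esub> z"
      using assms R f inj g unfolding injective_module_def by blast
    then show ?thesis using that by auto
  qed
  have "x \<odot>\<^bsub>J\<^esub> h \<one> = h (x \<otimes> \<one>)" using linear_maps_smult[OF h(1), of x \<one>] by simp
  also have "\<dots> = z" using h(2)[of \<one>] z by simp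
  finally show "\<exists>w\<in>carrier J. x \<odot>\<^bsub>J\<^esub> w = z" using linear_maps_closed[OF h(1), of \<one>] by auto
qed

lemma (in module) annihilator_mono:
  "\<lbrakk>c \<in> carrier R; r \<in> carrier R; v \<in> carrier M; r \<odot>\<^bsub>M\<^esub> v = \<zero>\<^bsub>M\<^esub>\<rbrakk> \<Longrightarrow> (c \<otimes> r) \<odot>\<^bsub>M\<^esub> v = \<zero>\<^bsub>M\<^esub>"
  by (simp add: smult_assoc1)

section \<open>The injective hull of the residue field over R and over the completion\<close>

context dvr_completion
begin

lemma m_I_1: "m = I 1" by (simp add: m_eq I_def)

text \<open>e1 is the image of 1. By essentiality every nonzero R e contains a nonzero element r e =
  a e1, and x kills it. Hence e is torsion; and if x e = 0, then r is not divisible by x, so it is a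
  unit and e is a multiple of e1.\<close>

lemma injective_hull_structure:
  fixes E :: "('a, 'e, 'c) module_scheme"
  assumes hull: "injective_hull R (residue_module R m) \<iota> E"
  shows "module R E" "divisible_by E x"
    "\<And>e. e \<in> carrier E \<Longrightarrow> \<exists>n::nat. x [^] n \<odot>\<^bsub>E\<^esub> e = \<zero>\<^bsub>E\<^esub>"
    "\<exists>e1\<in>carrier E. e1 \<noteq> \<zero>\<^bsub>E\<^esub> \<and> x \<odot>\<^bsub>E\<^esub> e1 = \<zero>\<^bsub>E\<^esub> \<and>
      (\<forall>e\<in>carrier E. x \<odot>\<^bsub>E\<^esub> e = \<zero>\<^bsub>E\<^esub> \<longrightarrow> (\<exists>r\<in>carrier R. e = r \<odot>\<^bsub>E\<^esub> e1))"
proof -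
  let ?k = "residue_module R m"
  have inj: "injective_module R E" and \<iota>: "\<iota> \<in> linear_maps R ?k E" "inj_on \<iota> (carrier ?k)"
    and ess: "\<And>N. submodule N R E \<Longrightarrow> N \<noteq> {\<zero>\<^bsub>E\<^esub>} \<Longrightarrow> N \<inter> \<iota> ` carrier ?k \<noteq> {\<zero>\<^bsub>E\<^esub>}"
    using hull by (auto simp: injective_hull_def)
  show mE: "module R E" using inj by (simp add: injective_module_def)
  interpret E: module R E by (rule mE)
  show "divisible_by E x" by (rule injective_module_divisible[OF inj])
  have mI: "ideal m R" by (simp add: m_I_1 I_ideal)
  have kc: "carrier ?k = a_rcosets m" "ring.zero ?k = m" by (simp_all add: residue_module_def FactRing_def)
  have mc: "m +> r \<in> carrier ?k" if "r \<in> carrier R" for r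
    unfolding kc(1) using a_rcosetsI[OF I_subset[of 1] that] by (simp add: m_I_1)
  have ksm: "r \<odot>\<^bsub>?k\<^esub> (m +> s) = m +> (r \<otimes> s)" if "r \<in> carrier R" "s \<in> carrier R" for r s
    using that ideal.rcoset_mult_add[OF mI] by (simp add: residue_module_def FactRing_def)
  define e1 where "e1 = \<iota> (m +> \<one>)"
  have e1: "e1 \<in> carrier E" unfolding e1_def by (rule linear_maps_closed[OF \<iota>(1) mc]) simp
  have \<iota>e1: "\<iota> (m +> r) = r \<odot>\<^bsub>E\<^esub> e1" if "r \<in> carrier R" for r
    using linear_maps_smult[OF \<iota>(1) that mc, of \<one>] ksm[OF that, of \<one>] that by (simp add: e1_def)
  have kx: "m +> x = m +> \<zero>"
    using coset_eq_iff[of x \<zero> 1, folded m_I_1] cgenideal_self[OF x_closed] by (simp add: m_eq[symmetric] a_minus_def)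
  have xe1: "x \<odot>\<^bsub>E\<^esub> e1 = \<zero>\<^bsub>E\<^esub>" using \<iota>e1[of x] \<iota>e1[of \<zero>] kx e1 by simp
  have e1nz: "e1 \<noteq> \<zero>\<^bsub>E\<^esub>"
  proof
    assume "e1 = \<zero>\<^bsub>E\<^esub>"
    then have "\<iota> (m +> \<one>) = \<iota> (m +> \<zero>)" using \<iota>e1[of \<one>] \<iota>e1[of \<zero>] by simp
    then have "m +> \<one> = m +> \<zero>" using \<iota>(2) mc by (auto dest: inj_onD)
    then have "\<one> \<in> I 1" using coset_eq_iff[of \<one> \<zero> 1, folded m_I_1] by (simp add: m_I_1[symmetric] a_minus_def del: One_nat_def)
    then show False using x_pow_notin_I[of 0] by simp
  qed
  have image: "\<exists>a\<in>carrier R. z = a \<odot>\<^bsub>E\<^esub> e1" if "z \<in> \<iota> ` carrier ?k" for z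
    using that \<iota>e1 unfolding kc A_RCOSETS_def' by blast
  have cyclic: "submodule ((\<lambda>r. r \<odot>\<^bsub>E\<^esub> e) ` carrier R) R E" if e: "e \<in> carrier E" for e
  proof (rule E.submoduleI)
    show "\<zero>\<^bsub>E\<^esub> \<in> (\<lambda>r. r \<odot>\<^bsub>E\<^esub> e) ` carrier R" using e by (intro image_eqI[of _ _ \<zero>]) auto
    show "\<ominus>\<^bsub>E\<^esub> a \<in> (\<lambda>r. r \<odot>\<^bsub>E\<^esub> e) ` carrier R" if "a \<in> (\<lambda>r. r \<odot>\<^bsub>E\<^esub> e) ` carrier R" for a
      using that e by (auto simp: E.smult_l_minus[symmetric])
    show "a \<oplus>\<^bsub>E\<^esub> b \<in> (\<lambda>r. r \<odot>\<^bsub>E\<^esub> e) ` carrier R"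
      if "a \<in> (\<lambda>r. r \<odot>\<^bsub>E\<^esub> e) ` carrier R" "b \<in> (\<lambda>r. r \<odot>\<^bsub>E\<^esub> e) ` carrier R" for a b
      using that e by (auto simp: E.smult_l_distr[symmetric])
    show "s \<odot>\<^bsub>E\<^esub> a \<in> (\<lambda>r. r \<odot>\<^bsub>E\<^esub> e) ` carrier R"
      if "s \<in> carrier R" "a \<in> (\<lambda>r. r \<odot>\<^bsub>E\<^esub> e) ` carrier R" for s a
      using that e by (auto simp: E.smult_assoc1[symmetric])
  qed (use e in auto)
  have meets: "\<exists>r\<in>carrier R. \<exists>a\<in>carrier R. r \<odot>\<^bsub>E\<^esub> e = a \<odot>\<^bsub>E\<^esub> e1 \<and> r \<odot>\<^bsub>E\<^esub> e \<noteq> \<zero>\<^bsub>E\<^esub>"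
    if e: "e \<in> carrier E" "e \<noteq> \<zero>\<^bsub>E\<^esub>" for e
  proof -
    let ?N = "(\<lambda>r. r \<odot>\<^bsub>E\<^esub> e) ` carrier R"
    have "e \<in> ?N" using e by (intro image_eqI[of _ _ \<one>]) auto
    then have "?N \<noteq> {\<zero>\<^bsub>E\<^esub>}" using e by blast
    then have "?N \<inter> \<iota> ` carrier ?k \<noteq> {\<zero>\<^bsub>E\<^esub>}" using ess cyclic[OF e(1)] by blast
    moreover have "\<zero>\<^bsub>E\<^esub> \<in> ?N" using e by (intro image_eqI[of _ _ \<zero>]) auto
    moreover have "\<zero>\<^bsub>E\<^esub> \<in> \<iota> ` carrier ?k" using \<iota>e1[of \<zero>] mc[of \<zero>] e1 by (intro image_eqI[of _ _ "m +> \<zero>"]) auto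
    ultimately obtain z where "z \<in> ?N" "z \<in> \<iota> ` carrier ?k" "z \<noteq> \<zero>\<^bsub>E\<^esub>" by blast
    then show ?thesis using image by blast
  qed
  have xae1: "x \<odot>\<^bsub>E\<^esub> (a \<odot>\<^bsub>E\<^esub> e1) = \<zero>\<^bsub>E\<^esub>" if "a \<in> carrier R" for a
    using that e1 xe1 by (simp add: E.smult_assoc1[symmetric] m_comm) (simp add: E.smult_assoc1)
  show "\<exists>n::nat. x [^] n \<odot>\<^bsub>E\<^esub> e = \<zero>\<^bsub>E\<^esub>" if e: "e \<in> carrier E" for e
  proof (cases "e = \<zero>\<^bsub>E\<^esub>")
    case True
    then show ?thesis by simp
  next
    case False
    obtain r a where r: "r \<in> carrier R" "a \<in> carrier R" "r \<odot>\<^bsub>E\<^esub> e = a \<odot>\<^bsub>E\<^esub> e1" "r \<odot>\<^bsub>E\<^esub> e \<noteq> \<zero>\<^bsub>E\<^esub>"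
      using meets[OF e False] by blast
    have "r \<noteq> \<zero>" using r(4) e by auto
    then obtain u n where u: "u \<in> Units R" "r = u \<otimes> x [^] (n::nat)" using unit_power_ex r(1) by blast
    \<comment> \<open>The exponent is n + 1: x^n e is a unit times a e1, and one more factor x kills
      it.\<close>
    have "x [^] Suc n \<odot>\<^bsub>E\<^esub> e = (inv u \<otimes> x \<otimes> (u \<otimes> x [^] n)) \<odot>\<^bsub>E\<^esub> e"
    proof -
      have "inv u \<otimes> x \<otimes> (u \<otimes> x [^] n) = (inv u \<otimes> u) \<otimes> (x [^] n \<otimes> x)"
        using u(1) Units_closed Units_inv_closed by (simp only: m_ac x_closed nat_pow_closed m_closed)
      then show ?thesis using u(1) by simp
    qed
    also have "\<dots> = inv u \<odot>\<^bsub>E\<^esub> (x \<odot>\<^bsub>E\<^esub> (r \<odot>\<^bsub>E\<^esub> e))"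
      using u e r(1) by (simp add: E.smult_assoc1 Units_closed)
    also have "\<dots> = \<zero>\<^bsub>E\<^esub>" using r(2,3) xae1 u by simp
    finally show ?thesis by blast
  qed
  have "\<exists>s\<in>carrier R. e = s \<odot>\<^bsub>E\<^esub> e1" if e: "e \<in> carrier E" "x \<odot>\<^bsub>E\<^esub> e = \<zero>\<^bsub>E\<^esub>" for e
  proof (cases "e = \<zero>\<^bsub>E\<^esub>")
    case True
    then show ?thesis using e1 by (intro bexI[of _ \<zero>]) auto
  next
    case False
    obtain r a where r: "r \<in> carrier R" "a \<in> carrier R" "r \<odot>\<^bsub>E\<^esub> e = a \<odot>\<^bsub>E\<^esub> e1" "r \<odot>\<^bsub>E\<^esub> e \<noteq> \<zero>\<^bsub>E\<^esub>"
      using meets[OF e(1) False] by blast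
    have "r \<notin> I 1"
    proof
      assume "r \<in> I 1"
      then obtain c where "c \<in> carrier R" "r = c \<otimes> x" by (auto simp: I_iff)
      then have "r \<odot>\<^bsub>E\<^esub> e = \<zero>\<^bsub>E\<^esub>" using e by (simp add: E.smult_assoc1)
      then show False using r by simp
    qed
    then have u: "r \<in> Units R" using I_1_unit r(1) by blast
    have "e = (inv r \<otimes> r) \<odot>\<^bsub>E\<^esub> e" using u e by simp
    also have "\<dots> = inv r \<odot>\<^bsub>E\<^esub> (a \<odot>\<^bsub>E\<^esub> e1)" unfolding r(3)[symmetric] using u e r by (simp only: E.smult_assoc1 Units_inv_closed)
    also have "\<dots> = (inv r \<otimes> a) \<odot>\<^bsub>E\<^esub> e1" using u r e1 by (simp add: E.smult_assoc1)
    finally show ?thesis using u r by blast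
  qed
  then show "\<exists>e1\<in>carrier E. e1 \<noteq> \<zero>\<^bsub>E\<^esub> \<and> x \<odot>\<^bsub>E\<^esub> e1 = \<zero>\<^bsub>E\<^esub> \<and>
      (\<forall>e\<in>carrier E. x \<odot>\<^bsub>E\<^esub> e = \<zero>\<^bsub>E\<^esub> \<longrightarrow> (\<exists>r\<in>carrier R. e = r \<odot>\<^bsub>E\<^esub> e1))"
    using e1 xe1 e1nz by blast
qed

lemma completion_module_simps [simp]:
  "carrier (completion_module R m E) = carrier E" "ring.add (completion_module R m E) = ring.add E"
  "ring.zero (completion_module R m E) = ring.zero E"
  by (simp_all add: completion_module_def)

text \<open>The definite description in \<open>completion_module\<close> is legitimate: two
  exponents that annihilate e give the same value, because the later term of a agrees with the
  earlier one modulo the smaller power of x.\<close>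

lemma completion_module_smult:
  assumes mE: "module R E" and a: "coherent a" and e: "e \<in> carrier E" "x [^] (n::nat) \<odot>\<^bsub>E\<^esub> e = \<zero>\<^bsub>E\<^esub>"
  shows "coset_seq a \<odot>\<^bsub>completion_module R m E\<^esub> e = a n \<odot>\<^bsub>E\<^esub> e"
proof -
  interpret E: module R E by (rule mE)
  note ac = coherentD(1)[OF a]
  have ann: "b \<odot>\<^bsub>E\<^esub> e = \<zero>\<^bsub>E\<^esub>" if "x [^] k \<odot>\<^bsub>E\<^esub> e = \<zero>\<^bsub>E\<^esub>" "b \<in> I k" for b k
    using that E.annihilator_mono[OF _ _ e(1)] by (auto simp: I_iff)
  have eq_le: "a k \<odot>\<^bsub>E\<^esub> e = a l \<odot>\<^bsub>E\<^esub> e" if "x [^] k \<odot>\<^bsub>E\<^esub> e = \<zero>\<^bsub>E\<^esub>" "k \<le> l" for k l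
  proof -
    have "a l \<odot>\<^bsub>E\<^esub> e = ((a l \<ominus> a k) \<oplus> a k) \<odot>\<^bsub>E\<^esub> e" using ac by (simp add: a_minus_def a_assoc l_neg)
    also have "\<dots> = a k \<odot>\<^bsub>E\<^esub> e"
      using ann[OF that(1) coherent_le[OF a that(2)]] ac e by (simp add: E.smult_l_distr)
    finally show ?thesis by simp
  qed
  have *: "r \<odot>\<^bsub>E\<^esub> e = a n \<odot>\<^bsub>E\<^esub> e" if k: "\<forall>b\<in>I k. b \<odot>\<^bsub>E\<^esub> e = \<zero>\<^bsub>E\<^esub>" and r: "r \<in> coset_seq a k" for k r
  proof -
    have xk: "x [^] k \<odot>\<^bsub>E\<^esub> e = \<zero>\<^bsub>E\<^esub>" using k by (auto simp: I_def cgenideal_self)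
    obtain h where "h \<in> I k" "r = h \<oplus> a k" using r by (auto simp: coset_seq_def a_r_coset_def')
    then have "r \<odot>\<^bsub>E\<^esub> e = a k \<odot>\<^bsub>E\<^esub> e" using k ac e I_carrier by (simp add: E.smult_l_distr)
    also have "\<dots> = a n \<odot>\<^bsub>E\<^esub> e"
      using eq_le[OF xk] eq_le[OF e(2), symmetric] nat_le_linear by blast
    finally show ?thesis .
  qed
  have "a n \<in> coset_seq a n" using ac I_zero by (auto simp: coset_seq_def a_r_coset_def' intro!: bexI[of _ \<zero>])
  then have ex: "\<exists>k. (\<forall>b\<in>ideal_pow R m k. b \<odot>\<^bsub>E\<^esub> e = \<zero>\<^bsub>E\<^esub>) \<and> (\<exists>r\<in>coset_seq a k. a n \<odot>\<^bsub>E\<^esub> e = r \<odot>\<^bsub>E\<^esub> e)"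
    using ann[OF e(2)] unfolding ideal_pow_m by blast
  have "(THE y. \<exists>n. (\<forall>b\<in>ideal_pow R m n. b \<odot>\<^bsub>E\<^esub> e = \<zero>\<^bsub>E\<^esub>) \<and> (\<exists>r\<in>coset_seq a n. y = r \<odot>\<^bsub>E\<^esub> e)) = a n \<odot>\<^bsub>E\<^esub> e"
  proof (rule the_equality)
    show "\<exists>k. (\<forall>b\<in>ideal_pow R m k. b \<odot>\<^bsub>E\<^esub> e = \<zero>\<^bsub>E\<^esub>) \<and> (\<exists>r\<in>coset_seq a k. a n \<odot>\<^bsub>E\<^esub> e = r \<odot>\<^bsub>E\<^esub> e)"
      by (rule ex)
    fix y assume "\<exists>n. (\<forall>b\<in>ideal_pow R m n. b \<odot>\<^bsub>E\<^esub> e = \<zero>\<^bsub>E\<^esub>) \<and> (\<exists>r\<in>coset_seq a n. y = r \<odot>\<^bsub>E\<^esub> e)"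
    then obtain k r where "\<forall>b\<in>I k. b \<odot>\<^bsub>E\<^esub> e = \<zero>\<^bsub>E\<^esub>" "r \<in> coset_seq a k" "y = r \<odot>\<^bsub>E\<^esub> e"
      unfolding ideal_pow_m by blast
    then show "y = a n \<odot>\<^bsub>E\<^esub> e" using * by simp
  qed
  then show ?thesis by (simp add: completion_module_def)
qed

lemma completion_module_smult_map:
  assumes mE: "module R E" and e: "e \<in> carrier E" "x [^] (n::nat) \<odot>\<^bsub>E\<^esub> e = \<zero>\<^bsub>E\<^esub>" and r: "r \<in> carrier R"
  shows "\<phi> r \<odot>\<^bsub>completion_module R m E\<^esub> e = r \<odot>\<^bsub>E\<^esub> e"
  using completion_module_smult[OF mE coherent_const[OF r] e] by (simp add: completion_map_eq)

lemma module_completion_module: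
  assumes mE: "module R E" and tors: "\<And>e. e \<in> carrier E \<Longrightarrow> \<exists>n::nat. x [^] n \<odot>\<^bsub>E\<^esub> e = \<zero>\<^bsub>E\<^esub>"
  shows "module S (completion_module R m E)"
proof -
  interpret E: module R E by (rule mE)
  let ?E = "completion_module R m E"
  have sm: "coset_seq a \<odot>\<^bsub>?E\<^esub> e = a n \<odot>\<^bsub>E\<^esub> e"
    if "coherent a" "e \<in> carrier E" "x [^] (n::nat) \<odot>\<^bsub>E\<^esub> e = \<zero>\<^bsub>E\<^esub>" for a e n
    using completion_module_smult[OF mE that] .
  have ab: "abelian_group ?E"
  proof (rule abelian_groupI)
    show "\<exists>w\<in>carrier ?E. w \<oplus>\<^bsub>?E\<^esub> v = \<zero>\<^bsub>?E\<^esub>" if "v \<in> carrier ?E" for v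
      using that by (intro bexI[of _ "\<ominus>\<^bsub>E\<^esub> v"]) (auto simp: E.M.l_neg)
  qed (auto simp: E.M.a_ac)
  show ?thesis
  proof (rule moduleI[OF completion_cring ab])
    fix f g e assume f: "f \<in> carrier S" and g: "g \<in> carrier S" and "e \<in> carrier ?E"
    then have e: "e \<in> carrier E" by simp
    then obtain n where n: "x [^] (n::nat) \<odot>\<^bsub>E\<^esub> e = \<zero>\<^bsub>E\<^esub>" using tors by blast
    obtain a where a: "coherent a" "f = coset_seq a" using f by (rule completion_cases)
    obtain b where b: "coherent b" "g = coset_seq b" using g by (rule completion_cases)
    note cl = coherentD(1)[OF a(1), of n] coherentD(1)[OF b(1), of n]
    \<comment> \<open>b n e is killed by the same power of x, so one index n serves both
      applications of the action.\<close>
    have nb: "x [^] n \<odot>\<^bsub>E\<^esub> (b n \<odot>\<^bsub>E\<^esub> e) = \<zero>\<^bsub>E\<^esub>"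
      using E.annihilator_mono[OF cl(2) _ e n] cl e by (simp add: E.smult_assoc1[symmetric] m_comm)
    show "f \<odot>\<^bsub>?E\<^esub> e \<in> carrier ?E" using sm[OF a(1) e n] a cl e by simp
    show "(f \<oplus>\<^bsub>S\<^esub> g) \<odot>\<^bsub>?E\<^esub> e = f \<odot>\<^bsub>?E\<^esub> e \<oplus>\<^bsub>?E\<^esub> g \<odot>\<^bsub>?E\<^esub> e"
      unfolding a(2) b(2) coset_seq_add[OF a(1) b(1)]
      using sm[OF a(1) e n] sm[OF b(1) e n] sm[OF coherent_add[OF a(1) b(1)] e n] cl e
      by (simp add: E.smult_l_distr)
    show "(f \<otimes>\<^bsub>S\<^esub> g) \<odot>\<^bsub>?E\<^esub> e = f \<odot>\<^bsub>?E\<^esub> (g \<odot>\<^bsub>?E\<^esub> e)"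
      unfolding a(2) b(2) coset_seq_mult[OF a(1) b(1)]
      using sm[OF a(1) _ nb] sm[OF b(1) e n] sm[OF coherent_mult[OF a(1) b(1)] e n] cl e
      by (simp add: E.smult_assoc1)
  next
    fix e assume "e \<in> carrier ?E"
    then show "\<one>\<^bsub>S\<^esub> \<odot>\<^bsub>?E\<^esub> e = e" using tors[of e] sm[OF coherent_const[OF one_closed], of e] by (auto simp: coset_seq_one)
  next
    fix f e e' assume f: "f \<in> carrier S" and "e \<in> carrier ?E" "e' \<in> carrier ?E"
    then have e: "e \<in> carrier E" "e' \<in> carrier E" by simp_all
    obtain k l where kl: "x [^] (k::nat) \<odot>\<^bsub>E\<^esub> e = \<zero>\<^bsub>E\<^esub>" "x [^] (l::nat) \<odot>\<^bsub>E\<^esub> e' = \<zero>\<^bsub>E\<^esub>"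
      using tors e by blast
    obtain a where a: "coherent a" "f = coset_seq a" using f by (rule completion_cases)
    \<comment> \<open>The exponent l + k kills e and e', hence also their sum, so a single term of a
      computes all three products.\<close>
    have n: "x [^] (l + k) \<odot>\<^bsub>E\<^esub> e = \<zero>\<^bsub>E\<^esub>" "x [^] (l + k) \<odot>\<^bsub>E\<^esub> e' = \<zero>\<^bsub>E\<^esub>"
      using E.annihilator_mono[OF _ _ e(1) kl(1), of "x [^] l"] E.annihilator_mono[OF _ _ e(2) kl(2), of "x [^] k"]
      by (simp_all add: nat_pow_mult add.commute)
    have n': "x [^] (l + k) \<odot>\<^bsub>E\<^esub> (e \<oplus>\<^bsub>E\<^esub> e') = \<zero>\<^bsub>E\<^esub>" using n e by (simp add: E.smult_r_distr)
    show "f \<odot>\<^bsub>?E\<^esub> (e \<oplus>\<^bsub>?E\<^esub> e') = f \<odot>\<^bsub>?E\<^esub> e \<oplus>\<^bsub>?E\<^esub> f \<odot>\<^bsub>?E\<^esub> e'"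
      unfolding a(2) using sm[OF a(1) e(1) n(1)] sm[OF a(1) e(2) n(2)] sm[OF a(1) _ n'] e coherentD(1)[OF a(1)]
      by (simp add: E.smult_r_distr)
  qed
qed

end

section \<open>Divisible modules with one-dimensional socle\<close>

lemma module_prod_simps [simp]:
  "carrier (module_prod M N) = carrier M \<times> carrier N"
  "(v, w) \<oplus>\<^bsub>module_prod M N\<^esub> (v', w') = (v \<oplus>\<^bsub>M\<^esub> v', w \<oplus>\<^bsub>N\<^esub> w')"
  "r \<odot>\<^bsub>module_prod M N\<^esub> (v, w) = (r \<odot>\<^bsub>M\<^esub> v, r \<odot>\<^bsub>N\<^esub> w)"
  by (simp_all add: module_prod_def)

text \<open>The kernel of x is a vector space over the residue field; t spans it, and it has
  dimension one.\<close>

definition generates_socle :: "('r, 'b) ring_scheme \<Rightarrow> 'r \<Rightarrow> ('r, 'm, 'c) module_scheme \<Rightarrow> 'm \<Rightarrow> bool" where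
  "generates_socle R x M t \<longleftrightarrow> t \<in> carrier M \<and> t \<noteq> \<zero>\<^bsub>M\<^esub> \<and> x \<odot>\<^bsub>M\<^esub> t = \<zero>\<^bsub>M\<^esub> \<and>
     (\<forall>v\<in>carrier M. x \<odot>\<^bsub>M\<^esub> v = \<zero>\<^bsub>M\<^esub> \<longrightarrow> (\<exists>r\<in>carrier R. v = r \<odot>\<^bsub>M\<^esub> t))"

lemma generates_socleD:
  assumes "generates_socle R x M t"
  shows "t \<in> carrier M" "t \<noteq> \<zero>\<^bsub>M\<^esub>" "x \<odot>\<^bsub>M\<^esub> t = \<zero>\<^bsub>M\<^esub>"
    "\<And>v. v \<in> carrier M \<Longrightarrow> x \<odot>\<^bsub>M\<^esub> v = \<zero>\<^bsub>M\<^esub> \<Longrightarrow> \<exists>r\<in>carrier R. v = r \<odot>\<^bsub>M\<^esub> t"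
  using assms by (auto simp: generates_socle_def)

lemma (in abelian_group) minus_eq_zero_iff:
  assumes "v \<in> carrier G" "w \<in> carrier G"
  shows "v \<ominus> w = \<zero> \<longleftrightarrow> v = w"
proof
  assume "v \<ominus> w = \<zero>"
  moreover have "v = (v \<ominus> w) \<oplus> w" using assms by (simp add: a_minus_def a_assoc l_neg)
  ultimately show "v = w" using assms by simp
qed (use assms in \<open>simp add: a_minus_def r_neg\<close>)

lemma (in domain) quotient_field_cancel:
  assumes "r \<in> carrier R" "r \<noteq> \<zero>" "P \<in> carrier K" "Q \<in> carrier K"
    and eq: "r \<odot>\<^bsub>quotient_field_module R\<^esub> P = r \<odot>\<^bsub>quotient_field_module R\<^esub> Q"
  shows "P = Q"
proof -
  obtain a b where P: "a \<in> carrier R" "b \<in> carrier R" "b \<noteq> \<zero>" "P = quot a b"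
    using assms(3) by (rule quotient_field_cases)
  obtain c d where Q: "c \<in> carrier R" "d \<in> carrier R" "d \<noteq> \<zero>" "Q = quot c d"
    using assms(4) by (rule quotient_field_cases)
  have "r \<otimes> (a \<otimes> d) = r \<otimes> (c \<otimes> b)"
    using eq assms(1) unfolding P(4) Q(4) using P(1-3) Q(1-3) by (simp add: quotient_field_smult fraction_eq_iff m_assoc)
  then have "a \<otimes> d = c \<otimes> b" using m_lcancel[OF assms(2,1)] P Q by simp
  then show ?thesis unfolding P(4) Q(4) using P(1-3) Q(1-3) by (simp add: fraction_eq_iff)
qed

context uniformized_domain
begin

text \<open>A scalar that is not a multiple of x is a unit and cannot kill t. So two socle
  generators have the same annihilator, and sending one to the other is well defined and
  injective.\<close>

lemma socle_annihilator_iff: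
  assumes M: "module R M" and t: "t \<in> carrier M" "t \<noteq> \<zero>\<^bsub>M\<^esub>" "x \<odot>\<^bsub>M\<^esub> t = \<zero>\<^bsub>M\<^esub>" and r: "r \<in> carrier R"
  shows "r \<odot>\<^bsub>M\<^esub> t = \<zero>\<^bsub>M\<^esub> \<longleftrightarrow> (\<exists>c\<in>carrier R. r = c \<otimes> x)"
proof
  interpret M: module R M by (rule M)
  assume rt: "r \<odot>\<^bsub>M\<^esub> t = \<zero>\<^bsub>M\<^esub>"
  show "\<exists>c\<in>carrier R. r = c \<otimes> x"
  proof (cases "r = \<zero>")
    case True
    then show ?thesis by (intro bexI[of _ \<zero>]) auto
  next
    case False
    then obtain u k where u: "u \<in> Units R" "r = u \<otimes> x [^] (k::nat)" using unit_power_ex r by blast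
    show ?thesis
    proof (cases k)
      case 0
      then have "t = inv u \<odot>\<^bsub>M\<^esub> (r \<odot>\<^bsub>M\<^esub> t)" using u t by (simp add: M.smult_assoc1[symmetric] Units_closed)
      then show ?thesis using rt t u by simp
    next
      case (Suc l)
      then have "r = (u \<otimes> x [^] l) \<otimes> x" using u by (simp add: m_assoc Units_closed)
      then show ?thesis using u by (intro bexI[of _ "u \<otimes> x [^] l"]) (auto simp: Units_closed)
    qed
  qed
next
  interpret M: module R M by (rule M)
  assume "\<exists>c\<in>carrier R. r = c \<otimes> x"
  then show "r \<odot>\<^bsub>M\<^esub> t = \<zero>\<^bsub>M\<^esub>" using t by (auto simp: M.smult_assoc1)
qed

lemma torsion_power:
  assumes M: "module R M" and v: "v \<in> carrier M" "s \<in> carrier R" "s \<noteq> \<zero>" "s \<odot>\<^bsub>M\<^esub> v = \<zero>\<^bsub>M\<^esub>"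
  shows "\<exists>n::nat. x [^] n \<odot>\<^bsub>M\<^esub> v = \<zero>\<^bsub>M\<^esub>"
proof -
  interpret M: module R M by (rule M)
  obtain u k where u: "u \<in> Units R" "s = u \<otimes> x [^] (k::nat)" using unit_power_ex v by blast
  have "x [^] k \<odot>\<^bsub>M\<^esub> v = (inv u \<otimes> s) \<odot>\<^bsub>M\<^esub> v"
    using u by (simp add: m_assoc[symmetric] Units_closed)
  also have "\<dots> = inv u \<odot>\<^bsub>M\<^esub> (s \<odot>\<^bsub>M\<^esub> v)" using u v by (simp only: M.smult_assoc1 Units_inv_closed)
  also have "\<dots> = \<zero>\<^bsub>M\<^esub>" using u v by simp
  finally show ?thesis by blast
qed

text \<open>R t and R e1 are isomorphic, both having annihilator (x). The resulting map from R t to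
  E extends to M since E is divisible.\<close>

lemma socle_extension:
  assumes M: "module R M" and E: "module R E" and div: "divisible_by E x"
    and t: "generates_socle R x M t" and e1: "generates_socle R x E e1"
  shows "\<exists>e\<in>linear_maps R M E. e t = e1"
proof -
  interpret M: module R M by (rule M)
  interpret E: module R E by (rule E)
  note T = generates_socleD[OF t] and T1 = generates_socleD[OF e1]
  let ?A = "(\<lambda>r. r \<odot>\<^bsub>M\<^esub> t) ` carrier R"
  have "submodule ?A R M"
  proof (rule M.submoduleI)
    show "?A \<subseteq> carrier M" using T(1) by auto
    show "\<zero>\<^bsub>M\<^esub> \<in> ?A" using T(1) by (intro image_eqI[of _ _ \<zero>]) auto
    show "\<ominus>\<^bsub>M\<^esub> a \<in> ?A" if "a \<in> ?A" for a using that T(1) by (auto simp: M.smult_l_minus[symmetric])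
    show "a \<oplus>\<^bsub>M\<^esub> b \<in> ?A" if "a \<in> ?A" "b \<in> ?A" for a b using that T(1) by (auto simp: M.smult_l_distr[symmetric])
    show "s \<odot>\<^bsub>M\<^esub> a \<in> ?A" if "s \<in> carrier R" "a \<in> ?A" for s a using that T(1) by (auto simp: M.smult_assoc1[symmetric])
  qed
  then have A: "module R (M\<lparr>carrier := ?A\<rparr>)" using submodule.submodule_is_module M by blast
  \<comment> \<open>The coefficient is determined modulo x only, and x kills e1, so the choice does
    not matter.\<close>
  define f where "f a = (SOME r. r \<in> carrier R \<and> a = r \<odot>\<^bsub>M\<^esub> t) \<odot>\<^bsub>E\<^esub> e1" for a
  have f: "f (r \<odot>\<^bsub>M\<^esub> t) = r \<odot>\<^bsub>E\<^esub> e1" if r: "r \<in> carrier R" for r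
  proof -
    define s where "s = (SOME s. s \<in> carrier R \<and> r \<odot>\<^bsub>M\<^esub> t = s \<odot>\<^bsub>M\<^esub> t)"
    have s: "s \<in> carrier R \<and> r \<odot>\<^bsub>M\<^esub> t = s \<odot>\<^bsub>M\<^esub> t" unfolding s_def by (rule someI[of _ r]) (use r in simp)
    then have "(s \<ominus> r) \<odot>\<^bsub>M\<^esub> t = \<zero>\<^bsub>M\<^esub>" using r T(1) by (simp add: a_minus_def M.smult_l_distr M.smult_l_minus M.M.r_neg)
    then have "(s \<ominus> r) \<odot>\<^bsub>E\<^esub> e1 = \<zero>\<^bsub>E\<^esub>"
      using socle_annihilator_iff[OF M T(1-3), of "s \<ominus> r"] socle_annihilator_iff[OF E T1(1-3), of "s \<ominus> r"] s r by simp
    then have "s \<odot>\<^bsub>E\<^esub> e1 \<ominus>\<^bsub>E\<^esub> r \<odot>\<^bsub>E\<^esub> e1 = \<zero>\<^bsub>E\<^esub>"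
      using s r T1(1) by (simp add: a_minus_def E.smult_l_distr E.smult_l_minus)
    moreover have "s \<odot>\<^bsub>E\<^esub> e1 = (s \<odot>\<^bsub>E\<^esub> e1 \<ominus>\<^bsub>E\<^esub> r \<odot>\<^bsub>E\<^esub> e1) \<oplus>\<^bsub>E\<^esub> r \<odot>\<^bsub>E\<^esub> e1"
      using s r T1(1) by (simp add: a_minus_def E.M.a_assoc E.M.l_neg)
    ultimately show ?thesis using r T1(1) by (simp add: f_def s_def)
  qed
  have "f \<in> linear_maps R (M\<lparr>carrier := ?A\<rparr>) E"
    using f T(1) T1(1)
    by (intro linear_mapsI)
      (auto simp: M.smult_l_distr[symmetric] E.smult_l_distr M.smult_assoc1[symmetric] E.smult_assoc1)
  moreover have "(\<lambda>a. a) \<in> linear_maps R (M\<lparr>carrier := ?A\<rparr>) M" using T(1) by (intro linear_mapsI) auto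
  ultimately obtain e where e: "e \<in> linear_maps R M E" "\<forall>a\<in>?A. e a = f a"
    using divisible_extension[OF M E A div, of "\<lambda>a. a" f] by (auto simp: inj_on_def)
  have "\<one> \<odot>\<^bsub>M\<^esub> t \<in> ?A" by blast
  then have "e (\<one> \<odot>\<^bsub>M\<^esub> t) = \<one> \<odot>\<^bsub>E\<^esub> e1" using e(2) f[of \<one>] by simp
  then have "e t = e1" using T(1) T1(1) by simp
  then show ?thesis using e(1) by blast
qed

text \<open>Induction on the exponent: x v has a smaller exponent and is killed by e, so it is zero
  and v lies in the socle, where e is injective. With the next lemma, e identifies the torsion of M
  with that of E.\<close>

lemma socle_map_torsion_injective:
  assumes M: "module R M" and E: "module R E"
    and t: "generates_socle R x M t" and e1: "generates_socle R x E e1"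
    and e: "e \<in> linear_maps R M E" "e t = e1"
    and v: "v \<in> carrier M" "x [^] (n::nat) \<odot>\<^bsub>M\<^esub> v = \<zero>\<^bsub>M\<^esub>" "e v = \<zero>\<^bsub>E\<^esub>"
  shows "v = \<zero>\<^bsub>M\<^esub>"
  using v
proof (induction n arbitrary: v)
  interpret M: module R M by (rule M)
  case 0
  then show ?case by simp
next
  interpret M: module R M by (rule M)
  interpret E: module R E by (rule E)
  note T = generates_socleD[OF t] and T1 = generates_socleD[OF e1]
  case (Suc n)
  have "x [^] n \<odot>\<^bsub>M\<^esub> (x \<odot>\<^bsub>M\<^esub> v) = \<zero>\<^bsub>M\<^esub>" using Suc.prems by (simp add: M.smult_assoc1[symmetric])
  moreover have "e (x \<odot>\<^bsub>M\<^esub> v) = \<zero>\<^bsub>E\<^esub>" using Suc.prems linear_maps_smult[OF e(1)] by simp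
  ultimately have "x \<odot>\<^bsub>M\<^esub> v = \<zero>\<^bsub>M\<^esub>" using Suc by simp
  then obtain r where r: "r \<in> carrier R" "v = r \<odot>\<^bsub>M\<^esub> t" using T(4) Suc.prems by blast
  then have "r \<odot>\<^bsub>E\<^esub> e1 = \<zero>\<^bsub>E\<^esub>" using Suc.prems linear_maps_smult[OF e(1) r(1) T(1)] e(2) by simp
  then show ?case
    using socle_annihilator_iff[OF M T(1-3) r(1)] socle_annihilator_iff[OF E T1(1-3) r(1)] r by simp
qed

text \<open>Induction on the exponent: x w has a preimage, which is divided by x in M; the remaining
  error lies in the socle of E and is corrected by a multiple of t.\<close>

lemma socle_map_torsion_surjective:
  assumes M: "module R M" and E: "module R E" and div: "divisible_by M x"
    and t: "generates_socle R x M t" and e1: "generates_socle R x E e1"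
    and e: "e \<in> linear_maps R M E" "e t = e1"
    and w: "w \<in> carrier E" "x [^] (n::nat) \<odot>\<^bsub>E\<^esub> w = \<zero>\<^bsub>E\<^esub>"
  shows "\<exists>v\<in>carrier M. x [^] n \<odot>\<^bsub>M\<^esub> v = \<zero>\<^bsub>M\<^esub> \<and> e v = w"
  using w
proof (induction n arbitrary: w)
  interpret M: module R M by (rule M)
  interpret E: module R E by (rule E)
  case 0
  then show ?case using linear_maps_zero[OF M E e(1)] by (intro bexI[of _ "\<zero>\<^bsub>M\<^esub>"]) auto
next
  interpret M: module R M by (rule M)
  interpret E: module R E by (rule E)
  note T = generates_socleD[OF t] and T1 = generates_socleD[OF e1]
  case (Suc n)
  have "x [^] n \<odot>\<^bsub>E\<^esub> (x \<odot>\<^bsub>E\<^esub> w) = \<zero>\<^bsub>E\<^esub>" using Suc.prems by (simp add: E.smult_assoc1[symmetric])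
  then obtain v where v: "v \<in> carrier M" "x [^] n \<odot>\<^bsub>M\<^esub> v = \<zero>\<^bsub>M\<^esub>" "e v = x \<odot>\<^bsub>E\<^esub> w" using Suc by blast
  obtain v' where v': "v' \<in> carrier M" "x \<odot>\<^bsub>M\<^esub> v' = v" using div v(1) by (auto simp: divisible_by_def)
  have ev': "e v' \<in> carrier E" using linear_maps_closed[OF e(1)] v' by blast
  have "x \<odot>\<^bsub>E\<^esub> (w \<ominus>\<^bsub>E\<^esub> e v') = \<zero>\<^bsub>E\<^esub>"
    using v v' ev' Suc.prems linear_maps_smult[OF e(1) x_closed v'(1)]
    by (simp add: a_minus_def E.smult_r_distr E.smult_r_minus E.M.r_neg)
  then obtain r where r: "r \<in> carrier R" "w \<ominus>\<^bsub>E\<^esub> e v' = r \<odot>\<^bsub>E\<^esub> e1" using T1(4) Suc.prems ev' by blast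
  have "w = (w \<ominus>\<^bsub>E\<^esub> e v') \<oplus>\<^bsub>E\<^esub> e v'" using Suc.prems ev' by (simp add: a_minus_def E.M.a_assoc E.M.l_neg)
  also have "\<dots> = e v' \<oplus>\<^bsub>E\<^esub> r \<odot>\<^bsub>E\<^esub> e t"
    unfolding r(2) e(2) using r(1) ev' T1(1) by (simp add: E.M.a_comm)
  also have "\<dots> = e (v' \<oplus>\<^bsub>M\<^esub> r \<odot>\<^bsub>M\<^esub> t)"
    using r(1) v'(1) T(1) by (simp add: linear_maps_add[OF e(1)] linear_maps_smult[OF e(1)])
  finally have "w = e (v' \<oplus>\<^bsub>M\<^esub> r \<odot>\<^bsub>M\<^esub> t)" .
  moreover have "x [^] Suc n \<odot>\<^bsub>M\<^esub> v' = \<zero>\<^bsub>M\<^esub>" using v v' by (simp add: M.smult_assoc1)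
  moreover have "x [^] Suc n \<odot>\<^bsub>M\<^esub> (r \<odot>\<^bsub>M\<^esub> t) = (x [^] n \<otimes> r) \<odot>\<^bsub>M\<^esub> (x \<odot>\<^bsub>M\<^esub> t)"
  proof -
    have "x [^] Suc n \<otimes> r = (x [^] n \<otimes> r) \<otimes> x" using r by (simp add: m_ac)
    then show ?thesis using r T(1) by (simp only: M.smult_assoc1[symmetric] nat_pow_closed m_closed x_closed)
  qed
  ultimately show ?case using v' r T by (intro bexI[of _ "v' \<oplus>\<^bsub>M\<^esub> r \<odot>\<^bsub>M\<^esub> t"]) (auto simp: M.smult_r_distr)
qed

text \<open>Divisibility of M realises one coordinate at a time: a solution z of b z = a c0 has
  coordinate a/b at c0 and 0 elsewhere.\<close>

lemma coordinates_onto: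
  assumes M: "module R M" and div: "divisible_by M x" and C: "coordinate_system R M C p"
    and "finite F" "F \<subseteq> C" "\<And>c. c \<in> C \<Longrightarrow> v c \<in> carrier K" "\<And>c. c \<in> C - F \<Longrightarrow> v c = \<zero>\<^bsub>K\<^esub>"
  shows "\<exists>y\<in>carrier M. \<forall>c\<in>C. p c y = v c"
  using assms(4-)
proof (induction F arbitrary: v)
  interpret M: module R M by (rule M)
  note D = coordinate_systemD[OF C]
  case empty
  then show ?case using linear_maps_zero[OF M module_quotient_field D(3)] by (intro bexI[of _ "\<zero>\<^bsub>M\<^esub>"]) auto
next
  interpret M: module R M by (rule M)
  interpret Q: module R "quotient_field_module R" by (rule module_quotient_field)
  note D = coordinate_systemD[OF C]
  case (insert c0 F)
  have c0: "c0 \<in> C" "c0 \<in> carrier M" using insert D(1) by auto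
  have "\<exists>y\<in>carrier M. \<forall>c\<in>C. p c y = (v(c0 := \<zero>\<^bsub>K\<^esub>)) c"
    using insert.prems Q.zero_closed by (intro insert.IH) auto
  then obtain y where y: "y \<in> carrier M" "\<And>c. c \<in> C \<Longrightarrow> p c y = (v(c0 := \<zero>\<^bsub>K\<^esub>)) c" by blast
  obtain a b where ab: "a \<in> carrier R" "b \<in> carrier R" "b \<noteq> \<zero>" "v c0 = quot a b"
    using insert.prems(2)[OF c0(1)] by (rule quotient_field_cases)
  have "a \<odot>\<^bsub>M\<^esub> c0 \<in> carrier M" using c0 ab(1) by simp
  then obtain z where z: "z \<in> carrier M" "b \<odot>\<^bsub>M\<^esub> z = a \<odot>\<^bsub>M\<^esub> c0"
    using divisible_by_nonzero[OF M div ab(2,3)] unfolding divisible_by_def by blast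
  have pz: "p c z = (if c = c0 then v c0 else \<zero>\<^bsub>K\<^esub>)" if c: "c \<in> C" for c
  proof -
    have pc: "p c z \<in> carrier K" using linear_maps_closed[OF D(3)[OF c] z(1)] by simp
    have "b \<odot>\<^bsub>quotient_field_module R\<^esub> p c z = a \<odot>\<^bsub>quotient_field_module R\<^esub> p c c0"
      using linear_maps_smult[OF D(3)[OF c]] ab z c0 by metis
    also have "\<dots> = b \<odot>\<^bsub>quotient_field_module R\<^esub> (if c = c0 then v c0 else \<zero>\<^bsub>K\<^esub>)"
    proof (cases "c = c0")
      case True
      then show ?thesis using D(4)[OF c] ab
        by (simp add: fraction_one quotient_field_smult fraction_eq_iff m_comm)
    next
      case False
      then show ?thesis using D(5)[OF c c0(1)] Q.smult_r_null ab by simp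
    qed
    finally show ?thesis using quotient_field_cancel[OF ab(2,3) pc] insert.prems(2)[OF c0(1)] Q.zero_closed by simp
  qed
  have "p c (y \<oplus>\<^bsub>M\<^esub> z) = v c" if c: "c \<in> C" for c
    using linear_maps_add[OF D(3)[OF c] y(1) z(1)] y(2)[OF c] pz[OF c] insert.prems(2) c c0
      Q.M.l_zero Q.M.r_zero by auto
  then show ?case using y z by (intro bexI[of _ "y \<oplus>\<^bsub>M\<^esub> z"]) auto
qed

text \<open>The isomorphism sends v to e v and the coordinates of v, where e takes t to e1. If all
  coordinates vanish, v is torsion, and e is injective on torsion. For surjectivity the coordinates
  are matched first; the component in E is then repaired by a torsion element, which coordinates in
  a torsion-free module do not see.\<close>

theorem divisible_module_structure:
  assumes M: "module R M" and divM: "divisible_by M x" and t: "generates_socle R x M t"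
    and E: "module R E" and divE: "divisible_by E x" and e1: "generates_socle R x E e1"
    and torsE: "\<And>w. w \<in> carrier E \<Longrightarrow> \<exists>n::nat. x [^] n \<odot>\<^bsub>E\<^esub> w = \<zero>\<^bsub>E\<^esub>"
    and C: "coordinate_system R M C p"
  shows "modules_isomorphic R M (module_prod E (direct_power (quotient_field_module R) C))"
proof -
  interpret M: module R M by (rule M)
  interpret E: module R E by (rule E)
  interpret Q: module R "quotient_field_module R" by (rule module_quotient_field)
  note D = coordinate_systemD[OF C]
  let ?P = "module_prod E (direct_power (quotient_field_module R) C)"
  obtain e where e: "e \<in> linear_maps R M E" "e t = e1" using socle_extension[OF M E divE t e1] by blast
  define h where "h v = (e v, \<lambda>c\<in>C. p c v)" for v
  have pcl: "p c v \<in> carrier K" if "c \<in> C" "v \<in> carrier M" for c v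
    using linear_maps_closed[OF D(3)[OF that(1)] that(2)] by simp
  have lin: "h \<in> linear_maps R M ?P"
  proof (rule linear_mapsI)
    fix v assume v: "v \<in> carrier M"
    then show "h v \<in> carrier ?P"
      using linear_maps_closed[OF e(1)] pcl coordinates_finite_support[OF M C v]
      by (auto simp: h_def direct_power_def cong: conj_cong)
    fix w assume w: "w \<in> carrier M"
    show "h (v \<oplus>\<^bsub>M\<^esub> w) = h v \<oplus>\<^bsub>?P\<^esub> h w"
      using v w linear_maps_add[OF e(1)] linear_maps_add[OF D(3)]
      by (auto simp: h_def direct_power_def restrict_def fun_eq_iff)
  next
    fix r v assume "r \<in> carrier R" "v \<in> carrier M"
    then show "h (r \<odot>\<^bsub>M\<^esub> v) = r \<odot>\<^bsub>?P\<^esub> h v"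
      using linear_maps_smult[OF e(1)] linear_maps_smult[OF D(3)]
      by (auto simp: h_def direct_power_def restrict_def fun_eq_iff)
  qed
  have kernel: "z = \<zero>\<^bsub>M\<^esub>" if z: "z \<in> carrier M" "e z = \<zero>\<^bsub>E\<^esub>" "\<And>c. c \<in> C \<Longrightarrow> p c z = \<zero>\<^bsub>K\<^esub>" for z
  proof -
    obtain s where s: "s \<in> carrier R" "s \<noteq> \<zero>" "s \<odot>\<^bsub>M\<^esub> z = \<zero>\<^bsub>M\<^esub>"
      using coordinates_joint_kernel[OF M C z(1,3)] by blast
    obtain n where n: "x [^] (n::nat) \<odot>\<^bsub>M\<^esub> z = \<zero>\<^bsub>M\<^esub>" using torsion_power[OF M z(1) s] by blast
    show ?thesis using socle_map_torsion_injective[OF M E t e1 e z(1) n z(2)] .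
  qed
  have inj: "inj_on h (carrier M)"
  proof (rule inj_onI)
    fix v w assume vw: "v \<in> carrier M" "w \<in> carrier M" "h v = h w"
    have "e v = e w" and pvw: "p c v = p c w" if "c \<in> C" for c
      using vw(3) that by (auto simp: h_def fun_eq_iff restrict_def split: if_splits)
    have "e v = e w" using vw(3) by (simp add: h_def)
    then have "e (v \<ominus>\<^bsub>M\<^esub> w) = \<zero>\<^bsub>E\<^esub>"
      using vw linear_maps_diff[OF M E e(1)] linear_maps_closed[OF e(1)] by (simp add: a_minus_def E.M.r_neg)
    moreover have "p c (v \<ominus>\<^bsub>M\<^esub> w) = \<zero>\<^bsub>K\<^esub>" if "c \<in> C" for c
      using vw linear_maps_diff[OF M module_quotient_field D(3)[OF that]] pvw[OF that] pcl[OF that]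
        Q.M.r_neg[of "p c w"] by (simp add: a_minus_def)
    ultimately have "v \<ominus>\<^bsub>M\<^esub> w = \<zero>\<^bsub>M\<^esub>" using kernel vw by simp
    then show "v = w" using M.M.minus_eq_zero_iff[OF vw(1,2)] by simp
  qed
  have surj: "z \<in> h ` carrier M" if z: "z \<in> carrier ?P" for z
  proof -
    obtain w v where wv: "z = (w, v)" "w \<in> carrier E" "v \<in> C \<rightarrow>\<^sub>E carrier K" "finite {c\<in>C. v c \<noteq> \<zero>\<^bsub>K\<^esub>}"
      using z by (auto simp: direct_power_def)
    have "\<exists>y\<in>carrier M. \<forall>c\<in>C. p c y = v c"
      by (rule coordinates_onto[OF M divM C wv(4)]) (use wv(3) in auto)
    then obtain y where y: "y \<in> carrier M" "\<And>c. c \<in> C \<Longrightarrow> p c y = v c" by blast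
    have ey: "e y \<in> carrier E" using linear_maps_closed[OF e(1) y(1)] .
    obtain n where n: "x [^] (n::nat) \<odot>\<^bsub>E\<^esub> (w \<ominus>\<^bsub>E\<^esub> e y) = \<zero>\<^bsub>E\<^esub>" using torsE ey wv(2) E.M.minus_closed by blast
    obtain y' where y': "y' \<in> carrier M" "x [^] n \<odot>\<^bsub>M\<^esub> y' = \<zero>\<^bsub>M\<^esub>" "e y' = w \<ominus>\<^bsub>E\<^esub> e y"
      using socle_map_torsion_surjective[OF M E divM t e1 e _ n] ey wv(2) by auto
    have "p c y' = \<zero>\<^bsub>K\<^esub>" if c: "c \<in> C" for c
    proof -
      have "x [^] n \<odot>\<^bsub>quotient_field_module R\<^esub> p c y' = \<zero>\<^bsub>K\<^esub>"
        using linear_maps_smult[OF D(3)[OF c] _ y'(1), of "x [^] n"] y'(2)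
          linear_maps_zero[OF M module_quotient_field D(3)[OF c]] by simp
      then show ?thesis using quotient_field_torsion_free x_pow_nonzero pcl[OF c y'(1)] by blast
    qed
    then have "p c (y \<oplus>\<^bsub>M\<^esub> y') = v c" if "c \<in> C" for c
      using linear_maps_add[OF D(3)[OF that] y(1) y'(1)] y(2)[OF that] that pcl[OF that y(1)] Q.M.r_zero by simp
    moreover have "e (y \<oplus>\<^bsub>M\<^esub> y') = w"
      using linear_maps_add[OF e(1) y(1) y'(1)] y' ey wv(2)
      by (simp add: a_minus_def E.M.a_ac E.M.r_neg E.M.r_neg2 E.M.r_neg1)
    ultimately have "h (y \<oplus>\<^bsub>M\<^esub> y') = z" using wv(1,3) by (auto simp: h_def restrict_def fun_eq_iff PiE_def extensional_def)
    then show ?thesis using y y' by (intro image_eqI[of _ _ "y \<oplus>\<^bsub>M\<^esub> y'"]) auto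
  qed
  have "bij_betw h (carrier M) (carrier ?P)"
    unfolding bij_betw_def using inj surj linear_maps_closed[OF lin] by blast
  then show ?thesis unfolding modules_isomorphic_def using lin by blast
qed

section \<open>Countable generation and diagonalisation\<close>

text \<open>\<open>W n\<close> consists of the vectors whose coordinates from n on vanish.
  \<open>p n\<close> embeds W (n + 1) / W n into K, of rank one, so one vector \<open>d n\<close>
  per step generates everything up to purity. The W n exhaust V by \<open>fin\<close>, and W 0 = 0
  by \<open>ker\<close>.\<close>

lemma countable_coordinates_generate:
  fixes p :: "nat \<Rightarrow> 'v \<Rightarrow> ('a \<times> 'a) set"
  assumes V: "module R V" and p: "\<And>n. p n \<in> linear_maps R V (quotient_field_module R)"
    and fin: "\<And>v. v \<in> carrier V \<Longrightarrow> \<exists>N. \<forall>n\<ge>N. p n v = \<zero>\<^bsub>K\<^esub>"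
    and ker: "\<And>v. v \<in> carrier V \<Longrightarrow> (\<And>n. p n v = \<zero>\<^bsub>K\<^esub>) \<Longrightarrow> v = \<zero>\<^bsub>V\<^esub>"
  shows "\<exists>d::nat \<Rightarrow> 'v. range d \<subseteq> carrier V \<and> carrier V \<subseteq> pure_span R V (range d)"
proof -
  interpret V: module R V by (rule V)
  interpret Q: module R "quotient_field_module R" by (rule module_quotient_field)
  define W where "W n = {v \<in> carrier V. \<forall>k\<ge>n. p k v = \<zero>\<^bsub>K\<^esub>}" for n
  \<comment> \<open>The zero vector is a placeholder for steps at which the filtration does not
    grow.\<close>
  define d where "d n = (if \<exists>v\<in>W (Suc n). p n v \<noteq> \<zero>\<^bsub>K\<^esub> then SOME v. v \<in> W (Suc n) \<and> p n v \<noteq> \<zero>\<^bsub>K\<^esub> else \<zero>\<^bsub>V\<^esub>)" for n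
  have d1: "d n \<in> W (Suc n) \<and> p n (d n) \<noteq> \<zero>\<^bsub>K\<^esub>" if "\<exists>v\<in>W (Suc n). p n v \<noteq> \<zero>\<^bsub>K\<^esub>" for n
    using that someI_ex[of "\<lambda>v. v \<in> W (Suc n) \<and> p n v \<noteq> \<zero>\<^bsub>K\<^esub>"] by (auto simp: d_def)
  have dV: "d n \<in> carrier V" for n
    using d1[of n] by (cases "\<exists>v\<in>W (Suc n). p n v \<noteq> \<zero>\<^bsub>K\<^esub>") (auto simp: W_def d_def)
  have "v \<in> pure_span R V (range d)" if "v \<in> W n" for n v
    using that
  proof (induction n arbitrary: v)
    case 0
    then have "v = \<zero>\<^bsub>V\<^esub>" using ker by (auto simp: W_def)
    then show ?case using pure_span.zero by metis
  next
    case (Suc n)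
    show ?case
    proof (cases "p n v = \<zero>\<^bsub>K\<^esub>")
      case True
      have "p k v = \<zero>\<^bsub>K\<^esub>" if "n \<le> k" for k
        using True Suc.prems that by (cases "k = n") (simp_all add: W_def)
      then have "v \<in> W n" using Suc.prems by (simp add: W_def)
      then show ?thesis by (rule Suc.IH)
    next
      case False
      have vV: "v \<in> carrier V" using Suc.prems by (simp add: W_def)
      have d: "d n \<in> W (Suc n)" "p n (d n) \<noteq> \<zero>\<^bsub>K\<^esub>" using d1 False Suc.prems by blast+
      have pcl: "p k w \<in> carrier K" if "w \<in> carrier V" for k w using linear_maps_closed[OF p that] by simp
      obtain r s where rs: "r \<in> carrier R" "r \<noteq> \<zero>" "s \<in> carrier R"
        "r \<odot>\<^bsub>quotient_field_module R\<^esub> p n v = s \<odot>\<^bsub>quotient_field_module R\<^esub> p n (d n)"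
        using quotient_field_common_multiple[OF pcl[OF vV] pcl[OF dV] d(2)] by blast
      have pk: "p k (r \<odot>\<^bsub>V\<^esub> v \<ominus>\<^bsub>V\<^esub> s \<odot>\<^bsub>V\<^esub> d n) = r \<odot>\<^bsub>quotient_field_module R\<^esub> p k v
          \<ominus>\<^bsub>quotient_field_module R\<^esub> s \<odot>\<^bsub>quotient_field_module R\<^esub> p k (d n)" for k
        using linear_maps_diff[OF V module_quotient_field p[of k]] linear_maps_smult[OF p[of k]] rs vV dV by simp
      \<comment> \<open>For k = n the two terms cancel by the choice of r and s; for larger k both
        vanish.\<close>
      have "p k (r \<odot>\<^bsub>V\<^esub> v \<ominus>\<^bsub>V\<^esub> s \<odot>\<^bsub>V\<^esub> d n) = \<zero>\<^bsub>K\<^esub>" if k: "n \<le> k" for k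
      proof (cases "k = n")
        case True
        have "s \<odot>\<^bsub>quotient_field_module R\<^esub> p n (d n) \<in> carrier (quotient_field_module R)"
          using rs pcl[OF dV] by (intro Q.smult_closed) auto
        then show ?thesis unfolding True pk rs(4) using Q.M.r_neg by (simp add: a_minus_def)
      next
        case False
        then have "p k v = \<zero>\<^bsub>K\<^esub>" "p k (d n) = \<zero>\<^bsub>K\<^esub>" using Suc.prems d(1) k by (auto simp: W_def)
        then show ?thesis unfolding pk
          using Q.smult_r_null[OF rs(1)] Q.smult_r_null[OF rs(3)] Q.M.r_neg[OF Q.M.zero_closed] by (simp add: a_minus_def)
      qed
      then have "r \<odot>\<^bsub>V\<^esub> v \<ominus>\<^bsub>V\<^esub> s \<odot>\<^bsub>V\<^esub> d n \<in> W n" using rs vV dV by (simp add: W_def)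
      then have "r \<odot>\<^bsub>V\<^esub> v \<ominus>\<^bsub>V\<^esub> s \<odot>\<^bsub>V\<^esub> d n \<in> pure_span R V (range d)" by (rule Suc.IH)
      then have "(r \<odot>\<^bsub>V\<^esub> v \<ominus>\<^bsub>V\<^esub> s \<odot>\<^bsub>V\<^esub> d n) \<oplus>\<^bsub>V\<^esub> s \<odot>\<^bsub>V\<^esub> d n \<in> pure_span R V (range d)"
        using rs by (intro pure_span.add[of _ R V "range d"] pure_span.smult[of s] pure_span.base[of "d n"]) auto
      then have "r \<odot>\<^bsub>V\<^esub> v \<in> pure_span R V (range d)"
        using rs vV dV by (simp add: a_minus_def V.M.a_assoc V.M.l_neg)
      then show ?thesis using pure_span.div rs vV by metis
    qed
  qed
  moreover have "\<exists>n. v \<in> W n" if "v \<in> carrier V" for v using fin that by (auto simp: W_def)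
  ultimately show ?thesis using dV by (intro exI[of _ d]) blast
qed

lemma infinite_split:
  assumes "infinite A"
  shows "\<exists>A1 A2. A1 \<subseteq> A \<and> A2 \<subseteq> A \<and> infinite A1 \<and> infinite A2 \<and> A1 \<inter> A2 = {}"
proof -
  obtain f :: "nat \<Rightarrow> 'c" where f: "inj f" "range f \<subseteq> A" using infinite_countable_subset[OF assms] by blast
  have "infinite (range (\<lambda>n. f (2 * n)))" "infinite (range (\<lambda>n. f (2 * n + 1)))"
    using f(1) by (auto intro!: range_inj_infinite injI dest!: injD[OF f(1)])
  moreover have "range (\<lambda>n. f (2 * n)) \<inter> range (\<lambda>n. f (2 * n + 1)) = {}"
    using f(1) by (auto dest!: injD[OF f(1)]) presburger
  ultimately show ?thesis using f(2) by (intro exI conjI) auto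
qed

text \<open>Every member of B is missing from A1 or from A2, so every coordinate of z
  vanishes.\<close>

lemma pure_span_disjoint:
  assumes V: "module R V" and tf: "\<And>r v. r \<in> carrier R \<Longrightarrow> r \<noteq> \<zero> \<Longrightarrow> v \<in> carrier V \<Longrightarrow> r \<odot>\<^bsub>V\<^esub> v = \<zero>\<^bsub>V\<^esub> \<Longrightarrow> v = \<zero>\<^bsub>V\<^esub>"
    and B: "coordinate_system R V B q"
    and A: "A1 \<subseteq> B" "A2 \<subseteq> B" "A1 \<inter> A2 = {}" and z: "z \<in> pure_span R V A1" "z \<in> pure_span R V A2"
  shows "z = \<zero>\<^bsub>V\<^esub>"
proof -
  interpret V: module R V by (rule V)
  have zV: "z \<in> carrier V" using z(1) V.pure_span_subset_carrier coordinate_systemD(1)[OF B] A(1) by blast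
  have "q b z = \<zero>\<^bsub>K\<^esub>" if b: "b \<in> B" for b
    using coordinate_vanishes[OF V B b A(1) _ z(1)] coordinate_vanishes[OF V B b A(2) _ z(2)] A(3) by blast
  then show ?thesis using coordinates_joint_kernel[OF V B zV] tf[OF _ _ zV] by blast
qed

text \<open>Splitting \<open>A\<close> into two infinite sets keeps the induction free of dimension counts.\<close>

lemma common_zero_in_span:
  assumes V: "module R V" and tf: "\<And>r v. r \<in> carrier R \<Longrightarrow> r \<noteq> \<zero> \<Longrightarrow> v \<in> carrier V \<Longrightarrow> r \<odot>\<^bsub>V\<^esub> v = \<zero>\<^bsub>V\<^esub> \<Longrightarrow> v = \<zero>\<^bsub>V\<^esub>"
    and B: "coordinate_system R V B q"
    and "finite F" "\<And>i. i \<in> F \<Longrightarrow> f i \<in> linear_maps R V (quotient_field_module R)"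
    and "A \<subseteq> B" "infinite A"
  shows "\<exists>y\<in>pure_span R V A. y \<noteq> \<zero>\<^bsub>V\<^esub> \<and> (\<forall>i\<in>F. f i y = \<zero>\<^bsub>K\<^esub>)"
  using assms(4-)
proof (induction F arbitrary: A)
  interpret V: module R V by (rule V)
  note D = coordinate_systemD[OF B]
  case empty
  then obtain b where b: "b \<in> A" "b \<in> B" by (metis finite.emptyI subsetD ex_in_conv)
  have "b \<noteq> \<zero>\<^bsub>V\<^esub>"
  proof
    assume "b = \<zero>\<^bsub>V\<^esub>"
    then have "q b b = \<zero>\<^bsub>K\<^esub>" using linear_maps_zero[OF V module_quotient_field D(3)[OF b(2)]] by simp
    then show False using D(4)[OF b(2)] by (simp add: fraction_one fraction_eq_zero_iff)
  qed
  then show ?case using b(1) by (intro bexI[of _ b] pure_span.base) auto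
next
  interpret V: module R V by (rule V)
  interpret Q: module R "quotient_field_module R" by (rule module_quotient_field)
  note D = coordinate_systemD[OF B]
  case (insert i F)
  obtain A1 A2 where A: "A1 \<subseteq> A" "A2 \<subseteq> A" "infinite A1" "infinite A2" "A1 \<inter> A2 = {}"
    using infinite_split[OF insert.prems(3)] by blast
  have AV: "A1 \<subseteq> carrier V" "A2 \<subseteq> carrier V" using A(1,2) insert.prems(2) D(1) by auto
  have sub: "pure_span R V A1 \<subseteq> pure_span R V A" "pure_span R V A2 \<subseteq> pure_span R V A"
    using A(1,2) by (auto intro: pure_span_mono[THEN subsetD])
  have "\<exists>y\<in>pure_span R V A1. y \<noteq> \<zero>\<^bsub>V\<^esub> \<and> (\<forall>i\<in>F. f i y = \<zero>\<^bsub>K\<^esub>)" using insert.prems A by (intro insert.IH) auto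
  then obtain y where y: "y \<in> pure_span R V A1" "y \<noteq> \<zero>\<^bsub>V\<^esub>" "\<And>i. i \<in> F \<Longrightarrow> f i y = \<zero>\<^bsub>K\<^esub>" by blast
  have "\<exists>y\<in>pure_span R V A2. y \<noteq> \<zero>\<^bsub>V\<^esub> \<and> (\<forall>i\<in>F. f i y = \<zero>\<^bsub>K\<^esub>)" using insert.prems A by (intro insert.IH) auto
  then obtain z where z: "z \<in> pure_span R V A2" "z \<noteq> \<zero>\<^bsub>V\<^esub>" "\<And>i. i \<in> F \<Longrightarrow> f i z = \<zero>\<^bsub>K\<^esub>" by blast
  have yz: "y \<in> carrier V" "z \<in> carrier V" 
    using y(1) z(1) V.pure_span_subset_carrier[OF AV(1)] V.pure_span_subset_carrier[OF AV(2)] by blast+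
  have fl: "f j \<in> linear_maps R V (quotient_field_module R)" if "j \<in> insert i F" for j using insert.prems(1) that .
  have cl: "f j v \<in> carrier K" if "j \<in> insert i F" "v \<in> carrier V" for j v
    using linear_maps_closed[OF fl[OF that(1)] that(2)] by simp
  show ?case
  proof (cases "f i y = \<zero>\<^bsub>K\<^esub>")
    case True
    then show ?thesis using y sub by auto
  next
    case False
    obtain r s where rs: "r \<in> carrier R" "r \<noteq> \<zero>" "s \<in> carrier R"
      "r \<odot>\<^bsub>quotient_field_module R\<^esub> f i z = s \<odot>\<^bsub>quotient_field_module R\<^esub> f i y"
      using quotient_field_common_multiple[OF cl[OF _ yz(2)] cl[OF _ yz(1)] False] by blast
    \<comment> \<open>All f j with j in F kill both y and z; this combination is killed by f i as
      well. It is nonzero because the pure spans of A1 and A2 meet in 0.\<close>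
    let ?w = "r \<odot>\<^bsub>V\<^esub> z \<ominus>\<^bsub>V\<^esub> s \<odot>\<^bsub>V\<^esub> y"
    have fw: "f j ?w = r \<odot>\<^bsub>quotient_field_module R\<^esub> f j z \<ominus>\<^bsub>quotient_field_module R\<^esub> s \<odot>\<^bsub>quotient_field_module R\<^esub> f j y"
      if "j \<in> insert i F" for j
      using linear_maps_diff[OF V module_quotient_field fl[OF that]] linear_maps_smult[OF fl[OF that]] rs yz by simp
    have "f j ?w = \<zero>\<^bsub>K\<^esub>" if j: "j \<in> insert i F" for j
    proof (cases "j = i")
      case True
      have "s \<odot>\<^bsub>quotient_field_module R\<^esub> f i y \<in> carrier (quotient_field_module R)"
        using rs cl[OF _ yz(1)] by (intro Q.smult_closed) auto
      then show ?thesis unfolding fw[OF j] unfolding True rs(4) using Q.M.r_neg by (simp add: a_minus_def)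
    next
      case False
      then show ?thesis unfolding fw[OF j] using j y(3)[of j] z(3)[of j]
          Q.smult_r_null[OF rs(1)] Q.smult_r_null[OF rs(3)] Q.M.r_neg[OF Q.M.zero_closed] by (simp add: a_minus_def)
    qed
    moreover have "?w \<in> pure_span R V A"
      using insert.prems(2) D(1) rs y(1) z(1) sub by (intro V.pure_span_diff pure_span.smult) auto
    moreover have "?w \<noteq> \<zero>\<^bsub>V\<^esub>"
    proof
      assume "?w = \<zero>\<^bsub>V\<^esub>"
      then have eq: "r \<odot>\<^bsub>V\<^esub> z = s \<odot>\<^bsub>V\<^esub> y" using rs yz V.M.minus_eq_zero_iff by simp
      then have z1: "z \<in> pure_span R V A1" using pure_span.div[OF rs(1,2) yz(2)] pure_span.smult[OF rs(3) y(1)] by simp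
      have "A1 \<subseteq> B" "A2 \<subseteq> B" using A(1,2) insert.prems(2) by auto
      from pure_span_disjoint[OF V tf B this A(5) z1 z(1)] show False using z(2) by simp
    qed
    ultimately show ?thesis by blast
  qed
qed

text \<open>The functional is the sum of the coordinates in B', which makes sense because only
  finitely many of them are nonzero on a given y. The diagonalisation evaluates it at vectors with a
  single relevant coordinate.\<close>

lemma coordinate_sum_functional:
  assumes V: "module R V" and B: "coordinate_system R V B q" and B': "B' \<subseteq> B"
  shows "\<exists>l\<in>linear_maps R V (quotient_field_module R).
    \<forall>y\<in>carrier V. \<forall>b\<in>B'. (\<forall>c\<in>B'. c \<noteq> b \<longrightarrow> q c y = \<zero>\<^bsub>K\<^esub>) \<longrightarrow> l y = q b y"
proof -
  interpret V: module R V by (rule V)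
  interpret Q: module R "quotient_field_module R" by (rule module_quotient_field)
  note D = coordinate_systemD[OF B]
  let ?Q = "quotient_field_module R"
  define supp where "supp y = {b\<in>B'. q b y \<noteq> \<zero>\<^bsub>?Q\<^esub>}" for y
  define sm where "sm y = (\<Oplus>\<^bsub>?Q\<^esub>b\<in>supp y. q b y)" for y
  have fin: "finite (supp y)" if "y \<in> carrier V" for y
  proof (rule finite_subset[OF _ coordinates_finite_support[OF V B that]])
    show "supp y \<subseteq> {c \<in> B. q c y \<noteq> \<zero>\<^bsub>K\<^esub>}" using B' by (auto simp: supp_def)
  qed
  have cl: "q b y \<in> carrier ?Q" if "b \<in> B'" "y \<in> carrier V" for b y
    using linear_maps_closed[OF D(3) that(2)] that(1) B' by blast
  \<comment> \<open>Adding zero terms lets sums with different supports be compared over a common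
    finite set.\<close>
  have sm: "sm y = (\<Oplus>\<^bsub>?Q\<^esub>b\<in>G. q b y)" if "y \<in> carrier V" "finite G" "supp y \<subseteq> G" "G \<subseteq> B'" for y G
    unfolding sm_def using that cl
    by (intro Q.M.add.finprod_mono_neutral_cong_left) (auto simp: supp_def)
  have lin: "sm \<in> linear_maps R V ?Q"
  proof (rule linear_mapsI)
    fix y assume y: "y \<in> carrier V"
    show "sm y \<in> carrier ?Q" unfolding sm_def using cl y by (intro Q.M.finsum_closed) (auto simp: supp_def)
    fix z assume z: "z \<in> carrier V"
    let ?G = "supp y \<union> supp z \<union> supp (y \<oplus>\<^bsub>V\<^esub> z)"
    have G: "finite ?G" "?G \<subseteq> B'" using fin y z by (auto simp: supp_def)
    have "sm (y \<oplus>\<^bsub>V\<^esub> z) = (\<Oplus>\<^bsub>?Q\<^esub>b\<in>?G. q b (y \<oplus>\<^bsub>V\<^esub> z))" using y z G by (intro sm) auto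
    also have "\<dots> = (\<Oplus>\<^bsub>?Q\<^esub>b\<in>?G. q b y \<oplus>\<^bsub>?Q\<^esub> q b z)"
    proof (rule Q.M.finsum_cong')
      show "q b (y \<oplus>\<^bsub>V\<^esub> z) = q b y \<oplus>\<^bsub>?Q\<^esub> q b z" if "b \<in> ?G" for b
        using linear_maps_add[OF D(3) y z, of b] that G(2) B' by blast
      show "(\<lambda>b. q b y \<oplus>\<^bsub>?Q\<^esub> q b z) \<in> ?G \<rightarrow> carrier ?Q"
        using y z G(2) by (intro Pi_I Q.M.a_closed cl) blast+
    qed auto
    also have "\<dots> = (\<Oplus>\<^bsub>?Q\<^esub>b\<in>?G. q b y) \<oplus>\<^bsub>?Q\<^esub> (\<Oplus>\<^bsub>?Q\<^esub>b\<in>?G. q b z)"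
      using cl y z G(2) by (intro Q.M.finsum_addf) blast+
    also have "\<dots> = sm y \<oplus>\<^bsub>?Q\<^esub> sm z" 
    proof -
      have "supp y \<subseteq> ?G" "supp z \<subseteq> ?G" by blast+
      then show ?thesis using sm[OF y G(1) _ G(2)] sm[OF z G(1) _ G(2)] by simp
    qed
    finally show "sm (y \<oplus>\<^bsub>V\<^esub> z) = sm y \<oplus>\<^bsub>?Q\<^esub> sm z" .
  next
    fix r y assume r: "r \<in> carrier R" and y: "y \<in> carrier V"
    let ?G = "supp y \<union> supp (r \<odot>\<^bsub>V\<^esub> y)"
    have G: "finite ?G" "?G \<subseteq> B'" using fin y r by (auto simp: supp_def)
    have "sm (r \<odot>\<^bsub>V\<^esub> y) = (\<Oplus>\<^bsub>?Q\<^esub>b\<in>?G. q b (r \<odot>\<^bsub>V\<^esub> y))" using y r G by (intro sm) auto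
    also have "\<dots> = (\<Oplus>\<^bsub>?Q\<^esub>b\<in>?G. r \<odot>\<^bsub>?Q\<^esub> q b y)"
    proof (rule Q.M.finsum_cong')
      show "q b (r \<odot>\<^bsub>V\<^esub> y) = r \<odot>\<^bsub>?Q\<^esub> q b y" if "b \<in> ?G" for b
        using linear_maps_smult[OF D(3) r y, of b] that G(2) B' by blast
      show "(\<lambda>b. r \<odot>\<^bsub>?Q\<^esub> q b y) \<in> ?G \<rightarrow> carrier ?Q"
        using y r G(2) by (intro Pi_I Q.smult_closed cl) blast+
    qed auto
    also have "\<dots> = r \<odot>\<^bsub>?Q\<^esub> (\<Oplus>\<^bsub>?Q\<^esub>b\<in>?G. q b y)"
      using cl y G r by (intro Q.finsum_smult_ldistr[symmetric]) blast+
    also have "\<dots> = r \<odot>\<^bsub>?Q\<^esub> sm y" using sm[OF y G(1) _ G(2)] by simp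
    finally show "sm (r \<odot>\<^bsub>V\<^esub> y) = r \<odot>\<^bsub>?Q\<^esub> sm y" .
  qed
  moreover have "sm y = q b y" if y: "y \<in> carrier V" and b: "b \<in> B'" and z: "\<forall>c\<in>B'. c \<noteq> b \<longrightarrow> q c y = \<zero>\<^bsub>K\<^esub>" for y b
  proof -
    have "sm y = (\<Oplus>\<^bsub>?Q\<^esub>b\<in>{b}. q b y)" using y b z by (intro sm) (auto simp: supp_def)
    also have "\<dots> = q b y" using Q.M.finsum_insert[of "{}" b "\<lambda>b. q b y"] cl[OF b y]
        Q.M.finsum_empty Q.M.r_zero by (simp del: quotient_field_module_simps)
    finally show ?thesis .
  qed
  ultimately show ?thesis by blast
qed

text \<open>Each finite F \<subseteq> Y gets a block \<open>A F\<close> of B and, in the pure span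
  of the block, a nonzero vector \<open>y F\<close> killed by F, with some coordinate
  \<open>b F\<close> nonzero. The functional l is the sum of the coordinates
  \<open>b F\<close>.\<close>

theorem functional_diagonalisation:
  fixes f :: "'i \<Rightarrow> 'v \<Rightarrow> ('a \<times> 'a) set"
  assumes V: "module R V" and tf: "\<And>r v. r \<in> carrier R \<Longrightarrow> r \<noteq> \<zero> \<Longrightarrow> v \<in> carrier V \<Longrightarrow> r \<odot>\<^bsub>V\<^esub> v = \<zero>\<^bsub>V\<^esub> \<Longrightarrow> v = \<zero>\<^bsub>V\<^esub>"
    and B: "coordinate_system R V B q" and inf: "infinite B"
    and f: "\<And>i. i \<in> Y \<Longrightarrow> f i \<in> linear_maps R V (quotient_field_module R)"
    and Y: "Y \<lesssim> B"
  shows "\<exists>l\<in>linear_maps R V (quotient_field_module R). \<forall>F. finite F \<longrightarrow> F \<subseteq> Y \<longrightarrow>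
    (\<exists>y\<in>carrier V. (\<forall>i\<in>F. f i y = \<zero>\<^bsub>K\<^esub>) \<and> l y \<noteq> \<zero>\<^bsub>K\<^esub>)"
proof -
  interpret V: module R V by (rule V)
  note D = coordinate_systemD[OF B]
  \<comment> \<open>The factor of natural numbers makes each block infinite.\<close>
  have "Fpow Y \<times> (UNIV :: nat set) \<lesssim> Fpow B \<times> B"
  proof (rule times_lepoll_mono)
    obtain g where g: "inj_on g Y" "g ` Y \<subseteq> B" using Y by (auto simp: lepoll_def)
    then show "Fpow Y \<lesssim> Fpow B"
      unfolding lepoll_def by (intro exI[of _ "image g"]) (use g inj_on_image_Fpow[OF g(1)] in \<open>auto simp: Fpow_def\<close>)
    show "(UNIV :: nat set) \<lesssim> B" using inf infinite_le_lepoll by blast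
  qed
  also have "Fpow B \<times> B \<approx> B \<times> B" using eqpoll_Fpow[OF inf] by (intro times_eqpoll_cong) auto
  also have "B \<times> B \<approx> B" using card_of_Times_same_infinite[OF inf] by (simp add: eqpoll_iff_card_of_ordIso)
  finally obtain j where j: "inj_on j (Fpow Y \<times> (UNIV :: nat set))" "j ` (Fpow Y \<times> UNIV) \<subseteq> B"
    unfolding lepoll_def by blast
  define A where "A F = (\<lambda>n::nat. j (F, n)) ` UNIV" for F
  have AB: "A F \<subseteq> B" if "F \<in> Fpow Y" for F using j(2) that by (auto simp: A_def)
  have Ainf: "infinite (A F)" if F: "F \<in> Fpow Y" for F
  proof -
    have "inj (\<lambda>n::nat. j (F, n))" using j(1) F by (auto intro!: injI dest: inj_onD)
    then show ?thesis unfolding A_def by (rule range_inj_infinite)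
  qed
  have Adisj: "A F \<inter> A G = {}" if "F \<in> Fpow Y" "G \<in> Fpow Y" "F \<noteq> G" for F G
    using j(1) that by (auto simp: A_def dest: inj_onD)
  have "\<exists>y b. y \<in> pure_span R V (A F) \<and> (\<forall>i\<in>F. f i y = \<zero>\<^bsub>K\<^esub>) \<and> b \<in> A F \<and> q b y \<noteq> \<zero>\<^bsub>K\<^esub>" if F: "F \<in> Fpow Y" for F
  proof -
    obtain y where y: "y \<in> pure_span R V (A F)" "y \<noteq> \<zero>\<^bsub>V\<^esub>" "\<forall>i\<in>F. f i y = \<zero>\<^bsub>K\<^esub>"
    proof -
      have "\<exists>y\<in>pure_span R V (A F). y \<noteq> \<zero>\<^bsub>V\<^esub> \<and> (\<forall>i\<in>F. f i y = \<zero>\<^bsub>K\<^esub>)"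
        by (rule common_zero_in_span[OF V tf B _ _ AB[OF F] Ainf[OF F]]) (use F f in \<open>auto simp: Fpow_def\<close>)
      then show ?thesis using that by blast
    qed
    have yV: "y \<in> carrier V" using y(1) V.pure_span_subset_carrier AB[OF F] D(1) by blast
    obtain b where b: "b \<in> B" "q b y \<noteq> \<zero>\<^bsub>K\<^esub>" using coordinates_joint_kernel[OF V B yV] tf[OF _ _ yV] y(2) by blast
    then have "b \<in> A F" using coordinate_vanishes[OF V B b(1) AB[OF F] _ y(1)] by blast
    then show ?thesis using y b by blast
  qed
  then obtain y b where yb: "\<And>F. F \<in> Fpow Y \<Longrightarrow> y F \<in> pure_span R V (A F)"
      "\<And>F i. F \<in> Fpow Y \<Longrightarrow> i \<in> F \<Longrightarrow> f i (y F) = \<zero>\<^bsub>K\<^esub>"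
      "\<And>F. F \<in> Fpow Y \<Longrightarrow> b F \<in> A F" "\<And>F. F \<in> Fpow Y \<Longrightarrow> q (b F) (y F) \<noteq> \<zero>\<^bsub>K\<^esub>"
    by metis
  have bB: "b ` Fpow Y \<subseteq> B" using yb(3) AB by blast
  obtain l where l: "l \<in> linear_maps R V (quotient_field_module R)"
    "\<And>y c. y \<in> carrier V \<Longrightarrow> c \<in> b ` Fpow Y \<Longrightarrow> (\<forall>c'\<in>b ` Fpow Y. c' \<noteq> c \<longrightarrow> q c' y = \<zero>\<^bsub>K\<^esub>) \<Longrightarrow> l y = q c y"
    using coordinate_sum_functional[OF V B bB] by blast
  have "\<exists>y\<in>carrier V. (\<forall>i\<in>F. f i y = \<zero>\<^bsub>K\<^esub>) \<and> l y \<noteq> \<zero>\<^bsub>K\<^esub>" if "finite F" "F \<subseteq> Y" for F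
  proof -
    have F: "F \<in> Fpow Y" using that by (simp add: Fpow_def)
    have yV: "y F \<in> carrier V" using yb(1)[OF F] V.pure_span_subset_carrier AB[OF F] D(1) by blast
    \<comment> \<open>Blocks are disjoint, so at y F only the coordinate b F contributes to
      l.\<close>
    have "q (b G) (y F) = \<zero>\<^bsub>K\<^esub>" if G: "G \<in> Fpow Y" "b G \<noteq> b F" for G
    proof (rule coordinate_vanishes[OF V B _ AB[OF F] _ yb(1)[OF F]])
      show "b G \<in> B" using bB G by blast
      show "b G \<notin> A F" using Adisj[OF F G(1)] yb(3)[OF G(1)] G(2) by blast
    qed
    then have "l (y F) = q (b F) (y F)" using F by (intro l(2)[OF yV]) auto
    then show ?thesis using yV yb(2,4) F by (intro bexI[of _ "y F"]) auto
  qed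
  then show ?thesis using l(1) by blast
qed

end

section \<open>The Ext modules of the completion\<close>

text \<open>The divisible kernel is a direct summand, with retraction \<rho>. Then \<kappa> = id -
  \<rho> vanishes on the kernel, so \<kappa> w depends on \<delta> w only, and applying \<kappa> to
  arbitrary preimages of f v gives a linear lift.\<close>

lemma (in uniformized_domain) lift_through_divisible_kernel:
  assumes M: "module R M" and J: "module R J" and J': "module R J'"
    and \<delta>: "\<delta> \<in> linear_maps R J J'"
    and div: "divisible_by (J\<lparr>carrier := {v \<in> carrier J. \<delta> v = \<zero>\<^bsub>J'\<^esub>}\<rparr>) x"
    and f: "f \<in> linear_maps R M J'" and im: "\<And>v. v \<in> carrier M \<Longrightarrow> f v \<in> \<delta> ` carrier J"
  shows "\<exists>g\<in>linear_maps R M J. \<forall>v\<in>carrier M. \<delta> (g v) = f v"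
proof -
  interpret M: module R M by (rule M)
  interpret J: module R J by (rule J)
  interpret J': module R J' by (rule J')
  let ?Z = "{v \<in> carrier J. \<delta> v = \<zero>\<^bsub>J'\<^esub>}"
  have "submodule ?Z R J"
    using linear_maps_zero[OF J J' \<delta>] linear_maps_a_inv[OF J J' \<delta>] linear_maps_add[OF \<delta>] linear_maps_smult[OF \<delta>]
    by (intro J.submoduleI) auto
  then have Z: "module R (J\<lparr>carrier := ?Z\<rparr>)" using submodule.submodule_is_module J by blast
  have "(\<lambda>v. v) \<in> linear_maps R (J\<lparr>carrier := ?Z\<rparr>) J"
       "(\<lambda>v. v) \<in> linear_maps R (J\<lparr>carrier := ?Z\<rparr>) (J\<lparr>carrier := ?Z\<rparr>)"
    by (intro linear_mapsI; auto)+
  then obtain \<rho> where \<rho>: "\<rho> \<in> linear_maps R J (J\<lparr>carrier := ?Z\<rparr>)" "\<And>v. v \<in> ?Z \<Longrightarrow> \<rho> v = v"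
    using divisible_extension[OF J Z Z div, of "\<lambda>v. v" "\<lambda>v. v"] by (auto simp: inj_on_def)
  have \<rho>Z: "\<rho> v \<in> ?Z" if "v \<in> carrier J" for v using linear_maps_closed[OF \<rho>(1) that] by simp
  have \<rho>J: "\<rho> \<in> linear_maps R J J"
    using \<rho>Z linear_maps_add[OF \<rho>(1)] linear_maps_smult[OF \<rho>(1)] by (intro linear_mapsI) auto
  define \<kappa> where "\<kappa> v = v \<ominus>\<^bsub>J\<^esub> \<rho> v" for v
  have \<kappa>: "\<kappa> \<in> linear_maps R J J"
    unfolding \<kappa>_def[abs_def] using linear_maps_pointwise_diff[OF J _ \<rho>J, of "\<lambda>v. v"] by (auto intro: linear_mapsI)
  have \<delta>\<kappa>: "\<delta> (\<kappa> v) = \<delta> v" if "v \<in> carrier J" for v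
    using that \<rho>Z[OF that] linear_maps_diff[OF J J' \<delta>] linear_maps_closed[OF \<delta> that] by (simp add: \<kappa>_def a_minus_def)
  have \<kappa>_cong: "\<kappa> v = \<kappa> w" if vw: "v \<in> carrier J" "w \<in> carrier J" "\<delta> v = \<delta> w" for v w
  proof -
    have "v \<ominus>\<^bsub>J\<^esub> w \<in> ?Z"
      using vw linear_maps_diff[OF J J' \<delta> vw(1,2)] linear_maps_closed[OF \<delta> vw(2)] by (simp add: a_minus_def J'.M.r_neg)
    then have "\<kappa> (v \<ominus>\<^bsub>J\<^esub> w) = \<zero>\<^bsub>J\<^esub>" using \<rho>(2) vw J.M.minus_closed by (simp add: \<kappa>_def J.M.minus_eq_zero_iff)
    then show ?thesis using linear_maps_diff[OF J J \<kappa> vw(1,2)] linear_maps_closed[OF \<kappa>] vw J.M.minus_eq_zero_iff by simp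
  qed
  \<comment> \<open>\<open>inv_into\<close> picks some preimage; by \<open>\<kappa>_cong\<close>
    every other one gives the same value, which yields linearity.\<close>
  define g where "g v = \<kappa> (inv_into (carrier J) \<delta> (f v))" for v
  have sec: "inv_into (carrier J) \<delta> (f v) \<in> carrier J" "\<delta> (inv_into (carrier J) \<delta> (f v)) = f v" if "v \<in> carrier M" for v
    using im[OF that] by (auto intro: inv_into_into f_inv_into_f)
  have g: "g v = \<kappa> w" if "v \<in> carrier M" "w \<in> carrier J" "\<delta> w = f v" for v w
    unfolding g_def using sec[OF that(1)] that by (intro \<kappa>_cong) auto
  have "g \<in> linear_maps R M J"
  proof (rule linear_mapsI)
    fix v assume v: "v \<in> carrier M"
    show "g v \<in> carrier J" unfolding g_def using sec[OF v] linear_maps_closed[OF \<kappa>] by blast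
    fix w assume w: "w \<in> carrier M"
    show "g (v \<oplus>\<^bsub>M\<^esub> w) = g v \<oplus>\<^bsub>J\<^esub> g w"
      unfolding g_def[of v] g_def[of w] using sec[OF v] sec[OF w] v w
      by (simp add: linear_maps_add[OF \<kappa>, symmetric] linear_maps_add[OF \<delta>] linear_maps_add[OF f] g)
  next
    fix r v assume r: "r \<in> carrier R" and v: "v \<in> carrier M"
    show "g (r \<odot>\<^bsub>M\<^esub> v) = r \<odot>\<^bsub>J\<^esub> g v"
      unfolding g_def[of v] using sec[OF v] v r
      by (simp add: linear_maps_smult[OF \<kappa>, symmetric] linear_maps_smult[OF \<delta>] linear_maps_smult[OF f] g)
  qed
  moreover have "\<delta> (g v) = f v" if "v \<in> carrier M" for v unfolding g_def using sec[OF that] \<delta>\<kappa> by simp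
  ultimately show ?thesis by blast
qed

text \<open>The kernel is zero, hence divisible.\<close>

lemma (in uniformized_domain) lift_through_injection:
  assumes M: "module R M" and J: "module R J" and J': "module R J'"
    and \<delta>: "\<delta> \<in> linear_maps R J J'" "inj_on \<delta> (carrier J)"
    and f: "f \<in> linear_maps R M J'" and im: "\<And>v. v \<in> carrier M \<Longrightarrow> f v \<in> \<delta> ` carrier J"
  shows "\<exists>g\<in>linear_maps R M J. \<forall>v\<in>carrier M. \<delta> (g v) = f v"
proof (rule lift_through_divisible_kernel[OF M J J' \<delta>(1) _ f im])
  interpret J: module R J by (rule J)
  have "{v \<in> carrier J. \<delta> v = \<zero>\<^bsub>J'\<^esub>} = {\<zero>\<^bsub>J\<^esub>}"
  proof (intro equalityI subsetI)
    fix v assume v: "v \<in> {v \<in> carrier J. \<delta> v = \<zero>\<^bsub>J'\<^esub>}"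
    then have "\<delta> v = \<delta> \<zero>\<^bsub>J\<^esub>" using linear_maps_zero[OF J J' \<delta>(1)] by simp
    from inj_onD[OF \<delta>(2) this] show "v \<in> {\<zero>\<^bsub>J\<^esub>}" using v by simp
  qed (use linear_maps_zero[OF J J' \<delta>(1)] in simp)
  then show "divisible_by (J\<lparr>carrier := {v \<in> carrier J. \<delta> v = \<zero>\<^bsub>J'\<^esub>}\<rparr>) x" by (simp add: divisible_by_def)
qed

lemma (in module) zero_submodule: "submodule {\<zero>\<^bsub>M\<^esub>} R M"
  by (rule submoduleI) auto

section \<open>Action of the completion on torsion elements\<close>

context dvr_completion
begin

text \<open>The completion acts on the elements annihilated by powers of \<open>x\<close>; \<open>act M y v\<close> is meaningless for
  other \<open>v\<close>.\<close>

definition torsion_part :: "('a, 'm, 'c) module_scheme \<Rightarrow> ('a, 'm, 'c) module_scheme" where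
  "torsion_part M = M\<lparr>carrier := {v \<in> carrier M. \<exists>n::nat. x [^] n \<odot>\<^bsub>M\<^esub> v = \<zero>\<^bsub>M\<^esub>}\<rparr>"

definition act :: "('a, 'm, 'c) module_scheme \<Rightarrow> (nat \<Rightarrow> 'a set) \<Rightarrow> 'm \<Rightarrow> 'm" where
  "act M y v = y \<odot>\<^bsub>completion_module R m (torsion_part M)\<^esub> v"

lemma torsion_part_simps [simp]:
  "v \<in> carrier (torsion_part M) \<longleftrightarrow> v \<in> carrier M \<and> (\<exists>n::nat. x [^] n \<odot>\<^bsub>M\<^esub> v = \<zero>\<^bsub>M\<^esub>)"
  "ring.add (torsion_part M) = ring.add M" "ring.zero (torsion_part M) = ring.zero M"
  "smult (torsion_part M) = smult M"
  by (simp_all add: torsion_part_def)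

lemma module_torsion_part:
  assumes "module R M"
  shows "module R (torsion_part M)"
proof -
  interpret M: module R M by fact
  let ?T = "{v \<in> carrier M. \<exists>n::nat. x [^] n \<odot>\<^bsub>M\<^esub> v = \<zero>\<^bsub>M\<^esub>}"
  have "submodule ?T R M"
  proof (rule M.submoduleI)
    show "\<zero>\<^bsub>M\<^esub> \<in> ?T" by simp
    show "\<ominus>\<^bsub>M\<^esub> v \<in> ?T" if "v \<in> ?T" for v using that by (auto simp: M.smult_r_minus)
    show "r \<odot>\<^bsub>M\<^esub> v \<in> ?T" if r: "r \<in> carrier R" and v: "v \<in> ?T" for r v
    proof -
      obtain n where n: "v \<in> carrier M" "x [^] (n::nat) \<odot>\<^bsub>M\<^esub> v = \<zero>\<^bsub>M\<^esub>" using v by blast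
      have "x [^] n \<odot>\<^bsub>M\<^esub> (r \<odot>\<^bsub>M\<^esub> v) = r \<odot>\<^bsub>M\<^esub> (x [^] n \<odot>\<^bsub>M\<^esub> v)"
        using n(1) r by (simp add: M.smult_assoc1[symmetric] m_comm)
      then show ?thesis using n r by auto
    qed
    show "v \<oplus>\<^bsub>M\<^esub> w \<in> ?T" if vw: "v \<in> ?T" "w \<in> ?T" for v w
    proof -
      obtain n where n: "v \<in> carrier M" "x [^] (n::nat) \<odot>\<^bsub>M\<^esub> v = \<zero>\<^bsub>M\<^esub>" using vw by blast
      obtain k where k: "w \<in> carrier M" "x [^] (k::nat) \<odot>\<^bsub>M\<^esub> w = \<zero>\<^bsub>M\<^esub>" using vw by blast
      have "x [^] (k + n) \<odot>\<^bsub>M\<^esub> v = \<zero>\<^bsub>M\<^esub>"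
        using M.annihilator_mono[OF _ _ n, of "x [^] k"] by (simp add: nat_pow_mult)
      moreover have "x [^] (k + n) \<odot>\<^bsub>M\<^esub> w = \<zero>\<^bsub>M\<^esub>"
        using M.annihilator_mono[OF _ _ k, of "x [^] n"] by (simp add: nat_pow_mult add.commute)
      ultimately have "x [^] (k + n) \<odot>\<^bsub>M\<^esub> (v \<oplus>\<^bsub>M\<^esub> w) = \<zero>\<^bsub>M\<^esub>" using n k by (simp add: M.smult_r_distr)
      then show ?thesis using n k by blast
    qed
  qed auto
  then show ?thesis unfolding torsion_part_def using submodule.submodule_is_module assms by blast
qed

lemma act_module:
  assumes "module R M"
  shows "module S (completion_module R m (torsion_part M))"
  by (rule module_completion_module[OF module_torsion_part[OF assms]]) auto

text \<open>In the last rule r may depend on v. It makes R-submodules of the torsion part, such as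
  kernels of the differentials, stable under S. The rule before it says that v sees a scalar only
  modulo a power of x.\<close>

lemma act_rules:
  assumes M: "module R M" and y: "y \<in> carrier S" and v: "v \<in> carrier (torsion_part M)"
  shows "act M y v \<in> carrier (torsion_part M)"
    "z \<in> carrier S \<Longrightarrow> act M (y \<oplus>\<^bsub>S\<^esub> z) v = act M y v \<oplus>\<^bsub>M\<^esub> act M z v"
    "z \<in> carrier S \<Longrightarrow> act M (y \<otimes>\<^bsub>S\<^esub> z) v = act M y (act M z v)"
    "w \<in> carrier (torsion_part M) \<Longrightarrow> act M y (v \<oplus>\<^bsub>M\<^esub> w) = act M y v \<oplus>\<^bsub>M\<^esub> act M y w"
    "r \<in> carrier R \<Longrightarrow> act M (\<phi> r) v = r \<odot>\<^bsub>M\<^esub> v"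
    "r \<in> carrier R \<Longrightarrow> act M y (r \<odot>\<^bsub>M\<^esub> v) = r \<odot>\<^bsub>M\<^esub> act M y v"
    "x [^] (n::nat) \<odot>\<^bsub>M\<^esub> v = \<zero>\<^bsub>M\<^esub> \<Longrightarrow> act M (\<phi> (x [^] n) \<otimes>\<^bsub>S\<^esub> y) v = \<zero>\<^bsub>M\<^esub>"
    "\<exists>r\<in>carrier R. act M y v = r \<odot>\<^bsub>M\<^esub> v"
proof -
  interpret A: module S "completion_module R m (torsion_part M)" by (rule act_module[OF M])
  have T: "module R (torsion_part M)" by (rule module_torsion_part[OF M])
  interpret T: module R "torsion_part M" by (rule T)
  show cl: "act M y v \<in> carrier (torsion_part M)"
    using A.smult_closed[OF y, of v] v unfolding act_def completion_module_simps by blast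
  show "act M (y \<oplus>\<^bsub>S\<^esub> z) v = act M y v \<oplus>\<^bsub>M\<^esub> act M z v" if "z \<in> carrier S"
    using A.smult_l_distr[OF y that, of v] v unfolding act_def completion_module_simps torsion_part_simps by blast
  have mult: "act M (y \<otimes>\<^bsub>S\<^esub> z) v = act M y (act M z v)" if "y \<in> carrier S" "z \<in> carrier S" for y z
    using A.smult_assoc1[OF that, of v] v unfolding act_def completion_module_simps by blast
  show "act M (y \<otimes>\<^bsub>S\<^esub> z) v = act M y (act M z v)" if "z \<in> carrier S" using mult[OF y that] .
  show "act M y (v \<oplus>\<^bsub>M\<^esub> w) = act M y v \<oplus>\<^bsub>M\<^esub> act M y w" if "w \<in> carrier (torsion_part M)"
    using A.smult_r_distr[OF y, of v w] v that unfolding act_def completion_module_simps torsion_part_simps by blast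
  have \<phi>: "act M (\<phi> r) w = r \<odot>\<^bsub>M\<^esub> w" if "r \<in> carrier R" "w \<in> carrier (torsion_part M)" for r w
    using completion_module_smult_map[OF T that(2) _ that(1)] that(2) by (auto simp: act_def)
  show "act M (\<phi> r) v = r \<odot>\<^bsub>M\<^esub> v" if "r \<in> carrier R" using \<phi>[OF that v] .
  show sm: "act M y (r \<odot>\<^bsub>M\<^esub> v) = r \<odot>\<^bsub>M\<^esub> act M y v" if r: "r \<in> carrier R"
  proof -
    have "act M y (r \<odot>\<^bsub>M\<^esub> v) = act M (y \<otimes>\<^bsub>S\<^esub> \<phi> r) v" using mult[OF y completion_map_closed[OF r]] \<phi>[OF r v] by simp
    also have "\<dots> = act M (\<phi> r \<otimes>\<^bsub>S\<^esub> y) v" using y r by (simp add: S.m_comm)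
    also have "\<dots> = r \<odot>\<^bsub>M\<^esub> act M y v" using mult[OF completion_map_closed[OF r] y] \<phi>[OF r cl] by simp
    finally show ?thesis .
  qed
  show "act M (\<phi> (x [^] n) \<otimes>\<^bsub>S\<^esub> y) v = \<zero>\<^bsub>M\<^esub>" if xn: "x [^] (n::nat) \<odot>\<^bsub>M\<^esub> v = \<zero>\<^bsub>M\<^esub>"
  proof -
    have "act M (\<phi> (x [^] n) \<otimes>\<^bsub>S\<^esub> y) v = act M (y \<otimes>\<^bsub>S\<^esub> \<phi> (x [^] n)) v" using y by (simp add: S.m_comm)
    also have "\<dots> = act M y (\<zero>\<^bsub>M\<^esub>)" using mult[OF y, of "\<phi> (x [^] n)"] \<phi>[OF _ v, of "x [^] n"] xn by simp
    also have "\<dots> = \<zero>\<^bsub>M\<^esub>" using A.smult_r_null[OF y] by (simp add: act_def)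
    finally show ?thesis .
  qed
  obtain n where n: "x [^] (n::nat) \<odot>\<^bsub>torsion_part M\<^esub> v = \<zero>\<^bsub>torsion_part M\<^esub>" using v by auto
  obtain a where a: "coherent a" "y = coset_seq a" using y by (rule completion_cases)
  have "act M y v = a n \<odot>\<^bsub>M\<^esub> v"
    using completion_module_smult[OF T a(1) v n] a(2) by (simp add: act_def)
  then show "\<exists>r\<in>carrier R. act M y v = r \<odot>\<^bsub>M\<^esub> v" using coherentD(1)[OF a(1)] by blast
qed

lemma act_linear:
  assumes M: "module R M" and v: "v \<in> carrier (torsion_part M)"
  shows "(\<lambda>y. act M y v) \<in> linear_maps R SR M"
proof (rule linear_mapsI)
  fix y assume "y \<in> carrier SR"
  then have y: "y \<in> carrier S" by simp
  show "act M y v \<in> carrier M" using act_rules(1)[OF M y v] by simp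
  show "act M (y \<oplus>\<^bsub>SR\<^esub> z) v = act M y v \<oplus>\<^bsub>M\<^esub> act M z v" if "z \<in> carrier SR" for z
    using act_rules(2)[OF M y v] that by simp
  show "act M (r \<odot>\<^bsub>SR\<^esub> y) v = r \<odot>\<^bsub>M\<^esub> act M y v" if r: "r \<in> carrier R" for r
    using act_rules(3)[OF M completion_map_closed[OF r] v y] act_rules(5)[OF M y act_rules(1)[OF M y v] r] by simp
qed

end

section \<open>The Hom complex of an injective resolution of R\<close>

locale completion_ext = dvr_completion +
  fixes \<epsilon> :: "'a \<Rightarrow> 'n" and J :: "nat \<Rightarrow> ('a, 'n) module" and d :: "nat \<Rightarrow> 'n \<Rightarrow> 'n"
  assumes not_complete: "\<not> adically_complete R m"
    and resolution: "injective_resolution R (ring_module R) \<epsilon> J d"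
begin

lemma module_J: "module R (J n)"
  using resolution by (simp add: injective_resolution_def injective_module_def)

sublocale J: module R "J n" for n by (rule module_J)

lemma J_divisible: "divisible_by (J n) x"
  using resolution by (intro injective_module_divisible) (simp add: injective_resolution_def)

lemma d_linear: "d n \<in> linear_maps R (J n) (J (Suc n))"
  using resolution by (simp add: injective_resolution_def)

lemma \<epsilon>_linear: "\<epsilon> \<in> linear_maps R (ring_module R) (J 0)" and \<epsilon>_inj: "inj_on \<epsilon> (carrier R)"
  using resolution by (simp_all add: injective_resolution_def)

text \<open>The cosyzygies of R: by exactness Z 0 is a copy of R, and Z (n + 1) is the image of J n.
  Cocycles of degree n are the maps from S into Z n.\<close>

definition Z :: "nat \<Rightarrow> ('a, 'n) module" where
  "Z n = (J n)\<lparr>carrier := {v \<in> carrier (J n). d n v = \<zero>\<^bsub>J (Suc n)\<^esub>}\<rparr>"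

lemma Z_simps [simp]:
  "v \<in> carrier (Z n) \<longleftrightarrow> v \<in> carrier (J n) \<and> d n v = \<zero>\<^bsub>J (Suc n)\<^esub>"
  "ring.add (Z n) = ring.add (J n)" "ring.zero (Z n) = ring.zero (J n)" "smult (Z n) = smult (J n)"
  by (simp_all add: Z_def)

lemma image_\<epsilon>: "\<epsilon> ` carrier R = carrier (Z 0)"
  using resolution by (simp add: injective_resolution_def Z_def)

lemma image_d: "d n ` carrier (J n) = carrier (Z (Suc n))"
  using resolution by (simp add: injective_resolution_def Z_def)

lemma d_d: "v \<in> carrier (J n) \<Longrightarrow> d (Suc n) (d n v) = \<zero>\<^bsub>J (Suc (Suc n))\<^esub>"
  using image_d[of n] by auto

lemma module_Z: "module R (Z n)"
proof -
  have "submodule {v \<in> carrier (J n). d n v = \<zero>\<^bsub>J (Suc n)\<^esub>} R (J n)"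
    using linear_maps_zero[OF module_J module_J d_linear] linear_maps_a_inv[OF module_J module_J d_linear]
      linear_maps_add[OF d_linear] linear_maps_smult[OF d_linear]
    by (intro J.submoduleI) auto
  then show ?thesis unfolding Z_def using submodule.submodule_is_module module_J by blast
qed

text \<open>An image of the divisible module J n is divisible. This accounts both for the vanishing
  of Ext^i with i \<ge> 2 and for the divisibility of Ext^1.\<close>

lemma Z_divisible: "divisible_by (Z (Suc n)) x"
  unfolding divisible_by_def
proof
  fix v assume "v \<in> carrier (Z (Suc n))"
  then obtain w where w: "w \<in> carrier (J n)" "v = d n w" using image_d by blast
  then obtain w' where w': "w' \<in> carrier (J n)" "x \<odot>\<^bsub>J n\<^esub> w' = w" using J_divisible by (auto simp: divisible_by_def)
  then have "x \<odot>\<^bsub>J (Suc n)\<^esub> d n w' = v" using w linear_maps_smult[OF d_linear x_closed w'(1)] by simp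
  moreover have "d n w' \<in> carrier (Z (Suc n))" using image_d w' by blast
  ultimately show "\<exists>w\<in>carrier (Z (Suc n)). x \<odot>\<^bsub>Z (Suc n)\<^esub> w = v" by auto
qed

lemma Z_linear_iff:
  assumes "module R M"
  shows "f \<in> linear_maps R M (Z n) \<longleftrightarrow> f \<in> linear_maps R M (J n) \<and> (\<forall>v\<in>carrier M. d n (f v) = \<zero>\<^bsub>J (Suc n)\<^esub>)"
  by (auto simp: linear_maps_def Pi_iff)

abbreviation "N \<equiv> ring_module S"
abbreviation "H n \<equiv> hom_module R \<phi> N (J n)"
abbreviation "cocyc n \<equiv> cocycles R \<phi> N J d n"
abbreviation "cobound n \<equiv> coboundaries R \<phi> N J d n"
abbreviation "HC n \<equiv> (H n)\<lparr>carrier := cocyc n\<rparr>"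
abbreviation "Ext n \<equiv> Ext_module R \<phi> N J d n"

lemma module_N: "module S N" by (rule module_ring_module[OF completion_cring])

lemma module_H: "module S (H n)"
  by (rule module_hom_module[OF is_cring completion_map_hom module_N module_J])

sublocale H: module S "H n" for n by (rule module_H)

lemma H_iff: "f \<in> carrier (H n) \<longleftrightarrow> f \<in> linear_maps R SR (J n) \<and> f \<in> extensional (carrier S)"
  by simp

lemma cocyc_iff: "f \<in> cocyc n \<longleftrightarrow> f \<in> linear_maps R SR (Z n) \<and> f \<in> extensional (carrier S)"
  using Z_linear_iff[OF module_SR] by (auto simp: cocycles_def)

lemma cocyc_restrict: "f \<in> linear_maps R SR (Z n) \<Longrightarrow> restrict f (carrier S) \<in> cocyc n"
  using restrict_linear[OF module_SR] by (simp add: cocyc_iff)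

lemma H_restrict: "f \<in> linear_maps R SR (J n) \<Longrightarrow> restrict f (carrier S) \<in> carrier (H n)"
  using restrict_linear[OF module_SR] by (simp add: H_iff)

lemma Z_J: "f \<in> linear_maps R SR (Z n) \<Longrightarrow> f \<in> linear_maps R SR (J n)"
  using Z_linear_iff[OF module_SR] by blast

lemma module_HC: "module S (HC n)"
proof -
  \<comment> \<open>Cocycles are homomorphisms into Z n, so the module axioms come from
    \<open>module_hom_module\<close>.\<close>
  have "HC n = hom_module R \<phi> N (Z n)"
    using cocyc_iff[of _ n] by (auto simp: hom_module_def)
  then show ?thesis using module_hom_module[OF is_cring completion_map_hom module_N module_Z] by simp
qed

sublocale HC: module S "HC n" for n by (rule module_HC)

lemma cobound_Suc: "f \<in> cobound (Suc n) \<longleftrightarrow> (\<exists>g\<in>linear_maps R SR (J n). f = (\<lambda>y\<in>carrier S. d n (g y)))"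
proof
  assume "f \<in> cobound (Suc n)"
  then show "\<exists>g\<in>linear_maps R SR (J n). f = (\<lambda>y\<in>carrier S. d n (g y))" by (auto simp: coboundaries_def)
next
  assume "\<exists>g\<in>linear_maps R SR (J n). f = (\<lambda>y\<in>carrier S. d n (g y))"
  then obtain g where g: "g \<in> linear_maps R SR (J n)" "f = (\<lambda>y\<in>carrier S. d n (g y))" by blast
  have "f = (\<lambda>y\<in>carrier N. d n (restrict g (carrier S) y))" using g(2) by (auto simp: restrict_def fun_eq_iff)
  then have "f \<in> (\<lambda>g. \<lambda>y\<in>carrier N. d n (g y)) ` carrier (H n)" by (rule image_eqI[OF _ H_restrict[OF g(1)]])
  then show "f \<in> cobound (Suc n)" by (simp only: coboundaries_def nat.case)
qed

lemma cobound_Suc_cocyc: "cobound (Suc n) \<subseteq> cocyc (Suc n)"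
proof
  fix f assume "f \<in> cobound (Suc n)"
  then obtain g where g: "g \<in> linear_maps R SR (J n)" "f = (\<lambda>y\<in>carrier S. d n (g y))" by (auto simp: cobound_Suc)
  have "(\<lambda>y. d n (g y)) \<in> linear_maps R SR (Z (Suc n))"
    using linear_maps_compose[OF g(1) d_linear] linear_maps_closed[OF g(1)] d_d
    by (simp add: Z_linear_iff[OF module_SR])
  then show "f \<in> cocyc (Suc n)" unfolding g(2) by (rule cocyc_restrict)
qed

lemma cobound_Suc_submodule: "submodule (cobound (Suc n)) S (HC (Suc n))"
proof (rule HC.submoduleI)
  show "cobound (Suc n) \<subseteq> carrier (HC (Suc n))" using cobound_Suc_cocyc by simp
  have zero: "(\<lambda>y. \<zero>\<^bsub>J n\<^esub>) \<in> linear_maps R SR (J n)" by (intro linear_mapsI) auto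
  have "\<zero>\<^bsub>HC (Suc n)\<^esub> = (\<lambda>y\<in>carrier S. d n \<zero>\<^bsub>J n\<^esub>)"
    using linear_maps_zero[OF module_J module_J d_linear] by simp
  then show "\<zero>\<^bsub>HC (Suc n)\<^esub> \<in> cobound (Suc n)" unfolding cobound_Suc by (rule bexI[OF _ zero])
  show smult: "s \<odot>\<^bsub>HC (Suc n)\<^esub> f \<in> cobound (Suc n)" if s: "s \<in> carrier S" and f: "f \<in> cobound (Suc n)" for s f
  proof -
    obtain g where g: "g \<in> linear_maps R SR (J n)" "f = (\<lambda>y\<in>carrier S. d n (g y))" using f by (auto simp: cobound_Suc)
    have "(\<lambda>y. s \<otimes>\<^bsub>S\<^esub> y) \<in> linear_maps R SR SR"
      using s by (intro linear_mapsI) (auto simp: S.r_distr S.m_ac)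
    from linear_maps_compose[OF this g(1)] have "(\<lambda>y. g (s \<otimes>\<^bsub>S\<^esub> y)) \<in> linear_maps R SR (J n)" .
    moreover have "s \<odot>\<^bsub>HC (Suc n)\<^esub> f = (\<lambda>y\<in>carrier S. d n (g (s \<otimes>\<^bsub>S\<^esub> y)))"
      using s g by (auto simp: restrict_def fun_eq_iff)
    ultimately show ?thesis unfolding cobound_Suc by (intro bexI[of _ "\<lambda>y. g (s \<otimes>\<^bsub>S\<^esub> y)"])
  qed
  show "f \<oplus>\<^bsub>HC (Suc n)\<^esub> f' \<in> cobound (Suc n)" if f: "f \<in> cobound (Suc n)" "f' \<in> cobound (Suc n)" for f f'
  proof -
    obtain g where g: "g \<in> linear_maps R SR (J n)" "f = (\<lambda>y\<in>carrier S. d n (g y))" using f by (auto simp: cobound_Suc)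
    obtain g' where g': "g' \<in> linear_maps R SR (J n)" "f' = (\<lambda>y\<in>carrier S. d n (g' y))" using f by (auto simp: cobound_Suc)
    have "f \<oplus>\<^bsub>HC (Suc n)\<^esub> f' = (\<lambda>y\<in>carrier S. d n (g y \<oplus>\<^bsub>J n\<^esub> g' y))"
      using g g' linear_maps_closed[OF g(1)] linear_maps_closed[OF g'(1)] linear_maps_add[OF d_linear]
      by (auto simp: restrict_def fun_eq_iff)
    then show ?thesis unfolding cobound_Suc by (rule bexI[OF _ linear_maps_pointwise_add[OF module_J g(1) g'(1)]])
  qed
  show "\<ominus>\<^bsub>HC (Suc n)\<^esub> f \<in> cobound (Suc n)" if f: "f \<in> cobound (Suc n)" for f
  proof -
    have "f \<in> carrier (HC (Suc n))" using f cobound_Suc_cocyc[of n] by auto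
    then show ?thesis using smult[OF _ f, of "\<ominus>\<^bsub>S\<^esub> \<one>\<^bsub>S\<^esub>"] HC.minus_as_smult[of f "Suc n"] by simp
  qed
qed

lemma quotient_module_trivial:
  assumes "submodule B S (HC n)" "B = cocyc n"
  shows "carrier (quotient_module (HC n) B) = {B}"
proof -
  have "P = B" if P: "P \<in> carrier (quotient_module (HC n) B)" for P
  proof -
    obtain v where "v \<in> carrier (HC n)" "P = B +>\<^bsub>HC n\<^esub> v" using P by (rule HC.quotient_cases)
    then show ?thesis using HC.quotient_zero_iff[OF assms(1)] assms(2) by simp
  qed
  moreover have "B \<in> carrier (quotient_module (HC n) B)"
    using HC.quotient_closed[OF assms(1), of "\<zero>\<^bsub>HC n\<^esub>"] HC.quotient_zero_iff[OF assms(1), of "\<zero>\<^bsub>HC n\<^esub>"]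
      HC.M.zero_closed[of n] assms(2) by simp
  ultimately show ?thesis by blast
qed

text \<open>Z 0 is isomorphic to R through \<epsilon>, and Hom(S, R) = 0.\<close>

lemma Hom_to_Z0_zero:
  assumes f: "f \<in> linear_maps R SR (Z 0)" and y: "y \<in> carrier S"
  shows "f y = \<zero>\<^bsub>J 0\<^esub>"
proof -
  have R: "module R (ring_module R)" by (rule module_ring_module[OF is_cring])
  have "f v \<in> \<epsilon> ` carrier (ring_module R)" if "v \<in> carrier SR" for v
    using linear_maps_closed[OF f that] image_\<epsilon> by simp
  then obtain g where g: "g \<in> linear_maps R SR (ring_module R)" "\<forall>v\<in>carrier SR. \<epsilon> (g v) = f v"
    using lift_through_injection[OF module_SR R module_J \<epsilon>_linear _ Z_J[OF f]] \<epsilon>_inj by auto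
  have "g y = \<zero>" using completion_dual_zero[OF not_complete g(1) y] .
  then show ?thesis using g(2) y linear_maps_zero[OF R module_J \<epsilon>_linear] by auto
qed

lemma Ext_0: "carrier (Ext 0) = {\<zero>\<^bsub>Ext 0\<^esub>}"
proof -
  have B: "cobound 0 = {\<zero>\<^bsub>HC 0\<^esub>}" by (simp add: coboundaries_def)
  have eq: "cobound 0 = cocyc 0"
  proof
    show "cobound 0 \<subseteq> cocyc 0" unfolding B using HC.M.zero_closed[of 0] by simp
    show "cocyc 0 \<subseteq> cobound 0"
    proof
      fix f assume f: "f \<in> cocyc 0"
      then have "f y = \<zero>\<^bsub>J 0\<^esub>" if "y \<in> carrier S" for y using Hom_to_Z0_zero that by (simp add: cocyc_iff)
      then have "f = \<zero>\<^bsub>HC 0\<^esub>" using f by (auto simp: cocyc_iff fun_eq_iff extensional_def)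
      then show "f \<in> cobound 0" using B by simp
    qed
  qed
  have "submodule (cobound 0) S (HC 0)"
    unfolding B by (rule HC.zero_submodule)
  then show ?thesis using quotient_module_trivial[OF _ eq] by (simp add: Ext_module_def)
qed

text \<open>A cocycle of this degree takes values in the image of d (n + 1), and the kernel Z (n +
  1) of that differential is divisible. So the cocycle lifts to J (n + 1) and is a
  coboundary.\<close>

lemma Ext_ge_2: "carrier (Ext (Suc (Suc n))) = {\<zero>\<^bsub>Ext (Suc (Suc n))\<^esub>}"
proof -
  have "cobound (Suc (Suc n)) = cocyc (Suc (Suc n))"
  proof
    show "cocyc (Suc (Suc n)) \<subseteq> cobound (Suc (Suc n))"
    proof
      fix f assume f: "f \<in> cocyc (Suc (Suc n))"
      then have fl: "f \<in> linear_maps R SR (Z (Suc (Suc n)))" "f \<in> extensional (carrier S)" by (simp_all add: cocyc_iff)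
      have "f y \<in> d (Suc n) ` carrier (J (Suc n))" if "y \<in> carrier SR" for y
        using linear_maps_closed[OF fl(1) that] image_d by simp
      then obtain g where g: "g \<in> linear_maps R SR (J (Suc n))" "\<forall>y\<in>carrier SR. d (Suc n) (g y) = f y"
        using lift_through_divisible_kernel[OF module_SR module_J module_J d_linear Z_divisible[unfolded Z_def] Z_J[OF fl(1)]]
        by auto
      have "f = (\<lambda>y\<in>carrier S. d (Suc n) (g y))"
        using g(2) fl(2) by (auto simp: fun_eq_iff extensional_def)
      then show "f \<in> cobound (Suc (Suc n))" unfolding cobound_Suc using g(1) by blast
    qed
  qed (rule cobound_Suc_cocyc)
  then show ?thesis using quotient_module_trivial[OF cobound_Suc_submodule] by (simp add: Ext_module_def)
qed

end

lemma (in domain) fraction_embedding_linear: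
  "(\<lambda>r. quot r \<one>) \<in> linear_maps R (ring_module R) (quotient_field_module R)"
  by (intro linear_mapsI) (auto simp: quotient_field_smult fraction_add)

lemma (in domain) fraction_embedding_inj: "inj_on (\<lambda>r. quot r \<one>) (carrier R)"
  by (rule inj_onI) (simp add: fraction_eq_iff)

lemma (in abelian_group) add_diff_diff_cancel:
  assumes "c \<in> carrier G" "a \<in> carrier G" "b \<in> carrier G"
  shows "b \<oplus> (a \<ominus> b \<ominus> c) = a \<ominus> c"
proof -
  have "b \<oplus> (a \<ominus> b \<ominus> c) = (a \<ominus> c) \<oplus> (b \<oplus> \<ominus> b)" using assms by (simp add: a_minus_def a_ac)
  then show ?thesis using assms by (simp add: r_neg)
qed

section \<open>Divisibility and socle of Ext^1\<close>

context completion_ext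
begin

abbreviation "QR \<equiv> quotient_field_module R"
abbreviation "E1 \<equiv> Ext (Suc 0)"
abbreviation "Z1_maps \<equiv> linear_maps R SR (Z (Suc 0))"

lemma E1_def: "E1 = quotient_module (HC (Suc 0)) (cobound (Suc 0))"
  by (simp add: Ext_module_def)

lemma module_E1: "module S E1"
  unfolding E1_def by (rule HC.module_quotient_module[OF cobound_Suc_submodule])

text \<open>The restriction is built in because modules of homomorphisms consist of extensional
  functions, while the cocycles below are given by formulas on the whole type.\<close>

definition ext_class :: "((nat \<Rightarrow> 'a set) \<Rightarrow> 'n) \<Rightarrow> ((nat \<Rightarrow> 'a set) \<Rightarrow> 'n) set" where
  "ext_class f = cobound (Suc 0) +>\<^bsub>HC (Suc 0)\<^esub> restrict f (carrier S)"

lemma ext_class_cong: "(\<And>y. y \<in> carrier S \<Longrightarrow> f y = g y) \<Longrightarrow> ext_class f = ext_class g"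
  by (simp add: ext_class_def restrict_def cong: if_cong)

lemma ext_class_closed: "f \<in> Z1_maps \<Longrightarrow> ext_class f \<in> carrier E1"
  unfolding E1_def ext_class_def by (rule HC.quotient_closed[OF cobound_Suc_submodule]) (simp add: cocyc_restrict)

lemma ext_class_cases:
  assumes "P \<in> carrier E1"
  obtains f where "f \<in> Z1_maps" "P = ext_class f"
proof -
  obtain f where f: "f \<in> carrier (HC (Suc 0))" "P = cobound (Suc 0) +>\<^bsub>HC (Suc 0)\<^esub> f"
    using assms unfolding E1_def by (rule HC.quotient_cases)
  then have "f \<in> Z1_maps" "restrict f (carrier S) = f" by (auto simp: cocyc_iff extensional_restrict)
  then show ?thesis using that[of f] f by (simp add: ext_class_def)
qed

lemma ext_class_add:
  assumes "f \<in> Z1_maps" "g \<in> Z1_maps"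
  shows "ext_class f \<oplus>\<^bsub>E1\<^esub> ext_class g = ext_class (\<lambda>y. f y \<oplus>\<^bsub>J (Suc 0)\<^esub> g y)"
proof -
  have "restrict f (carrier S) \<oplus>\<^bsub>HC (Suc 0)\<^esub> restrict g (carrier S) = restrict (\<lambda>y. f y \<oplus>\<^bsub>J (Suc 0)\<^esub> g y) (carrier S)"
    by (auto simp: restrict_def fun_eq_iff)
  then show ?thesis
    using HC.quotient_add[OF cobound_Suc_submodule, of "restrict f (carrier S)" 0 "restrict g (carrier S)"] assms
    by (simp only: ext_class_def E1_def) (simp add: cocyc_restrict)
qed

lemma ext_class_smult:
  assumes "f \<in> Z1_maps" "s \<in> carrier S"
  shows "s \<odot>\<^bsub>E1\<^esub> ext_class f = ext_class (\<lambda>y. f (s \<otimes>\<^bsub>S\<^esub> y))"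
proof -
  have "s \<odot>\<^bsub>HC (Suc 0)\<^esub> restrict f (carrier S) = restrict (\<lambda>y. f (s \<otimes>\<^bsub>S\<^esub> y)) (carrier S)"
    using assms(2) by (auto simp: restrict_def fun_eq_iff)
  then show ?thesis
    using HC.quotient_smult[OF cobound_Suc_submodule, of "restrict f (carrier S)" 0 s] assms
    by (simp only: ext_class_def E1_def) (simp add: cocyc_restrict)
qed

lemma ext_class_zero_iff:
  assumes "f \<in> Z1_maps"
  shows "ext_class f = \<zero>\<^bsub>E1\<^esub> \<longleftrightarrow> (\<exists>g\<in>linear_maps R SR (J 0). \<forall>y\<in>carrier S. f y = d 0 (g y))"
proof -
  have "ext_class f = \<zero>\<^bsub>E1\<^esub> \<longleftrightarrow> restrict f (carrier S) \<in> cobound (Suc 0)"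
    using HC.quotient_zero_iff[OF cobound_Suc_submodule, of "restrict f (carrier S)" 0] cocyc_restrict[OF assms]
    by (simp add: ext_class_def E1_def)
  also have "\<dots> \<longleftrightarrow> (\<exists>g\<in>linear_maps R SR (J 0). \<forall>y\<in>carrier S. f y = d 0 (g y))"
    unfolding cobound_Suc by (rule bex_cong) (auto simp: restrict_def fun_eq_iff split: if_splits)
  finally show ?thesis .
qed

lemma scale_linear: "s \<in> carrier S \<Longrightarrow> (\<lambda>y. s \<otimes>\<^bsub>S\<^esub> y) \<in> linear_maps R SR SR"
  by (intro linear_mapsI) (auto simp: S.r_distr S.m_ac)

lemma precompose_scale: "f \<in> linear_maps R SR M \<Longrightarrow> s \<in> carrier S \<Longrightarrow> (\<lambda>y. f (s \<otimes>\<^bsub>S\<^esub> y)) \<in> linear_maps R SR M"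
  using linear_maps_compose[OF scale_linear] by blast

text \<open>Multiplication by x embeds S into itself, and f extends along this embedding. As x acts
  on Hom(S, M) by precomposition, this divides f by x.\<close>

lemma extend_along_x:
  assumes M: "module R M" and div: "divisible_by M x" and f: "f \<in> linear_maps R SR M"
  shows "\<exists>g\<in>linear_maps R SR M. \<forall>y\<in>carrier S. g (\<phi> x \<otimes>\<^bsub>S\<^esub> y) = f y"
proof -
  have "inj_on (\<lambda>y. \<phi> x \<otimes>\<^bsub>S\<^esub> y) (carrier SR)"
    by (rule inj_onI) (simp add: S.m_lcancel[OF S.x_nonzero])
  then show ?thesis
    using divisible_extension[OF module_SR M module_SR div scale_linear[OF S.x_closed] _ f] by simp
qed

lemma E1_divisible: "divisible_by E1 (\<phi> x)"
  unfolding divisible_by_def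
proof
  fix P assume "P \<in> carrier E1"
  then obtain f where f: "f \<in> Z1_maps" "P = ext_class f" by (rule ext_class_cases)
  obtain g where g: "g \<in> Z1_maps" "\<forall>y\<in>carrier S. g (\<phi> x \<otimes>\<^bsub>S\<^esub> y) = f y"
    using extend_along_x[OF module_Z Z_divisible f(1)] by blast
  have "\<phi> x \<odot>\<^bsub>E1\<^esub> ext_class g = ext_class f" unfolding ext_class_smult[OF g(1) S.x_closed] using g(2) by (intro ext_class_cong) blast
  then show "\<exists>w\<in>carrier E1. \<phi> x \<odot>\<^bsub>E1\<^esub> w = P" using f g ext_class_closed by blast
qed

text \<open>\<open>u\<close> embeds \<open>K\<close> into \<open>J\<^sup>0\<close> over \<open>\<epsilon>\<close>, and \<open>\<theta>\<close> is the resulting embedding of \<open>K/R\<close> into \<open>J\<^sup>1\<close>. The map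
  \<open>\<tau>\<close> is \<open>y \<mapsto> y/x\<close> modulo \<open>R\<close>.\<close>

definition u :: "('a \<times> 'a) set \<Rightarrow> 'n" where
  "u = (SOME h. h \<in> linear_maps R QR (J 0) \<and> (\<forall>r\<in>carrier R. h (quot r \<one>) = \<epsilon> r))"

lemma u_linear: "u \<in> linear_maps R QR (J 0)" and u_embed: "r \<in> carrier R \<Longrightarrow> u (quot r \<one>) = \<epsilon> r"
proof -
  have "\<exists>h\<in>linear_maps R QR (J 0). \<forall>r\<in>carrier (ring_module R). h (quot r \<one>) = \<epsilon> r"
    using divisible_extension[OF module_quotient_field module_J module_ring_module[OF is_cring] J_divisible
      fraction_embedding_linear _ \<epsilon>_linear] fraction_embedding_inj by simp
  then have "\<exists>h. h \<in> linear_maps R QR (J 0) \<and> (\<forall>r\<in>carrier R. h (quot r \<one>) = \<epsilon> r)" by auto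
  from someI_ex[OF this] show "u \<in> linear_maps R QR (J 0)" "r \<in> carrier R \<Longrightarrow> u (quot r \<one>) = \<epsilon> r"
    unfolding u_def by blast+
qed

lemma \<epsilon>_zero: "\<epsilon> \<zero> = \<zero>\<^bsub>J 0\<^esub>"
  using linear_maps_zero[OF module_ring_module[OF is_cring] module_J \<epsilon>_linear] by simp

sublocale QR: module R QR by (rule module_quotient_field)

lemma u_zero: assumes P: "P \<in> carrier K" "u P = \<zero>\<^bsub>J 0\<^esub>" shows "P = \<zero>\<^bsub>K\<^esub>"
proof -
  obtain a b where ab: "a \<in> carrier R" "b \<in> carrier R" "b \<noteq> \<zero>" "P = quot a b" using P(1) by (rule quotient_field_cases)
  have "b \<odot>\<^bsub>QR\<^esub> P = quot a \<one>" using ab by (simp add: quotient_field_smult fraction_eq_iff m_comm)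
  then have "\<epsilon> a = b \<odot>\<^bsub>J 0\<^esub> u P" using u_embed[OF ab(1)] linear_maps_smult[OF u_linear ab(2), of P] P(1) by simp
  then have "\<epsilon> a = \<epsilon> \<zero>" using P ab \<epsilon>_zero by simp
  then have "a = \<zero>" using \<epsilon>_inj ab by (auto dest: inj_onD)
  then show ?thesis using ab by (simp add: fraction_eq_zero_iff)
qed

lemma u_inj: "inj_on u (carrier K)"
proof (rule inj_onI)
  fix P Q assume PQ: "P \<in> carrier K" "Q \<in> carrier K" "u P = u Q"
  then have c: "P \<in> carrier QR" "Q \<in> carrier QR" by simp_all
  have "u (P \<ominus>\<^bsub>QR\<^esub> Q) = \<zero>\<^bsub>J 0\<^esub>"
    using linear_maps_diff[OF module_quotient_field module_J u_linear c] PQ(3) linear_maps_closed[OF u_linear c(2)]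
    by (simp add: a_minus_def J.M.r_neg)
  then have "P \<ominus>\<^bsub>QR\<^esub> Q = \<zero>\<^bsub>QR\<^esub>" using u_zero QR.M.minus_closed[OF c] by simp
  then show "P = Q" using QR.M.minus_eq_zero_iff[OF c] by simp
qed

definition \<theta> :: "('a \<times> 'a) set \<Rightarrow> 'n" where "\<theta> P = d 0 (u P)"

lemma \<theta>_linear: "\<theta> \<in> linear_maps R QR (J (Suc 0))"
  unfolding \<theta>_def[abs_def] by (rule linear_maps_compose[OF u_linear d_linear])

lemma \<theta>_embed: "r \<in> carrier R \<Longrightarrow> \<theta> (quot r \<one>) = \<zero>\<^bsub>J (Suc 0)\<^esub>"
  using image_\<epsilon> by (auto simp: \<theta>_def u_embed)

lemma \<theta>_Z: "P \<in> carrier K \<Longrightarrow> d (Suc 0) (\<theta> P) = \<zero>\<^bsub>J (Suc (Suc 0))\<^esub>"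
  using d_d linear_maps_closed[OF u_linear] by (simp add: \<theta>_def)

text \<open>The unit part of a denominator moves to the numerator, which leaves a power of
  x.\<close>

lemma x_power_denominator:
  assumes "P \<in> carrier K"
  shows "\<exists>n::nat. \<exists>r\<in>carrier R. x [^] n \<odot>\<^bsub>QR\<^esub> P = quot r \<one>"
proof -
  obtain a b where ab: "a \<in> carrier R" "b \<in> carrier R" "b \<noteq> \<zero>" "P = quot a b" using assms by (rule quotient_field_cases)
  obtain v n where v: "v \<in> Units R" "b = v \<otimes> x [^] (n::nat)" using unit_power_ex ab by blast
  have "b \<otimes> inv v = (v \<otimes> inv v) \<otimes> x [^] n" unfolding v(2)
    using Units_closed[OF v(1)] Units_inv_closed[OF v(1)] nat_pow_closed[OF x_closed, of n] by (simp only: m_ac m_closed)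
  then have "b \<otimes> inv v = x [^] n" using v(1) by simp
  then have "x [^] n \<odot>\<^bsub>QR\<^esub> P = quot (a \<otimes> inv v) \<one>"
    using ab v(1) by (simp add: quotient_field_smult fraction_eq_iff m_ac)
  then show ?thesis using ab v by blast
qed

text \<open>A power of x carries P into R, and \<theta> kills R. This is the torsion of K/R, which
  lets S act on the image of \<theta>.\<close>

lemma \<theta>_torsion: "P \<in> carrier K \<Longrightarrow> \<theta> P \<in> carrier (torsion_part (J (Suc 0)))"
proof -
  assume P: "P \<in> carrier K"
  obtain n r where "r \<in> carrier R" "x [^] (n::nat) \<odot>\<^bsub>QR\<^esub> P = quot r \<one>" using x_power_denominator[OF P] by blast
  then have "x [^] n \<odot>\<^bsub>J (Suc 0)\<^esub> \<theta> P = \<zero>\<^bsub>J (Suc 0)\<^esub>"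
    using linear_maps_smult[OF \<theta>_linear, of "x [^] n" P] \<theta>_embed P by simp
  then show ?thesis using linear_maps_closed[OF \<theta>_linear] P by auto
qed

text \<open>On the single element v, y acts like an element of R, and d n commutes with
  those.\<close>

lemma act_Z:
  assumes "y \<in> carrier S" "v \<in> carrier (torsion_part (J n))" "d n v = \<zero>\<^bsub>J (Suc n)\<^esub>"
  shows "d n (act (J n) y v) = \<zero>\<^bsub>J (Suc n)\<^esub>"
proof -
  obtain r where "r \<in> carrier R" "act (J n) y v = r \<odot>\<^bsub>J n\<^esub> v" using act_rules(8)[OF module_J assms(1,2)] by blast
  then show ?thesis using linear_maps_smult[OF d_linear] assms by simp
qed

abbreviation "xinv \<equiv> quot \<one> x"

definition \<tau> :: "(nat \<Rightarrow> 'a set) \<Rightarrow> 'n" where "\<tau> y = act (J (Suc 0)) y (\<theta> xinv)"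

lemma xinv_closed: "xinv \<in> carrier K" using x_nonzero by simp

lemma x_xinv: "x \<odot>\<^bsub>QR\<^esub> xinv = quot \<one> \<one>"
  using x_nonzero by (simp add: quotient_field_smult fraction_eq_iff)

lemma x_\<theta>_xinv: "x \<odot>\<^bsub>J (Suc 0)\<^esub> \<theta> xinv = \<zero>\<^bsub>J (Suc 0)\<^esub>"
  using linear_maps_smult[OF \<theta>_linear x_closed, of xinv] xinv_closed x_xinv \<theta>_embed[of \<one>] by simp

lemma \<tau>_linear: "\<tau> \<in> Z1_maps"
  unfolding Z_linear_iff[OF module_SR] \<tau>_def[abs_def]
  using act_linear[OF module_J \<theta>_torsion[OF xinv_closed]] act_Z[OF _ \<theta>_torsion[OF xinv_closed] \<theta>_Z[OF xinv_closed]]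
  by simp

lemma residue_decomposition:
  assumes "y \<in> carrier S"
  shows "\<exists>r\<in>carrier R. \<exists>z\<in>carrier S. y = \<phi> r \<oplus>\<^bsub>S\<^esub> \<phi> x \<otimes>\<^bsub>S\<^esub> z"
  using completion_dense[OF assms, of 1] by simp

text \<open>An element killed by x sees only the residue class of a scalar.\<close>

lemma act_residue:
  assumes v: "v \<in> carrier (J n)" "x \<odot>\<^bsub>J n\<^esub> v = \<zero>\<^bsub>J n\<^esub>" and r: "r \<in> carrier R" "z \<in> carrier S"
  shows "act (J n) (\<phi> r \<oplus>\<^bsub>S\<^esub> \<phi> x \<otimes>\<^bsub>S\<^esub> z) v = r \<odot>\<^bsub>J n\<^esub> v" "v \<in> carrier (torsion_part (J n))"
proof -
  have x1: "x [^] (1::nat) \<odot>\<^bsub>J n\<^esub> v = \<zero>\<^bsub>J n\<^esub>" using v by simp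
  then show t: "v \<in> carrier (torsion_part (J n))" using v unfolding torsion_part_simps by blast
  have "act (J n) (\<phi> (x [^] (1::nat)) \<otimes>\<^bsub>S\<^esub> z) v = \<zero>\<^bsub>J n\<^esub>" by (rule act_rules(7)[OF module_J r(2) t x1])
  then show "act (J n) (\<phi> r \<oplus>\<^bsub>S\<^esub> \<phi> x \<otimes>\<^bsub>S\<^esub> z) v = r \<odot>\<^bsub>J n\<^esub> v"
    using act_rules(2)[OF module_J completion_map_closed[OF r(1)] t, of "\<phi> x \<otimes>\<^bsub>S\<^esub> z"] act_rules(5)[OF module_J r(2) t r(1)] r v by simp
qed

text \<open>If \<tau> were g followed by d 0, then x g would map S into Z 0, hence be zero. So w = g
  1 satisfies x w = 0, while u (1/x) - w lies in Z 0 and equals some \<epsilon> r. Multiplying by x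
  gives x r = 1.\<close>

lemma \<tau>_nonzero: "ext_class \<tau> \<noteq> \<zero>\<^bsub>E1\<^esub>"
proof
  assume "ext_class \<tau> = \<zero>\<^bsub>E1\<^esub>"
  then obtain g where g: "g \<in> linear_maps R SR (J 0)" "\<And>y. y \<in> carrier S \<Longrightarrow> \<tau> y = d 0 (g y)"
    using ext_class_zero_iff[OF \<tau>_linear] by auto
  have gc: "g y \<in> carrier (J 0)" if "y \<in> carrier S" for y using linear_maps_closed[OF g(1)] that by simp
  have xg: "(\<lambda>y. x \<odot>\<^bsub>J 0\<^esub> g y) \<in> linear_maps R SR (Z 0)"
    unfolding Z_linear_iff[OF module_SR]
  proof (intro conjI ballI linear_maps_pointwise_smult[OF module_J g(1) x_closed])
    fix y assume "y \<in> carrier SR"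
    then have y: "y \<in> carrier S" by simp
    have "d 0 (x \<odot>\<^bsub>J 0\<^esub> g y) = x \<odot>\<^bsub>J (Suc 0)\<^esub> \<tau> y" using linear_maps_smult[OF d_linear x_closed gc[OF y]] g(2)[OF y] by simp
    also have "\<dots> = act (J (Suc 0)) y (x \<odot>\<^bsub>J (Suc 0)\<^esub> \<theta> xinv)"
      using act_rules(6)[OF module_J y \<theta>_torsion[OF xinv_closed] x_closed] by (simp add: \<tau>_def)
    also have "\<dots> = \<zero>\<^bsub>J (Suc 0)\<^esub>"
      unfolding x_\<theta>_xinv using module.smult_r_null[OF act_module[OF module_J] y] by (simp add: act_def)
    finally show "d 0 (x \<odot>\<^bsub>J 0\<^esub> g y) = \<zero>\<^bsub>J (Suc 0)\<^esub>" .
  qed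
  define w where "w = g \<one>\<^bsub>S\<^esub>"
  have w: "w \<in> carrier (J 0)" "x \<odot>\<^bsub>J 0\<^esub> w = \<zero>\<^bsub>J 0\<^esub>"
    using Hom_to_Z0_zero[OF xg S.one_closed] gc[OF S.one_closed] by (simp_all add: w_def)
  have ux: "u xinv \<in> carrier (J 0)" using linear_maps_closed[OF u_linear] xinv_closed by simp
  have \<tau>1: "\<tau> \<one>\<^bsub>S\<^esub> = \<theta> xinv"
    using act_rules(5)[OF module_J S.one_closed \<theta>_torsion[OF xinv_closed] one_closed] linear_maps_closed[OF \<theta>_linear] xinv_closed
    by (simp add: \<tau>_def completion_map_simps)
  have "d 0 (u xinv \<ominus>\<^bsub>J 0\<^esub> w) = \<zero>\<^bsub>J (Suc 0)\<^esub>"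
    using linear_maps_diff[OF module_J module_J d_linear ux w(1)] \<tau>1 g(2)[OF S.one_closed] linear_maps_closed[OF d_linear w(1)]
    by (simp add: \<theta>_def w_def a_minus_def J.M.r_neg)
  then have "u xinv \<ominus>\<^bsub>J 0\<^esub> w \<in> carrier (Z 0)" using ux w by simp
  then obtain r where r: "r \<in> carrier R" "u xinv \<ominus>\<^bsub>J 0\<^esub> w = \<epsilon> r" using image_\<epsilon> by blast
  have "\<epsilon> (x \<otimes> r) = x \<odot>\<^bsub>J 0\<^esub> (u xinv \<ominus>\<^bsub>J 0\<^esub> w)" using linear_maps_smult[OF \<epsilon>_linear x_closed] r by simp
  also have "\<dots> = x \<odot>\<^bsub>J 0\<^esub> u xinv" using ux w by (simp add: a_minus_def J.smult_r_distr J.smult_r_minus)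
  also have "\<dots> = \<epsilon> \<one>" using linear_maps_smult[OF u_linear x_closed, of xinv] xinv_closed x_xinv u_embed by simp
  finally have "x \<otimes> r = \<one>" using \<epsilon>_inj r by (auto dest: inj_onD)
  then have "x \<in> Units R" using r m_comm[of x r] unfolding Units_def by auto
  then show False using x_not_unit by simp
qed

text \<open>If x kills the class of f, then f can be changed by a coboundary so that it vanishes on
  x S. It is then determined by its value v at 1, which x kills. Writing v = d 0 w gives x w =
  \<epsilon> r, and f becomes r \<tau> plus the coboundary that comes from w - r u (1/x).\<close>

lemma E1_socle: "generates_socle S (\<phi> x) E1 (ext_class \<tau>)"
  unfolding generates_socle_def
proof (intro conjI ballI impI)
  interpret E1: module S E1 by (rule module_E1)
  show "ext_class \<tau> \<in> carrier E1" by (rule ext_class_closed[OF \<tau>_linear])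
  show "ext_class \<tau> \<noteq> \<zero>\<^bsub>E1\<^esub>" by (rule \<tau>_nonzero)
  have "\<tau> (\<phi> x \<otimes>\<^bsub>S\<^esub> y) = \<zero>\<^bsub>J (Suc 0)\<^esub>" if "y \<in> carrier S" for y
    using linear_maps_smult[OF \<tau>_linear x_closed, of y] that
      act_rules(6)[OF module_J that \<theta>_torsion[OF xinv_closed] x_closed, symmetric]
      module.smult_r_null[OF act_module[OF module_J] that] by (simp add: x_\<theta>_xinv \<tau>_def act_def)
  then show "\<phi> x \<odot>\<^bsub>E1\<^esub> ext_class \<tau> = \<zero>\<^bsub>E1\<^esub>"
    unfolding ext_class_smult[OF \<tau>_linear S.x_closed] ext_class_zero_iff[OF precompose_scale[OF \<tau>_linear S.x_closed]]
    using linear_maps_zero[OF module_J module_J d_linear[of 0]]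
    by (intro bexI[of _ "\<lambda>y. \<zero>\<^bsub>J 0\<^esub>"] linear_mapsI) auto
  fix P assume "P \<in> carrier E1" and xP: "\<phi> x \<odot>\<^bsub>E1\<^esub> P = \<zero>\<^bsub>E1\<^esub>"
  then obtain f where f: "f \<in> Z1_maps" "P = ext_class f" by (elim ext_class_cases)
  obtain g where g: "g \<in> linear_maps R SR (J 0)" "\<And>y. y \<in> carrier S \<Longrightarrow> f (\<phi> x \<otimes>\<^bsub>S\<^esub> y) = d 0 (g y)"
    using xP unfolding f(2) ext_class_smult[OF f(1) S.x_closed] ext_class_zero_iff[OF precompose_scale[OF f(1) S.x_closed]] by auto
  obtain g' where g': "g' \<in> linear_maps R SR (J 0)" "\<And>y. y \<in> carrier S \<Longrightarrow> g' (\<phi> x \<otimes>\<^bsub>S\<^esub> y) = g y"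
    using extend_along_x[OF module_J J_divisible g(1)] by auto
  \<comment> \<open>Since g' is g divided by x, subtracting its coboundary makes the cocycle vanish
    on x S.\<close>
  define f' where "f' y = f y \<ominus>\<^bsub>J (Suc 0)\<^esub> d 0 (g' y)" for y
  note fJ = Z_J[OF f(1)] and dg' = linear_maps_compose[OF g'(1) d_linear]
  have f'l: "f' \<in> linear_maps R SR (J (Suc 0))"
    unfolding f'_def[abs_def] by (rule linear_maps_pointwise_diff[OF module_J fJ dg'])
  have fc: "f y \<in> carrier (J (Suc 0))" "d 0 (g' y) \<in> carrier (J (Suc 0))" "g' y \<in> carrier (J 0)" if "y \<in> carrier S" for y
    using linear_maps_closed[OF fJ] linear_maps_closed[OF dg'] linear_maps_closed[OF g'(1)] that by simp_all
  have f'x: "f' (\<phi> x \<otimes>\<^bsub>S\<^esub> y) = \<zero>\<^bsub>J (Suc 0)\<^esub>" if "y \<in> carrier S" for y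
    using g(2)[OF that] g'(2)[OF that] fc[of "\<phi> x \<otimes>\<^bsub>S\<^esub> y"] that by (simp add: f'_def a_minus_def J.M.r_neg)
  define v where "v = f' \<one>\<^bsub>S\<^esub>"
  have vZ: "v \<in> carrier (Z (Suc 0))"
    using linear_maps_closed[OF f(1), of "\<one>\<^bsub>S\<^esub>"] fc[OF S.one_closed] d_d[OF fc(3)[OF S.one_closed]]
      linear_maps_diff[OF module_J module_J d_linear fc(1,2)[OF S.one_closed]]
    by (simp add: v_def f'_def a_minus_def J.M.a_inv_zero)
  have f'r: "f' (\<phi> r \<oplus>\<^bsub>S\<^esub> \<phi> x \<otimes>\<^bsub>S\<^esub> z) = r \<odot>\<^bsub>J (Suc 0)\<^esub> v" if "r \<in> carrier R" "z \<in> carrier S" for r z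
    using linear_maps_add[OF f'l, of "\<phi> r" "\<phi> x \<otimes>\<^bsub>S\<^esub> z"] linear_maps_smult[OF f'l that(1), of "\<one>\<^bsub>S\<^esub>"] f'x[OF that(2)] that vZ
    by (simp add: v_def)
  have xv: "x \<odot>\<^bsub>J (Suc 0)\<^esub> v = \<zero>\<^bsub>J (Suc 0)\<^esub>"
    using linear_maps_smult[OF f'l x_closed, of "\<one>\<^bsub>S\<^esub>"] f'x[OF S.one_closed] by (simp add: v_def)
  obtain w where w: "w \<in> carrier (J 0)" "v = d 0 w" using vZ image_d[of 0] by blast
  have "d 0 (x \<odot>\<^bsub>J 0\<^esub> w) = \<zero>\<^bsub>J (Suc 0)\<^esub>" using linear_maps_smult[OF d_linear x_closed w(1)] xv w by simp
  then have "x \<odot>\<^bsub>J 0\<^esub> w \<in> carrier (Z 0)" using w by simp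
  then obtain r where r: "r \<in> carrier R" "x \<odot>\<^bsub>J 0\<^esub> w = \<epsilon> r" using image_\<epsilon> by blast
  have ux: "u xinv \<in> carrier (J 0)" using linear_maps_closed[OF u_linear] xinv_closed by simp
  have xux: "x \<odot>\<^bsub>J 0\<^esub> u xinv = \<epsilon> \<one>" using linear_maps_smult[OF u_linear x_closed, of xinv] xinv_closed x_xinv u_embed by simp
  \<comment> \<open>Subtracting the element r/x of K from w leaves something killed by x, on which S
    therefore acts.\<close>
  define w1 where "w1 = w \<ominus>\<^bsub>J 0\<^esub> r \<odot>\<^bsub>J 0\<^esub> u xinv"
  have w1: "w1 \<in> carrier (J 0)" using w ux r by (simp add: w1_def)
  have "x \<odot>\<^bsub>J 0\<^esub> (r \<odot>\<^bsub>J 0\<^esub> u xinv) = r \<odot>\<^bsub>J 0\<^esub> \<epsilon> \<one>"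
    unfolding xux[symmetric] using r ux by (simp add: J.smult_assoc1[symmetric] m_comm)
  also have "\<dots> = \<epsilon> r" using linear_maps_smult[OF \<epsilon>_linear r(1), of \<one>] r by simp
  finally have xw1: "x \<odot>\<^bsub>J 0\<^esub> w1 = \<zero>\<^bsub>J 0\<^esub>"
    using w ux r linear_maps_closed[OF \<epsilon>_linear] by (simp add: w1_def a_minus_def J.smult_r_distr J.smult_r_minus J.M.r_neg)
  have dw1: "d 0 w1 = v \<ominus>\<^bsub>J (Suc 0)\<^esub> r \<odot>\<^bsub>J (Suc 0)\<^esub> \<theta> xinv"
    using linear_maps_diff[OF module_J module_J d_linear w(1), of "r \<odot>\<^bsub>J 0\<^esub> u xinv"] linear_maps_smult[OF d_linear r(1) ux] w ux r
    by (simp add: w1_def \<theta>_def)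
  have \<theta>x: "\<theta> xinv \<in> carrier (J (Suc 0))" using linear_maps_closed[OF \<theta>_linear] xinv_closed by simp
  \<comment> \<open>\<kappa> is the R-linear map on S with value w1 at 1; it factors through S/xS,
    as \<open>f'\<close> does.\<close>
  define \<kappa> where "\<kappa> y = act (J 0) y w1" for y
  have w1t: "w1 \<in> carrier (torsion_part (J 0))" using act_residue(2)[OF w1 xw1 one_closed S.one_closed] .
  have \<kappa>: "\<kappa> \<in> linear_maps R SR (J 0)" unfolding \<kappa>_def[abs_def] by (rule act_linear[OF module_J w1t])
  \<comment> \<open>\<tau>, \<kappa> and \<open>f'\<close> depend only on the residue s of y, so the
    claim is s times the relation \<open>dw1\<close>.\<close>
  have eq: "f y \<ominus>\<^bsub>J (Suc 0)\<^esub> r \<odot>\<^bsub>J (Suc 0)\<^esub> \<tau> y = d 0 (g' y \<oplus>\<^bsub>J 0\<^esub> \<kappa> y)" if y: "y \<in> carrier S" for y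
  proof -
    obtain s z where s: "s \<in> carrier R" "z \<in> carrier S" "y = \<phi> s \<oplus>\<^bsub>S\<^esub> \<phi> x \<otimes>\<^bsub>S\<^esub> z" using residue_decomposition[OF y] by blast
    have \<tau>y: "\<tau> y = s \<odot>\<^bsub>J (Suc 0)\<^esub> \<theta> xinv" unfolding \<tau>_def s(3) using act_residue(1)[OF \<theta>x x_\<theta>_xinv s(1,2)] .
    have \<kappa>y: "\<kappa> y = s \<odot>\<^bsub>J 0\<^esub> w1" unfolding \<kappa>_def s(3) using act_residue(1)[OF w1 xw1 s(1,2)] .
    have f'y: "f' y = s \<odot>\<^bsub>J (Suc 0)\<^esub> v" unfolding s(3) using f'r[OF s(1,2)] .
    have "d 0 (g' y \<oplus>\<^bsub>J 0\<^esub> \<kappa> y) = d 0 (g' y) \<oplus>\<^bsub>J (Suc 0)\<^esub> s \<odot>\<^bsub>J (Suc 0)\<^esub> d 0 w1"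
      unfolding \<kappa>y using fc[OF y] w1 s(1) linear_maps_add[OF d_linear] linear_maps_smult[OF d_linear] by simp
    also have "\<dots> = d 0 (g' y) \<oplus>\<^bsub>J (Suc 0)\<^esub> (s \<odot>\<^bsub>J (Suc 0)\<^esub> v \<ominus>\<^bsub>J (Suc 0)\<^esub> r \<odot>\<^bsub>J (Suc 0)\<^esub> \<tau> y)"
    proof -
      have "s \<odot>\<^bsub>J (Suc 0)\<^esub> (r \<odot>\<^bsub>J (Suc 0)\<^esub> \<theta> xinv) = r \<odot>\<^bsub>J (Suc 0)\<^esub> (s \<odot>\<^bsub>J (Suc 0)\<^esub> \<theta> xinv)"
        using s r \<theta>x by (simp add: J.smult_assoc1[symmetric] m_comm)
      then show ?thesis unfolding dw1 \<tau>y using s r \<theta>x vZ by (simp add: a_minus_def J.smult_r_distr J.smult_r_minus)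
    qed
    also have "\<dots> = d 0 (g' y) \<oplus>\<^bsub>J (Suc 0)\<^esub> (f y \<ominus>\<^bsub>J (Suc 0)\<^esub> d 0 (g' y) \<ominus>\<^bsub>J (Suc 0)\<^esub> r \<odot>\<^bsub>J (Suc 0)\<^esub> \<tau> y)"
      unfolding f'y[symmetric] f'_def ..
    also have "\<dots> = f y \<ominus>\<^bsub>J (Suc 0)\<^esub> r \<odot>\<^bsub>J (Suc 0)\<^esub> \<tau> y"
    proof -
      have "r \<odot>\<^bsub>J (Suc 0)\<^esub> \<tau> y \<in> carrier (J (Suc 0))" unfolding \<tau>y using s(1) r(1) \<theta>x by simp
      then show ?thesis using fc(1,2)[OF y] by (rule J.M.add_diff_diff_cancel)
    qed
    finally show ?thesis by simp
  qed
  have r\<tau>: "(\<lambda>y. \<tau> (\<phi> r \<otimes>\<^bsub>S\<^esub> y)) \<in> Z1_maps" by (rule precompose_scale[OF \<tau>_linear completion_map_closed[OF r(1)]])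
  have \<tau>r: "\<tau> (\<phi> r \<otimes>\<^bsub>S\<^esub> y) = r \<odot>\<^bsub>J (Suc 0)\<^esub> \<tau> y" if "y \<in> carrier S" for y
    using linear_maps_smult[OF \<tau>_linear r(1), of y] that by simp
  define h where "h y = f y \<ominus>\<^bsub>J (Suc 0)\<^esub> \<tau> (\<phi> r \<otimes>\<^bsub>S\<^esub> y)" for y
  have hl: "h \<in> Z1_maps"
    unfolding Z_linear_iff[OF module_SR] h_def[abs_def]
  proof (intro conjI ballI linear_maps_pointwise_diff[OF module_J fJ Z_J[OF r\<tau>]])
    fix y assume "y \<in> carrier SR"
    then have "f y \<in> carrier (Z (Suc 0))" "\<tau> (\<phi> r \<otimes>\<^bsub>S\<^esub> y) \<in> carrier (Z (Suc 0))"
      using linear_maps_closed[OF f(1)] linear_maps_closed[OF r\<tau>] by blast+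
    then show "d (Suc 0) (f y \<ominus>\<^bsub>J (Suc 0)\<^esub> \<tau> (\<phi> r \<otimes>\<^bsub>S\<^esub> y)) = \<zero>\<^bsub>J (Suc (Suc 0))\<^esub>"
      using linear_maps_diff[OF module_J module_J d_linear] by (simp add: a_minus_def)
  qed
  have "ext_class h = \<zero>\<^bsub>E1\<^esub>"
    unfolding ext_class_zero_iff[OF hl] using eq \<tau>r by (intro bexI[OF _ linear_maps_pointwise_add[OF module_J g'(1) \<kappa>]]) (simp add: h_def)
  moreover have "ext_class f = ext_class h \<oplus>\<^bsub>E1\<^esub> ext_class (\<lambda>y. \<tau> (\<phi> r \<otimes>\<^bsub>S\<^esub> y))"
    unfolding ext_class_add[OF hl r\<tau>]
  proof (rule ext_class_cong)
    fix y assume y: "y \<in> carrier S"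
    have "\<tau> (\<phi> r \<otimes>\<^bsub>S\<^esub> y) \<in> carrier (J (Suc 0))" using linear_maps_closed[OF Z_J[OF r\<tau>]] y by simp
    then show "f y = h y \<oplus>\<^bsub>J (Suc 0)\<^esub> \<tau> (\<phi> r \<otimes>\<^bsub>S\<^esub> y)" using fc[OF y] by (simp add: h_def a_minus_def J.M.a_assoc J.M.l_neg)
  qed
  ultimately have "P = \<phi> r \<odot>\<^bsub>E1\<^esub> ext_class \<tau>"
    using f(2) ext_class_smult[OF \<tau>_linear completion_map_closed[OF r(1)]] ext_class_closed[OF r\<tau>] E1.M.l_zero by simp
  then show "\<exists>s\<in>carrier S. P = s \<odot>\<^bsub>E1\<^esub> ext_class \<tau>" using r by blast
qed

end

section \<open>The quotient field of the completion over K\<close>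

context dvr_completion
begin

lemma SR_torsion_free:
  "\<lbrakk>r \<in> carrier R; r \<noteq> \<zero>; y \<in> carrier SR; r \<odot>\<^bsub>SR\<^esub> y = \<zero>\<^bsub>SR\<^esub>\<rbrakk> \<Longrightarrow> y = \<zero>\<^bsub>SR\<^esub>"
  using completion_map_inject[of r] S.integral_iff[of "\<phi> r" y] by auto

lemma fraction_lift_quot:
  assumes "a \<in> carrier R" "b \<in> carrier R" "b \<noteq> \<zero>"
  shows "fraction_lift S \<phi> (quot a b) = fraction S (\<phi> a) (\<phi> b)"
proof -
  have nz: "\<phi> c \<noteq> \<zero>\<^bsub>S\<^esub>" if "c \<in> carrier R" "c \<noteq> \<zero>" for c using that completion_map_inject by blast
  have "fraction S (\<phi> a') (\<phi> b') = fraction S (\<phi> a) (\<phi> b)" if ab: "(a', b') \<in> quot a b" for a' b'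
  proof -
    have *: "a' \<in> carrier R" "b' \<in> carrier R" "b' \<noteq> \<zero>" "a \<otimes> b' = a' \<otimes> b"
      using ab fraction_mem_iff[OF assms] by auto
    then have "\<phi> a' \<otimes>\<^bsub>S\<^esub> \<phi> b = \<phi> a \<otimes>\<^bsub>S\<^esub> \<phi> b'" using assms by (simp add: completion_map_simps[symmetric])
    then show ?thesis using * assms nz by (simp add: S.fraction_eq_iff)
  qed
  then have "(\<Union>(a', b')\<in>quot a b. fraction S (\<phi> a') (\<phi> b')) = (\<Union>z\<in>quot a b. fraction S (\<phi> a) (\<phi> b))"
    by (intro SUP_cong) auto
  moreover have "(a, b) \<in> quot a b" using assms by (simp add: fraction_mem_iff)
  ultimately show ?thesis unfolding fraction_lift_def by auto
qed

lemma fraction_lift_hom: "fraction_lift S \<phi> \<in> ring_hom K (quotient_field S)"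
proof -
  have nz: "\<phi> c \<noteq> \<zero>\<^bsub>S\<^esub>" if "c \<in> carrier R" "c \<noteq> \<zero>" for c using that completion_map_inject by blast
  show ?thesis
  proof (rule ring_hom_memI)
    fix P assume "P \<in> carrier K"
    then obtain a b where P: "a \<in> carrier R" "b \<in> carrier R" "b \<noteq> \<zero>" "P = quot a b" by (rule quotient_field_cases)
    then show "fraction_lift S \<phi> P \<in> carrier (quotient_field S)" using nz by (simp add: fraction_lift_quot)
    fix Q assume "Q \<in> carrier K"
    then obtain c e where Q: "c \<in> carrier R" "e \<in> carrier R" "e \<noteq> \<zero>" "Q = quot c e" by (rule quotient_field_cases)
    show "fraction_lift S \<phi> (P \<otimes>\<^bsub>K\<^esub> Q) = fraction_lift S \<phi> P \<otimes>\<^bsub>quotient_field S\<^esub> fraction_lift S \<phi> Q"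
      unfolding P(4) Q(4) using P(1-3) Q(1-3) nz
      by (simp add: fraction_mult fraction_lift_quot S.fraction_mult integral_iff completion_map_simps)
    show "fraction_lift S \<phi> (P \<oplus>\<^bsub>K\<^esub> Q) = fraction_lift S \<phi> P \<oplus>\<^bsub>quotient_field S\<^esub> fraction_lift S \<phi> Q"
      unfolding P(4) Q(4) using P(1-3) Q(1-3) nz
      by (simp add: fraction_add fraction_lift_quot S.fraction_add integral_iff completion_map_simps)
  next
    show "fraction_lift S \<phi> \<one>\<^bsub>K\<^esub> = \<one>\<^bsub>quotient_field S\<^esub>"
      by (simp add: fraction_one fraction_lift_quot S.fraction_one completion_map_simps)
  qed
qed

text \<open>A finite B would span Q(S) over the image of K. The K-span of B contains S because it
  allows division by nonzero elements of R; and every fraction y/z can be rewritten with a power of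
  x, an element of K, as denominator.\<close>

lemma completion_basis_infinite:
  assumes degree: "infinite_degree R \<phi> S" and B: "coordinate_system R SR B q"
  shows "infinite B"
proof
  assume fin: "finite B"
  interpret KS: field "quotient_field S" by (rule S.quotient_field_field)
  interpret K: field K by (rule quotient_field_field)
  interpret SRm: module R SR by (rule module_SR)
  let ?KS = "quotient_field S" and ?L = "fraction_lift S \<phi>"
  interpret L: ring_hom_ring K ?KS ?L
    by (rule ring_hom_ringI2[OF K.ring_axioms KS.ring_axioms fraction_lift_hom])
  let ?F = "?L ` carrier K"
  have sub: "subfield ?F ?KS" using L.img_is_subfield(2)[OF K.carrier_is_subfield] by simp
  have BS: "B \<subseteq> carrier S" using coordinate_systemD(1)[OF B] by simp
  obtain bs where bs: "set bs = B" using finite_list[OF fin] by blast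
  define us where "us = map (\<lambda>b. fraction S b \<one>\<^bsub>S\<^esub>) bs"
  have us: "set us \<subseteq> carrier ?KS" using bs BS by (auto simp: us_def)
  let ?E = "KS.Span ?F us"
  note Span = KS.Span_subgroup_props[OF sub us] KS.Span_smult_closed[OF sub us]
  have nz: "\<phi> c \<noteq> \<zero>\<^bsub>S\<^esub>" if "c \<in> carrier R" "c \<noteq> \<zero>" for c using that completion_map_inject by blast
  define T where "T = {y \<in> carrier S. fraction S y \<one>\<^bsub>S\<^esub> \<in> ?E}"
  have "pure_span R SR B \<subseteq> T"
  proof (rule pure_span_least)
    show "B \<subseteq> T" using KS.Span_base_incl[OF sub us] bs BS by (auto simp: T_def us_def)
    show "\<zero>\<^bsub>SR\<^esub> \<in> T" using Span(2) S.fraction_zero by (simp add: T_def)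
    show "v \<oplus>\<^bsub>SR\<^esub> w \<in> T" if "v \<in> T" "w \<in> T" for v w
      using that Span(3)[of "fraction S v \<one>\<^bsub>S\<^esub>" "fraction S w \<one>\<^bsub>S\<^esub>"] by (simp add: T_def S.fraction_add)
    show "r \<odot>\<^bsub>SR\<^esub> v \<in> T" if r: "r \<in> carrier R" and v: "v \<in> T" for r v
    proof -
      have "?L (quot r \<one>) \<otimes>\<^bsub>?KS\<^esub> fraction S v \<one>\<^bsub>S\<^esub> \<in> ?E" using r v by (intro Span(5) imageI) (auto simp: T_def)
      then show ?thesis using r v by (simp add: T_def fraction_lift_quot S.fraction_mult completion_map_simps)
    qed
    show "v \<in> T" if r: "r \<in> carrier R" "r \<noteq> \<zero>" and v: "v \<in> carrier SR" "r \<odot>\<^bsub>SR\<^esub> v \<in> T" for r v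
    proof -
      have "?L (quot \<one> r) \<otimes>\<^bsub>?KS\<^esub> fraction S (\<phi> r \<otimes>\<^bsub>S\<^esub> v) \<one>\<^bsub>S\<^esub> \<in> ?E" using r v by (intro Span(5) imageI) (auto simp: T_def)
      also have "?L (quot \<one> r) \<otimes>\<^bsub>?KS\<^esub> fraction S (\<phi> r \<otimes>\<^bsub>S\<^esub> v) \<one>\<^bsub>S\<^esub> = fraction S v \<one>\<^bsub>S\<^esub>"
        using r v nz[OF r] by (simp add: fraction_lift_quot S.fraction_mult completion_map_simps S.fraction_eq_iff S.m_comm)
      finally show ?thesis using v by (simp add: T_def)
    qed
  qed
  then have T: "fraction S y \<one>\<^bsub>S\<^esub> \<in> ?E" if "y \<in> carrier S" for y
    using coordinate_systemD(2)[OF B] that by (auto simp: T_def)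
  have "P \<in> ?E" if P: "P \<in> carrier ?KS" for P
  proof -
    obtain y z where yz: "y \<in> carrier S" "z \<in> carrier S" "z \<noteq> \<zero>\<^bsub>S\<^esub>" "P = fraction S y z"
      using P by (rule S.quotient_field_cases)
    obtain v n where v: "v \<in> Units S" "z = v \<otimes>\<^bsub>S\<^esub> \<phi> x [^]\<^bsub>S\<^esub> (n::nat)" using S.unit_power_ex yz by blast
    have vc: "v \<in> carrier S" "inv\<^bsub>S\<^esub> v \<in> carrier S" using v by auto
    have "?L (quot \<one> (x [^] n)) \<otimes>\<^bsub>?KS\<^esub> fraction S (y \<otimes>\<^bsub>S\<^esub> inv\<^bsub>S\<^esub> v) \<one>\<^bsub>S\<^esub> \<in> ?E"
      using T yz vc x_pow_nonzero by (intro Span(5) imageI) auto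
    also have "?L (quot \<one> (x [^] n)) \<otimes>\<^bsub>?KS\<^esub> fraction S (y \<otimes>\<^bsub>S\<^esub> inv\<^bsub>S\<^esub> v) \<one>\<^bsub>S\<^esub>
        = fraction S (y \<otimes>\<^bsub>S\<^esub> inv\<^bsub>S\<^esub> v) (\<phi> x [^]\<^bsub>S\<^esub> n)"
      using yz vc x_pow_nonzero S.x_pow_nonzero
      by (simp add: fraction_lift_quot S.fraction_mult completion_map_simps completion_map_pow)
    also have "\<dots> = P"
    proof -
      have "y \<otimes>\<^bsub>S\<^esub> inv\<^bsub>S\<^esub> v \<otimes>\<^bsub>S\<^esub> (v \<otimes>\<^bsub>S\<^esub> \<phi> x [^]\<^bsub>S\<^esub> n) = y \<otimes>\<^bsub>S\<^esub> (inv\<^bsub>S\<^esub> v \<otimes>\<^bsub>S\<^esub> v) \<otimes>\<^bsub>S\<^esub> \<phi> x [^]\<^bsub>S\<^esub> n"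
        using yz vc by (simp only: S.m_assoc S.m_closed S.nat_pow_closed S.x_closed)
      also have "\<dots> = y \<otimes>\<^bsub>S\<^esub> \<phi> x [^]\<^bsub>S\<^esub> n" using v(1) yz by simp
      finally show ?thesis unfolding yz(4) using v(2) yz vc S.x_pow_nonzero by (simp add: S.fraction_eq_iff)
    qed
    finally show ?thesis .
  qed
  then have "?E = carrier ?KS" using Span(1) by blast
  then have "KS.finite_dimension ?F (carrier ?KS)" using KS.Span_finite_dimension[OF sub us] by simp
  then show False using degree by (simp add: infinite_degree_def)
qed

text \<open>S meets K in R: once the unit part of r is cancelled, the claim is that x^k divides s in
  R if it does so in S.\<close>

lemma completion_map_image:
  assumes \<alpha>: "\<alpha> \<in> carrier S" and r: "r \<in> carrier R" "r \<noteq> \<zero>" and s: "s \<in> carrier R"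
    and eq: "\<phi> r \<otimes>\<^bsub>S\<^esub> \<alpha> = \<phi> s"
  shows "\<alpha> \<in> \<phi> ` carrier R"
proof -
  obtain v k where v: "v \<in> Units R" "r = v \<otimes> x [^] (k::nat)" using unit_power_ex r by blast
  have vc: "v \<in> carrier R" "inv v \<in> carrier R" using v by auto
  have e: "\<phi> s = \<phi> (x [^] k) \<otimes>\<^bsub>S\<^esub> (\<phi> v \<otimes>\<^bsub>S\<^esub> \<alpha>)"
    using eq v(2) vc \<alpha> by (simp add: completion_map_simps S.m_ac)
  then have "s \<in> I k" using completion_map_in_divisible[OF s, of "\<phi> v \<otimes>\<^bsub>S\<^esub> \<alpha>" k] vc \<alpha> by simp
  then obtain t where t: "t \<in> carrier R" "s = t \<otimes> x [^] k" by (auto simp: I_iff)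
  then have "\<phi> (x [^] k) \<otimes>\<^bsub>S\<^esub> \<phi> t = \<phi> (x [^] k) \<otimes>\<^bsub>S\<^esub> (\<phi> v \<otimes>\<^bsub>S\<^esub> \<alpha>)"
    using e by (simp add: completion_map_simps S.m_comm)
  then have "\<phi> t = \<phi> v \<otimes>\<^bsub>S\<^esub> \<alpha>"
    using S.m_lcancel[of "\<phi> (x [^] k)" "\<phi> t" "\<phi> v \<otimes>\<^bsub>S\<^esub> \<alpha>"] S.x_pow_nonzero[of k] t vc \<alpha> by (simp add: completion_map_pow)
  then have "\<phi> (inv v \<otimes> t) = \<phi> (inv v \<otimes> v) \<otimes>\<^bsub>S\<^esub> \<alpha>"
    using vc t \<alpha> by (simp add: completion_map_simps S.m_assoc del: Units_l_inv)
  then have "\<phi> (inv v \<otimes> t) = \<alpha>" using v \<alpha> by (simp add: completion_map_simps)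
  then show ?thesis using vc t by (intro image_eqI[of _ _ "inv v \<otimes> t"]) auto
qed

end

section \<open>Injectivity of the twisted map\<close>

context completion_ext
begin

text \<open>Under \<open>K/R \<cong> Q(S)/S\<close>, this is the map \<open>P \<mapsto> \<alpha> P\<close> modulo \<open>S\<close>.\<close>

definition twist :: "(nat \<Rightarrow> 'a set) \<Rightarrow> ('a \<times> 'a) set \<Rightarrow> 'n" where
  "twist \<alpha> P = act (J (Suc 0)) \<alpha> (\<theta> P)"

lemma twist_linear:
  assumes \<alpha>: "\<alpha> \<in> carrier S"
  shows "twist \<alpha> \<in> linear_maps R QR (Z (Suc 0))"
proof (rule linear_mapsI)
  fix P assume "P \<in> carrier QR"
  then have P: "P \<in> carrier K" by simp
  note t = \<theta>_torsion[OF P]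
  show "twist \<alpha> P \<in> carrier (Z (Suc 0))"
    using act_rules(1)[OF module_J \<alpha> t] act_Z[OF \<alpha> t \<theta>_Z[OF P]] by (simp add: twist_def)
  show "twist \<alpha> (P \<oplus>\<^bsub>QR\<^esub> Q) = twist \<alpha> P \<oplus>\<^bsub>Z (Suc 0)\<^esub> twist \<alpha> Q" if Q: "Q \<in> carrier QR" for Q
    using act_rules(4)[OF module_J \<alpha> t, of "\<theta> Q"] \<theta>_torsion[of Q] Q linear_maps_add[OF \<theta>_linear, of P Q] P
    by (simp add: twist_def)
  show "twist \<alpha> (r \<odot>\<^bsub>QR\<^esub> P) = r \<odot>\<^bsub>Z (Suc 0)\<^esub> twist \<alpha> P" if r: "r \<in> carrier R" for r
    using act_rules(6)[OF module_J \<alpha> t r] linear_maps_smult[OF \<theta>_linear r, of P] P by (simp add: twist_def)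
qed

text \<open>If \<open>\<alpha> l\<close> agrees modulo \<open>R\<close> with an \<open>R\<close>-linear map \<open>\<mu>\<close> to \<open>K\<close>, then \<open>\<mu> - \<alpha> l\<close> is an \<open>R\<close>-linear
  endomorphism of the completion, that is, multiplication by some \<open>c\<close>. On the kernel of \<open>l\<close> this
  multiplication takes values in \<open>K\<close>, which for reasons of dimension forces \<open>c = 0\<close>.\<close>

lemma twist_kernel:
  assumes \<alpha>: "\<alpha> \<in> carrier S" "\<alpha> \<notin> \<phi> ` carrier R"
    and B: "coordinate_system R SR B q" and inf: "infinite B"
    and l: "l \<in> linear_maps R SR QR" and g: "g \<in> linear_maps R SR (J 0)"
    and eq: "\<And>y. y \<in> carrier S \<Longrightarrow> twist \<alpha> (l y) = d 0 (g y)"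
    and y: "y \<in> carrier S"
  shows "l y = \<zero>\<^bsub>K\<^esub>"
proof -
  let ?W = "quotient_field_module S"
  let ?WR = "restrict_scalars \<phi> ?W"
  let ?e = "\<lambda>s. fraction S s \<one>\<^bsub>S\<^esub>"
  interpret W: module S ?W by (rule S.module_quotient_field)
  have WR: "module R ?WR" by (rule module_restrict_scalars[OF is_cring completion_map_hom S.module_quotient_field])
  interpret WR: module R ?WR by (rule WR)
  have Rm: "module R (ring_module R)" by (rule module_ring_module[OF is_cring])
  have divW: "divisible_by ?WR x" using S.quotient_field_divisible[OF S.x_closed S.x_nonzero] by (simp add: divisible_by_def)
  have e_add: "?e (s \<oplus>\<^bsub>S\<^esub> t) = ?e s \<oplus>\<^bsub>?W\<^esub> ?e t" if "s \<in> carrier S" "t \<in> carrier S" for s t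
    using that by (simp add: S.fraction_add)
  have e_smult: "?e (s \<otimes>\<^bsub>S\<^esub> t) = s \<odot>\<^bsub>?W\<^esub> ?e t" if "s \<in> carrier S" "t \<in> carrier S" for s t
    using that by (simp add: S.quotient_field_smult)
  have e_inj: "inj_on ?e (carrier S)" by (rule S.fraction_embedding_inj)
  have e_lin: "?e \<in> linear_maps R SR ?WR" by (intro linear_mapsI) (auto simp: S.fraction_add S.quotient_field_smult)
  have "(\<lambda>r. ?e (\<phi> r)) \<in> linear_maps R (ring_module R) ?WR"
    by (intro linear_mapsI) (auto simp: completion_map_simps S.fraction_add S.quotient_field_smult)
  \<comment> \<open>j is the inclusion of K into Q(S); extending the inclusion of R provides it as
    an R-linear map.\<close>
  then have "\<exists>j\<in>linear_maps R QR ?WR. \<forall>r\<in>carrier (ring_module R). j (quot r \<one>) = ?e (\<phi> r)"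
    using fraction_embedding_inj by (intro divisible_extension[OF module_quotient_field WR Rm divW fraction_embedding_linear]) auto
  then obtain j where j: "j \<in> linear_maps R QR ?WR" "\<And>r. r \<in> carrier R \<Longrightarrow> j (quot r \<one>) = ?e (\<phi> r)" by auto
  have jc: "j P \<in> carrier ?W" if "P \<in> carrier K" for P using linear_maps_closed[OF j(1)] that by simp
  have j_smult: "j (r \<odot>\<^bsub>QR\<^esub> P) = \<phi> r \<odot>\<^bsub>?W\<^esub> j P" if "r \<in> carrier R" "P \<in> carrier K" for r P
    using linear_maps_smult[OF j(1) that(1)] that(2) by simp
  have j_zero: "P = \<zero>\<^bsub>K\<^esub>" if P: "P \<in> carrier K" "j P = \<zero>\<^bsub>?W\<^esub>" for P
  proof -
    obtain n r where r: "r \<in> carrier R" "x [^] (n::nat) \<odot>\<^bsub>QR\<^esub> P = quot r \<one>" using x_power_denominator[OF P(1)] by blast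
    have "?e (\<phi> r) = \<zero>\<^bsub>?W\<^esub>" 
      using j_smult[of "x [^] n" P] j(2)[OF r(1)] r(2) P W.smult_r_null[of "\<phi> (x [^] n)"] by simp
    then have "r = \<zero>" using r(1) completion_map_inject by (simp add: S.fraction_eq_zero_iff)
    then have "x [^] n \<odot>\<^bsub>QR\<^esub> P = \<zero>\<^bsub>K\<^esub>" using r(2) fraction_zero by simp
    then show ?thesis using quotient_field_torsion_free[OF _ x_pow_nonzero P(1)] by simp
  qed
  have "(\<lambda>v. v) \<in> linear_maps R QR QR" by (intro linear_mapsI) auto
  \<comment> \<open>A retraction of u turns the cochain g with values in J^0 into the map \<mu> with
    values in K.\<close>
  then have "\<exists>q\<in>linear_maps R (J 0) QR. \<forall>P\<in>carrier QR. q (u P) = P"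
    using u_inj by (intro divisible_extension[OF module_J module_quotient_field module_quotient_field
      quotient_field_divisible[OF x_closed x_nonzero] u_linear]) auto
  then obtain q0 where q0: "q0 \<in> linear_maps R (J 0) QR" "\<And>P. P \<in> carrier K \<Longrightarrow> q0 (u P) = P" by auto
  define \<mu> where "\<mu> y = q0 (g y)" for y
  have \<mu>: "\<mu> \<in> linear_maps R SR QR" unfolding \<mu>_def[abs_def] by (rule linear_maps_compose[OF g q0(1)])
  have lc: "l y \<in> carrier K" and \<mu>c: "\<mu> y \<in> carrier K" and gc: "g y \<in> carrier (J 0)" if "y \<in> carrier S" for y
    using linear_maps_closed[OF l] linear_maps_closed[OF \<mu>] linear_maps_closed[OF g] that by simp_all
  define \<rho>' where "\<rho>' y = j (\<mu> y) \<ominus>\<^bsub>?WR\<^esub> \<alpha> \<odot>\<^bsub>?W\<^esub> j (l y)" for y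
  have "(\<lambda>P. \<alpha> \<odot>\<^bsub>?W\<^esub> P) \<in> linear_maps R ?WR ?WR"
    using \<alpha>(1) by (intro linear_mapsI) (auto simp: W.smult_r_distr[simplified] W.smult_assoc1[symmetric, simplified] S.m_comm
      intro: W.smult_closed[simplified])
  from linear_maps_compose[OF linear_maps_compose[OF l j(1)] this]
  have \<rho>'_lin: "\<rho>' \<in> linear_maps R SR ?WR"
    unfolding \<rho>'_def[abs_def] by (intro linear_maps_pointwise_diff[OF WR linear_maps_compose[OF \<mu> j(1)]])
  \<comment> \<open>With x^n l y in R, write \<alpha> = s + x^n \<alpha>'. On the class of l y
    modulo R, \<alpha> acts as s does, so \<mu> y - s l y lies in R; the remaining term \<alpha>'
    x^n l y lies in S.\<close>
  have im: "\<rho>' y \<in> ?e ` carrier S" if y: "y \<in> carrier S" for y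
  proof -
    let ?P = "l y"
    obtain n r where r: "r \<in> carrier R" "x [^] (n::nat) \<odot>\<^bsub>QR\<^esub> ?P = quot r \<one>" using x_power_denominator[OF lc[OF y]] by blast
    obtain s \<alpha>' where s: "s \<in> carrier R" "\<alpha>' \<in> carrier S" "\<alpha> = \<phi> s \<oplus>\<^bsub>S\<^esub> \<phi> (x [^] n) \<otimes>\<^bsub>S\<^esub> \<alpha>'"
      using completion_dense[OF \<alpha>(1)] by blast
    note t = \<theta>_torsion[OF lc[OF y]]
    have x\<theta>: "x [^] n \<odot>\<^bsub>J (Suc 0)\<^esub> \<theta> ?P = \<zero>\<^bsub>J (Suc 0)\<^esub>"
      using linear_maps_smult[OF \<theta>_linear, of "x [^] n" ?P] lc[OF y] r \<theta>_embed by simp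
    have \<theta>c: "\<theta> ?P \<in> carrier (J (Suc 0))" using t by simp
    have "d 0 (g y) = act (J (Suc 0)) (\<phi> s) (\<theta> ?P) \<oplus>\<^bsub>J (Suc 0)\<^esub> act (J (Suc 0)) (\<phi> (x [^] n) \<otimes>\<^bsub>S\<^esub> \<alpha>') (\<theta> ?P)"
      unfolding eq[OF y, symmetric] twist_def s(3) using s by (intro act_rules(2)[OF module_J _ t]) auto
    also have "\<dots> = s \<odot>\<^bsub>J (Suc 0)\<^esub> \<theta> ?P"
      using act_rules(7)[OF module_J s(2) t x\<theta>] act_rules(5)[OF module_J s(2) t s(1)] s(1) \<theta>c by simp
    also have "\<dots> = d 0 (s \<odot>\<^bsub>J 0\<^esub> u ?P)"
      using linear_maps_smult[OF d_linear s(1), of "u ?P" 0] linear_maps_closed[OF u_linear] lc[OF y] by (simp add: \<theta>_def)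
    finally have dd: "d 0 (g y) = d 0 (s \<odot>\<^bsub>J 0\<^esub> u ?P)" .
    have uc: "s \<odot>\<^bsub>J 0\<^esub> u ?P \<in> carrier (J 0)" using s(1) linear_maps_closed[OF u_linear] lc[OF y] by simp
    have "g y \<ominus>\<^bsub>J 0\<^esub> s \<odot>\<^bsub>J 0\<^esub> u ?P \<in> carrier (Z 0)"
      using linear_maps_diff[OF module_J module_J d_linear gc[OF y] uc] dd gc[OF y] uc linear_maps_closed[OF d_linear uc]
      by (simp add: a_minus_def J.M.r_neg)
    then obtain r' where r': "r' \<in> carrier R" "g y \<ominus>\<^bsub>J 0\<^esub> s \<odot>\<^bsub>J 0\<^esub> u ?P = u (quot r' \<one>)"
      using image_\<epsilon> u_embed by (metis imageE)
    have "q0 (g y \<ominus>\<^bsub>J 0\<^esub> s \<odot>\<^bsub>J 0\<^esub> u ?P) = \<mu> y \<ominus>\<^bsub>QR\<^esub> q0 (s \<odot>\<^bsub>J 0\<^esub> u ?P)"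
      unfolding \<mu>_def by (rule linear_maps_diff[OF module_J module_quotient_field q0(1) gc[OF y] uc])
    also have "q0 (s \<odot>\<^bsub>J 0\<^esub> u ?P) = s \<odot>\<^bsub>QR\<^esub> ?P"
      using linear_maps_smult[OF q0(1) s(1), of "u ?P"] q0(2) lc[OF y] linear_maps_closed[OF u_linear] by simp
    finally have "\<mu> y \<ominus>\<^bsub>QR\<^esub> s \<odot>\<^bsub>QR\<^esub> ?P = quot r' \<one>" unfolding r'(2) using q0(2) r'(1) by simp
    then have "j (quot r' \<one>) = j (\<mu> y) \<ominus>\<^bsub>?WR\<^esub> j (s \<odot>\<^bsub>QR\<^esub> ?P)"
      using linear_maps_diff[OF module_quotient_field WR j(1), of "\<mu> y" "s \<odot>\<^bsub>QR\<^esub> ?P"] \<mu>c[OF y] lc[OF y] QR.smult_closed[OF s(1), of ?P]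
      by simp
    then have 1: "j (\<mu> y) \<ominus>\<^bsub>?WR\<^esub> \<phi> s \<odot>\<^bsub>?W\<^esub> j ?P = ?e (\<phi> r')"
      using j(2)[OF r'(1)] j_smult[OF s(1) lc[OF y]] by simp
    have sj: "\<phi> s \<odot>\<^bsub>?W\<^esub> j ?P \<in> carrier ?W" using s(1) jc[OF lc[OF y]] by (intro W.smult_closed) auto
    have "\<alpha> \<odot>\<^bsub>?W\<^esub> j ?P = \<phi> s \<odot>\<^bsub>?W\<^esub> j ?P \<oplus>\<^bsub>?W\<^esub> (\<alpha>' \<otimes>\<^bsub>S\<^esub> \<phi> (x [^] n)) \<odot>\<^bsub>?W\<^esub> j ?P"
      unfolding s(3) using s W.smult_l_distr[of "\<phi> s" "\<phi> (x [^] n) \<otimes>\<^bsub>S\<^esub> \<alpha>'" "j ?P"] jc[OF lc[OF y]] by (simp add: S.m_comm)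
    also have "(\<alpha>' \<otimes>\<^bsub>S\<^esub> \<phi> (x [^] n)) \<odot>\<^bsub>?W\<^esub> j ?P = \<alpha>' \<odot>\<^bsub>?W\<^esub> (\<phi> (x [^] n) \<odot>\<^bsub>?W\<^esub> j ?P)"
      using s jc[OF lc[OF y]] by (intro W.smult_assoc1) auto
    also have "\<phi> (x [^] n) \<odot>\<^bsub>?W\<^esub> j ?P = ?e (\<phi> r)" using j_smult[of "x [^] n" ?P] lc[OF y] r(2) j(2)[OF r(1)] by simp
    also have "\<alpha>' \<odot>\<^bsub>?W\<^esub> ?e (\<phi> r) = ?e (\<alpha>' \<otimes>\<^bsub>S\<^esub> \<phi> r)" using e_smult[OF s(2)] r(1) by simp
    finally have 2: "\<alpha> \<odot>\<^bsub>?W\<^esub> j ?P = \<phi> s \<odot>\<^bsub>?W\<^esub> j ?P \<oplus>\<^bsub>?W\<^esub> ?e (\<alpha>' \<otimes>\<^bsub>S\<^esub> \<phi> r)" .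
    have ec: "?e (\<alpha>' \<otimes>\<^bsub>S\<^esub> \<phi> r) \<in> carrier ?W" using s(2) r(1) by simp
    have "\<rho>' y = (j (\<mu> y) \<ominus>\<^bsub>?WR\<^esub> \<phi> s \<odot>\<^bsub>?W\<^esub> j ?P) \<ominus>\<^bsub>?WR\<^esub> ?e (\<alpha>' \<otimes>\<^bsub>S\<^esub> \<phi> r)"
      unfolding \<rho>'_def 2 using jc[OF \<mu>c[OF y]] sj ec
      WR.M.minus_add[of "\<phi> s \<odot>\<^bsub>?W\<^esub> j ?P" "?e (\<alpha>' \<otimes>\<^bsub>S\<^esub> \<phi> r)"]
      WR.M.a_assoc[of "j (\<mu> y)" "\<ominus>\<^bsub>?WR\<^esub> (\<phi> s \<odot>\<^bsub>?W\<^esub> j ?P)" "\<ominus>\<^bsub>?WR\<^esub> ?e (\<alpha>' \<otimes>\<^bsub>S\<^esub> \<phi> r)"]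
      WR.M.a_inv_closed[of "\<phi> s \<odot>\<^bsub>?W\<^esub> j ?P"] WR.M.a_inv_closed[of "?e (\<alpha>' \<otimes>\<^bsub>S\<^esub> \<phi> r)"]
      by (simp add: a_minus_def)
    also have "\<dots> = ?e (\<phi> r' \<ominus>\<^bsub>S\<^esub> \<alpha>' \<otimes>\<^bsub>S\<^esub> \<phi> r)"
      unfolding 1 using linear_maps_diff[OF module_SR WR e_lin, of "\<phi> r'" "\<alpha>' \<otimes>\<^bsub>S\<^esub> \<phi> r"] r r' s
      by (simp add: a_minus_def a_inv_def m_inv_def)
    finally show ?thesis using r r' s by blast
  qed
  have "\<exists>\<rho>\<in>linear_maps R SR SR. \<forall>v\<in>carrier SR. ?e (\<rho> v) = \<rho>' v"
    using im e_inj by (intro lift_through_injection[OF module_SR module_SR WR e_lin _ \<rho>'_lin]) auto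
  then obtain \<rho> where \<rho>: "\<rho> \<in> linear_maps R SR SR" "\<And>v. v \<in> carrier S \<Longrightarrow> ?e (\<rho> v) = \<rho>' v" by auto
  define c where "c = \<rho> \<one>\<^bsub>S\<^esub>"
  have c: "c \<in> carrier S" using linear_maps_closed[OF \<rho>(1)] by (simp add: c_def)
  have main: "j (\<mu> y) \<ominus>\<^bsub>?WR\<^esub> \<alpha> \<odot>\<^bsub>?W\<^esub> j (l y) = ?e (y \<otimes>\<^bsub>S\<^esub> c)" if "y \<in> carrier S" for y
    using \<rho>(2)[OF that] completion_endomorphism[OF \<rho>(1) that] by (simp add: \<rho>'_def c_def)
  have main0: "j (\<mu> y) = ?e (y \<otimes>\<^bsub>S\<^esub> c)" if "y \<in> carrier S" "l y = \<zero>\<^bsub>K\<^esub>" for y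
  proof -
    have "j (l y) = \<zero>\<^bsub>?WR\<^esub>" using that(2) linear_maps_zero[OF module_quotient_field WR j(1)] by simp
    then have "\<alpha> \<odot>\<^bsub>?W\<^esub> j (l y) = \<zero>\<^bsub>?WR\<^esub>" using W.smult_r_null[OF \<alpha>(1)] by simp
    then show ?thesis using main[OF that(1)] jc[OF \<mu>c[OF that(1)]] WR.M.r_zero[of "j (\<mu> y)"] WR.M.a_inv_zero
      by (simp add: a_minus_def)
  qed
  \<comment> \<open>Disjoint halves of B supply nonzero y1 and y2 in the kernel of l whose pure
    spans meet in 0. Were c nonzero, y1 c and y2 c would both lie in K and be commensurable over R;
    cancelling c would make y1 and y2 dependent.\<close>
  have "c = \<zero>\<^bsub>S\<^esub>"
  proof (rule ccontr)
    assume cnz: "c \<noteq> \<zero>\<^bsub>S\<^esub>"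
    obtain A1 A2 where A: "A1 \<subseteq> B" "A2 \<subseteq> B" "infinite A1" "infinite A2" "A1 \<inter> A2 = {}"
      using infinite_split[OF inf] by blast
    have ker: "\<exists>y\<in>pure_span R SR A. y \<noteq> \<zero>\<^bsub>SR\<^esub> \<and> (\<forall>i\<in>{()}. l y = \<zero>\<^bsub>K\<^esub>)" if "A \<subseteq> B" "infinite A" for A
      using l by (intro common_zero_in_span[OF module_SR SR_torsion_free B _ _ that, where F = "{()}" and f = "\<lambda>_. l"]) auto
    obtain y1 where y1: "y1 \<in> pure_span R SR A1" "y1 \<noteq> \<zero>\<^bsub>S\<^esub>" "l y1 = \<zero>\<^bsub>K\<^esub>" using ker[OF A(1,3)] by auto
    obtain y2 where y2: "y2 \<in> pure_span R SR A2" "y2 \<noteq> \<zero>\<^bsub>S\<^esub>" "l y2 = \<zero>\<^bsub>K\<^esub>" using ker[OF A(2,4)] by auto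
    have BS: "B \<subseteq> carrier SR" using coordinate_systemD(1)[OF B] .
    have yc: "y1 \<in> carrier S" "y2 \<in> carrier S"
      using subsetD[OF module.pure_span_subset_carrier[OF module_SR subset_trans[OF A(1) BS]] y1(1)]
        subsetD[OF module.pure_span_subset_carrier[OF module_SR subset_trans[OF A(2) BS]] y2(1)] by simp_all
    have "\<mu> y2 \<noteq> \<zero>\<^bsub>K\<^esub>"
    proof
      assume "\<mu> y2 = \<zero>\<^bsub>K\<^esub>"
      then have "?e (y2 \<otimes>\<^bsub>S\<^esub> c) = \<zero>\<^bsub>?W\<^esub>"
        using main0[OF yc(2) y2(3)] linear_maps_zero[OF module_quotient_field WR j(1)] by simp
      then show False using y2(2) cnz yc c by (simp add: S.fraction_eq_zero_iff S.integral_iff)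
    qed
    then obtain r s where rs: "r \<in> carrier R" "r \<noteq> \<zero>" "s \<in> carrier R" "r \<odot>\<^bsub>QR\<^esub> \<mu> y1 = s \<odot>\<^bsub>QR\<^esub> \<mu> y2"
      using quotient_field_common_multiple[OF \<mu>c[OF yc(1)] \<mu>c[OF yc(2)]] by blast
    have "?e (\<phi> r \<otimes>\<^bsub>S\<^esub> (y1 \<otimes>\<^bsub>S\<^esub> c)) = ?e (\<phi> s \<otimes>\<^bsub>S\<^esub> (y2 \<otimes>\<^bsub>S\<^esub> c))"
      using j_smult[OF rs(1) \<mu>c[OF yc(1)]] j_smult[OF rs(3) \<mu>c[OF yc(2)]] rs(4)
        main0[OF yc(1) y1(3)] main0[OF yc(2) y2(3)] e_smult rs(1,3) yc c by simp
    then have "\<phi> r \<otimes>\<^bsub>S\<^esub> (y1 \<otimes>\<^bsub>S\<^esub> c) = \<phi> s \<otimes>\<^bsub>S\<^esub> (y2 \<otimes>\<^bsub>S\<^esub> c)"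
      by (rule inj_onD[OF e_inj]) (use rs yc c in auto)
    then have "c \<otimes>\<^bsub>S\<^esub> (\<phi> r \<otimes>\<^bsub>S\<^esub> y1) = c \<otimes>\<^bsub>S\<^esub> (\<phi> s \<otimes>\<^bsub>S\<^esub> y2)" using rs(1,3) yc c by (simp add: S.m_ac)
    then have "\<phi> r \<otimes>\<^bsub>S\<^esub> y1 = \<phi> s \<otimes>\<^bsub>S\<^esub> y2" using S.m_lcancel[OF cnz c] rs(1,3) yc by simp
    then have "r \<odot>\<^bsub>SR\<^esub> y1 \<in> pure_span R SR A2" using pure_span.smult[OF rs(3) y2(1)] by simp
    then have y1A2: "y1 \<in> pure_span R SR A2" using pure_span.div[OF rs(1,2), of y1 SR A2] yc by simp
    have "y1 = \<zero>\<^bsub>SR\<^esub>"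
      by (rule pure_span_disjoint[OF module_SR _ B A(1,2,5) y1(1) y1A2]) (rule SR_torsion_free)
    then show False using y1(2) by simp
  qed
  show "l y = \<zero>\<^bsub>K\<^esub>"
  proof (rule ccontr)
    \<comment> \<open>With c = 0 the relation reads \<mu> y = \<alpha> l y in Q(S). Both \<mu> y and
      l y lie in K, so \<alpha> would lie in K, hence in R.\<close>
    assume nz: "l y \<noteq> \<zero>\<^bsub>K\<^esub>"
    obtain r s where rs: "r \<in> carrier R" "r \<noteq> \<zero>" "s \<in> carrier R" "r \<odot>\<^bsub>QR\<^esub> \<mu> y = s \<odot>\<^bsub>QR\<^esub> l y"
      using quotient_field_common_multiple[OF \<mu>c[OF y] lc[OF y] nz] by blast
    have ac: "\<alpha> \<odot>\<^bsub>?W\<^esub> j (l y) \<in> carrier ?W" using W.smult_closed[OF \<alpha>(1) jc[OF lc[OF y]]] .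
    have "j (\<mu> y) \<ominus>\<^bsub>?WR\<^esub> \<alpha> \<odot>\<^bsub>?W\<^esub> j (l y) = \<zero>\<^bsub>?WR\<^esub>"
      using main[OF y] \<open>c = \<zero>\<^bsub>S\<^esub>\<close> y S.fraction_zero by simp
    then have j\<mu>: "j (\<mu> y) = \<alpha> \<odot>\<^bsub>?W\<^esub> j (l y)"
      using WR.M.minus_eq_zero_iff[of "j (\<mu> y)" "\<alpha> \<odot>\<^bsub>?W\<^esub> j (l y)"] jc[OF \<mu>c[OF y]] ac by simp
    have "(\<phi> r \<otimes>\<^bsub>S\<^esub> \<alpha>) \<odot>\<^bsub>?W\<^esub> j (l y) = \<phi> r \<odot>\<^bsub>?W\<^esub> j (\<mu> y)"
      unfolding j\<mu> using rs(1) \<alpha>(1) jc[OF lc[OF y]] by (intro W.smult_assoc1) auto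
    also have "\<dots> = \<phi> s \<odot>\<^bsub>?W\<^esub> j (l y)"
      using j_smult[OF rs(1) \<mu>c[OF y]] j_smult[OF rs(3) lc[OF y]] rs(4) by simp
    finally have eq': "(\<phi> r \<otimes>\<^bsub>S\<^esub> \<alpha>) \<odot>\<^bsub>?W\<^esub> j (l y) = \<phi> s \<odot>\<^bsub>?W\<^esub> j (l y)" .
    have sc: "\<phi> s \<odot>\<^bsub>?W\<^esub> j (l y) \<in> carrier ?W" using rs(3) jc[OF lc[OF y]] by (intro W.smult_closed) auto
    have "(\<phi> r \<otimes>\<^bsub>S\<^esub> \<alpha> \<ominus>\<^bsub>S\<^esub> \<phi> s) \<odot>\<^bsub>?W\<^esub> j (l y) = (\<phi> r \<otimes>\<^bsub>S\<^esub> \<alpha>) \<odot>\<^bsub>?W\<^esub> j (l y) \<oplus>\<^bsub>?W\<^esub> \<ominus>\<^bsub>?W\<^esub> (\<phi> s \<odot>\<^bsub>?W\<^esub> j (l y))"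
      unfolding a_minus_def using rs(1,3) \<alpha>(1) jc[OF lc[OF y]] W.smult_l_distr[of "\<phi> r \<otimes>\<^bsub>S\<^esub> \<alpha>" "\<ominus>\<^bsub>S\<^esub> \<phi> s" "j (l y)"]
        W.smult_l_minus[of "\<phi> s" "j (l y)"] by simp
    also have "\<dots> = \<zero>\<^bsub>?W\<^esub>" unfolding eq' by (rule W.M.r_neg[OF sc])
    finally have z: "(\<phi> r \<otimes>\<^bsub>S\<^esub> \<alpha> \<ominus>\<^bsub>S\<^esub> \<phi> s) \<odot>\<^bsub>?W\<^esub> j (l y) = \<zero>\<^bsub>?W\<^esub>" .
    have "j (l y) \<noteq> \<zero>\<^bsub>?W\<^esub>" using j_zero[OF lc[OF y]] nz by blast
    then have "\<phi> r \<otimes>\<^bsub>S\<^esub> \<alpha> \<ominus>\<^bsub>S\<^esub> \<phi> s = \<zero>\<^bsub>S\<^esub>"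
      using S.quotient_field_torsion_free[of "\<phi> r \<otimes>\<^bsub>S\<^esub> \<alpha> \<ominus>\<^bsub>S\<^esub> \<phi> s" "j (l y)"] z jc[OF lc[OF y]] rs(1,3) \<alpha>(1) by auto
    then have "\<phi> r \<otimes>\<^bsub>S\<^esub> \<alpha> = \<phi> s" using rs(1,3) \<alpha>(1) by simp
    then show False using completion_map_image[OF \<alpha>(1) rs(1,2,3)] \<alpha>(2) by blast
  qed
qed

end

section \<open>The dual Hom(S, K) and the rank of Ext^1\<close>

context completion_ext
begin

abbreviation "dual \<equiv> hom_module R \<phi> N QR"

lemma module_dual: "module S dual"
  by (rule module_hom_module[OF is_cring completion_map_hom module_N module_quotient_field])

sublocale dual: module S dual by (rule module_dual)

lemma dual_linear: "l \<in> carrier dual \<Longrightarrow> l \<in> linear_maps R SR QR" by simp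

lemma dual_values: "l \<in> carrier dual \<Longrightarrow> y \<in> carrier S \<Longrightarrow> l y \<in> carrier K"
  using linear_maps_closed[of l R SR QR y] by simp

lemma dual_eq_zero: "l \<in> carrier dual \<Longrightarrow> (\<And>y. y \<in> carrier S \<Longrightarrow> l y = \<zero>\<^bsub>K\<^esub>) \<Longrightarrow> l = \<zero>\<^bsub>dual\<^esub>"
  by (auto simp: fun_eq_iff extensional_def)

definition dual_to_E1 :: "(nat \<Rightarrow> 'a set) \<Rightarrow> ((nat \<Rightarrow> 'a set) \<Rightarrow> ('a \<times> 'a) set) \<Rightarrow> ((nat \<Rightarrow> 'a set) \<Rightarrow> 'n) set" where
  "dual_to_E1 \<alpha> l = ext_class (\<lambda>y. twist \<alpha> (l y))"

lemma twist_compose: "\<alpha> \<in> carrier S \<Longrightarrow> l \<in> carrier dual \<Longrightarrow> (\<lambda>y. twist \<alpha> (l y)) \<in> Z1_maps"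
  by (rule linear_maps_compose[OF dual_linear twist_linear])

lemma dual_to_E1_linear:
  assumes \<alpha>: "\<alpha> \<in> carrier S"
  shows "dual_to_E1 \<alpha> \<in> linear_maps S dual E1"
proof (rule linear_mapsI)
  fix l assume l: "l \<in> carrier dual"
  note lz = twist_compose[OF \<alpha> l]
  show "dual_to_E1 \<alpha> l \<in> carrier E1" unfolding dual_to_E1_def by (rule ext_class_closed[OF lz])
  show "dual_to_E1 \<alpha> (l \<oplus>\<^bsub>dual\<^esub> l') = dual_to_E1 \<alpha> l \<oplus>\<^bsub>E1\<^esub> dual_to_E1 \<alpha> l'" if l': "l' \<in> carrier dual" for l'
    unfolding dual_to_E1_def ext_class_add[OF lz twist_compose[OF \<alpha> l']]
    using linear_maps_add[OF twist_linear[OF \<alpha>], of "l y" "l' y" for y] dual_values[OF l] dual_values[OF l']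
    by (intro ext_class_cong) simp
  show "dual_to_E1 \<alpha> (s \<odot>\<^bsub>dual\<^esub> l) = s \<odot>\<^bsub>E1\<^esub> dual_to_E1 \<alpha> l" if s: "s \<in> carrier S" for s
    unfolding dual_to_E1_def ext_class_smult[OF lz s] by (rule ext_class_cong) simp
qed

text \<open>By S-linearity s l has zero class, so \<open>twist_kernel\<close> gives s l = 0. Up to a
  unit s is x^n, and x^n l = 0 forces l = 0 because K is torsion-free.\<close>

lemma dual_to_E1_torsion_kernel:
  assumes \<alpha>: "\<alpha> \<in> carrier S" "\<alpha> \<notin> \<phi> ` carrier R" and B: "coordinate_system R SR B q" "infinite B"
    and l: "l \<in> carrier dual" and s: "s \<in> carrier S" "s \<noteq> \<zero>\<^bsub>S\<^esub>"
    and tors: "s \<odot>\<^bsub>E1\<^esub> dual_to_E1 \<alpha> l = \<zero>\<^bsub>E1\<^esub>"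
  shows "l = \<zero>\<^bsub>dual\<^esub>"
proof (rule dual_eq_zero[OF l])
  fix y assume y: "y \<in> carrier S"
  let ?l = "s \<odot>\<^bsub>dual\<^esub> l"
  have sl: "?l \<in> carrier dual" using s(1) l by (rule dual.smult_closed)
  have "dual_to_E1 \<alpha> ?l = \<zero>\<^bsub>E1\<^esub>" using linear_maps_smult[OF dual_to_E1_linear[OF \<alpha>(1)] s(1) l] tors by simp
  then obtain g where g: "g \<in> linear_maps R SR (J 0)" "\<And>y. y \<in> carrier S \<Longrightarrow> twist \<alpha> (?l y) = d 0 (g y)"
    unfolding dual_to_E1_def ext_class_zero_iff[OF twist_compose[OF \<alpha>(1) sl]] by blast
  have zero: "?l z = \<zero>\<^bsub>K\<^esub>" if "z \<in> carrier S" for z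
    by (rule twist_kernel[OF \<alpha> B dual_linear[OF sl] g that])
  obtain v n where v: "v \<in> Units S" "s = v \<otimes>\<^bsub>S\<^esub> \<phi> x [^]\<^bsub>S\<^esub> (n::nat)" using S.unit_power_ex s by blast
  have vc: "v \<in> carrier S" "inv\<^bsub>S\<^esub> v \<in> carrier S" using v by auto
  have "s \<otimes>\<^bsub>S\<^esub> (inv\<^bsub>S\<^esub> v \<otimes>\<^bsub>S\<^esub> y) = (v \<otimes>\<^bsub>S\<^esub> inv\<^bsub>S\<^esub> v) \<otimes>\<^bsub>S\<^esub> (\<phi> (x [^] n) \<otimes>\<^bsub>S\<^esub> y)"
    unfolding v(2) completion_map_pow[OF x_closed] using vc y
    by (simp only: S.m_ac S.m_closed S.nat_pow_closed S.x_closed)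
  also have "\<dots> = \<phi> (x [^] n) \<otimes>\<^bsub>S\<^esub> y" using v(1) y by simp
  finally have "l (\<phi> (x [^] n) \<otimes>\<^bsub>S\<^esub> y) = \<zero>\<^bsub>K\<^esub>"
    using zero[of "inv\<^bsub>S\<^esub> v \<otimes>\<^bsub>S\<^esub> y"] vc y by simp
  then have "x [^] n \<odot>\<^bsub>QR\<^esub> l y = \<zero>\<^bsub>K\<^esub>" using linear_maps_smult[OF dual_linear[OF l], of "x [^] n" y] y by simp
  then show "l y = \<zero>\<^bsub>K\<^esub>" using quotient_field_torsion_free[OF _ x_pow_nonzero dual_values[OF l y]] by simp
qed

text \<open>The functionals that vanish on the common zeros of finitely many \<open>y \<mapsto> D\<^sub>n(b y)\<close>, with \<open>b\<close> in the
  basis \<open>B\<close>, form a pure submodule over the completion, and the diagonal functional is not among them.\<close>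

lemma dual_not_countably_generated:
  fixes D :: "nat \<Rightarrow> (nat \<Rightarrow> 'a set) \<Rightarrow> ('a \<times> 'a) set"
  assumes B: "coordinate_system R SR B q" "infinite B" and D: "range D \<subseteq> carrier dual"
  shows "\<not> carrier dual \<subseteq> pure_span S dual (range D)"
proof
  assume span: "carrier dual \<subseteq> pure_span S dual (range D)"
  let ?Y = "(UNIV :: nat set) \<times> B"
  \<comment> \<open>B spans S up to torsion, so the scalings of D n by members of B control all its
    S-multiples. The index set is no larger than B.\<close>
  define f where "f = (\<lambda>(n, b) y. D n (b \<otimes>\<^bsub>S\<^esub> y))"
  have Dd: "D n \<in> carrier dual" for n using D by blast
  have BS: "B \<subseteq> carrier S" using coordinate_systemD(1)[OF B(1)] by simp
  have fl: "f i \<in> linear_maps R SR QR" if "i \<in> ?Y" for i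
    using that BS precompose_scale[OF dual_linear[OF Dd]] by (auto simp: f_def)
  have "?Y \<lesssim> B \<times> B" using B(2) infinite_le_lepoll by (intro times_lepoll_mono) auto
  also have "B \<times> B \<approx> B" using card_of_Times_same_infinite[OF B(2)] by (simp add: eqpoll_iff_card_of_ordIso)
  finally have Y: "?Y \<lesssim> B" .
  obtain l where l: "l \<in> linear_maps R SR QR"
    "\<And>F. finite F \<Longrightarrow> F \<subseteq> ?Y \<Longrightarrow> \<exists>y\<in>carrier SR. (\<forall>i\<in>F. f i y = \<zero>\<^bsub>K\<^esub>) \<and> l y \<noteq> \<zero>\<^bsub>K\<^esub>"
  proof -
    have "\<exists>l\<in>linear_maps R SR QR. \<forall>F. finite F \<longrightarrow> F \<subseteq> ?Y \<longrightarrow>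
        (\<exists>y\<in>carrier SR. (\<forall>i\<in>F. f i y = \<zero>\<^bsub>K\<^esub>) \<and> l y \<noteq> \<zero>\<^bsub>K\<^esub>)"
    proof (rule functional_diagonalisation[OF module_SR _ B _ Y])
      show "f i \<in> linear_maps R SR QR" if "i \<in> ?Y" for i using fl[OF that] .
    qed (rule SR_torsion_free)
    then show ?thesis using that by blast
  qed
  \<comment> \<open>For linear h this means that h is a K-combination of finitely many f i; common
    zeros express it without coefficients.\<close>
  define fin_det where "fin_det h \<longleftrightarrow> (\<exists>F. finite F \<and> F \<subseteq> ?Y \<and>
    (\<forall>y\<in>carrier S. (\<forall>i\<in>F. f i y = \<zero>\<^bsub>K\<^esub>) \<longrightarrow> h y = \<zero>\<^bsub>K\<^esub>))" for h :: "(nat \<Rightarrow> 'a set) \<Rightarrow> ('a \<times> 'a) set"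
  have fin_detI: "fin_det h" if "finite F" "F \<subseteq> ?Y"
    "\<And>y. y \<in> carrier S \<Longrightarrow> \<forall>i\<in>F. f i y = \<zero>\<^bsub>K\<^esub> \<Longrightarrow> h y = \<zero>\<^bsub>K\<^esub>" for F h
    unfolding fin_det_def using that by (intro exI[of _ F] conjI ballI impI)
  have add: "fin_det (\<lambda>y. g y \<oplus>\<^bsub>K\<^esub> h y)" if gh: "fin_det g" "fin_det h" for g h
  proof -
    obtain F where F: "finite F" "F \<subseteq> ?Y" "\<forall>y\<in>carrier S. (\<forall>i\<in>F. f i y = \<zero>\<^bsub>K\<^esub>) \<longrightarrow> g y = \<zero>\<^bsub>K\<^esub>"
      using gh(1) unfolding fin_det_def by (elim exE conjE)
    obtain G where G: "finite G" "G \<subseteq> ?Y" "\<forall>y\<in>carrier S. (\<forall>i\<in>G. f i y = \<zero>\<^bsub>K\<^esub>) \<longrightarrow> h y = \<zero>\<^bsub>K\<^esub>"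
      using gh(2) unfolding fin_det_def by (elim exE conjE)
    have "\<zero>\<^bsub>K\<^esub> \<oplus>\<^bsub>K\<^esub> \<zero>\<^bsub>K\<^esub> = \<zero>\<^bsub>K\<^esub>" using QR.M.l_zero[OF QR.M.zero_closed] by simp
    then show ?thesis unfolding fin_det_def using F G by (intro exI[of _ "F \<union> G"]) auto
  qed
  have cong: "fin_det h" if "fin_det g" "\<And>y. y \<in> carrier S \<Longrightarrow> g y = h y" for g h
    using that unfolding fin_det_def by (metis (no_types, lifting))
  have torsion_free: "P = \<zero>\<^bsub>K\<^esub>" if "r \<in> carrier R" "r \<noteq> \<zero>" "P \<in> carrier K" "r \<odot>\<^bsub>QR\<^esub> P = \<zero>\<^bsub>K\<^esub>" for r P
    using quotient_field_torsion_free that by blast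
  \<comment> \<open>The admissible s form a pure R-submodule of S that contains B, hence all of
    S.\<close>
  have D_scaled: "fin_det (\<lambda>y. D n (s \<otimes>\<^bsub>S\<^esub> y))" if s: "s \<in> carrier S" for s n
  proof -
    define T where "T = {s \<in> carrier S. fin_det (\<lambda>y. D n (s \<otimes>\<^bsub>S\<^esub> y))}"
    note Dl = dual_linear[OF Dd[of n]]
    have "pure_span R SR B \<subseteq> T"
    proof (rule pure_span_least)
      show "B \<subseteq> T"
      proof
        fix b assume b: "b \<in> B"
        have "fin_det (\<lambda>y. D n (b \<otimes>\<^bsub>S\<^esub> y))"
          unfolding fin_det_def using b by (intro exI[of _ "{(n, b)}"]) (auto simp: f_def)
        then show "b \<in> T" using b BS by (auto simp: T_def)
      qed
      have "fin_det (\<lambda>y. D n (\<zero>\<^bsub>S\<^esub> \<otimes>\<^bsub>S\<^esub> y))"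
        unfolding fin_det_def using linear_maps_zero[OF module_SR module_quotient_field Dl] by (intro exI[of _ "{}"]) auto
      then show "\<zero>\<^bsub>SR\<^esub> \<in> T" by (simp add: T_def)
      show "v \<oplus>\<^bsub>SR\<^esub> w \<in> T" if vw: "v \<in> T" "w \<in> T" for v w
      proof -
        have c: "v \<in> carrier S" "w \<in> carrier S" using vw by (auto simp: T_def)
        have "fin_det (\<lambda>y. D n (v \<otimes>\<^bsub>S\<^esub> y) \<oplus>\<^bsub>K\<^esub> D n (w \<otimes>\<^bsub>S\<^esub> y))" using vw by (intro add) (auto simp: T_def)
        then have "fin_det (\<lambda>y. D n ((v \<oplus>\<^bsub>S\<^esub> w) \<otimes>\<^bsub>S\<^esub> y))"
        proof (rule cong)
          fix y assume y: "y \<in> carrier S"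
          show "D n (v \<otimes>\<^bsub>S\<^esub> y) \<oplus>\<^bsub>K\<^esub> D n (w \<otimes>\<^bsub>S\<^esub> y) = D n ((v \<oplus>\<^bsub>S\<^esub> w) \<otimes>\<^bsub>S\<^esub> y)"
            using linear_maps_add[OF Dl, of "v \<otimes>\<^bsub>S\<^esub> y" "w \<otimes>\<^bsub>S\<^esub> y"] c y by (simp add: S.l_distr)
        qed
        then show ?thesis using c by (simp add: T_def)
      qed
      have scaled: "D n (\<phi> r \<otimes>\<^bsub>S\<^esub> v \<otimes>\<^bsub>S\<^esub> y) = r \<odot>\<^bsub>QR\<^esub> D n (v \<otimes>\<^bsub>S\<^esub> y)"
        if "r \<in> carrier R" "v \<in> carrier S" "y \<in> carrier S" for r v y
        using linear_maps_smult[OF Dl that(1), of "v \<otimes>\<^bsub>S\<^esub> y"] that by (simp add: S.m_assoc)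
      show "r \<odot>\<^bsub>SR\<^esub> v \<in> T" if r: "r \<in> carrier R" and v: "v \<in> T" for r v
      proof -
        have vc: "v \<in> carrier S" using v by (simp add: T_def)
        obtain F where "finite F" "F \<subseteq> ?Y" "\<forall>y\<in>carrier S. (\<forall>i\<in>F. f i y = \<zero>\<^bsub>K\<^esub>) \<longrightarrow> D n (v \<otimes>\<^bsub>S\<^esub> y) = \<zero>\<^bsub>K\<^esub>"
          using v unfolding T_def fin_det_def by blast
        then have "fin_det (\<lambda>y. D n (\<phi> r \<otimes>\<^bsub>S\<^esub> v \<otimes>\<^bsub>S\<^esub> y))"
          unfolding fin_det_def using scaled[OF r vc] QR.smult_r_null[OF r] by (intro exI[of _ F]) auto
        then show ?thesis using r vc by (simp add: T_def)
      qed
      show "v \<in> T" if r: "r \<in> carrier R" "r \<noteq> \<zero>" and v: "v \<in> carrier SR" "r \<odot>\<^bsub>SR\<^esub> v \<in> T" for r v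
      proof -
        have vc: "v \<in> carrier S" using v by simp
        obtain F where F: "finite F" "F \<subseteq> ?Y" "\<forall>y\<in>carrier S. (\<forall>i\<in>F. f i y = \<zero>\<^bsub>K\<^esub>) \<longrightarrow> D n (\<phi> r \<otimes>\<^bsub>S\<^esub> v \<otimes>\<^bsub>S\<^esub> y) = \<zero>\<^bsub>K\<^esub>"
          using v unfolding T_def fin_det_def by auto
        have "D n (v \<otimes>\<^bsub>S\<^esub> y) = \<zero>\<^bsub>K\<^esub>" if y: "y \<in> carrier S" and "\<forall>i\<in>F. f i y = \<zero>\<^bsub>K\<^esub>" for y
        proof (rule torsion_free[OF r])
          show "D n (v \<otimes>\<^bsub>S\<^esub> y) \<in> carrier K" using dual_values[OF Dd] vc y by blast
          show "r \<odot>\<^bsub>QR\<^esub> D n (v \<otimes>\<^bsub>S\<^esub> y) = \<zero>\<^bsub>K\<^esub>" using F(3) that scaled[OF r(1) vc y] by simp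
        qed
        then have "fin_det (\<lambda>y. D n (v \<otimes>\<^bsub>S\<^esub> y))" by (rule fin_detI[OF F(1,2)])
        then show ?thesis using vc by (simp add: T_def)
      qed
    qed
    then show ?thesis using coordinate_systemD(2)[OF B(1)] s by (auto simp: T_def)
  qed
  have scale: "fin_det (\<lambda>y. h (s \<otimes>\<^bsub>S\<^esub> y))" if h: "fin_det h" and s: "s \<in> carrier S" for h s
  proof -
    obtain F where F: "finite F" "F \<subseteq> ?Y" and "\<forall>y\<in>carrier S. (\<forall>i\<in>F. f i y = \<zero>\<^bsub>K\<^esub>) \<longrightarrow> h y = \<zero>\<^bsub>K\<^esub>"
      using h unfolding fin_det_def by (elim exE conjE)
    then have F_zero: "h y = \<zero>\<^bsub>K\<^esub>" if "y \<in> carrier S" "\<And>i. i \<in> F \<Longrightarrow> f i y = \<zero>\<^bsub>K\<^esub>" for y using that by simp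
    \<comment> \<open>Scaling f (n, b) by s gives D n scaled by b s, which finitely many f k
      determine; the union of these finite sets over F serves h.\<close>
    have "\<exists>G. finite G \<and> G \<subseteq> ?Y \<and> (\<forall>y\<in>carrier S. (\<forall>i\<in>G. f i y = \<zero>\<^bsub>K\<^esub>) \<longrightarrow> f i (s \<otimes>\<^bsub>S\<^esub> y) = \<zero>\<^bsub>K\<^esub>)" if i: "i \<in> F" for i
    proof -
      obtain n b where nb: "i = (n, b)" "b \<in> carrier S" using F(2) i BS by blast
      have "fin_det (\<lambda>y. D n ((b \<otimes>\<^bsub>S\<^esub> s) \<otimes>\<^bsub>S\<^esub> y))" using nb s by (intro D_scaled) auto
      then have "fin_det (\<lambda>y. f i (s \<otimes>\<^bsub>S\<^esub> y))" by (rule cong) (use nb s in \<open>auto simp: f_def S.m_assoc\<close>)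
      then show ?thesis unfolding fin_det_def .
    qed
    then obtain G where G: "\<And>i. i \<in> F \<Longrightarrow> finite (G i)" "\<And>i. i \<in> F \<Longrightarrow> G i \<subseteq> ?Y"
      "\<And>i y. i \<in> F \<Longrightarrow> y \<in> carrier S \<Longrightarrow> (\<forall>k\<in>G i. f k y = \<zero>\<^bsub>K\<^esub>) \<Longrightarrow> f i (s \<otimes>\<^bsub>S\<^esub> y) = \<zero>\<^bsub>K\<^esub>"
      by metis
    have "h (s \<otimes>\<^bsub>S\<^esub> y) = \<zero>\<^bsub>K\<^esub>" if y: "y \<in> carrier S" "\<forall>k\<in>(\<Union>i\<in>F. G i). f k y = \<zero>\<^bsub>K\<^esub>" for y
      using G(3)[OF _ y(1)] y s by (intro F_zero) auto
    moreover have "finite (\<Union>i\<in>F. G i)" "(\<Union>i\<in>F. G i) \<subseteq> ?Y" using F(1) G(1,2) by blast+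
    ultimately show ?thesis by (intro fin_detI[of "\<Union>i\<in>F. G i"])
  qed
  define X where "X = {h \<in> carrier dual. fin_det h}"
  have "pure_span S dual (range D) \<subseteq> X"
  proof (rule pure_span_least)
    have "fin_det (D n)" for n
      using D_scaled[OF S.one_closed, of n] by (rule cong) simp
    then show "range D \<subseteq> X" using Dd by (auto simp: X_def simp del: hom_module_simps)
    have "fin_det \<zero>\<^bsub>dual\<^esub>" unfolding fin_det_def by (intro exI[of _ "{}"]) auto
    then show "\<zero>\<^bsub>dual\<^esub> \<in> X" using dual.M.zero_closed by (simp add: X_def del: hom_module_simps)
    show "g \<oplus>\<^bsub>dual\<^esub> h \<in> X" if gh: "g \<in> X" "h \<in> X" for g h
    proof -
      have "fin_det (\<lambda>y. g y \<oplus>\<^bsub>K\<^esub> h y)" using gh by (intro add) (auto simp: X_def)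
      then have "fin_det (g \<oplus>\<^bsub>dual\<^esub> h)" by (rule cong) simp
      moreover have "g \<oplus>\<^bsub>dual\<^esub> h \<in> carrier dual" using gh unfolding X_def by (intro dual.M.a_closed) blast+
      ultimately show ?thesis unfolding X_def by blast
    qed
    show "s \<odot>\<^bsub>dual\<^esub> h \<in> X" if s: "s \<in> carrier S" and h: "h \<in> X" for s h
    proof -
      have "fin_det (\<lambda>y. h (s \<otimes>\<^bsub>S\<^esub> y))" using h s by (intro scale) (auto simp: X_def)
      then have "fin_det (s \<odot>\<^bsub>dual\<^esub> h)" by (rule cong) simp
      moreover have "s \<odot>\<^bsub>dual\<^esub> h \<in> carrier dual" using s h unfolding X_def by (intro dual.smult_closed) blast+
      ultimately show ?thesis unfolding X_def by blast
    qed
    show "h \<in> X" if s: "s \<in> carrier S" "s \<noteq> \<zero>\<^bsub>S\<^esub>" and h: "h \<in> carrier dual" "s \<odot>\<^bsub>dual\<^esub> h \<in> X" for s h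
    proof -
      \<comment> \<open>Scaling s h by the inverse of the unit part of s leaves x^n h, and x^n can
        be cancelled in K.\<close>
      obtain v n where v: "v \<in> Units S" "s = v \<otimes>\<^bsub>S\<^esub> \<phi> x [^]\<^bsub>S\<^esub> (n::nat)" using S.unit_power_ex s by blast
      have vc: "v \<in> carrier S" "inv\<^bsub>S\<^esub> v \<in> carrier S" using v by auto
      have sv: "s \<otimes>\<^bsub>S\<^esub> (inv\<^bsub>S\<^esub> v \<otimes>\<^bsub>S\<^esub> y) = \<phi> (x [^] n) \<otimes>\<^bsub>S\<^esub> y" if y: "y \<in> carrier S" for y
      proof -
        have "s \<otimes>\<^bsub>S\<^esub> (inv\<^bsub>S\<^esub> v \<otimes>\<^bsub>S\<^esub> y) = (v \<otimes>\<^bsub>S\<^esub> inv\<^bsub>S\<^esub> v) \<otimes>\<^bsub>S\<^esub> (\<phi> (x [^] n) \<otimes>\<^bsub>S\<^esub> y)"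
          unfolding v(2) completion_map_pow[OF x_closed] using vc y
          by (simp only: S.m_ac S.m_closed S.nat_pow_closed S.x_closed)
        then show ?thesis using v(1) y by simp
      qed
      have "fin_det (s \<odot>\<^bsub>dual\<^esub> h)" using h(2) unfolding X_def by blast
      from scale[OF this vc(2)]
      have "fin_det (\<lambda>y. x [^] n \<odot>\<^bsub>QR\<^esub> h y)"
        by (rule cong) (use sv vc linear_maps_smult[OF dual_linear[OF h(1)], of "x [^] n"] in simp)
      then obtain F where F: "finite F" "F \<subseteq> ?Y"
        and F_zero: "\<forall>y\<in>carrier S. (\<forall>i\<in>F. f i y = \<zero>\<^bsub>K\<^esub>) \<longrightarrow> x [^] n \<odot>\<^bsub>QR\<^esub> h y = \<zero>\<^bsub>K\<^esub>"
        unfolding fin_det_def by (elim exE conjE)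
      have "h y = \<zero>\<^bsub>K\<^esub>" if "y \<in> carrier S" "\<forall>i\<in>F. f i y = \<zero>\<^bsub>K\<^esub>" for y
        using torsion_free[OF _ x_pow_nonzero[of n] dual_values[OF h(1) that(1)]] F_zero that by simp
      then have "fin_det h" by (rule fin_detI[OF F(1,2)])
      then show ?thesis using h(1) unfolding X_def by blast
    qed
  qed
  moreover have "restrict l (carrier S) \<in> carrier dual" using restrict_linear[OF module_SR l(1)] by simp
  ultimately have "fin_det (restrict l (carrier S))" using span by (auto simp: X_def simp del: hom_module_simps)
  then obtain F where "finite F" "F \<subseteq> ?Y" "\<forall>y\<in>carrier S. (\<forall>i\<in>F. f i y = \<zero>\<^bsub>K\<^esub>) \<longrightarrow> l y = \<zero>\<^bsub>K\<^esub>"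
    unfolding fin_det_def by auto
  then show False using l(2)[of F] by auto
qed

text \<open>Pulled back along \<open>dual_to_E1\<close>, the coordinates of Ext^1 have joint kernel
  0, by injectivity modulo torsion, and only finitely many are nonzero on a given functional.
  Countably many of them would make Hom(S, K) countably generated up to purity over S.\<close>

theorem E1_rank_uncountable:
  assumes degree: "infinite_degree R \<phi> S" and C: "coordinate_system S E1 C p"
  shows "uncountable C"
proof
  assume cnt: "countable C"
  obtain B q where B: "coordinate_system R SR B q" using coordinate_system_exists[OF module_SR] by blast
  have inf: "infinite B" by (rule completion_basis_infinite[OF degree B])
  have "\<phi> ` carrier R \<noteq> carrier S"
  proof
    assume surj: "\<phi> ` carrier R = carrier S"
    have "inj_on \<phi> (carrier R)" by (rule completion_map_inj)
    then show False using surj not_complete completion_map_hom by (simp add: adically_complete_def ring_iso_def bij_betw_def)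
  qed
  then obtain \<alpha> where \<alpha>: "\<alpha> \<in> carrier S" "\<alpha> \<notin> \<phi> ` carrier R" by auto
  let ?W = "quotient_field_module S" and ?e = "to_nat_on C"
  interpret W: module S ?W by (rule S.module_quotient_field)
  note Cd = coordinate_systemD[OF C]
  \<comment> \<open>C may be finite, so indices outside the range of the enumeration get the zero
    map.\<close>
  define P where "P n l = (if n \<in> ?e ` C then p (from_nat_into C n) (dual_to_E1 \<alpha> l) else \<zero>\<^bsub>?W\<^esub>)" for n l
  have index_inverse: "from_nat_into C (?e c) = c" if "c \<in> C" for c using cnt that by simp
  have P_at: "P (?e c) l = p c (dual_to_E1 \<alpha> l)" if "c \<in> C" for c l using index_inverse that by (simp add: P_def)
  have Plin: "P n \<in> linear_maps S dual ?W" for n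
  proof (cases "n \<in> ?e ` C")
    case True
    then obtain c where "c \<in> C" "n = ?e c" by blast
    then have "P n = (\<lambda>l. p c (dual_to_E1 \<alpha> l))" using P_at by (simp add: fun_eq_iff)
    then show ?thesis using linear_maps_compose[OF dual_to_E1_linear[OF \<alpha>(1)] Cd(3)[OF \<open>c \<in> C\<close>]] by simp
  next
    case False
    then have "P n = (\<lambda>l. \<zero>\<^bsub>?W\<^esub>)" by (simp add: P_def fun_eq_iff)
    then show ?thesis using W.M.zero_closed W.M.l_zero[OF W.M.zero_closed] W.smult_r_null by (auto intro!: linear_mapsI)
  qed
  have Lc: "dual_to_E1 \<alpha> l \<in> carrier E1" if "l \<in> carrier dual" for l using linear_maps_closed[OF dual_to_E1_linear[OF \<alpha>(1)] that] .
  have fin: "\<exists>k. \<forall>n\<ge>k. P n l = \<zero>\<^bsub>quotient_field S\<^esub>" if l: "l \<in> carrier dual" for l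
  proof -
    have "finite (?e ` {c\<in>C. p c (dual_to_E1 \<alpha> l) \<noteq> \<zero>\<^bsub>quotient_field S\<^esub>})"
      using S.coordinates_finite_support[OF module_E1 C Lc[OF l]] by simp
    then obtain k where k: "\<forall>n\<in>?e ` {c\<in>C. p c (dual_to_E1 \<alpha> l) \<noteq> \<zero>\<^bsub>quotient_field S\<^esub>}. n < k"
      unfolding finite_nat_set_iff_bounded ..
    have "P n l = \<zero>\<^bsub>quotient_field S\<^esub>" if n: "k \<le> n" for n
    proof (cases "n \<in> ?e ` C")
      case True
      then obtain c where c: "c \<in> C" "n = ?e c" by blast
      then have "p c (dual_to_E1 \<alpha> l) = \<zero>\<^bsub>quotient_field S\<^esub>" using k n by fastforce
      then show ?thesis unfolding c(2) P_at[OF c(1)] .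
    qed (simp add: P_def)
    then show ?thesis by blast
  qed
  have ker: "l = \<zero>\<^bsub>dual\<^esub>" if l: "l \<in> carrier dual" and z: "\<And>n. P n l = \<zero>\<^bsub>quotient_field S\<^esub>" for l
  proof -
    have "p c (dual_to_E1 \<alpha> l) = \<zero>\<^bsub>quotient_field S\<^esub>" if "c \<in> C" for c using z[of "?e c"] P_at[OF that] by simp
    then obtain s where "s \<in> carrier S" "s \<noteq> \<zero>\<^bsub>S\<^esub>" "s \<odot>\<^bsub>E1\<^esub> dual_to_E1 \<alpha> l = \<zero>\<^bsub>E1\<^esub>"
      using S.coordinates_joint_kernel[OF module_E1 C Lc[OF l]] by blast
    then show ?thesis by (rule dual_to_E1_torsion_kernel[OF \<alpha> B inf l])
  qed
  obtain D where "range (D :: nat \<Rightarrow> _) \<subseteq> carrier dual" "carrier dual \<subseteq> pure_span S dual (range D)"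
    using S.countable_coordinates_generate[OF module_dual Plin fin ker] by blast
  then show False using dual_not_countably_generated[OF B inf] by blast
qed

end

section \<open>Decomposition of Ext^1 and vanishing in the other degrees\<close>

theorem proposition4p2:
  fixes R :: "('a, 'b) ring_scheme"
    and x :: 'a and m :: "'a set"
    and E :: "('a, 'e) module" and \<iota> :: "'a set \<Rightarrow> 'e"
    and \<epsilon> :: "'a \<Rightarrow> 'n" and J :: "nat \<Rightarrow> ('a, 'n) module" and d :: "nat \<Rightarrow> 'n \<Rightarrow> 'n"
  assumes dvr: "discrete_valuation_ring R m"
    and generator: "x \<in> carrier R" "m = cgenideal R x"
    and not_complete: "\<not> adically_complete R m"
    and hull: "injective_hull R (residue_module R m) \<iota> E"
    and degree: "infinite_degree R (completion_map R m) (adic_completion R m)"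
    and resolution: "injective_resolution R (ring_module R) \<epsilon> J d"
  shows "let Ext = Ext_module R (completion_map R m) (ring_module (adic_completion R m)) J d in
    \<exists>C :: ((nat \<Rightarrow> 'a set) \<Rightarrow> 'n) set set.
      uncountable C \<and>
      (\<forall>i. i \<noteq> 1 \<longrightarrow> carrier (Ext i) = {\<zero>\<^bsub>Ext i\<^esub>}) \<and>
      modules_isomorphic (adic_completion R m) (Ext 1)
        (module_prod (completion_module R m E)
          (direct_power (quotient_field_module (adic_completion R m)) C))"
proof -
  interpret uniformized_domain R x
    by (rule discrete_valuation_ring_uniformized[OF dvr generator])
  interpret completion_ext R x m \<epsilon> J d
    using generator(2) not_complete resolution by unfold_locales
  note E = injective_hull_structure[OF hull]
  let ?E = "completion_module R m E"
  have mE: "module S ?E" by (rule module_completion_module[OF E(1,3)])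
  \<comment> \<open>R acts on E in the same way directly and through S, so divisibility, the socle
    generator and torsion carry over to S.\<close>
  have act: "\<phi> r \<odot>\<^bsub>?E\<^esub> e = r \<odot>\<^bsub>E\<^esub> e" if "r \<in> carrier R" "e \<in> carrier E" for r e
    using completion_module_smult_map[OF E(1) that(2) _ that(1)] E(3)[OF that(2)] by blast
  have divE: "divisible_by ?E (\<phi> x)"
    using E(2) act[OF x_closed] by (simp add: divisible_by_def)
  obtain e1 where e1: "generates_socle S (\<phi> x) ?E e1"
  proof -
    obtain e1 where "e1 \<in> carrier E" "e1 \<noteq> \<zero>\<^bsub>E\<^esub>" "x \<odot>\<^bsub>E\<^esub> e1 = \<zero>\<^bsub>E\<^esub>"
      "\<And>e. e \<in> carrier E \<Longrightarrow> x \<odot>\<^bsub>E\<^esub> e = \<zero>\<^bsub>E\<^esub> \<Longrightarrow> \<exists>r\<in>carrier R. e = r \<odot>\<^bsub>E\<^esub> e1"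
      using E(4) by blast
    then have "generates_socle S (\<phi> x) ?E e1"
      unfolding generates_socle_def using act by simp (metis completion_map_closed)
    then show ?thesis using that by blast
  qed
  have torsE: "\<exists>n::nat. \<phi> x [^]\<^bsub>S\<^esub> n \<odot>\<^bsub>?E\<^esub> e = \<zero>\<^bsub>?E\<^esub>" if "e \<in> carrier ?E" for e
  proof -
    have e: "e \<in> carrier E" using that by simp
    obtain n :: nat where "x [^]\<^bsub>R\<^esub> n \<odot>\<^bsub>E\<^esub> e = \<zero>\<^bsub>E\<^esub>" using E(3)[OF e] by blast
    then have "\<phi> x [^]\<^bsub>S\<^esub> n \<odot>\<^bsub>?E\<^esub> e = \<zero>\<^bsub>?E\<^esub>"
      using act[OF nat_pow_closed[OF x_closed] e] by (simp add: completion_map_pow[symmetric])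
    then show ?thesis by blast
  qed
  \<comment> \<open>C is a maximal independent subset of Ext^1 over S, which is why the index set
    consists of Ext classes.\<close>
  obtain C p where C: "coordinate_system S E1 C p" using S.coordinate_system_exists[OF module_E1] by blast
  have "modules_isomorphic S E1 (module_prod ?E (direct_power (quotient_field_module S) C))"
    by (rule S.divisible_module_structure[OF module_E1 E1_divisible E1_socle mE divE e1 torsE C])
  moreover have "carrier (Ext i) = {\<zero>\<^bsub>Ext i\<^esub>}" if i: "i \<noteq> 1" for i
  proof (cases i)
    case 0
    then show ?thesis using Ext_0 by simp
  next
    case (Suc k)
    with i obtain n where "i = Suc (Suc n)" by (cases k) auto
    then show ?thesis using Ext_ge_2 by simp
  qed
  ultimately show ?thesis
    unfolding Let_def One_nat_def using E1_rank_uncountable[OF degree C] by blast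
qed

end
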